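(* There exist constants $C(s,s',m)\ge0$, depending only on $(s,s',m)$, such that the following holds. Let $\varsigma=(s_1,\ldots,s_d)\in\mathbb Z_{>0}^d$ be valences with $s_1+\cdots+s_d=2N$, let $\alpha\in\mathrm{LP}_\varsigma$, $j\in\{1,\ldots,d-1\}$, and let $\mathrm m_{j,j+1}$ be the multiplicity of the link $\{j,j+1\}$ in the multiset $\alpha$. Then, for $\xi\in(x_{j-1},x_{j+2})$, $$\lim_{x_j,x_{j+1}\to\xi}\frac{\mathcal Z_\alpha(x_1,\ldots,x_d)}{|x_{j+1}-x_j|^{\Delta^{s_j,s_{j+1}}_{\mathrm m_{j,j+1}}}}=C(s_j,s_{j+1},\mathrm m_{j,j+1})\;\mathcal Z_{\hat\alpha}(\hat{\boldsymbol x}),$$ where $\mathcal Z_\emptyset\equiv1$ for the empty link pattern and $$\Delta^{s_j,s_{j+1}}_m=h_{1,s_j+s_{j+1}+1-2m}-h_{1,s_j+1}-h_{1,s_{j+1}+1}=2m^2-m(2s_j+2s_{j+1}+1)+s_js_{j+1},\qquad h_{1,s+1}=\tfrac{s(s+1)}2 .$$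
   Context: **Fused data.** If $\mathrm m_{j,j+1}=s_j=s_{j+1}$, set $\hat\varsigma=(s_1,\ldots,s_{j-1},s_{j+2},\ldots,s_d)$ and $\hat{\boldsymbol x}=(x_1,\ldots,x_{j-1},x_{j+2},\ldots,x_d)$. In all other cases set $\hat\varsigma=(s_1,\ldots,s_{j-1},s_j+s_{j+1}-2\mathrm m_{j,j+1},s_{j+2},\ldots,s_d)$ and $\hat{\boldsymbol x}=(x_1,\ldots,x_{j-1},\xi,x_{j+2},\ldots,x_d)$. $\hat\alpha\in\mathrm{LP}_{\hat\varsigma}$ is obtained from $\alpha$ by removing the $\mathrm m_{j,j+1}$ links $\{j,j+1\}$, merging $j$ and $j+1$ into one index (if any links remain at them), and relabelling the remaining indices in order. Conventions $x_0=-\infty$, $x_{d+1}=+\infty$. **Link patterns.** $\mathrm{LP}_N$ is the set of partitions of $\{1,\ldots,2N\}$ into $N$ pairs (links) that can be drawn as $N$ disjoint curves in the upper half-plane joining points of the real axis. A link pattern is always written $\beta=\{\{a_1,b_1\},\ldots,\{a_N,b_N\}\}$ with $a_1<\cdots<a_N$ and $a_k<b_k$ for all $k$. **Valences.** For $\varsigma=(s_1,\ldots,s_d)\in\mathbb Z_{>0}^d$ with $\sum_i s_i=2N$, put $q_0=0$, $q_j=s_1+\cdots+s_j$. The $j$th block is $\{q_{j-1}+1,\ldots,q_j\}$. $\mathrm{LP}_\varsigma$ is the set of multisets of $N$ pairs $\{i,j\}$, $i\neq j$ in $\{1,\ldots,d\}$, obtained from some element of $\mathrm{LP}_N$ having no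 link inside a block by replacing each index by the number of its block. This replacement is injective, so each $\alpha\in\mathrm{LP}_\varsigma$ comes from a unique $\iota(\alpha)\in\mathrm{LP}_N$; $\alpha$ is identified with $\iota(\alpha)$ in $\succeq$ and $\mathcal C$. **Order and Dyck tilings.** Identify $\alpha\in\mathrm{LP}_N$ with the Dyck path $\alpha:\{0,\ldots,2N\}\to\mathbb Z_{\ge0}$, $\alpha(0)=0$, with $\alpha(j)-\alpha(j-1)=+1$ if $j$ is a left endpoint of a link and $-1$ if it is a right endpoint. $\beta\succeq\alpha$ means $\beta(j)\ge\alpha(j)$ for all $j$. Then the skew Young diagram $\alpha/\beta$ is the region between the two paths, a union of boxes (a box centred at $(x,y)$, $x+y$ odd, has vertices $(x\pm1,y)$, $(x,y\pm1)$). A Dyck tile is a nonempty set of boxes whose centres, from left to right, are the consecutive points of a lattice path with steps $(1,\pm1)$ that starts and ends at the same height and never goes below it (a single box is allowed). A Dyck tiling of $\alpha/\beta$ is a partition of its boxes into Dyck tiles. It is cover-inclusive if, whenever a tile $T_1$ has a box whose centre lies vertically straight above the centre of a box of another tile $T_2$, the horizontal extent of $T_1$ (interval from the leftmost to the rightmost $x$-coordinate of its box centres) is contained in that of $T_2$. $\#\mathcal C(\alpha/\beta)$ is the number of cover-inclusive Dyck tilings of $\alpha/\beta$ (with $\#\mathcal C(\alpha/\alpha)=1$). **Pure partition functions.** For $\alpha\in\mathrm{LP}_\varsigma$ and $x_1<\cdots<x_d$, $$\mathcal Z_\alpha(x_1,\ldots,x_d):=\sum_{\beta\in\mathrm{LP}_N,\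 \beta\succeq\alpha}\#\mathcal C(\alpha/\beta)\,\det\big(\mathfrak K(a_k,b_\ell)\big)_{k,\ell=1}^N,\qquad \beta=\{\{a_1,b_1\},\ldots,\{a_N,b_N\}\},$$ with the symmetric kernel $\mathfrak K(a,b)=\partial_{x_i}^{m_a-1}\partial_{x_j}^{m_b-1}\frac{1}{\pi(x_i-x_j)^2}$ if $a=q_{i-1}+m_a$ lies in block $i$ and $b=q_{j-1}+m_b$ lies in block $j\ne i$, and $\mathfrak K(a,b)=0$ if $a,b$ lie in the same block. *)

theory Defs
  imports "HOL-Analysis.Analysis" "Jordan_Normal_Form.Determinant"
begin

text \<open>
  All indices (points, blocks, links) are 1-based, and families indexed by \<open>1, \<dots>, d\<close> are functions
  on \<^typ>\<open>nat\<close> of which only the values on \<open>{1..d}\<close> matter. A link is a two-element set.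
\<close>

subsection \<open>Link patterns and valences\<close>

definition link_patterns :: "nat \<Rightarrow> nat set set set" where
  "link_patterns N = {\<beta>. partition_on {1..2*N} \<beta> \<and> (\<forall>l\<in>\<beta>. card l = 2) \<and>
     (\<exists>\<gamma> :: nat set \<Rightarrow> real \<Rightarrow> complex.
        (\<forall>l\<in>\<beta>. path (\<gamma> l) \<and> {pathstart (\<gamma> l), pathfinish (\<gamma> l)} = of_nat ` l \<and>
               (\<forall>t\<in>{0<..<1}. 0 < Im (\<gamma> l t))) \<and>
        disjoint_family_on (\<lambda>l. path_image (\<gamma> l)) \<beta>)}"

definition valence_sum :: "(nat \<Rightarrow> nat) \<Rightarrow> nat \<Rightarrow> nat" where
  "valence_sum s j = (\<Sum>i=1..j. s i)"

definition block :: "(nat \<Rightarrow> nat) \<Rightarrow> nat \<Rightarrow> nat set" where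
  "block s i = {valence_sum s (i - 1)<..valence_sum s i}"

definition block_of :: "(nat \<Rightarrow> nat) \<Rightarrow> nat \<Rightarrow> nat" where
  "block_of s a = (THE i. a \<in> block s i)"

definition no_link_in_block :: "nat \<Rightarrow> (nat \<Rightarrow> nat) \<Rightarrow> nat set set \<Rightarrow> bool" where
  "no_link_in_block d s \<beta> \<longleftrightarrow> (\<forall>l\<in>\<beta>. \<forall>i\<in>{1..d}. \<not> l \<subseteq> block s i)"

definition collapse :: "(nat \<Rightarrow> nat) \<Rightarrow> nat set set \<Rightarrow> nat set multiset" where
  "collapse s \<beta> = image_mset (\<lambda>l. block_of s ` l) (mset_set \<beta>)"

definition link_patterns_val :: "nat \<Rightarrow> (nat \<Rightarrow> nat) \<Rightarrow> nat set multiset set" where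
  "link_patterns_val d s =
     {collapse s \<beta> | \<beta> N. valence_sum s d = 2 * N \<and> \<beta> \<in> link_patterns N \<and> no_link_in_block d s \<beta>}"

text \<open>The inverse of the collapsing map, written \<open>\<iota>\<close>.\<close>

definition unfold_pattern :: "nat \<Rightarrow> (nat \<Rightarrow> nat) \<Rightarrow> nat set multiset \<Rightarrow> nat set set" where
  "unfold_pattern d s \<alpha> =
     (THE \<beta>. \<beta> \<in> link_patterns (valence_sum s d div 2) \<and> no_link_in_block d s \<beta> \<and> collapse s \<beta> = \<alpha>)"

subsection \<open>Dyck paths and cover-inclusive Dyck tilings\<close>

definition dyck_path :: "nat set set \<Rightarrow> nat \<Rightarrow> int" where
  "dyck_path \<alpha> j = (\<Sum>i=1..j. if i \<in> Min ` \<alpha> then 1 else - 1)"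

definition dyck_above :: "nat \<Rightarrow> nat set set \<Rightarrow> nat set set \<Rightarrow> bool" where
  "dyck_above N \<beta> \<alpha> \<longleftrightarrow> (\<forall>j\<le>2*N. dyck_path \<beta> j \<ge> dyck_path \<alpha> j)"

text \<open>
  A box is represented by its centre. On each interval \<open>[k, k+1]\<close> the paths and the edges of the boxes
  are affine, so a box lies between the two paths iff its four vertices do.
\<close>

definition skew_boxes :: "nat \<Rightarrow> nat set set \<Rightarrow> nat set set \<Rightarrow> (nat \<times> int) set" where
  "skew_boxes N \<alpha> \<beta> =
     {(x, y). 0 < x \<and> x < 2*N \<and> odd (int x + y) \<and>
        (\<forall>(u, v)\<in>{(x-1, y), (x+1, y), (x, y-1), (x, y+1)}. dyck_path \<alpha> u \<le> v \<and> v \<le> dyck_path \<beta> u)}"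

definition dyck_tile :: "(nat \<times> int) set \<Rightarrow> bool" where
  "dyck_tile T \<longleftrightarrow> (\<exists>a n (h :: nat \<Rightarrow> int). T = (\<lambda>i. (a + i, h i)) ` {0..n} \<and>
     (\<forall>i<n. h (Suc i) = h i + 1 \<or> h (Suc i) = h i - 1) \<and> h n = h 0 \<and> (\<forall>i\<le>n. h 0 \<le> h i))"

definition horizontal_extent :: "(nat \<times> int) set \<Rightarrow> nat set" where
  "horizontal_extent T = {Min (fst ` T)..Max (fst ` T)}"

definition cover_inclusive :: "(nat \<times> int) set set \<Rightarrow> bool" where
  "cover_inclusive P \<longleftrightarrow> (\<forall>T1\<in>P. \<forall>T2\<in>P.
     T1 \<noteq> T2 \<and> (\<exists>x y1 y2. (x, y1) \<in> T1 \<and> (x, y2) \<in> T2 \<and> y1 > y2) \<longrightarrow>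
     horizontal_extent T1 \<subseteq> horizontal_extent T2)"

definition cover_inclusive_tilings :: "nat \<Rightarrow> nat set set \<Rightarrow> nat set set \<Rightarrow> (nat \<times> int) set set set" where
  "cover_inclusive_tilings N \<alpha> \<beta> =
     {P. partition_on (skew_boxes N \<alpha> \<beta>) P \<and> (\<forall>T\<in>P. dyck_tile T) \<and> cover_inclusive P}"

subsection \<open>Pure partition functions\<close>

definition kernel :: "(nat \<Rightarrow> nat) \<Rightarrow> (nat \<Rightarrow> real) \<Rightarrow> nat \<Rightarrow> nat \<Rightarrow> real" where
  "kernel s x a b =
     (let i = block_of s a; j = block_of s b;
          m_a = a - valence_sum s (i - 1); m_b = b - valence_sum s (j - 1)
      in if i = j then 0
         else (deriv ^^ (m_a - 1)) (\<lambda>u. (deriv ^^ (m_b - 1)) (\<lambda>v. 1 / (pi * (u - v)^2)) (x j)) (x i))"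

text \<open>The endpoints \<open>a\<^sub>1 < \<dots> < a\<^sub>N\<close> and \<open>b\<^sub>1, \<dots>, b\<^sub>N\<close>; here the position \<open>k\<close> counts from 0.\<close>

definition left_endpoint :: "nat set set \<Rightarrow> nat \<Rightarrow> nat" where
  "left_endpoint \<beta> k = sorted_list_of_set (Min ` \<beta>) ! k"

definition right_endpoint :: "nat set set \<Rightarrow> nat \<Rightarrow> nat" where
  "right_endpoint \<beta> k = (THE b. {left_endpoint \<beta> k, b} \<in> \<beta>)"

definition pure_partition_function ::
  "nat \<Rightarrow> (nat \<Rightarrow> nat) \<Rightarrow> nat set multiset \<Rightarrow> (nat \<Rightarrow> real) \<Rightarrow> real" where
  "pure_partition_function d s \<alpha> x =
     (let N = valence_sum s d div 2; \<alpha>' = unfold_pattern d s \<alpha>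
      in \<Sum>\<beta> | \<beta> \<in> link_patterns N \<and> dyck_above N \<beta> \<alpha>'.
           real (card (cover_inclusive_tilings N \<alpha>' \<beta>)) *
           Determinant.det (Matrix.mat N N
             (\<lambda>(k, l). kernel s x (left_endpoint \<beta> k) (right_endpoint \<beta> l))))"

subsection \<open>Fusion of the points \<open>j\<close> and \<open>j + 1\<close>\<close>

text \<open>
  Below, \<open>m\<close> is the multiplicity of \<open>{j, j+1}\<close> in a pattern with valences \<open>s\<close>, so that
  \<open>m \<le> s j\<close> and \<open>m \<le> s (j+1)\<close>, and the subtraction on \<^typ>\<open>nat\<close> does not truncate.
\<close>

definition fully_linked :: "(nat \<Rightarrow> nat) \<Rightarrow> nat \<Rightarrow> nat \<Rightarrow> bool" where
  "fully_linked s j m \<longleftrightarrow> m = s j \<and> s j = s (j+1)"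

definition fused_length :: "nat \<Rightarrow> (nat \<Rightarrow> nat) \<Rightarrow> nat \<Rightarrow> nat \<Rightarrow> nat" where
  "fused_length d s j m = (if fully_linked s j m then d - 2 else d - 1)"

definition fused_valences :: "(nat \<Rightarrow> nat) \<Rightarrow> nat \<Rightarrow> nat \<Rightarrow> nat \<Rightarrow> nat" where
  "fused_valences s j m =
     (if fully_linked s j m then (\<lambda>i. if i < j then s i else s (i+2))
      else (\<lambda>i. if i < j then s i else if i = j then s j + s (j+1) - 2*m else s (i+1)))"

definition fused_points ::
  "(nat \<Rightarrow> nat) \<Rightarrow> nat \<Rightarrow> nat \<Rightarrow> (nat \<Rightarrow> real) \<Rightarrow> real \<Rightarrow> nat \<Rightarrow> real" where
  "fused_points s j m x \<xi> =
     (if fully_linked s j m then (\<lambda>i. if i < j then x i else x (i+2))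
      else (\<lambda>i. if i < j then x i else if i = j then \<xi> else x (i+1)))"

definition fused_pattern :: "(nat \<Rightarrow> nat) \<Rightarrow> nat \<Rightarrow> nat \<Rightarrow> nat set multiset \<Rightarrow> nat set multiset" where
  "fused_pattern s j m \<alpha> =
     (let relabel = (if fully_linked s j m then (\<lambda>i. if i < j then i else i - 2)
                     else (\<lambda>i. if i \<le> j then i else i - 1))
      in image_mset (\<lambda>l. relabel ` l) (filter_mset (\<lambda>l. l \<noteq> {j, j+1}) \<alpha>))"

subsection \<open>Exponents\<close>

text \<open>The weight \<open>h\<^sub>1\<^sub>,\<^sub>r\<close>, normalised so that \<open>h\<^sub>1\<^sub>,\<^sub>s\<^sub>+\<^sub>1 = s (s + 1) / 2\<close>.\<close>

definition h1 :: "int \<Rightarrow> real" where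
  "h1 r = real_of_int ((r - 1) * r) / 2"

definition fusion_exponent :: "nat \<Rightarrow> nat \<Rightarrow> nat \<Rightarrow> real" where
  "fusion_exponent s s' m =
     h1 (int s + int s' + 1 - 2 * int m) - h1 (int s + 1) - h1 (int s' + 1)"

end

theory Submission
  imports Defs
begin

text \<open>
  For an arbitrary symmetric kernel \<open>K\<close> put \<open>Zp N \<alpha> K = (\<Sum>\<beta>\<succeq>\<alpha>. #C(\<alpha>/\<beta>) * det K(a\<^sub>k, b\<^sub>l))\<close>.
  Flipping a peak of \<open>\<beta>\<close> relates the numbers of cover-inclusive tilings in such a way that \<open>Zp\<close> changes
  sign when two neighbouring indices not linked in \<open>\<alpha>\<close> are exchanged, and that, if \<open>{k, k+1}\<close> is a link
  of \<open>\<alpha>\<close> and the rows \<open>k\<close> and \<open>k+1\<close> of \<open>K\<close> agree, \<open>Zp\<close> factors through the pattern with this link removed.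
  Hence \<open>Zp\<close> is multilinear and alternating in the rows of each block.

  Binomial row operations in the blocks of \<open>j\<close> and \<open>j + 1\<close> diagonalise the coupling of the two blocks: only
  the \<open>l\<close>-th rows on both sides of the gap remain coupled, with the constant \<open>-l/\<pi>\<close>. The remaining entries
  of these rows are Taylor expansions in \<open>y = x\<^sub>j\<^sub>+\<^sub>1 - x\<^sub>j\<close> of the kernel at the merged point, starting at order \<open>y\<close>.
  A multilinear expansion selects a set \<open>I\<close> of coupled pairs. More than \<open>m\<close> pairs contribute zero because every
  pair uses up a link \<open>{j, j+1}\<close>; fewer than \<open>m\<close> pairs contribute to higher order in \<open>y\<close> because the links left
  over make \<open>Zp\<close> vanish unless the rows carry more distinct orders of derivatives. For \<open>m\<close> pairs the orders
  \<open>1, \<dots>, L\<close> with \<open>L = s\<^sub>j + s\<^sub>j\<^sub>+\<^sub>1 - 2 m\<close> of \<open>y\<close> lead to the exponent and to the rows of the fused block. The coefficient is a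
  determinant of polynomials in the signed distances of the rows to the gap, equal to the product of these
  distances times a positive number, which fixes its sign independently of \<open>I\<close>.
\<close>

subsection \<open>Determinants over finite index sets\<close>

text \<open>The single determinants are in general more singular at the fusion point than their sum,
  so no estimate term by term can work. The cancellations are proved for arbitrary symmetric kernels
  because removing a link replaces the kernel by a Schur complement, which need not be a kernel of
  derivatives any more. The binomial row operations have a closed form. Put u = x_j, v = x_(j+1), y
  = v - u and \<phi>(w) = (u - w)/(v - w). The row at signed distance \<mu> from the gap becomes
  -(1/\<pi>) times the w-derivative of \<phi>(w)^\<mu>, with \<mu> = -l left and \<mu> = l right of
  the gap. For \<mu> = -l this uses the derivatives 0, ..., l-1 at u only, for \<mu> = l those at v
  only. Expanded at u, both have coefficients given by one formula \<open>row_coeff \<mu> n\<close>,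
  polynomial in \<mu>, which is why the two blocks merge into a single determinant. The coupling of
  two rows is a residue pairing of powers of \<phi>, hence diagonal and proportional to l. All sets
  of m coupled pairs contribute at the same order, so the constant is a sum over them and the common
  sign is what makes it nonnegative.\<close>

definition gdet :: "'a set \<Rightarrow> ('a \<Rightarrow> 'b) \<Rightarrow> ('a \<Rightarrow> 'b \<Rightarrow> real) \<Rightarrow> real" where
  "gdet A f K = (\<Sum>\<sigma> | \<sigma> permutes A. of_int (sign \<sigma>) * (\<Prod>a\<in>A. K a (f (\<sigma> a))))"

lemma gdet_cong:
  assumes "A = A'" "\<And>a. a \<in> A' \<Longrightarrow> f a = f' a" "\<And>a b. a \<in> A' \<Longrightarrow> b \<in> f' ` A' \<Longrightarrow> K a b = K' a b"
  shows "gdet A f K = gdet A' f' K'"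
proof -
  have "(\<Prod>a\<in>A'. K a (f (\<sigma> a))) = (\<Prod>a\<in>A'. K' a (f' (\<sigma> a)))" if "\<sigma> permutes A'" for \<sigma>
    by (rule prod.cong[OF refl]) (use assms permutes_in_image[OF that] in auto)
  thus ?thesis unfolding gdet_def assms(1) by (intro sum.cong) auto
qed

lemma gdet_image: "gdet A (h \<circ> f) K = gdet A f (\<lambda>a b. K a (h b))"
  by (simp add: gdet_def)

lemma gdet_perm:
  assumes "\<rho> permutes A" "finite A"
  shows "gdet A (f \<circ> \<rho>) K = of_int (sign \<rho>) * gdet A f K"
proof -
  have P: "permutation p" if "p permutes A" for p
    using that assms(2) permutation_permutes by blast
  have "gdet A f K = (\<Sum>\<sigma> | \<sigma> permutes A. of_int (sign (\<rho> \<circ> \<sigma>)) * (\<Prod>a\<in>A. K a (f ((\<rho> \<circ> \<sigma>) a))))"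
    unfolding gdet_def by (rule setum_permutations_compose_left[OF assms(1)])
  also have "\<dots> = of_int (sign \<rho>) * gdet A (f \<circ> \<rho>) K"
    unfolding gdet_def sum_distrib_left
    by (intro sum.cong) (auto simp: sign_compose P[OF assms(1)] P)
  finally show ?thesis by (cases \<rho> rule: sign_cases) auto
qed

lemma gdet_reindex:
  assumes "inj_on g A" "finite A"
  shows "gdet (g ` A) f K = gdet A (f \<circ> g) (\<lambda>a b. K (g a) b)"
proof -
  have bb: "bij_betw g A (g ` A)" using assms(1) inj_on_imp_bij_betw by blast
  have *: "(\<Prod>a\<in>g ` A. K a (f (map_permutation A g \<sigma> a))) = (\<Prod>a\<in>A. K (g a) (f (g (\<sigma> a))))" for \<sigma>
    using assms(1) by (subst prod.reindex) (auto simp: map_permutation_apply)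
  have bi: "bij_betw (map_permutation A g) {\<sigma>. \<sigma> permutes A} {\<sigma>. \<sigma> permutes (g ` A)}"
  proof (rule bij_betw_byWitness[where f'="map_permutation (g ` A) (inv_into A g)"])
    show "\<forall>a\<in>{\<sigma>. \<sigma> permutes A}. map_permutation (g ` A) (inv_into A g) (map_permutation A g a) = a"
      using map_permutation_compose_inv[OF bb] assms(1) by auto
    show "\<forall>a'\<in>{\<sigma>. \<sigma> permutes g ` A}. map_permutation A g (map_permutation (g ` A) (inv_into A g) a') = a'"
      using map_permutation_compose_inv[OF bij_betw_inv_into[OF bb]] by (auto simp: f_inv_into_f)
  qed (use map_permutation_permutes[OF bb] map_permutation_permutes[OF bij_betw_inv_into[OF bb]] in blast)+
  show ?thesis unfolding gdet_def
    by (subst sum.reindex_bij_betw[OF bi, symmetric]) (use assms in \<open>auto simp: * sign_map_permutation intro!: sum.cong\<close>)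
qed

text \<open>Reindexing the rows by the transposition moves it into the pairing \<open>f\<close>,
  where it costs a sign; in the kernel the equal rows make it invisible.\<close>

lemma gdet_twin:
  assumes "finite A" "a \<in> A" "a' \<in> A" "a \<noteq> a'" "\<And>b. b \<in> f ` A \<Longrightarrow> K a b = K a' b"
  shows "gdet A f K = 0"
proof -
  let ?t = "Transposition.transpose a a'"
  have t: "?t permutes A" using assms by (simp add: permutes_swap_id)
  have A: "?t ` A = A" by (rule permutes_image[OF t])
  have "gdet A f K = gdet (?t ` A) f K" by (simp only: A)
  also have "\<dots> = gdet A (f \<circ> ?t) (\<lambda>x b. K (?t x) b)"
    by (rule gdet_reindex) (use assms in auto)
  also have "\<dots> = gdet A (f \<circ> ?t) K"
  proof (rule gdet_cong)
    fix x b assume x: "x \<in> A" and "b \<in> (f \<circ> ?t) ` A"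
    then have b: "b \<in> f ` A" using A by (metis image_comp)
    show "K (?t x) b = K x b"
      using assms(5)[OF b] by (cases "x = a"; cases "x = a'") auto
  qed auto
  also have "\<dots> = - gdet A f K"
    using gdet_perm[OF t assms(1), of f K] assms(4) by (simp add: sign_swap_id)
  finally show ?thesis by simp
qed

lemma gdet_row_add:
  assumes "finite A" "a \<in> A"
  shows "gdet A f (\<lambda>x b. if x = a then K a b + c * r b else K x b)
       = gdet A f K + c * gdet A f (\<lambda>x b. if x = a then r b else K x b)"
proof -
  define R where "R \<sigma> = (\<Prod>x\<in>A-{a}. K x (f (\<sigma> x)))" for \<sigma>
  have *: "(\<Prod>x\<in>A. if x = a then g (\<sigma> x) else K x (f (\<sigma> x))) = g (\<sigma> a) * R \<sigma>" for g :: "'a \<Rightarrow> real" and \<sigma>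
    unfolding R_def by (subst prod.remove[OF assms]) (auto intro!: prod.cong)
  have **: "(\<Prod>x\<in>A. K x (f (\<sigma> x))) = K a (f (\<sigma> a)) * R \<sigma>" for \<sigma>
    unfolding R_def by (rule prod.remove[OF assms])
  have "gdet A f (\<lambda>x b. if x = a then K a b + c * r b else K x b)
      = (\<Sum>\<sigma> | \<sigma> permutes A. of_int (sign \<sigma>) * ((K a (f (\<sigma> a)) + c * r (f (\<sigma> a))) * R \<sigma>))"
    unfolding gdet_def by (simp only: *[where g="\<lambda>z. K a (f z) + c * r (f z)"])
  moreover have "gdet A f (\<lambda>x b. if x = a then r b else K x b)
      = (\<Sum>\<sigma> | \<sigma> permutes A. of_int (sign \<sigma>) * (r (f (\<sigma> a)) * R \<sigma>))"
    unfolding gdet_def by (simp only: *[where g="\<lambda>z. r (f z)"])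
  moreover have "gdet A f K = (\<Sum>\<sigma> | \<sigma> permutes A. of_int (sign \<sigma>) * (K a (f (\<sigma> a)) * R \<sigma>))"
    unfolding gdet_def ** ..
  ultimately show ?thesis
    by (simp add: sum_distrib_left sum.distrib[symmetric] algebra_simps)
qed

lemma gdet_row_op:
  assumes "finite A" "k \<in> A" "S \<subseteq> A - {k}"
  shows "gdet A f (\<lambda>x b. if x \<in> S then K x b + c x * K k b else K x b) = gdet A f K"
proof -
  have "finite S" using assms finite_subset by blast
  thus ?thesis using assms(3)
  proof (induction S rule: finite_induct)
    case empty
    then show ?case by simp
  next
    case (insert a S)
    let ?L = "\<lambda>x b. if x \<in> S then K x b + c x * K k b else K x b"
    have a: "a \<in> A" "a \<noteq> k" "k \<notin> S" using insert by auto
    have "gdet A f (\<lambda>x b. if x \<in> insert a S then K x b + c x * K k b else K x b)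
        = gdet A f (\<lambda>x b. if x = a then ?L a b + c a * K k b else ?L x b)"
      by (rule gdet_cong) (use insert.hyps in auto)
    also have "\<dots> = gdet A f ?L + c a * gdet A f (\<lambda>x b. if x = a then K k b else ?L x b)"
      by (rule gdet_row_add[OF assms(1) a(1)])
    also have "gdet A f (\<lambda>x b. if x = a then K k b else ?L x b) = 0"
      by (rule gdet_twin[OF assms(1) a(1) assms(2) a(2)]) (use a in auto)
    finally show ?case using insert by simp
  qed
qed

text \<open>Row operations with pivot row \<open>k\<close> clear the column \<open>f k\<close> in
  all other rows, and then only permutations fixing \<open>k\<close> contribute. The pivot sits on
  the diagonal of the pairing \<open>f\<close>, so no sign appears.\<close>

lemma gdet_schur:
  assumes "finite A" "k \<in> A" "K k (f k) \<noteq> 0"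
  shows "gdet A f K = K k (f k) * gdet (A - {k}) f (\<lambda>a b. K a b - K a (f k) * K k b / K k (f k))"
proof -
  define L where "L = (\<lambda>a b. if a \<in> A - {k} then K a b + (- K a (f k) / K k (f k)) * K k b else K a b)"
  have z: "L a (f k) = 0" if "a \<in> A - {k}" for a using that assms(3) by (simp add: L_def)
  have "gdet A f K = gdet A f L" unfolding L_def by (rule gdet_row_op[symmetric]) (use assms in auto)
  also have "\<dots> = (\<Sum>\<sigma> | \<sigma> permutes A - {k}. of_int (sign \<sigma>) * (\<Prod>a\<in>A. L a (f (\<sigma> a))))"
    unfolding gdet_def
  proof (rule sum.mono_neutral_right)
    show "finite {\<sigma>. \<sigma> permutes A}" using assms(1) by (rule finite_permutations)
    show "{\<sigma>. \<sigma> permutes A - {k}} \<subseteq> {\<sigma>. \<sigma> permutes A}" by (auto intro: permutes_subset)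
    show "\<forall>\<sigma>\<in>{\<sigma>. \<sigma> permutes A} - {\<sigma>. \<sigma> permutes A - {k}}. of_int (sign \<sigma>) * (\<Prod>a\<in>A. L a (f (\<sigma> a))) = 0"
    proof
      fix \<sigma> assume s: "\<sigma> \<in> {\<sigma>. \<sigma> permutes A} - {\<sigma>. \<sigma> permutes A - {k}}"
      then have p: "\<sigma> permutes A" and np: "\<not> \<sigma> permutes A - {k}" by auto
      have "\<sigma> k \<noteq> k" using np permutes_superset[OF p, of "A - {k}"] by auto
      define a where "a = inv_into UNIV \<sigma> k"
      have a: "\<sigma> a = k" using p by (simp add: a_def permutes_inverses)
      have "a \<in> A" using a p assms(2) by (metis permutes_in_image)
      moreover have "a \<noteq> k" using a \<open>\<sigma> k \<noteq> k\<close> by auto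
      ultimately have "L a (f (\<sigma> a)) = 0" using a z by simp
      then show "of_int (sign \<sigma>) * (\<Prod>a\<in>A. L a (f (\<sigma> a))) = 0"
        using \<open>a \<in> A\<close> assms(1) by (auto intro!: prod_zero)
    qed
  qed
  also have "\<dots> = (\<Sum>\<sigma> | \<sigma> permutes A - {k}. K k (f k) * (of_int (sign \<sigma>) * (\<Prod>a\<in>A - {k}. L a (f (\<sigma> a)))))"
  proof (intro sum.cong refl)
    fix \<sigma> assume "\<sigma> \<in> {\<sigma>. \<sigma> permutes A - {k}}"
    then have "\<sigma> k = k" by (auto simp: permutes_def)
    then show "of_int (sign \<sigma>) * (\<Prod>a\<in>A. L a (f (\<sigma> a))) = K k (f k) * (of_int (sign \<sigma>) * (\<Prod>a\<in>A - {k}. L a (f (\<sigma> a))))"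
      by (subst prod.remove[OF assms(1,2)]) (simp add: L_def)
  qed
  also have "\<dots> = K k (f k) * gdet (A - {k}) f L" by (simp add: gdet_def sum_distrib_left)
  also have "gdet (A - {k}) f L = gdet (A - {k}) f (\<lambda>a b. K a b - K a (f k) * K k b / K k (f k))"
    by (rule gdet_cong) (auto simp: L_def)
  finally show ?thesis .
qed

section \<open>Combinatorics of link patterns: matchings, Dyck paths and local moves\<close>

subsection \<open>Noncrossing perfect matchings\<close>

definition matching :: "nat \<Rightarrow> nat set set \<Rightarrow> bool" where
  "matching N \<beta> \<longleftrightarrow> partition_on {1..2*N} \<beta> \<and> (\<forall>l\<in>\<beta>. card l = 2)"

definition noncrossing :: "nat set set \<Rightarrow> bool" where
  "noncrossing \<beta> \<longleftrightarrow> (\<forall>a b c e. {a, b} \<in> \<beta> \<longrightarrow> {c, e} \<in> \<beta> \<longrightarrow> \<not> (a < c \<and> c < b \<and> b < e))"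

definition NC :: "nat \<Rightarrow> nat set set set" where
  "NC N = {\<beta>. matching N \<beta> \<and> noncrossing \<beta>}"

definition mate :: "nat set set \<Rightarrow> nat \<Rightarrow> nat" where
  "mate \<beta> a = (THE b. {a, b} \<in> \<beta>)"

definition lefts :: "nat set set \<Rightarrow> nat set" where
  "lefts \<beta> = Min ` \<beta>"

lemma matchingD:
  assumes "matching N \<beta>"
  shows "l \<in> \<beta> \<Longrightarrow> \<exists>a b. l = {a, b} \<and> a < b \<and> a \<in> {1..2*N} \<and> b \<in> {1..2*N}"
    and "a \<in> {1..2*N} \<Longrightarrow> \<exists>b. {a, b} \<in> \<beta>"
    and "{a, b} \<in> \<beta> \<Longrightarrow> {a, c} \<in> \<beta> \<Longrightarrow> b = c"
proof -
  have p: "partition_on {1..2*N} \<beta>" and c: "\<forall>l\<in>\<beta>. card l = 2"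
    using assms by (auto simp: matching_def)
  have sub: "l \<subseteq> {1..2*N}" if "l \<in> \<beta>" for l using partition_onD1[OF p] that by auto
  show 1: "\<exists>a b. l = {a, b} \<and> a < b \<and> a \<in> {1..2*N} \<and> b \<in> {1..2*N}" if l: "l \<in> \<beta>" for l
  proof -
    obtain x y where xy: "l = {x, y}" "x \<noteq> y" using c l card_2_iff by metis
    have r: "x \<in> {1..2*N}" "y \<in> {1..2*N}" using sub[OF l] xy by auto
    have yx: "l = {y, x}" using xy by auto
    show ?thesis
    proof (cases "x < y")
      case True
      then show ?thesis using r xy(1) by blast
    next
      case False
      then have "y < x" using xy(2) by simp
      then show ?thesis using r yx by blast
    qed
  qed
  show "\<exists>b. {a, b} \<in> \<beta>" if a: "a \<in> {1..2*N}"
  proof -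
    obtain l where l: "l \<in> \<beta>" "a \<in> l" using a partition_onD1[OF p] by blast
    obtain x y where "l = {x, y}" using 1[OF l(1)] by auto
    with l show ?thesis by (auto simp: insert_commute)
  qed
  show "b = c" if "{a, b} \<in> \<beta>" "{a, c} \<in> \<beta>"
  proof -
    have "{a, b} = {a, c}"
      using disjointD[OF partition_onD2[OF p] that] by blast
    moreover have "a \<noteq> b" "a \<noteq> c" using c that by auto
    ultimately show ?thesis by (auto simp: doubleton_eq_iff)
  qed
qed

lemma matchingI:
  assumes "\<And>l. l \<in> \<beta> \<Longrightarrow> \<exists>a b. l = {a, b} \<and> a \<noteq> b \<and> a \<in> {1..2*N} \<and> b \<in> {1..2*N}"
    and "\<And>a. a \<in> {1..2*N} \<Longrightarrow> \<exists>b. {a, b} \<in> \<beta>"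
    and "\<And>a b c. {a, b} \<in> \<beta> \<Longrightarrow> {a, c} \<in> \<beta> \<Longrightarrow> b = c"
  shows "matching N \<beta>"
  unfolding matching_def
proof (intro conjI ballI partition_onI)
  show "\<Union>\<beta> = {1..2*N}" using assms(1,2) by blast
  show "{} \<notin> \<beta>" using assms(1) by blast
  show "disjnt p q" if pq: "p \<in> \<beta>" "q \<in> \<beta>" "p \<noteq> q" for p q
  proof (rule ccontr)
    assume "\<not> disjnt p q"
    then obtain x where x: "x \<in> p" "x \<in> q" by (auto simp: disjnt_def)
    obtain y where y: "p = {x, y}" using assms(1)[OF pq(1)] x by (auto simp: insert_commute)
    obtain z where z: "q = {x, z}" using assms(1)[OF pq(2)] x by (auto simp: insert_commute)
    show False using assms(3)[of x y z] pq y z by auto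
  qed
  show "card l = 2" if "l \<in> \<beta>" for l using assms(1)[OF that] by auto
qed

context
  fixes N \<beta>
  assumes M: "matching N \<beta>"
begin

lemma mate_eqI: "{a, b} \<in> \<beta> \<Longrightarrow> mate \<beta> a = b"
  unfolding mate_def using matchingD(3)[OF M] by blast

lemma mate_link: "a \<in> {1..2*N} \<Longrightarrow> {a, mate \<beta> a} \<in> \<beta>"
  using matchingD(2)[OF M] mate_eqI by blast

lemma link_range: "{a, b} \<in> \<beta> \<Longrightarrow> a \<in> {1..2*N} \<and> b \<in> {1..2*N} \<and> a \<noteq> b"
  using matchingD(1)[OF M, of "{a, b}"] by (auto simp: doubleton_eq_iff)

lemma link_iff: "{a, b} \<in> \<beta> \<longleftrightarrow> a \<in> {1..2*N} \<and> b = mate \<beta> a"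
  using mate_link mate_eqI link_range by blast

lemma mate_in: "a \<in> {1..2*N} \<Longrightarrow> mate \<beta> a \<in> {1..2*N}"
  using mate_link[of a] link_range[of a "mate \<beta> a"] by auto

lemma mate_neq: "a \<in> {1..2*N} \<Longrightarrow> mate \<beta> a \<noteq> a"
  using mate_link[of a] link_range[of a "mate \<beta> a"] by auto

lemma mate_mate: "a \<in> {1..2*N} \<Longrightarrow> mate \<beta> (mate \<beta> a) = a"
  using mate_link mate_eqI by (metis insert_commute)

lemma mate_inj: "inj_on (mate \<beta>) {1..2*N}"
  using mate_mate by (metis inj_onI)

lemma lefts_eq: "lefts \<beta> = {a \<in> {1..2*N}. a < mate \<beta> a}"
proof (intro equalityI subsetI)
  fix x assume "x \<in> lefts \<beta>"
  then obtain l where l: "l \<in> \<beta>" "x = Min l" by (auto simp: lefts_def)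
  obtain a b where ab: "l = {a, b}" "a < b" using matchingD(1)[OF M l(1)] by blast
  then have "x = a" using l by simp
  then show "x \<in> {a \<in> {1..2*N}. a < mate \<beta> a}" using ab l link_iff[of a b] by auto
next
  fix x assume x: "x \<in> {a \<in> {1..2*N}. a < mate \<beta> a}"
  then have "Min {x, mate \<beta> x} = x" by simp
  moreover have "{x, mate \<beta> x} \<in> \<beta>" using x mate_link by blast
  ultimately show "x \<in> lefts \<beta>" unfolding lefts_def by (metis imageI)
qed

lemma finite_lefts: "finite (lefts \<beta>)" unfolding lefts_eq by simp

lemma lefts_sub: "a \<in> lefts \<beta> \<Longrightarrow> a \<in> {1..2*N}" by (simp add: lefts_eq)

lemma mate_lefts: "mate \<beta> ` lefts \<beta> = {1..2*N} - lefts \<beta>"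
proof (intro equalityI subsetI)
  fix x assume "x \<in> mate \<beta> ` lefts \<beta>"
  then obtain a where a: "a \<in> {1..2*N}" "a < mate \<beta> a" "x = mate \<beta> a" by (auto simp: lefts_eq)
  then show "x \<in> {1..2*N} - lefts \<beta>" using mate_mate[of a] mate_in[of a] by (auto simp: lefts_eq)
next
  fix x assume x: "x \<in> {1..2*N} - lefts \<beta>"
  then have "mate \<beta> x < x" using mate_neq[of x] by (auto simp: lefts_eq)
  then have "mate \<beta> x \<in> lefts \<beta>" using x mate_mate[of x] mate_in[of x] by (auto simp: lefts_eq)
  then show "x \<in> mate \<beta> ` lefts \<beta>" using x mate_mate[of x] by (metis DiffD1 imageI)
qed

lemma card_lefts: "card (lefts \<beta>) = N"
proof -
  have i: "inj_on (mate \<beta>) (lefts \<beta>)" using mate_inj by (rule inj_on_subset) (auto simp: lefts_eq)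
  have "card {1..2*N} = card (lefts \<beta>) + card ({1..2*N} - lefts \<beta>)"
  proof -
    have s: "lefts \<beta> \<subseteq> {1..2*N}" using lefts_sub by blast
    show ?thesis using card_Diff_subset[OF finite_lefts s] card_mono[OF _ s] by simp
  qed
  also have "card ({1..2*N} - lefts \<beta>) = card (lefts \<beta>)"
    unfolding mate_lefts[symmetric] by (rule card_image[OF i])
  finally show ?thesis by simp
qed

lemma dyck_path_Suc: "dyck_path \<beta> (Suc j) = dyck_path \<beta> j + (if Suc j \<in> lefts \<beta> then 1 else - 1)"
  by (simp add: dyck_path_def lefts_def)

text \<open>The height counts the arcs passing over the point j + 1/2. This gives nonnegativity and,
  at a peak whose foot has positive height, an arc above the peak.\<close>

lemma dyck_path_card:
  "j \<le> 2*N \<Longrightarrow> dyck_path \<beta> j = int (card {a \<in> lefts \<beta>. a \<le> j \<and> j < mate \<beta> a})"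
proof (induction j)
  case 0
  then show ?case by (auto simp: dyck_path_def lefts_eq)
next
  case (Suc j)
  let ?O = "\<lambda>j. {a \<in> lefts \<beta>. a \<le> j \<and> j < mate \<beta> a}"
  have f: "finite (?O j)" for j using finite_lefts by simp
  have sj: "Suc j \<in> {1..2*N}" using Suc by auto
  show ?case
  proof (cases "Suc j \<in> lefts \<beta>")
    case True
    then have l: "Suc j < mate \<beta> (Suc j)" by (simp add: lefts_eq)
    have "mate \<beta> a \<noteq> Suc j" if "a \<in> lefts \<beta>" for a
      using imageI[OF that, of "mate \<beta>"] True unfolding mate_lefts by auto
    then have "?O (Suc j) = insert (Suc j) (?O j)"
      using True l by (force simp: le_Suc_eq)
    then show ?thesis using Suc True f by (simp add: dyck_path_Suc)
  next
    case False
    have lt: "mate \<beta> (Suc j) < Suc j" using False mate_neq[OF sj] sj by (auto simp: lefts_eq)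
    have mm: "mate \<beta> (mate \<beta> (Suc j)) = Suc j" by (rule mate_mate[OF sj])
    have ml: "mate \<beta> (Suc j) \<in> lefts \<beta>" using lt mm mate_in[OF sj] by (auto simp: lefts_eq)
    have e: "a = mate \<beta> (Suc j)" if "a \<in> lefts \<beta>" "mate \<beta> a = Suc j" for a
      using that mate_mate[of a] by (auto simp: lefts_eq)
    have "?O j = insert (mate \<beta> (Suc j)) (?O (Suc j))"
      using False lt mm ml by (auto simp: le_Suc_eq less_Suc_eq_le dest: e intro: Suc_lessI)
    moreover have "mate \<beta> (Suc j) \<notin> ?O (Suc j)" using mm by simp
    ultimately have "card (?O j) = Suc (card (?O (Suc j)))"
      using f[of "Suc j"] by simp
    then show ?thesis using Suc False by (simp add: dyck_path_Suc)
  qed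
qed

lemma dyck_path_nonneg: "j \<le> 2*N \<Longrightarrow> 0 \<le> dyck_path \<beta> j"
  by (simp add: dyck_path_card)

lemma dyck_path_end: "dyck_path \<beta> (2*N) = 0"
proof -
  have "{a \<in> lefts \<beta>. a \<le> 2*N \<and> 2*N < mate \<beta> a} = {}"
    using mate_in by (fastforce simp: lefts_eq)
  then show ?thesis by (simp add: dyck_path_card)
qed

end

lemma dyck_path_0 [simp]: "dyck_path \<beta> 0 = 0"
  by (simp add: dyck_path_def)

lemma matching_eqI:
  assumes "matching N \<beta>" "matching N \<beta>'" "\<And>a. a \<in> {1..2*N} \<Longrightarrow> mate \<beta> a = mate \<beta>' a"
  shows "\<beta> = \<beta>'"
proof -
  have "\<gamma> \<subseteq> \<gamma>'" if H: "matching N \<gamma>" "matching N \<gamma>'" "\<And>a. a \<in> {1..2*N} \<Longrightarrow> mate \<gamma> a = mate \<gamma>' a" for \<gamma> \<gamma>'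
  proof
    fix l assume "l \<in> \<gamma>"
    then obtain a b where "l = {a, b}" "{a, b} \<in> \<gamma>" using matchingD(1)[OF H(1), of l] by auto
    then show "l \<in> \<gamma>'" using H(3) link_iff[OF H(1), of a b] link_iff[OF H(2), of a b] by auto
  qed
  then show ?thesis using assms by (metis subset_antisym)
qed

lemma NC_matching: "\<beta> \<in> NC N \<Longrightarrow> matching N \<beta>" by (simp add: NC_def)

lemma finite_NC: "finite (NC N)"
proof (rule finite_subset)
  show "NC N \<subseteq> Pow (Pow {1..2*N})"
    by (auto simp: NC_def matching_def partition_on_def)
qed simp

lemma NC_not_crossing:
  assumes "\<beta> \<in> NC N" "a \<in> {1..2*N}" "c \<in> {1..2*N}"
  shows "\<not> (a < c \<and> c < mate \<beta> a \<and> mate \<beta> a < mate \<beta> c)"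
  using mate_link[OF NC_matching[OF assms(1)] assms(2)] mate_link[OF NC_matching[OF assms(1)] assms(3)] assms(1)
  unfolding NC_def noncrossing_def by blast

lemma NC_I:
  assumes M: "matching N \<beta>"
    and "\<And>a c. a \<in> {1..2*N} \<Longrightarrow> c \<in> {1..2*N} \<Longrightarrow> a < c \<Longrightarrow> c < mate \<beta> a \<Longrightarrow> mate \<beta> a < mate \<beta> c \<Longrightarrow> False"
  shows "\<beta> \<in> NC N"
proof -
  have "\<not> (a < c \<and> c < b \<and> b < e)" if "{a, b} \<in> \<beta>" "{c, e} \<in> \<beta>" for a b c e
    using assms(2)[of a c] that link_iff[OF M, of a b] link_iff[OF M, of c e] by auto
  then show ?thesis using M by (simp add: NC_def noncrossing_def)
qed

text \<open>Induction on the length of a link \<open>{a, b}\<close>: in the second pattern the points strictly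
  between \<open>a\<close> and \<open>b\<close> are already linked among themselves.\<close>

lemma NC_eqI_lefts:
  assumes "\<beta> \<in> NC N" "\<beta>' \<in> NC N" "lefts \<beta> = lefts \<beta>'"
  shows "\<beta> = \<beta>'"
proof -
  note M = NC_matching[OF assms(1)] and M' = NC_matching[OF assms(2)]
  have L: "mate \<beta>' a = b" if "{a, b} \<in> \<beta>" "a < b" for a b
    using that
  proof (induction "b - a" arbitrary: a b rule: less_induct)
    case less
    have ab: "a \<in> {1..2*N}" "b \<in> {1..2*N}" "mate \<beta> a = b" "mate \<beta> b = a"
      using link_range[OF M less.prems(1)] less.prems(1) link_iff[OF M, of a b] mate_mate[OF M, of a] by auto
    have al: "a \<in> lefts \<beta>'" and bl: "b \<notin> lefts \<beta>'"
      using ab less.prems unfolding assms(3)[symmetric] by (auto simp: lefts_eq[OF M])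
    \<comment> \<open>The induction hypothesis applies to the link of every intermediate point,
      which cannot leave the interval without crossing {a, b}.\<close>
    have mid: "a < mate \<beta>' c \<and> mate \<beta>' c < b" if c: "a < c" "c < b" for c
    proof -
      have cr: "c \<in> {1..2*N}" using c ab by auto
      let ?m = "mate \<beta> c"
      have mr: "?m \<in> {1..2*N}" "mate \<beta> ?m = c" "?m \<noteq> c" using mate_in[OF M cr] mate_mate[OF M cr] mate_neq[OF M cr] by auto
      have "?m \<noteq> a" "?m \<noteq> b" using c ab mr mate_mate[OF M cr] by auto
      moreover have "\<not> b < ?m" using NC_not_crossing[OF assms(1) ab(1) cr] c ab by auto
      moreover have "\<not> ?m < a" using NC_not_crossing[OF assms(1) mr(1) ab(1)] c ab mr by auto
      ultimately have m: "a < ?m" "?m < b" by auto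
      have "mate \<beta>' c = ?m"
      proof (cases "c < ?m")
        case True
        have "?m - c < b - a" using True c m by auto
        then show ?thesis using less.hyps[of ?m c] mate_link[OF M cr] True by auto
      next
        case False
        then have l: "?m < c" using mr by auto
        have "c - ?m < b - a" using l c m by auto
        then have "mate \<beta>' ?m = c" using less.hyps[of c ?m] mate_link[OF M mr(1)] mr l by auto
        then show ?thesis using mate_mate[OF M' mr(1)] by simp
      qed
      then show ?thesis using m by simp
    qed
    let ?x = "mate \<beta>' a" and ?y = "mate \<beta>' b"
    have x: "a < ?x" "?x \<in> {1..2*N}" "mate \<beta>' ?x = a" using al mate_in[OF M' ab(1)] mate_mate[OF M' ab(1)] by (auto simp: lefts_eq[OF M'])
    have y: "?y < b" "?y \<in> {1..2*N}" "mate \<beta>' ?y = b" using bl ab mate_neq[OF M' ab(2)] mate_in[OF M' ab(2)] mate_mate[OF M' ab(2)] by (auto simp: lefts_eq[OF M'])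
    have "\<not> ?x < b" using mid[of ?x] x by auto
    moreover have "\<not> a < ?y" using mid[of ?y] y by auto
    \<comment> \<open>In \<beta>' the mates of \<open>a\<close> and \<open>b\<close> lie outside the
      open interval; were they not each other, the two links would cross.\<close>
    moreover have False if "b < ?x" "?y < a"
      using NC_not_crossing[OF assms(2) y(2) ab(1)] that y less.prems by auto
    ultimately show ?case using y mate_mate[OF M' ab(2)] mate_mate[OF M' ab(1)]
      by (metis linorder_neqE_nat)
  qed
  show ?thesis
  proof (rule matching_eqI[OF M M'])
    fix a assume a: "a \<in> {1..2*N}"
    let ?m = "mate \<beta> a"
    have mr: "?m \<in> {1..2*N}" "mate \<beta> ?m = a" "?m \<noteq> a" using mate_in[OF M a] mate_mate[OF M a] mate_neq[OF M a] by auto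
    show "mate \<beta> a = mate \<beta>' a"
    proof (cases "a < ?m")
      case True
      then show ?thesis using L[of a ?m] mate_link[OF M a] by auto
    next
      case False
      then have "mate \<beta>' ?m = a" using L[of ?m a] mate_link[OF M mr(1)] mr by auto
      then show ?thesis using mate_mate[OF M' mr(1)] by simp
    qed
  qed
qed

text \<open>If \<open>k\<close> opens an arc and \<open>k + 1\<close> closes a different one, the
  latter starts before \<open>k\<close> and the former ends after \<open>k + 1\<close>, which is a
  crossing.\<close>

lemma peak_iff:
  assumes "\<beta> \<in> NC N" "1 \<le> k" "k < 2*N"
  shows "{k, k+1} \<in> \<beta> \<longleftrightarrow> k \<in> lefts \<beta> \<and> k + 1 \<notin> lefts \<beta>"
proof
  note M = NC_matching[OF assms(1)]
  assume "{k, k+1} \<in> \<beta>"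
  then have "mate \<beta> k = k+1" "mate \<beta> (k+1) = k" using mate_eqI[OF M] by (auto simp: insert_commute)
  then show "k \<in> lefts \<beta> \<and> k + 1 \<notin> lefts \<beta>" using assms by (simp add: lefts_eq[OF M])
next
  note M = NC_matching[OF assms(1)]
  assume a: "k \<in> lefts \<beta> \<and> k + 1 \<notin> lefts \<beta>"
  have r: "k \<in> {1..2*N}" "k+1 \<in> {1..2*N}" using assms by auto
  have kr: "k < mate \<beta> k" using a by (auto simp: lefts_eq[OF M])
  have y: "mate \<beta> (k+1) < k+1" "mate \<beta> (k+1) \<in> {1..2*N}" "mate \<beta> (mate \<beta> (k+1)) = k+1"
    using a r mate_neq[OF M r(2)] mate_in[OF M r(2)] mate_mate[OF M r(2)] by (auto simp: lefts_eq[OF M])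
  have "mate \<beta> k = k + 1"
  proof (rule ccontr)
    assume n: "mate \<beta> k \<noteq> k + 1"
    then have "mate \<beta> (k+1) \<noteq> k" using y(3) by auto
    then show False using NC_not_crossing[OF assms(1) y(2) r(1)] y kr n by auto
  qed
  then show "{k, k+1} \<in> \<beta>" using mate_link[OF M r(1)] by simp
qed

subsection \<open>The determinants of link patterns\<close>

text \<open>Rows are the left endpoints, and \<open>mate\<close> pairs them with the columns. No
  enumeration of the endpoints is chosen, so that surgery on the pattern shows as a change of index
  set and pairing.\<close>

definition ndet :: "nat set set \<Rightarrow> (nat \<Rightarrow> nat \<Rightarrow> real) \<Rightarrow> real" where
  "ndet \<beta> K = gdet (lefts \<beta>) (mate \<beta>) K"

lemma ndet_cong:
  assumes M: "matching N \<beta>" and "\<And>a b. a \<in> {1..2*N} \<Longrightarrow> b \<in> {1..2*N} \<Longrightarrow> a \<noteq> b \<Longrightarrow> K a b = K' a b"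
  shows "ndet \<beta> K = ndet \<beta> K'"
  unfolding ndet_def
  by (rule gdet_cong) (use assms(2) mate_lefts[OF M] lefts_sub[OF M] in auto)

text \<open>One bijection enumerates the rows and, through \<open>mate\<close>, also the columns, so
  the reordering contributes no sign.\<close>

lemma det_eq_ndet:
  assumes M: "matching N \<beta>"
  shows "Determinant.det (Matrix.mat N N (\<lambda>(k, l). K (left_endpoint \<beta> k) (right_endpoint \<beta> l))) = ndet \<beta> K"
proof -
  define g where "g k = left_endpoint \<beta> k" for k
  have g: "bij_betw g {0..<N} (lefts \<beta>)"
    using bij_betw_nth[of "sorted_list_of_set (lefts \<beta>)" "{0..<N}" "lefts \<beta>"] finite_lefts[OF M] card_lefts[OF M]
    by (simp add: g_def[abs_def] left_endpoint_def lefts_def[symmetric] atLeast0LessThan)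
  have r: "right_endpoint \<beta> l = mate \<beta> (g l)" for l by (simp add: right_endpoint_def mate_def g_def)
  have "ndet \<beta> K = gdet (g ` {0..<N}) (mate \<beta>) K"
    using g by (simp add: ndet_def bij_betw_def)
  also have "\<dots> = gdet {0..<N} (mate \<beta> \<circ> g) (\<lambda>a b. K (g a) b)"
    by (rule gdet_reindex) (use g in \<open>auto simp: bij_betw_def\<close>)
  also have "\<dots> = Determinant.det (Matrix.mat N N (\<lambda>(k, l). K (g k) (mate \<beta> (g l))))"
    unfolding gdet_def
    by (subst det_def'[of _ N]) (auto intro!: sum.cong prod.cong arg_cong2[where f="(*)"] simp: permutes_in_image[where S="{0..<N}", simplified])
  finally show ?thesis by (simp add: r g_def)
qed

subsection \<open>Local moves on link patterns\<close>

text \<open>A pattern is produced from its fixed-point free involution, so that rewiring links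
  becomes a function update.\<close>

definition of_involution :: "nat \<Rightarrow> (nat \<Rightarrow> nat) \<Rightarrow> nat set set" where
  "of_involution N f = (\<lambda>a. {a, f a}) ` {1..2*N}"

lemma of_involution:
  assumes "\<And>a. a \<in> {1..2*N} \<Longrightarrow> f a \<in> {1..2*N} \<and> f a \<noteq> a \<and> f (f a) = a"
  shows matching_of_involution: "matching N (of_involution N f)"
    and mate_of_involution: "a \<in> {1..2*N} \<Longrightarrow> mate (of_involution N f) a = f a"
proof -
  show M: "matching N (of_involution N f)"
  proof (rule matchingI)
    fix l assume "l \<in> of_involution N f"
    then obtain a where a: "a \<in> {1..2*N}" "l = {a, f a}" by (auto simp: of_involution_def)
    show "\<exists>a b. l = {a, b} \<and> a \<noteq> b \<and> a \<in> {1..2*N} \<and> b \<in> {1..2*N}"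
      using a assms[OF a(1)] by metis
  next
    fix a assume "a \<in> {1..2*N}"
    then have "{a, f a} \<in> of_involution N f" unfolding of_involution_def by (rule imageI)
    then show "\<exists>b. {a, b} \<in> of_involution N f" by blast
  next
    fix a b c assume "{a, b} \<in> of_involution N f" "{a, c} \<in> of_involution N f"
    moreover have "y = f a" if yp: "{a, y} \<in> of_involution N f" for y
    proof -
      obtain z where z: "z \<in> {1..2*N}" "{a, y} = {z, f z}" using yp by (auto simp: of_involution_def)
      then show ?thesis using assms[OF z(1)] by (auto simp: doubleton_eq_iff)
    qed
    ultimately show "b = c" by metis
  qed
  show "mate (of_involution N f) a = f a" if "a \<in> {1..2*N}"
    by (rule mate_eqI[OF M]) (use that in \<open>auto simp: of_involution_def\<close>)
qed

text \<open>At a valley \<open>k\<close> closes an arc and \<open>k + 1\<close> opens one. They are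
  reconnected to an outer arc between the two mates and the short link {k, k+1}, which raises the
  Dyck path by one box.\<close>

definition flip_up :: "nat \<Rightarrow> nat \<Rightarrow> nat set set \<Rightarrow> nat set set" where
  "flip_up N k \<beta> = of_involution N ((mate \<beta>)(mate \<beta> k := mate \<beta> (k+1), mate \<beta> (k+1) := mate \<beta> k, k := k+1, k+1 := k))"

text \<open>A link crossing the new outer arc would already cross one of the two arcs that it
  replaces.\<close>

lemma flip_up:
  assumes B: "\<beta> \<in> NC N" and k: "1 \<le> k" "k < 2*N" and v: "k \<notin> lefts \<beta>" "k + 1 \<in> lefts \<beta>"
  shows flip_up_NC: "flip_up N k \<beta> \<in> NC N"
    and mate_flip_up: "x \<in> {1..2*N} \<Longrightarrow> mate (flip_up N k \<beta>) x =
      ((mate \<beta>)(mate \<beta> k := mate \<beta> (k+1), mate \<beta> (k+1) := mate \<beta> k, k := k+1, k+1 := k)) x"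
    and lefts_flip_up: "lefts (flip_up N k \<beta>) = insert k (lefts \<beta> - {k+1})"
proof -
  note M = NC_matching[OF B]
  let ?a = "mate \<beta> k" and ?b = "mate \<beta> (k+1)"
  let ?f = "(mate \<beta>)(?a := ?b, ?b := ?a, k := k+1, k+1 := k)"
  have r: "k \<in> {1..2*N}" "k+1 \<in> {1..2*N}" using k by auto
  have a: "?a < k" "?a \<in> {1..2*N}" "mate \<beta> ?a = k"
    using v(1) mate_neq[OF M r(1)] r(1) mate_in[OF M r(1)] mate_mate[OF M r(1)] by (auto simp: lefts_eq[OF M])
  have b: "k + 1 < ?b" "?b \<in> {1..2*N}" "mate \<beta> ?b = k+1"
    using v(2) mate_in[OF M r(2)] mate_mate[OF M r(2)] by (auto simp: lefts_eq[OF M])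
  have oth: "mate \<beta> x \<notin> {?a, ?b, k, k+1}" if "x \<in> {1..2*N}" "x \<notin> {?a, ?b, k, k+1}" for x
    using mate_mate[OF M that(1)] that(2) a(3) b(3) by auto
  have I: "?f x \<in> {1..2*N} \<and> ?f x \<noteq> x \<and> ?f (?f x) = x" if x: "x \<in> {1..2*N}" for x
  proof (cases "x \<in> {?a, ?b, k, k+1}")
    case True
    then show ?thesis using a b r by auto
  next
    case False
    then show ?thesis using oth[OF x False] mate_in[OF M x] mate_neq[OF M x] mate_mate[OF M x] by auto
  qed
  have M': "matching N (flip_up N k \<beta>)" unfolding flip_up_def by (rule matching_of_involution[OF I])
  show m: "mate (flip_up N k \<beta>) x = ?f x" if "x \<in> {1..2*N}" for x
    unfolding flip_up_def by (rule mate_of_involution[OF I that])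
  define F where "F = ?f"
  have mF: "mate (flip_up N k \<beta>) x = F x" if "x \<in> {1..2*N}" for x using m[OF that] F_def by simp
  have Fv: "F ?a = ?b" "F ?b = ?a" "F k = k + 1" "F (k+1) = k" using a b by (auto simp: F_def)
  have Fo: "F x = mate \<beta> x" if "x \<notin> {?a, ?b, k, k+1}" for x using that by (auto simp: F_def)
  show "flip_up N k \<beta> \<in> NC N"
  proof (rule NC_I[OF M'])
    fix x y assume x: "x \<in> {1..2*N}" and y: "y \<in> {1..2*N}" and xy: "x < y"
      and "y < mate (flip_up N k \<beta>) x" and "mate (flip_up N k \<beta>) x < mate (flip_up N k \<beta>) y"
    then have f: "y < F x" "F x < F y" using mF x y by auto
    note nc = NC_not_crossing[OF B]
    consider "x = ?a" | "x = ?b" | "x = k" | "x = k + 1" | "x \<notin> {?a, ?b, k, k+1}" by blast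
    then show False
    proof cases
      case 1
      then have fx: "F x = ?b" using Fv by simp
      have yn: "y \<notin> {?a, ?b, k, k+1}" using f fx xy 1 a b Fv by auto
      then have fy: "F y = mate \<beta> y" by (rule Fo)
      show False
        using nc[OF a(2) y] nc[OF r(2) y] f fx fy xy 1 a b yn by auto
    next
      case 2
      then show False using f xy a b Fv by auto
    next
      case 3
      then show False using f xy a b Fv by auto
    next
      case 4
      then show False using f xy a b Fv by auto
    next
      case 5
      then have fx: "F x = mate \<beta> x" by (rule Fo)
      have c: "mate \<beta> x \<notin> {?a, ?b, k, k+1}" by (rule oth[OF x 5])
      consider "y = ?a" | "y = ?b" | "y = k" | "y = k + 1" | "y \<notin> {?a, ?b, k, k+1}" by blast
      then show False
      proof cases
        case 1
        then have fy: "F y = ?b" using Fv by simp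
        show False using nc[OF x a(2)] nc[OF x r(2)] f fx fy xy 1 a b c by auto
      next
        case 2
        then show False using f xy a b Fv by auto
      next
        case 3
        then show False using f xy a b Fv by auto
      next
        case 4
        then show False using f xy a b Fv by auto
      next
        case 5
        then have "F y = mate \<beta> y" by (rule Fo)
        then show False using nc[OF x y] f fx xy by auto
      qed
    qed
  qed
  show "lefts (flip_up N k \<beta>) = insert k (lefts \<beta> - {k+1})"
  proof (rule Set.set_eqI)
    fix x
    show "x \<in> lefts (flip_up N k \<beta>) \<longleftrightarrow> x \<in> insert k (lefts \<beta> - {k+1})"
    proof (cases "x \<in> {1..2*N}")
      case True
      then have "x \<in> lefts (flip_up N k \<beta>) \<longleftrightarrow> x < F x" using mF[OF True] by (auto simp: lefts_eq[OF M'])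
      moreover have "x \<in> lefts \<beta> \<longleftrightarrow> x < mate \<beta> x" using True by (auto simp: lefts_eq[OF M])
      ultimately show ?thesis
        using a b Fv Fo[of x] by (cases "x \<in> {?a, ?b, k, k+1}") auto
    next
      case False
      then show ?thesis using r by (auto simp: lefts_eq[OF M] lefts_eq[OF M'])
    qed
  qed
qed

text \<open>Positive height at the foot of the peak gives an arc over it. The innermost one {a, b}
  is split into {a, k} and {k+1, b}; taking the largest left end \<open>a\<close> keeps all other
  arcs uncrossed.\<close>

lemma flip_down_ex:
  assumes B: "\<beta> \<in> NC N" and k: "1 \<le> k" "k < 2*N" and p: "{k, k+1} \<in> \<beta>" and h: "0 < dyck_path \<beta> (k - 1)"
  shows "\<exists>\<beta>'\<in>NC N. k \<notin> lefts \<beta>' \<and> k + 1 \<in> lefts \<beta>' \<and> lefts \<beta> = insert k (lefts \<beta>' - {k+1})"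
proof -
  note M = NC_matching[OF B]
  define Op where "Op = {a \<in> lefts \<beta>. a \<le> k - 1 \<and> k - 1 < mate \<beta> a}"
  have fO: "finite Op" unfolding Op_def using finite_lefts[OF M] by simp
  have "Op \<noteq> {}" using h dyck_path_card[OF M, of "k-1"] k unfolding Op_def
    by (metis (no_types, lifting) card.empty diff_le_self int_ops(1) le_trans less_imp_le_nat less_irrefl)
  define a where "a = Max Op"
  have aO: "a \<in> Op" unfolding a_def using Max_in[OF fO \<open>Op \<noteq> {}\<close>] .
  have amax: "x \<le> a" if "x \<in> Op" for x unfolding a_def using Max_ge[OF fO that] .
  have mk: "mate \<beta> k = k+1" "mate \<beta> (k+1) = k" using p mate_eqI[OF M] by (auto simp: insert_commute)
  have r: "k \<in> {1..2*N}" "k+1 \<in> {1..2*N}" using k by auto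
  have a: "a \<in> {1..2*N}" "a < k" using aO k by (auto simp: Op_def lefts_eq[OF M])
  define b where "b = mate \<beta> a"
  have bb: "b \<in> {1..2*N}" "mate \<beta> b = a" using mate_in[OF M a(1)] mate_mate[OF M a(1)] by (auto simp: b_def)
  have "b \<noteq> k" "b \<noteq> k + 1" using bb mk a by auto
  then have b: "k + 1 < b" using aO by (auto simp: Op_def b_def[symmetric])
  let ?f = "(mate \<beta>)(a := k, k := a, k + 1 := b, b := k + 1)"
  have oth: "mate \<beta> x \<notin> {a, b, k, k+1}" if "x \<in> {1..2*N}" "x \<notin> {a, b, k, k+1}" for x
    using mate_mate[OF M that(1)] that(2) bb mk b_def by auto
  have I: "?f x \<in> {1..2*N} \<and> ?f x \<noteq> x \<and> ?f (?f x) = x" if x: "x \<in> {1..2*N}" for x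
  proof (cases "x \<in> {a, b, k, k+1}")
    case True
    then show ?thesis using a b bb r by auto
  next
    case False
    then show ?thesis using oth[OF x False] mate_in[OF M x] mate_neq[OF M x] mate_mate[OF M x] by auto
  qed
  define g where "g = of_involution N ?f"
  have M': "matching N g" unfolding g_def by (rule matching_of_involution[OF I])
  have m: "mate g x = ?f x" if "x \<in> {1..2*N}" for x
    unfolding g_def by (rule mate_of_involution[OF I that])
  have "g \<in> NC N"
  proof (rule NC_I[OF M'])
    fix x y assume x: "x \<in> {1..2*N}" and y: "y \<in> {1..2*N}" and xy: "x < y"
      and "y < mate g x" and "mate g x < mate g y"
    then have f: "y < ?f x" "?f x < ?f y" using m by auto
    note nc = NC_not_crossing[OF B]
    have ab: "?f a = k" "?f k = a" "?f (k+1) = b" "?f b = k+1" using a b by auto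
    consider "x = a" | "x = k + 1" | "x \<in> {b, k}" | "x \<notin> {a, b, k, k+1}" by blast
    then show False
    proof cases
      case 1
      then have yn: "y \<notin> {a, b, k, k+1}" using f ab xy a b by auto
      then have fy: "?f y = mate \<beta> y" by auto
      have "y \<in> Op" using f ab fy 1 y a xy by (auto simp: Op_def lefts_eq[OF M])
      then show False using amax[of y] 1 xy by auto
    next
      case 2
      then have yn: "y \<notin> {a, b, k, k+1}" using f ab xy a b by auto
      then have fy: "?f y = mate \<beta> y" by auto
      show False using nc[OF a(1) y] f ab fy 2 xy a b by (auto simp: b_def[symmetric])
    next
      case 3
      then show False using f xy ab a b by auto
    next
      case 4
      then have fx: "?f x = mate \<beta> x" by auto
      have c: "mate \<beta> x \<notin> {a, b, k, k+1}" by (rule oth[OF x 4])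
      consider "y = a" | "y = k + 1" | "y \<in> {b, k}" | "y \<notin> {a, b, k, k+1}" by blast
      then show False
      proof cases
        case 1
        show False using nc[OF x a(1)] f fx ab xy 1 a b by (auto simp: b_def[symmetric])
      next
        case 2
        have f2: "k + 1 < mate \<beta> x" "mate \<beta> x < b" using 2 f fx ab by auto
        show False
        proof (cases "x < a")
          case True
          then show ?thesis using nc[OF x a(1)] f2 a by (auto simp: b_def[symmetric])
        next
          case False
          then have "x \<in> Op" using 4 f2 xy 2 x by (auto simp: Op_def lefts_eq[OF M])
          then show ?thesis using amax False 4 by force
        qed
      next
        case 3
        then show False using f fx ab xy a b by auto
      next
        case 4
        then have "?f y = mate \<beta> y" by auto
        then show False using nc[OF x y] f fx xy by auto
      qed
    qed
  qed
  moreover have "k \<notin> lefts g" "k + 1 \<in> lefts g" using m[OF r(1)] m[OF r(2)] a b r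
    by (auto simp: lefts_eq[OF M'])
  moreover have "lefts \<beta> = insert k (lefts g - {k+1})"
  proof (rule Set.set_eqI)
    fix x
    show "x \<in> lefts \<beta> \<longleftrightarrow> x \<in> insert k (lefts g - {k+1})"
    proof (cases "x \<in> {1..2*N}")
      case True
      then have "x \<in> lefts g \<longleftrightarrow> x < ?f x" using m[OF True] by (auto simp: lefts_eq[OF M'])
      moreover have "x \<in> lefts \<beta> \<longleftrightarrow> x < mate \<beta> x" using True by (auto simp: lefts_eq[OF M])
      ultimately show ?thesis
        using a b mk bb b_def by (cases "x \<in> {a, b, k, k+1}") auto
    next
      case False
      then show ?thesis using r by (auto simp: lefts_eq[OF M] lefts_eq[OF M'])
    qed
  qed
  ultimately show ?thesis by blast
qed

lemma dyck_path_flip: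
  assumes "k \<notin> lefts \<beta>" "k + 1 \<in> lefts \<beta>" "lefts \<beta>' = insert k (lefts \<beta> - {k+1})" "1 \<le> k"
  shows "dyck_path \<beta>' j = dyck_path \<beta> j + (if j = k then 2 else 0)"
proof (induction j)
  case 0
  then show ?case using assms by simp
next
  case (Suc j)
  have "dyck_path b (Suc j) = dyck_path b j + (if Suc j \<in> lefts b then 1 else - 1)" for b
    by (simp add: dyck_path_def lefts_def)
  then show ?case using Suc assms by auto
qed

definition swapped :: "nat \<Rightarrow> (nat \<Rightarrow> nat \<Rightarrow> real) \<Rightarrow> nat \<Rightarrow> nat \<Rightarrow> real" where
  "swapped k K a b = K (Transposition.transpose k (k+1) a) (Transposition.transpose k (k+1) b)"

lemma ndet_swapped_eq:
  "ndet \<beta> (swapped k K) = gdet (lefts \<beta>) (Transposition.transpose k (k+1) \<circ> mate \<beta>)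
     (\<lambda>a b. K (Transposition.transpose k (k+1) a) b)"
  by (simp add: ndet_def swapped_def[abs_def] gdet_def)

text \<open>Both exchanged labels are rows and no column carries them, so two rows are
  interchanged.\<close>

lemma ndet_swapped_up:
  assumes M: "matching N \<beta>" and k: "1 \<le> k" "k < 2*N" and v: "k \<in> lefts \<beta>" "k + 1 \<in> lefts \<beta>"
  shows "ndet \<beta> (swapped k K) = - ndet \<beta> K"
proof -
  let ?t = "Transposition.transpose k (k+1)"
  let ?L = "lefts \<beta>"
  have t: "?t permutes ?L" using v by (simp add: permutes_swap_id)
  have L: "?t ` ?L = ?L" by (rule permutes_image[OF t])
  have "ndet \<beta> K = gdet (?t ` ?L) (mate \<beta>) K" by (simp only: L ndet_def)
  also have "\<dots> = gdet ?L (mate \<beta> \<circ> ?t) (\<lambda>a b. K (?t a) b)"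
    by (rule gdet_reindex) (use finite_lefts[OF M] in auto)
  also have "\<dots> = - gdet ?L (mate \<beta>) (\<lambda>a b. K (?t a) b)"
    by (subst gdet_perm[OF t finite_lefts[OF M]]) (simp add: sign_swap_id)
  also have "gdet ?L (mate \<beta>) (\<lambda>a b. K (?t a) b) = gdet ?L (?t \<circ> mate \<beta>) (\<lambda>a b. K (?t a) b)"
  proof (rule gdet_cong)
    fix a assume "a \<in> ?L"
    then have "mate \<beta> a \<notin> ?L" using mate_lefts[OF M] by blast
    then have "mate \<beta> a \<noteq> k" "mate \<beta> a \<noteq> k+1" using v by auto
    then show "mate \<beta> a = (?t \<circ> mate \<beta>) a" by simp
  qed auto
  finally show ?thesis by (simp add: ndet_swapped_eq)
qed

text \<open>Both exchanged labels are columns, so the exchange acts on the pairing as the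
  transposition of their mates.\<close>

lemma ndet_swapped_down:
  assumes M: "matching N \<beta>" and k: "1 \<le> k" "k < 2*N" and v: "k \<notin> lefts \<beta>" "k + 1 \<notin> lefts \<beta>"
  shows "ndet \<beta> (swapped k K) = - ndet \<beta> K"
proof -
  let ?t = "Transposition.transpose k (k+1)"
  let ?L = "lefts \<beta>"
  have r: "k \<in> {1..2*N}" "k+1 \<in> {1..2*N}" using k by auto
  let ?a = "mate \<beta> k" and ?b = "mate \<beta> (k+1)"
  have a: "?a \<in> ?L" "mate \<beta> ?a = k"
    using v(1) r(1) mate_neq[OF M r(1)] mate_in[OF M r(1)] mate_mate[OF M r(1)] by (auto simp: lefts_eq[OF M])
  have b: "?b \<in> ?L" "mate \<beta> ?b = k + 1"
    using v(2) r(2) mate_neq[OF M r(2)] mate_in[OF M r(2)] mate_mate[OF M r(2)] by (auto simp: lefts_eq[OF M])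
  let ?s = "Transposition.transpose ?a ?b"
  have ab: "?a \<noteq> ?b" using a b by auto
  have s: "?s permutes ?L" using a b by (simp add: permutes_swap_id)
  have "ndet \<beta> (swapped k K) = gdet ?L (mate \<beta> \<circ> ?s) K"
    unfolding ndet_swapped_eq
  proof (rule gdet_cong)
    fix x assume x: "x \<in> ?L"
    have xr: "x \<in> {1..2*N}" using lefts_sub[OF M x] .
    show "(?t \<circ> mate \<beta>) x = (mate \<beta> \<circ> ?s) x"
    proof (cases "x = ?a \<or> x = ?b")
      case True
      then show ?thesis using a b by auto
    next
      case False
      then have "mate \<beta> x \<noteq> k" "mate \<beta> x \<noteq> k+1" using mate_mate[OF M xr] by auto
      then show ?thesis using False by simp
    qed
  next
    fix x y assume "x \<in> ?L"
    then have "x \<noteq> k" "x \<noteq> k+1" using v by auto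
    then show "K (?t x) y = K x y" by simp
  qed auto
  also have "\<dots> = - ndet \<beta> K"
    unfolding ndet_def by (subst gdet_perm[OF s finite_lefts[OF M]]) (use ab in \<open>simp add: sign_swap_id\<close>)
  finally show ?thesis .
qed

text \<open>The exchange turns the row and column sets of \<beta> into those of the flipped pattern.
  The two pairings differ by the transposition of \<open>mate \<beta> k\<close> and
  \<open>k + 1\<close>, which is the sign. This is the only case in which the exchange leads to
  another pattern.\<close>

lemma ndet_swapped_valley:
  assumes B: "\<beta> \<in> NC N" and k: "1 \<le> k" "k < 2*N" and v: "k \<notin> lefts \<beta>" "k + 1 \<in> lefts \<beta>"
  shows "ndet \<beta> (swapped k K) = - ndet (flip_up N k \<beta>) K"
proof -
  note M = NC_matching[OF B]
  let ?t = "Transposition.transpose k (k+1)"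
  let ?L = "lefts \<beta>" and ?m = "mate (flip_up N k \<beta>)"
  have r: "k \<in> {1..2*N}" "k+1 \<in> {1..2*N}" using k by auto
  let ?a = "mate \<beta> k" and ?b = "mate \<beta> (k+1)"
  have a: "?a \<in> ?L" "mate \<beta> ?a = k" "?a < k"
    using v(1) r(1) mate_neq[OF M r(1)] mate_in[OF M r(1)] mate_mate[OF M r(1)] by (auto simp: lefts_eq[OF M])
  have b: "?b \<notin> ?L" "mate \<beta> ?b = k + 1" "k + 1 < ?b"
    using v(2) mate_mate[OF M r(2)] by (auto simp: lefts_eq[OF M])
  let ?s = "Transposition.transpose ?a (k+1)"
  have s: "?s permutes ?L" using a v by (simp add: permutes_swap_id)
  have L: "lefts (flip_up N k \<beta>) = ?t ` ?L"
  proof -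
    have "?t x = (if x = k + 1 then k else x)" if "x \<in> ?L" for x
      using that v by (cases "x = k"; cases "x = k + 1") auto
    then have "?t ` ?L = (\<lambda>x. if x = k + 1 then k else x) ` ?L" by auto
    also have "\<dots> = insert k (?L - {k+1})" using v by auto
    finally show ?thesis by (simp add: lefts_flip_up[OF assms])
  qed
  have "ndet (flip_up N k \<beta>) K = gdet ?L (?m \<circ> ?t) (\<lambda>a b. K (?t a) b)"
    unfolding ndet_def L by (rule gdet_reindex) (use finite_lefts[OF M] in auto)
  moreover have "ndet \<beta> (swapped k K) = gdet ?L ((?m \<circ> ?t) \<circ> ?s) (\<lambda>a b. K (?t a) b)"
    unfolding ndet_swapped_eq
  proof (rule gdet_cong)
    fix x assume x: "x \<in> ?L"
    have xr: "x \<in> {1..2*N}" using lefts_sub[OF M x] .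
    have ar: "?a \<in> {1..2*N}" using lefts_sub[OF M a(1)] .
    show "(?t \<circ> mate \<beta>) x = ((?m \<circ> ?t) \<circ> ?s) x"
    proof (cases "x = ?a \<or> x = k + 1")
      case True
      then show ?thesis using a b mate_flip_up[OF assms r(1)] mate_flip_up[OF assms ar] by auto
    next
      case False
      then have "mate \<beta> x \<noteq> k" "mate \<beta> x \<noteq> k+1" "x \<noteq> k" "x \<noteq> ?b"
        using mate_mate[OF M xr] x v b by auto
      then show ?thesis using False mate_flip_up[OF assms xr] by simp
    qed
  qed auto
  moreover have "?a \<noteq> k + 1" using a by auto
  ultimately show ?thesis
    using gdet_perm[OF s finite_lefts[OF M], of "?m \<circ> ?t" "\<lambda>a b. K (?t a) b"] by (simp add: sign_swap_id)
qed

section \<open>Counting tilings: the effect of flipping or deleting a peak\<close>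

subsection \<open>Tilings of a skew shape given by its set of boxes\<close>

text \<open>Tilings are attached to a bare set of boxes, because boxes will be removed and columns
  contracted without reference to link patterns.\<close>

definition tilings :: "(nat \<times> int) set \<Rightarrow> (nat \<times> int) set set set" where
  "tilings B = {P. partition_on B P \<and> (\<forall>T\<in>P. dyck_tile T) \<and> cover_inclusive P}"

definition boxes :: "nat \<Rightarrow> (nat \<Rightarrow> int) \<Rightarrow> (nat \<Rightarrow> int) \<Rightarrow> (nat \<times> int) set" where
  "boxes n f g = {(x, y). 0 < x \<and> x < n \<and> odd (int x + y) \<and> f x < y \<and> y < g x}"

definition lattice_path :: "nat \<Rightarrow> (nat \<Rightarrow> int) \<Rightarrow> bool" where
  "lattice_path n f \<longleftrightarrow> f 0 = 0 \<and> (\<forall>i<n. f (Suc i) = f i + 1 \<or> f (Suc i) = f i - 1)"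

definition tile_at :: "(nat \<times> int) set \<Rightarrow> nat \<Rightarrow> nat \<Rightarrow> (nat \<Rightarrow> int) \<Rightarrow> bool" where
  "tile_at T a b H \<longleftrightarrow> a \<le> b \<and> T = (\<lambda>x. (x, H x)) ` {a..b} \<and>
     (\<forall>x. a \<le> x \<and> x < b \<longrightarrow> H (Suc x) = H x + 1 \<or> H (Suc x) = H x - 1) \<and> H b = H a \<and>
     (\<forall>x. a \<le> x \<and> x \<le> b \<longrightarrow> H a \<le> H x)"

lemma dyck_tile_iff: "dyck_tile T \<longleftrightarrow> (\<exists>a b H. tile_at T a b H)"
proof
  assume "dyck_tile T"
  then obtain a n h where T: "T = (\<lambda>i. (a + i, h i)) ` {0..n}"
    and st: "\<forall>i<n. h (Suc i) = h i + 1 \<or> h (Suc i) = h i - (1::int)" and e: "h n = h 0" and m: "\<forall>i\<le>n. h 0 \<le> h i"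
    unfolding dyck_tile_def by blast
  have "tile_at T a (a + n) (\<lambda>x. h (x - a))"
    unfolding tile_at_def
  proof (intro conjI allI impI)
    have "{a..a+n} = (+) a ` {0..n}" by simp
    then show "T = (\<lambda>x. (x, h (x - a))) ` {a..a+n}" unfolding T by (simp only: image_image add_diff_cancel_left')
    show "h (Suc x - a) = h (x - a) + 1 \<or> h (Suc x - a) = h (x - a) - 1" if "a \<le> x \<and> x < a + n" for x
      using st[rule_format, of "x - a"] that by (simp add: Suc_diff_le less_diff_conv2)
    show "h (a - a) \<le> h (x - a)" if "a \<le> x \<and> x \<le> a + n" for x
      using m[rule_format, of "x - a"] that by (simp add: le_diff_conv)
  qed (use e in auto)
  then show "\<exists>a b H. tile_at T a b H" by blast
next
  assume "\<exists>a b H. tile_at T a b H"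
  then obtain a b H where t: "tile_at T a b H" by blast
  have ab: "a \<le> b" using t by (simp add: tile_at_def)
  define h where "h i = H (a + i)" for i
  have "T = (\<lambda>i. (a + i, h i)) ` {0..b - a}"
  proof -
    have "{a..b} = (+) a ` {0..b - a}" using ab by simp
    then show ?thesis using t unfolding tile_at_def h_def by (simp only: image_image)
  qed
  moreover have "\<forall>i<b - a. h (Suc i) = h i + 1 \<or> h (Suc i) = h i - 1" "h (b - a) = h 0" "\<forall>i\<le>b - a. h 0 \<le> h i"
    using t ab by (auto simp: tile_at_def h_def)
  ultimately show "dyck_tile T" unfolding dyck_tile_def by blast
qed

lemma tile_at_mem: "tile_at T a b H \<Longrightarrow> (x, y) \<in> T \<longleftrightarrow> a \<le> x \<and> x \<le> b \<and> y = H x"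
  by (auto simp: tile_at_def)

lemma horizontal_extent_tile:
  assumes "tile_at T a b H"
  shows "horizontal_extent T = {a..b}"
proof -
  have "fst ` T = {a..b}" using assms by (auto simp: tile_at_def image_image)
  moreover have "a \<le> b" using assms by (simp add: tile_at_def)
  moreover from this have "Min {a..b} = a" "Max {a..b} = b" by (auto intro!: Min_eqI Max_eqI)
  ultimately show ?thesis by (simp add: horizontal_extent_def)
qed

lemma horizontal_extent_mem:
  assumes "dyck_tile T"
  shows "x \<in> horizontal_extent T \<longleftrightarrow> (\<exists>y. (x, y) \<in> T)"
  using assms by (auto simp: dyck_tile_iff horizontal_extent_tile tile_at_mem)

lemma cover_inclusiveD:
  assumes "cover_inclusive P" "T1 \<in> P" "T2 \<in> P" "T1 \<noteq> T2" "(x, y1) \<in> T1" "(x, y2) \<in> T2" "y1 > y2"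
  shows "horizontal_extent T1 \<subseteq> horizontal_extent T2"
  using assms unfolding cover_inclusive_def by blast

lemma finite_boxes: "finite (boxes n f g)"
proof (rule finite_subset)
  show "boxes n f g \<subseteq> (SIGMA x:{..<n}. {f x..g x})" by (auto simp: boxes_def)
qed auto

lemma finite_tilings: "finite B \<Longrightarrow> finite (tilings B)"
  by (rule finite_subset[of _ "Pow (Pow B)"]) (auto simp: tilings_def partition_on_def)

text \<open>Points of the paths have x + y even and box centres x + y odd, so a centre is never on a
  path. A centre strictly between the paths then has all four vertices weakly between them, because
  the slopes are 1 or -1.\<close>

lemma skew_boxes_eq:
  assumes "lattice_path (2*N) (dyck_path \<alpha>)" "lattice_path (2*N) (dyck_path \<beta>)"
  shows "skew_boxes N \<alpha> \<beta> = boxes (2*N) (dyck_path \<alpha>) (dyck_path \<beta>)"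
proof -
  have par: "even (int x + f x)" if "lattice_path (2*N) f" "x \<le> 2*N" for f x
    using that
  proof (induction x)
    case (Suc x)
    then have "f (Suc x) = f x + 1 \<or> f (Suc x) = f x - 1" "even (int x + f x)" by (auto simp: lattice_path_def)
    then show ?case by auto
  qed (simp add: lattice_path_def)
  have st: "\<bar>f (Suc x) - f x\<bar> = 1" if "lattice_path (2*N) f" "x < 2*N" for f x
    using that by (force simp: lattice_path_def)
  have "(x, y) \<in> skew_boxes N \<alpha> \<beta> \<longleftrightarrow> (x, y) \<in> boxes (2*N) (dyck_path \<alpha>) (dyck_path \<beta>)" for x y
    proof (cases "0 < x \<and> x < 2*N \<and> odd (int x + y)")
      case True
      let ?f = "dyck_path \<alpha>" and ?g = "dyck_path \<beta>"
      have s: "\<bar>?f (x+1) - ?f x\<bar> = 1" "\<bar>?g (x+1) - ?g x\<bar> = 1" "\<bar>?f x - ?f (x-1)\<bar> = 1" "\<bar>?g x - ?g (x-1)\<bar> = 1"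
        using st[OF assms(1), of x] st[OF assms(2), of x] st[OF assms(1), of "x-1"] st[OF assms(2), of "x-1"] True
        by (simp_all add: less_imp_diff_less)
      have "?f x \<noteq> y" "?g x \<noteq> y" using par[OF assms(1), of x] par[OF assms(2), of x] True by auto
      have "(x, y) \<in> skew_boxes N \<alpha> \<beta> \<longleftrightarrow> ?f (x-1) \<le> y \<and> y \<le> ?g (x-1) \<and> ?f (x+1) \<le> y \<and> y \<le> ?g (x+1)
          \<and> ?f x \<le> y - 1 \<and> y - 1 \<le> ?g x \<and> ?f x \<le> y + 1 \<and> y + 1 \<le> ?g x"
        unfolding skew_boxes_def using True by simp
      also have "\<dots> \<longleftrightarrow> ?f x < y \<and> y < ?g x"
      proof -
        define f0 f1 f2 g0 g1 g2 where "f0 = ?f (x-1)" and "f1 = ?f x" and "f2 = ?f (x+1)"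
          and "g0 = ?g (x-1)" and "g1 = ?g x" and "g2 = ?g (x+1)"
        note defs = this
        have 1: "f1 - 1 \<le> f0" "f0 \<le> f1 + 1" "f1 - 1 \<le> f2" "f2 \<le> f1 + 1"
          "g1 - 1 \<le> g0" "g0 \<le> g1 + 1" "g1 - 1 \<le> g2" "g2 \<le> g1 + 1" "f1 \<noteq> y" "g1 \<noteq> y"
          using s \<open>?f x \<noteq> y\<close> \<open>?g x \<noteq> y\<close> unfolding defs[symmetric] by linarith+
        show ?thesis unfolding defs[symmetric]
        proof
          assume "f1 < y \<and> y < g1"
          then show "f0 \<le> y \<and> y \<le> g0 \<and> f2 \<le> y \<and> y \<le> g2 \<and> f1 \<le> y - 1 \<and> y - 1 \<le> g1 \<and> f1 \<le> y + 1 \<and> y + 1 \<le> g1"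
            using 1 by auto
        qed (use 1 in auto)
      qed
      finally show ?thesis using True by (simp add: boxes_def)
    qed (auto simp: skew_boxes_def boxes_def)
  then show ?thesis by auto
qed

lemma tiling_tile_unique:
  assumes "P \<in> tilings B" "T1 \<in> P" "T2 \<in> P" "p \<in> T1" "p \<in> T2"
  shows "T1 = T2"
  using assms by (auto simp: tilings_def partition_on_def disjoint_def)

lemma tiling_tile_ex:
  assumes "P \<in> tilings B" "p \<in> B"
  obtains T where "T \<in> P" "p \<in> T"
  using assms by (auto simp: tilings_def partition_on_def)

text \<open>A column \<open>k\<close> in which the upper path has a peak, with top box at height \<open>h\<close>.\<close>

locale peak_column =
  fixes n k :: nat and f g :: "nat \<Rightarrow> int" and h :: int
  assumes k: "0 < k" "k < n"
    and gk: "g k = h + 1" "g (k - 1) = h" "g (k + 1) = h"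
    and par: "odd (int k + h)" "even (int k + f k)"
    and lp: "lattice_path n f"
begin

abbreviation "B \<equiv> boxes n f g"

text \<open>The tilings whose top box in column \<open>k\<close> is not a tile of its own. If (k, h)
  lies outside the shape, these are all tilings.\<close>

definition "multi = {P \<in> tilings B. {(k, h)} \<notin> P}"

lemma column_height: "(k, y) \<in> B \<Longrightarrow> y \<le> h"
  using gk by (simp add: boxes_def)

lemma no_box_beside: "(k - 1, h + 1) \<notin> B" "(k + 1, h + 1) \<notin> B"
  using gk by (auto simp: boxes_def)

text \<open>Cover-inclusiveness propagates the shape of the tile at the top of the column downwards.\<close>

lemma multi_middle:
  assumes P: "P \<in> multi" and "T \<in> P" "(k, y) \<in> T"
  shows "(k - 1, y - 1) \<in> T \<and> (k + 1, y - 1) \<in> T"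
proof -
  have Pt: "P \<in> tilings B" and ns: "{(k, h)} \<notin> P" using P by (auto simp: multi_def)
  have PB: "T \<in> P \<Longrightarrow> T \<subseteq> B" "T \<in> P \<Longrightarrow> dyck_tile T" for T
    using Pt by (auto simp: tilings_def partition_on_def)
  have ci: "cover_inclusive P" using Pt by (auto simp: tilings_def)
  \<comment> \<open>The boxes of the column have heights h, h - 2, h - 4, ...; the claim is carried
    down by the depth \<open>i\<close>.\<close>
  have main: "\<forall>T\<in>P. (k, h - 2 * int i) \<in> T \<longrightarrow> (k - 1, h - 2 * int i - 1) \<in> T \<and> (k + 1, h - 2 * int i - 1) \<in> T" for i
  proof (induction i)
    case 0
    show ?case
    proof (intro ballI impI)
      fix T assume T: "T \<in> P" and "(k, h - 2 * int 0) \<in> T"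
      then have kh: "(k, h) \<in> T" by simp
      obtain a b H where t: "tile_at T a b H" using PB(2)[OF T] dyck_tile_iff by blast
      have H: "a \<le> k" "k \<le> b" "H k = h" using kh tile_at_mem[OF t] by auto
      have hi: "H a \<le> H x" if "a \<le> x" "x \<le> b" for x using t that by (simp add: tile_at_def)
      have hab: "H b = H a" using t by (simp add: tile_at_def)
      have st: "H (Suc x) = H x + 1 \<or> H (Suc x) = H x - 1" if "a \<le> x" "x < b" for x using t that by (simp add: tile_at_def)
      \<comment> \<open>A neighbour at height h + 1 would lie above the upper path, so the tile can
        only step down from its top box. Since its ends are its lowest points, it does not end in
        column \<open>k\<close> unless it is a single box.\<close>
      have lft: "H (k - 1) = h - 1" if "a < k"
      proof -
        have "(k - 1, H (k - 1)) \<in> T" using that H tile_at_mem[OF t] by auto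
        then have "(k - 1, H (k - 1)) \<in> B" using PB(1)[OF T] by blast
        then have "H (k - 1) \<noteq> h + 1" using no_box_beside by auto
        then show ?thesis using st[of "k - 1"] that H by auto
      qed
      have rgt: "H (k + 1) = h - 1" if "k < b"
      proof -
        have "(k + 1, H (k + 1)) \<in> T" using that H tile_at_mem[OF t] by auto
        then have "(k + 1, H (k + 1)) \<in> B" using PB(1)[OF T] by blast
        then have "H (k + 1) \<noteq> h + 1" using no_box_beside by auto
        then show ?thesis using st[of k] that H by auto
      qed
      have "a \<noteq> k \<or> b \<noteq> k"
      proof (rule ccontr)
        assume "\<not> (a \<noteq> k \<or> b \<noteq> k)"
        then have "T = {(k, h)}" using t H by (auto simp: tile_at_def)
        then show False using T ns by simp
      qed
      have ak: "a < k"
      proof (rule ccontr)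
        assume "\<not> a < k"
        then have ak: "a = k" "k < b" using H \<open>a \<noteq> k \<or> b \<noteq> k\<close> by auto
        then show False using rgt hi[of "k + 1"] H by auto
      qed
      have kb: "k < b"
      proof (rule ccontr)
        assume "\<not> k < b"
        then have "b = k" using H by auto
        have "a \<le> k - 1" using ak by simp
        then show False using lft[OF ak] hi[of "k - 1"] hab H \<open>b = k\<close> by auto
      qed
      show "(k - 1, h - 2 * int 0 - 1) \<in> T \<and> (k + 1, h - 2 * int 0 - 1) \<in> T"
        using lft[OF ak] rgt[OF kb] ak kb tile_at_mem[OF t] by auto
    qed
  next
    case (Suc i)
    show ?case
    proof (intro ballI impI)
      let ?y = "h - 2 * int i"
      fix T2 assume T2: "T2 \<in> P" and "(k, h - 2 * int (Suc i)) \<in> T2"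
      then have k2: "(k, ?y - 2) \<in> T2" by (simp add: algebra_simps)
      have "(k, ?y - 2) \<in> B" using k2 PB(1)[OF T2] by auto
      then have "(k, ?y) \<in> B" using gk par k by (auto simp: boxes_def)
      then obtain T1 where T1: "T1 \<in> P" "(k, ?y) \<in> T1" using tiling_tile_ex[OF Pt] by blast
      have m1: "(k - 1, ?y - 1) \<in> T1" "(k + 1, ?y - 1) \<in> T1" using Suc.IH T1 by auto
      obtain a b H where t: "tile_at T2 a b H" using PB(2)[OF T2] dyck_tile_iff by blast
      have ne: "T1 \<noteq> T2"
      proof
        assume "T1 = T2"
        then show False using T1(2) k2 tile_at_mem[OF t] by auto
      qed
      have "horizontal_extent T1 \<subseteq> horizontal_extent T2"
        by (rule cover_inclusiveD[OF ci T1(1) T2 ne T1(2) k2]) simp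
      moreover have "k - 1 \<in> horizontal_extent T1" "k + 1 \<in> horizontal_extent T1"
        using m1 horizontal_extent_mem[OF PB(2)[OF T1(1)]] by auto
      ultimately have "k - 1 \<in> {a..b}" "k + 1 \<in> {a..b}" using horizontal_extent_tile[OF t] by auto
      then have ab: "a \<le> k - 1" "k + 1 \<le> b" by auto
      have st: "H (Suc x) = H x + 1 \<or> H (Suc x) = H x - 1" if "a \<le> x" "x < b" for x using t that by (simp add: tile_at_def)
      have Hk: "H k = ?y - 2" using k2 tile_at_mem[OF t] by auto
      have n1: "H (k - 1) \<noteq> ?y - 1"
      proof
        assume "H (k - 1) = ?y - 1"
        then have "(k - 1, ?y - 1) \<in> T2" using ab tile_at_mem[OF t] by auto
        then show False using tiling_tile_unique[OF Pt T1(1) T2 m1(1)] ne by auto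
      qed
      have n2: "H (k + 1) \<noteq> ?y - 1"
      proof
        assume "H (k + 1) = ?y - 1"
        then have "(k + 1, ?y - 1) \<in> T2" using ab tile_at_mem[OF t] by auto
        then show False using tiling_tile_unique[OF Pt T1(1) T2 m1(2)] ne by auto
      qed
      \<comment> \<open>The extent of the tile above forces \<open>T2\<close> into both neighbouring
        columns, where the height \<open>?y - 1\<close> is already occupied by that tile; only the
        steps down remain.\<close>
      have "H (k - 1) = ?y - 3" "H (k + 1) = ?y - 3"
        using st[of "k - 1"] st[of k] ab k Hk n1 n2 by auto
      then show "(k - 1, h - 2 * int (Suc i) - 1) \<in> T2 \<and> (k + 1, h - 2 * int (Suc i) - 1) \<in> T2"
        using ab tile_at_mem[OF t] by auto
    qed
  qed
  have "(k, y) \<in> B" using assms PB(1) by auto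
  then have yb: "y \<le> h" "odd (int k + y)" using gk by (auto simp: boxes_def)
  then have "even (h - y)" using par by presburger
  then have "h - y = 2 * int (nat ((h - y) div 2))" using yb(1) by simp
  then obtain i where "h - y = 2 * int i" by blast
  then have "y = h - 2 * int i" by simp
  then show ?thesis using main assms by auto
qed

text \<open>The lowest box of the column sits on the lower path. Its tile also contains the two
  boxes diagonally below it, and these lie above the lower path only if that path has a peak at
  \<open>k\<close>.\<close>

lemma multi_peak:
  assumes "P \<in> multi" "(k, h) \<in> B"
  shows "f (k - 1) = f k - 1 \<and> f (k + 1) = f k - 1"
proof -
  have Pt: "P \<in> tilings B" using assms by (simp add: multi_def)
  have "f k < h" using assms(2) by (simp add: boxes_def)
  then have "(k, f k + 1) \<in> B" using k gk par by (auto simp: boxes_def)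
  then obtain T where T: "T \<in> P" "(k, f k + 1) \<in> T" using tiling_tile_ex[OF Pt] by blast
  then have "(k - 1, f k) \<in> T" "(k + 1, f k) \<in> T" using multi_middle[OF assms(1) T] by auto
  moreover have "T \<subseteq> B" using Pt T by (auto simp: tilings_def partition_on_def)
  ultimately have "(k - 1, f k) \<in> B" "(k + 1, f k) \<in> B" by auto
  then have "f (k - 1) < f k" "f (k + 1) < f k" by (auto simp: boxes_def)
  moreover have "f k = f (k - 1) + 1 \<or> f k = f (k - 1) - 1" "f (Suc k) = f k + 1 \<or> f (Suc k) = f k - 1"
    using lp k unfolding lattice_path_def by (auto dest: spec[of _ "k - 1"])
  ultimately show ?thesis by auto
qed

text \<open>A single tile on top of the column can be taken away or added freely: nothing lies above
  it, and its extent {k} is contained in that of every tile below it.\<close>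

lemma card_tilings_split:
  assumes kh: "(k, h) \<in> B"
  shows "card (tilings B) = card (tilings (B - {(k, h)})) + card multi"
proof -
  let ?S = "{P \<in> tilings B. {(k, h)} \<in> P}"
  have "tilings B = ?S \<union> multi" by (auto simp: multi_def)
  moreover have "finite (tilings B)" using finite_tilings finite_boxes by blast
  moreover have "?S \<inter> multi = {}" by (auto simp: multi_def)
  ultimately have c: "card (tilings B) = card ?S + card multi"
    by (metis card_Un_disjoint finite_Un)
  have "bij_betw (\<lambda>P. P - {{(k, h)}}) ?S (tilings (B - {(k, h)}))"
  proof (rule bij_betw_byWitness[where f'="insert {(k, h)}"])
    show "\<forall>P\<in>?S. insert {(k, h)} (P - {{(k, h)}}) = P" by auto
    have nin: "{(k, h)} \<notin> P" if "P \<in> tilings (B - {(k, h)})" for P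
      using that by (auto simp: tilings_def partition_on_def)
    then show "\<forall>P\<in>tilings (B - {(k, h)}). insert {(k, h)} P - {{(k, h)}} = P" by auto
    show "(\<lambda>P. P - {{(k, h)}}) ` ?S \<subseteq> tilings (B - {(k, h)})"
    proof clarify
      fix P assume P: "P \<in> tilings B" "{(k, h)} \<in> P"
      have d: "disjoint P" "\<Union>P = B" "{} \<notin> P" using P by (auto simp: tilings_def partition_on_def)
      have "\<Union>(P - {{(k, h)}}) = B - {(k, h)}"
      proof -
        have "(k, h) \<notin> T" if "T \<in> P" "T \<noteq> {(k, h)}" for T
          using disjointD[OF d(1) that(1) P(2) that(2)] by blast
        then show ?thesis using d(2) by blast
      qed
      then have "partition_on (B - {(k, h)}) (P - {{(k, h)}})"
        using d by (auto simp: partition_on_def disjoint_def)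
      moreover have "cover_inclusive (P - {{(k, h)}})" using P(1) by (auto simp: tilings_def cover_inclusive_def)
      ultimately show "P - {{(k, h)}} \<in> tilings (B - {(k, h)})" using P(1) by (auto simp: tilings_def)
    qed
    show "insert {(k, h)} ` tilings (B - {(k, h)}) \<subseteq> ?S"
    proof clarify
      fix P assume P: "P \<in> tilings (B - {(k, h)})"
      have d: "disjoint P" "\<Union>P = B - {(k, h)}" "{} \<notin> P" and ci: "cover_inclusive P" and dt: "\<And>T. T \<in> P \<Longrightarrow> dyck_tile T"
        using P by (auto simp: tilings_def partition_on_def)
      have t: "tile_at {(k, h)} k k (\<lambda>_. h)" by (auto simp: tile_at_def)
      have "partition_on B (insert {(k, h)} P)"
        unfolding partition_on_def
      proof (intro conjI)
        show "\<Union>(insert {(k, h)} P) = B" using d(2) kh by auto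
        show "disjoint (insert {(k, h)} P)" using d(1,2) by (auto simp: disjoint_def)
        show "{} \<notin> insert {(k, h)} P" using d(3) by auto
      qed
      moreover have "\<forall>T\<in>insert {(k, h)} P. dyck_tile T" using dt t dyck_tile_iff by blast
      moreover have "cover_inclusive (insert {(k, h)} P)"
        unfolding cover_inclusive_def
      proof (intro ballI impI)
        fix T1 T2 assume T: "T1 \<in> insert {(k, h)} P" "T2 \<in> insert {(k, h)} P"
        assume "T1 \<noteq> T2 \<and> (\<exists>x y1 y2. (x, y1) \<in> T1 \<and> (x, y2) \<in> T2 \<and> y2 < y1)"
        then obtain x y1 y2 where ne: "T1 \<noteq> T2" and xy: "(x, y1) \<in> T1" "(x, y2) \<in> T2" "y2 < y1" by blast
        have "(x, y1) \<in> B" using T(1) xy(1) d(2) kh by blast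
        then have "\<not> (x = k \<and> y2 = h)" using column_height[of y1] xy(3) by auto
        then have T2: "T2 \<in> P" using T(2) xy(2) by auto
        show "horizontal_extent T1 \<subseteq> horizontal_extent T2"
        proof (cases "T1 = {(k, h)}")
          case True
          then have "horizontal_extent T1 = {k}" using horizontal_extent_tile[OF t] by simp
          moreover have "k \<in> horizontal_extent T2" using horizontal_extent_mem[OF dt[OF T2]] xy True by auto
          ultimately show ?thesis by auto
        next
          case False
          then show ?thesis using cover_inclusiveD[OF ci _ T2 ne xy] T(1) by auto
        qed
      qed
      ultimately show "insert {(k, h)} P \<in> tilings B \<and> {(k, h)} \<in> insert {(k, h)} P" by (auto simp: tilings_def)
    qed
  qed
  from bij_betw_same_card[OF this] show ?thesis using c by simp
qed

end

text \<open>Two peaks in the same column: contracting the columns \<open>k - 1, k, k + 1\<close> to one.\<close>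

locale two_peaks = peak_column +
  assumes fp: "f (k - 1) = f k - 1" "f (k + 1) = f k - 1"
    and ends: "f 0 = g 0" "f n = g n"
begin

definition "squeeze x = (if x < k then x else if x = k then k - 1 else x - 2)"
text \<open>The boxes (k-1, y-1), (k, y), (k+1, y-1), which belong together by
  \<open>multi_middle\<close>, have the common image (k-1, y-1).\<close>

definition "co p = (squeeze (fst p), if fst p = k then snd p - 1 else snd p)" for p :: "nat \<times> int"
definition "fc x = (if x < k then f x else f (x + 2))"
definition "gc x = (if x < k then g x else g (x + 2))"

abbreviation "Bc \<equiv> boxes (n - 2) fc gc"

lemma co_simps:
  "x < k \<Longrightarrow> co (x, y) = (x, y)" "co (k, y) = (k - 1, y - 1)" "k < x \<Longrightarrow> co (x, y) = (x - 2, y)"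
  by (auto simp: co_def squeeze_def)

text \<open>Both paths have a peak in column \<open>k\<close>, so the admissible heights in the
  three columns agree up to the shift by one.\<close>

lemma co_mem: "co p \<in> Bc \<longleftrightarrow> p \<in> B"
proof -
  obtain x y where p: "p = (x, y)" by (cases p)
  consider "x < k" | "x = k" | "x = k + 1" | "k + 1 < x" by linarith
  then show ?thesis
  proof cases
    case 1
    \<comment> \<open>At the border the two paths meet, so a column next to it that would be lost in
      the contraction contains no box.\<close>
    have "x < n - 2 \<longleftrightarrow> x < n" if "f x < y" "y < g x"
    proof -
      have "f x \<noteq> g x" using that by auto
      then have "x \<noteq> k - 1 \<or> k + 1 \<noteq> n" using gk fp ends by auto
      then show ?thesis using 1 k by auto
    qed
    then show ?thesis using 1 by (auto simp: p co_simps boxes_def fc_def gc_def)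
  next
    case 2
    have "k - 1 < n - 2 \<and> 0 < k - 1" if "f k < y" "y < g k"
    proof -
      have "f k \<noteq> g k" using that by auto
      then have "k + 1 \<noteq> n" "k - 1 \<noteq> 0" using gk fp ends by auto
      then show ?thesis using k by auto
    qed
    moreover have "odd (int (k - 1) + (y - 1)) \<longleftrightarrow> odd (int k + y)" using k by (auto simp: of_nat_diff)
    ultimately show ?thesis using k 2 gk fp by (auto simp: p co_simps boxes_def fc_def gc_def)
  next
    case 3
    have "k - 1 < n - 2 \<and> 0 < k - 1 \<longleftrightarrow> k + 1 < n" if "f (k + 1) < y" "y < g (k + 1)"
    proof -
      have "f (k + 1) \<noteq> g (k + 1)" using that by auto
      then have "k + 1 \<noteq> n" "k - 1 \<noteq> 0" using gk fp ends by auto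
      then show ?thesis using k by auto
    qed
    moreover have "odd (int (k - 1) + y) \<longleftrightarrow> odd (int (k + 1) + y)" using k by (auto simp: of_nat_diff)
    ultimately show ?thesis using k 3 gk fp by (auto simp: p co_simps boxes_def fc_def gc_def)
  next
    case 4
    then have "odd (int (x - 2) + y) \<longleftrightarrow> odd (int x + y)" by (auto simp: of_nat_diff)
    moreover have "Suc (Suc (x - 2)) = x" "x - 2 < n - 2 \<longleftrightarrow> x < n" "\<not> x - 2 < k" "0 < x - 2" using 4 k by auto
    ultimately show ?thesis using 4 by (auto simp: p co_simps boxes_def fc_def gc_def)
  qed
qed

definition "raise p = (if fst p < k then p else (fst p + 2, snd p))" for p :: "nat \<times> int"

lemma co_raise: "co (raise p) = p"
  by (cases p) (auto simp: raise_def co_simps)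

lemma co_image_vimage: "co ` (co -` U) = U"
  by (rule surj_image_vimage_eq, rule surjI[of co raise], rule co_raise)

lemma vimage_inj: "co -` U = co -` U' \<Longrightarrow> U = U'"
  by (metis co_image_vimage)

lemma squeeze_surj: "\<exists>x. squeeze x = z"
  by (rule exI[of _ "if z < k then z else z + 2"]) (auto simp: squeeze_def)

lemma vimage_column: "(\<exists>y. (x, y) \<in> co -` U) \<longleftrightarrow> (\<exists>y. (squeeze x, y) \<in> U)"
proof -
  have e: "(x, y) \<in> co -` U \<longleftrightarrow> (squeeze x, if x = k then y - 1 else y) \<in> U" for y by (simp add: co_def)
  show ?thesis
  proof (cases "x = k")
    case True
    have "(squeeze x, y) \<in> U \<longleftrightarrow> (x, y + 1) \<in> co -` U" for y using e[of "y + 1"] True by simp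
    moreover have "(x, y) \<in> co -` U \<longleftrightarrow> (squeeze x, y - 1) \<in> U" for y using e[of y] True by simp
    ultimately show ?thesis by blast
  qed (use e in auto)
qed

lemma tile_set_eqI:
  assumes "\<And>x y. (x, y) \<in> T \<longleftrightarrow> a \<le> x \<and> x \<le> b \<and> y = H x"
  shows "T = (\<lambda>x. (x, H x)) ` {a..b}"
  using assms by auto

text \<open>Pulling back inserts an up-step and a down-step after column k - 1, which preserves the
  Dyck property.\<close>

lemma dyck_tile_vimage:
  assumes "dyck_tile U"
  shows "dyck_tile (co -` U)"
proof -
  obtain a b H where t: "tile_at U a b H" using assms dyck_tile_iff by blast
  define a' where "a' = (if a < k then a else a + 2)"
  define b' where "b' = (if b + 1 < k then b else b + 2)"
  define H' where "H' x = (if x < k then H x else if x = k then H (k - 1) + 1 else H (x - 2))" for x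
  have ab: "a \<le> b" and Hab: "H b = H a" and st: "\<And>x. a \<le> x \<Longrightarrow> x < b \<Longrightarrow> H (Suc x) = H x + 1 \<or> H (Suc x) = H x - 1"
    and low: "\<And>x. a \<le> x \<Longrightarrow> x \<le> b \<Longrightarrow> H a \<le> H x"
    using t by (auto simp: tile_at_def)
  have mem: "(x, y) \<in> co -` U \<longleftrightarrow> a' \<le> x \<and> x \<le> b' \<and> y = H' x" for x y
  proof -
    consider "x < k" | "x = k" | "k < x" by linarith
    then show ?thesis
      by cases (use k in \<open>auto simp: co_simps tile_at_mem[OF t] a'_def b'_def H'_def\<close>)
  qed
  have "tile_at (co -` U) a' b' H'"
    unfolding tile_at_def
  proof (intro conjI allI impI)
    show "a' \<le> b'" using ab by (auto simp: a'_def b'_def)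
    show "co -` U = (\<lambda>x. (x, H' x)) ` {a'..b'}"
      by (rule tile_set_eqI, rule mem)
    show "H' b' = H' a'" using Hab ab k by (auto simp: a'_def b'_def H'_def)
    fix x
    show "H' a' \<le> H' x" if x: "a' \<le> x \<and> x \<le> b'"
    proof -
      have e: "H' a' = H a" by (auto simp: a'_def H'_def)
      consider "x < k" | "x = k" | "k < x" by linarith
      then show ?thesis
      proof cases
        case 1
        then show ?thesis using x low[of x] unfolding e by (auto simp: a'_def b'_def H'_def split: if_splits)
      next
        case 2
        then have "a \<le> k - 1" "k - 1 \<le> b" using x k by (auto simp: a'_def b'_def split: if_splits)
        then show ?thesis using 2 low[of "k - 1"] unfolding e by (auto simp: H'_def)
      next
        case 3
        then have "a \<le> x - 2" "x - 2 \<le> b" using x ab by (auto simp: a'_def b'_def split: if_splits)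
        then show ?thesis using 3 low[of "x - 2"] unfolding e by (auto simp: H'_def)
      qed
    qed
    show "H' (Suc x) = H' x + 1 \<or> H' (Suc x) = H' x - 1" if x: "a' \<le> x \<and> x < b'"
    proof -
      consider "Suc x < k" | "Suc x = k" | "x = k" | "k < x" by linarith
      then show ?thesis
      proof cases
        case 1
        then show ?thesis using x st[of x] by (auto simp: a'_def b'_def H'_def split: if_splits)
      next
        case 2
        then show ?thesis by (auto simp: H'_def)
      next
        case 3
        then show ?thesis using k by (auto simp: H'_def)
      next
        case 4
        then have "a \<le> x - 2" "x - 2 < b" using x ab by (auto simp: a'_def b'_def split: if_splits)
        moreover have "x = k + 1 \<Longrightarrow> x - 2 = k - 1" "Suc x - 2 = Suc (x - 2)" using 4 k by auto
        ultimately show ?thesis using 4 st[of "x - 2"] by (auto simp: H'_def)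
      qed
    qed
  qed
  then show ?thesis using dyck_tile_iff by blast
qed

lemma dyck_tile_vimageD:
  assumes "dyck_tile (co -` U)"
  shows "dyck_tile U"
proof -
  obtain a b H where t: "tile_at (co -` U) a b H" using assms dyck_tile_iff by blast
  define a' where "a' = (if a < k then a else a - 2)"
  define b' where "b' = (if b < k then b else b - 2)"
  define H' where "H' x = (if x < k then H x else H (x + 2))" for x
  have ab: "a \<le> b" and Hab: "H b = H a" and st: "\<And>x. a \<le> x \<Longrightarrow> x < b \<Longrightarrow> H (Suc x) = H x + 1 \<or> H (Suc x) = H x - 1"
    and low: "\<And>x. a \<le> x \<Longrightarrow> x \<le> b \<Longrightarrow> H a \<le> H x"
    using t by (auto simp: tile_at_def)
  have e1: "(k, y + 1) \<in> co -` U \<longleftrightarrow> (k - 1, y) \<in> co -` U" for y using k by (simp add: co_simps)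
  have e2: "(k + 1, y) \<in> co -` U \<longleftrightarrow> (k - 1, y) \<in> co -` U" for y using k by (simp add: co_simps)
  have e3: "(k, y) \<in> co -` U \<longleftrightarrow> (k - 1, y - 1) \<in> co -` U" for y using e1[of "y - 1"] by simp
  \<comment> \<open>A preimage that meets one of the three columns meets all of them, with the
    middle box raised by one; the peak so formed is the piece to cut out.\<close>
  have mm: "a \<le> k - 1 \<and> k + 1 \<le> b \<and> H k = H (k - 1) + 1 \<and> H (k + 1) = H (k - 1)" if "\<not> (b < k - 1 \<or> k + 1 < a)"
  proof -
    have "(k - 1, H (k - 1)) \<in> co -` U \<or> (k, H k) \<in> co -` U \<or> (k + 1, H (k + 1)) \<in> co -` U"
      using that ab tile_at_mem[OF t] by auto
    then obtain y where "(k - 1, y) \<in> co -` U" using e2 e3 by metis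
    then have "(k - 1, y) \<in> co -` U" "(k, y + 1) \<in> co -` U" "(k + 1, y) \<in> co -` U" using e1 e2 by auto
    then show ?thesis unfolding tile_at_mem[OF t] by simp
  qed
  consider (l) "b < k - 1" | (r) "k + 1 < a" | (m) "a \<le> k - 1" "k + 1 \<le> b" using mm by blast
  then have cs: "(b < k - 1 \<and> a' = a \<and> b' = b) \<or> (k + 1 < a \<and> a' = a - 2 \<and> b' = b - 2 \<and> b = b' + 2 \<and> a = a' + 2)
      \<or> (a \<le> k - 1 \<and> k + 1 \<le> b \<and> a' = a \<and> b' = b - 2 \<and> b = b' + 2 \<and> H k = H (k - 1) + 1 \<and> H (k + 1) = H (k - 1))"
    by cases (use ab mm k in \<open>auto simp: a'_def b'_def\<close>)
  have mem: "(x, y) \<in> U \<longleftrightarrow> a' \<le> x \<and> x \<le> b' \<and> y = H' x" for x y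
  proof (cases "x < k")
    case True
    then have "(x, y) \<in> U \<longleftrightarrow> (x, y) \<in> co -` U" by (simp add: co_simps)
    then show ?thesis using True cs unfolding tile_at_mem[OF t] by (auto simp: H'_def)
  next
    case False
    then have "(x, y) \<in> U \<longleftrightarrow> (x + 2, y) \<in> co -` U" by (simp add: co_simps)
    then show ?thesis using False cs unfolding tile_at_mem[OF t] by (auto simp: H'_def)
  qed
  have "tile_at U a' b' H'"
    unfolding tile_at_def
  proof (intro conjI allI impI)
    show "a' \<le> b'" using cs ab by auto
    show "U = (\<lambda>x. (x, H' x)) ` {a'..b'}" by (rule tile_set_eqI, rule mem)
    have e: "H' a' = H a"
    proof -
      have "(b < k - 1 \<and> a' = a) \<or> (k + 1 < a \<and> a = a' + 2) \<or> (a \<le> k - 1 \<and> a' = a)" using cs by blast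
      then have "(a < k \<and> a' = a) \<or> (\<not> a' < k \<and> a = a' + 2)" using ab k by presburger
      then show ?thesis by (elim disjE) (simp_all add: H'_def)
    qed
    show "H' b' = H' a'"
    proof (cases "b < k - 1")
      case True
      then show ?thesis using Hab cs e ab by (auto simp: H'_def)
    next
      case False
      then have b': "b' = b - 2" "k + 1 \<le> b" using cs ab by auto
      show ?thesis
      proof (cases "b = k + 1")
        case True
        then have "b' = k - 1" "H (k + 1) = H (k - 1)" using b' cs ab False by auto
        then show ?thesis using Hab e True k by (simp add: H'_def)
      next
        case False
        then have "\<not> b - 2 < k" "b - 2 + 2 = b" using b' by auto
        then show ?thesis using Hab e b' by (simp add: H'_def)
      qed
    qed
    fix x
    show "H' a' \<le> H' x" if x: "a' \<le> x \<and> x \<le> b'"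
    proof (cases "x < k")
      case True
      then show ?thesis using x low[of x] cs unfolding e by (auto simp: H'_def)
    next
      case False
      then show ?thesis using x low[of "x + 2"] cs unfolding e by (auto simp: H'_def)
    qed
    show "H' (Suc x) = H' x + 1 \<or> H' (Suc x) = H' x - 1" if x: "a' \<le> x \<and> x < b'"
    proof -
      consider "Suc x < k" | "Suc x = k" | "k \<le> x" by linarith
      then show ?thesis
      proof cases
        case 1
        then show ?thesis using x st[of x] cs by (auto simp: H'_def)
      next
        case 2
        then have "H (k + 1) = H (k - 1)" "k + 1 < b" "a \<le> k + 1" "x = k - 1" using x cs by auto
        then show ?thesis using st[of "k + 1"] 2 by (auto simp: H'_def)
      next
        case 3
        then show ?thesis using x st[of "x + 2"] cs by (auto simp: H'_def)
      qed
    qed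
  qed
  then show ?thesis using dyck_tile_iff by blast
qed

text \<open>A box in column \<open>k\<close> brings its two lower neighbours into its tile.
  Conversely, for a box in a neighbouring column the companion in column \<open>k\<close> lies in
  the shape, and its tile contains the given box, hence is the same tile. So tiles are unions of
  fibres of \<open>co\<close>.\<close>

lemma multi_saturated:
  assumes P: "P \<in> multi" and T: "T \<in> P"
  shows "co -` (co ` T) = T"
proof (intro equalityI subsetI)
  have Pt: "P \<in> tilings B" using P by (simp add: multi_def)
  have TB: "T \<subseteq> B" using Pt T by (auto simp: tilings_def partition_on_def)
  have s1: "(k - 1, y) \<in> T' \<longleftrightarrow> (k, y + 1) \<in> T'" "(k + 1, y) \<in> T' \<longleftrightarrow> (k, y + 1) \<in> T'" if T': "T' \<in> P" for y T'
  proof -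
    have *: "(k, y + 1) \<in> T'" if p: "p \<in> T'" "p = (k - 1, y) \<or> p = (k + 1, y)" for p
    proof -
      have "p \<in> B" using p(1) T' Pt by (auto simp: tilings_def partition_on_def)
      then have "co p \<in> Bc" by (simp add: co_mem)
      moreover have "co p = co (k, y + 1)" using p(2) k by (auto simp: co_simps)
      ultimately have "(k, y + 1) \<in> B" by (metis co_mem)
      then obtain T2 where T2: "T2 \<in> P" "(k, y + 1) \<in> T2" using tiling_tile_ex[OF Pt] by blast
      then have "p \<in> T2" using multi_middle[OF P T2] p(2) by auto
      then show ?thesis using tiling_tile_unique[OF Pt T' T2(1) p(1)] T2 by auto
    qed
    show "(k - 1, y) \<in> T' \<longleftrightarrow> (k, y + 1) \<in> T'" "(k + 1, y) \<in> T' \<longleftrightarrow> (k, y + 1) \<in> T'"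
      using * multi_middle[OF P T', of "y + 1"] by auto
  qed
  show "p \<in> T" if "p \<in> co -` (co ` T)" for p
  proof -
    obtain q where q: "q \<in> T" "co p = co q" using \<open>p \<in> co -` (co ` T)\<close> by auto
    obtain x y x' y' where pq: "p = (x, y)" "q = (x', y')" by (cases p, cases q)
    have s2: "(k, z) \<in> T \<longleftrightarrow> (k - 1, z - 1) \<in> T" "(k, z) \<in> T \<longleftrightarrow> (k + 1, z - 1) \<in> T" for z
      using s1[OF T, of "z - 1"] by auto
    have s3: "(k - 1, z) \<in> T \<longleftrightarrow> (k + 1, z) \<in> T" for z using s1[OF T] by auto
    have c: "squeeze x = squeeze x'" "(if x = k then y - 1 else y) = (if x' = k then y' - 1 else y')"
      using q(2) by (auto simp: pq co_def)
    have "x = x' \<or> (x \<in> {k - 1, k, k + 1} \<and> x' \<in> {k - 1, k, k + 1})"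
      using c(1) k by (auto simp: squeeze_def split: if_splits)
    then show ?thesis
    proof
      assume "x = x'"
      then show ?thesis using c(2) q(1) pq by (auto split: if_splits)
    next
      assume "x \<in> {k - 1, k, k + 1} \<and> x' \<in> {k - 1, k, k + 1}"
      then have X: "x = k - 1 \<or> x = k \<or> x = k + 1" "x' = k - 1 \<or> x' = k \<or> x' = k + 1" by auto
      have "(x', y') \<in> T \<longleftrightarrow> (k, if x' = k then y' else y' + 1) \<in> T"
        using X(2) s1[OF T, of y'] k by auto
      moreover have "(x, y) \<in> T \<longleftrightarrow> (k, if x = k then y else y + 1) \<in> T"
        using X(1) s1[OF T, of y] k by auto
      moreover have "(if x = k then y else y + 1) = (if x' = k then y' else y' + 1)"
        using c(2) by (auto split: if_splits)
      ultimately show ?thesis using q(1) pq by simp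
    qed
  qed
qed auto

text \<open>By saturation, taking preimages under \<open>co\<close> is a bijection between the
  tilings of the contracted shape and \<open>multi\<close>. Cover-inclusiveness passes both ways
  because \<open>co\<close> keeps the vertical order within a column and extents are compared
  through \<open>squeeze\<close>.\<close>

lemma card_multi: "card multi = card (tilings Bc)"
proof -
  have "bij_betw (\<lambda>P. (-`) co ` P) (tilings Bc) multi"
    unfolding bij_betw_def
  proof (intro conjI)
    show "inj_on (\<lambda>P. (-`) co ` P) (tilings Bc)"
      by (rule inj_onI) (use vimage_inj in \<open>auto simp: inj_image_eq_iff inj_def\<close>)
    show "(\<lambda>P. (-`) co ` P) ` tilings Bc = multi"
    proof (intro equalityI subsetI)
      fix P' assume "P' \<in> (\<lambda>P. (-`) co ` P) ` tilings Bc"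
      then obtain P where P: "P \<in> tilings Bc" and P': "P' = (-`) co ` P" by blast
      have part: "partition_on Bc P" and tl: "\<And>U. U \<in> P \<Longrightarrow> dyck_tile U" and ci: "cover_inclusive P"
        using P by (auto simp: tilings_def)
      have ne: "co -` U \<noteq> {}" if "U \<in> P" for U
        using co_image_vimage[of U] that part by (metis image_empty partition_onD3)
      have "partition_on (co -` Bc) P'"
        using partition_on_vimage[OF part, of co] ne unfolding P' by (metis (no_types, lifting) Diff_empty Diff_insert0 imageE)
      moreover have "co -` Bc = B" by (rule Set.set_eqI) (simp only: vimage_eq co_mem)
      moreover have "\<forall>T\<in>P'. dyck_tile T" unfolding P' using tl dyck_tile_vimage by auto
      moreover have "cover_inclusive P'"
        unfolding cover_inclusive_def
      proof (intro ballI impI)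
        fix T1 T2 assume "T1 \<in> P'" "T2 \<in> P'"
        then obtain U1 U2 where U: "U1 \<in> P" "U2 \<in> P" "T1 = co -` U1" "T2 = co -` U2" by (auto simp: P')
        assume "T1 \<noteq> T2 \<and> (\<exists>x y1 y2. (x, y1) \<in> T1 \<and> (x, y2) \<in> T2 \<and> y2 < y1)"
        then obtain x y1 y2 where ne: "U1 \<noteq> U2" and xy: "(x, y1) \<in> T1" "(x, y2) \<in> T2" "y2 < y1" using U by blast
        have "(squeeze x, if x = k then y1 - 1 else y1) \<in> U1" "(squeeze x, if x = k then y2 - 1 else y2) \<in> U2"
          using xy by (auto simp: U co_def)
        then have "horizontal_extent U1 \<subseteq> horizontal_extent U2"
          by (rule cover_inclusiveD[OF ci U(1,2) ne]) (use xy in auto)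
        then show "horizontal_extent T1 \<subseteq> horizontal_extent T2"
        proof (intro subsetI)
          fix z assume "z \<in> horizontal_extent T1"
          then have "\<exists>y. (z, y) \<in> co -` U1"
            using horizontal_extent_mem[OF dyck_tile_vimage[OF tl[OF U(1)]]] U(3) by simp
          then have "squeeze z \<in> horizontal_extent U1"
            unfolding vimage_column horizontal_extent_mem[OF tl[OF U(1)]] .
          then have "\<exists>y. (z, y) \<in> co -` U2"
            using \<open>horizontal_extent U1 \<subseteq> horizontal_extent U2\<close>
            unfolding vimage_column horizontal_extent_mem[OF tl[OF U(2)], symmetric] by blast
          then show "z \<in> horizontal_extent T2"
            using horizontal_extent_mem[OF dyck_tile_vimage[OF tl[OF U(2)]]] U(4) by simp
        qed
      qed
      moreover have "{(k, h)} \<notin> P'"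
      proof
        assume "{(k, h)} \<in> P'"
        then obtain U where U: "{(k, h)} = co -` U" by (auto simp: P')
        then have "(k, h) \<in> co -` U" by auto
        then have "(k - 1, h - 1) \<in> co -` U" using k by (simp add: co_simps)
        then show False using U[symmetric] by simp
      qed
      ultimately show "P' \<in> multi" by (auto simp: multi_def tilings_def)
    next
      fix P assume P: "P \<in> multi"
      note sat = multi_saturated[OF P]
      have Pt: "P \<in> tilings B" using P by (simp add: multi_def)
      have part: "partition_on B P" and tl: "\<And>U. U \<in> P \<Longrightarrow> dyck_tile U" and ci: "cover_inclusive P"
        using Pt by (auto simp: tilings_def)
      let ?Q = "(`) co ` P"
      have "P = (-`) co ` ?Q" using sat by (auto simp: image_image)
      moreover have "?Q \<in> tilings Bc"
        unfolding tilings_def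
      proof (intro CollectI conjI ballI)
        have "co ` B = Bc"
        proof -
          have "B = co -` Bc" by (rule Set.set_eqI) (simp only: vimage_eq co_mem)
          then show ?thesis using co_image_vimage by simp
        qed
        moreover have "\<Union>P = B" using part by (simp add: partition_on_def)
        moreover have "\<Union>?Q = co ` \<Union>P" by (simp add: image_Union)
        ultimately have "\<Union>?Q = Bc" by simp
        moreover have "disjoint ?Q"
        proof (rule disjointI)
          fix U1 U2 assume "U1 \<in> ?Q" "U2 \<in> ?Q" "U1 \<noteq> U2"
          then obtain T1 T2 where T: "T1 \<in> P" "T2 \<in> P" "U1 = co ` T1" "U2 = co ` T2" by blast
          have "T1 \<inter> T2 = {}" using part T \<open>U1 \<noteq> U2\<close> unfolding partition_on_def by (metis disjointD)
          then have "co -` U1 \<inter> co -` U2 = {}" using sat T by simp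
          then show "U1 \<inter> U2 = {}" using co_image_vimage[of "U1 \<inter> U2"] by (metis image_empty vimage_Int)
        qed
        moreover have "{} \<notin> ?Q" using part by (auto simp: partition_on_def)
        ultimately show "partition_on Bc ?Q" by (simp add: partition_on_def)
        show dt: "dyck_tile U" if "U \<in> ?Q" for U
        proof -
          obtain T where T: "T \<in> P" "U = co ` T" using \<open>U \<in> ?Q\<close> by blast
          then show ?thesis using dyck_tile_vimageD[of U] sat[OF T(1)] tl[OF T(1)] by simp
        qed
        show "cover_inclusive ?Q"
          unfolding cover_inclusive_def
        proof (intro ballI impI)
          fix U1 U2 assume U: "U1 \<in> ?Q" "U2 \<in> ?Q"
          then have T: "co -` U1 \<in> P" "co -` U2 \<in> P" using sat by auto
          assume "U1 \<noteq> U2 \<and> (\<exists>x y1 y2. (x, y1) \<in> U1 \<and> (x, y2) \<in> U2 \<and> y2 < y1)"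
          then obtain x y1 y2 where ne: "U1 \<noteq> U2" and xy: "(x, y1) \<in> U1" "(x, y2) \<in> U2" "y2 < y1" by blast
          have ne': "co -` U1 \<noteq> co -` U2" using ne vimage_inj by blast
          have r: "raise (x, y1) \<in> co -` U1" "raise (x, y2) \<in> co -` U2" using xy by (simp_all add: co_raise)
          have x': "raise (x, y1) = (if x < k then x else x + 2, y1)" "raise (x, y2) = (if x < k then x else x + 2, y2)"
            by (simp_all add: raise_def)
          have "horizontal_extent (co -` U1) \<subseteq> horizontal_extent (co -` U2)"
            by (rule cover_inclusiveD[OF ci T ne' r[unfolded x'] xy(3)])
          then have sub: "\<exists>y. (squeeze x, y) \<in> U2" if "\<exists>y. (squeeze x, y) \<in> U1" for x
            using that horizontal_extent_mem[OF tl[OF T(1)], of x] horizontal_extent_mem[OF tl[OF T(2)], of x]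
            unfolding vimage_column by blast
          show "horizontal_extent U1 \<subseteq> horizontal_extent U2"
          proof
            fix z assume "z \<in> horizontal_extent U1"
            moreover obtain x where "squeeze x = z" using squeeze_surj by blast
            ultimately show "z \<in> horizontal_extent U2"
              using sub[of x] horizontal_extent_mem[OF dt[OF U(1)], of z] horizontal_extent_mem[OF dt[OF U(2)], of z] by blast
          qed
        qed
      qed
      ultimately show "P \<in> (\<lambda>P. (-`) co ` P) ` tilings Bc" by blast
    qed
  qed
  then show ?thesis by (simp add: bij_betw_same_card)
qed

end

subsection \<open>Removing nested short links\<close>

text \<open>For m \<le> k this is the increasing map that leaves out the 2m points k - m + 1, ..., k
  + m.\<close>

definition up :: "nat \<Rightarrow> nat \<Rightarrow> nat \<Rightarrow> nat" where
  "up k m a = (if a + m \<le> k then a else a + 2 * m)"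

text \<open>Links are pulled back along \<open>up\<close>, so links touching an omitted point
  disappear. This yields a matching when the omitted points are linked among themselves.\<close>

definition rem :: "nat \<Rightarrow> nat \<Rightarrow> nat set set \<Rightarrow> nat set set" where
  "rem k m \<beta> = {l. up k m ` l \<in> \<beta>}"

lemma up_less_iff: "up k m a < up k m b \<longleftrightarrow> a < b"
  by (auto simp: up_def)

lemma up_eq_iff: "up k m a = up k m b \<longleftrightarrow> a = b"
  by (auto simp: up_def)

lemma rem_link: "{a, b} \<in> rem k m \<beta> \<longleftrightarrow> {up k m a, up k m b} \<in> \<beta>"
  by (simp add: rem_def)

lemma up1_range: "x \<noteq> k \<Longrightarrow> x \<noteq> k + 1 \<Longrightarrow> up k 1 (if x < k then x else x - 2) = x"
  by (auto simp: up_def)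

lemma up1_notin: "up k 1 a \<noteq> k" "up k 1 a \<noteq> k + 1"
  by (auto simp: up_def)

lemma up1_in: "1 \<le> k \<Longrightarrow> k < 2*N \<Longrightarrow> up k 1 a \<in> {1..2*N} \<longleftrightarrow> a \<in> {1..2*(N-1)}"
  by (auto simp: up_def)

context
  fixes N k \<beta>
  assumes B: "\<beta> \<in> NC N" and k: "1 \<le> k" "k < 2*N" and kk: "{k, k+1} \<in> \<beta>"
begin

lemma rem1_matching: "matching (N - 1) (rem k 1 \<beta>)"
  and rem1_mate: "a \<in> {1..2*(N-1)} \<Longrightarrow> up k 1 (mate (rem k 1 \<beta>) a) = mate \<beta> (up k 1 a)"
proof -
  note M = NC_matching[OF B]
  have mk: "mate \<beta> k = k + 1" "mate \<beta> (k+1) = k" using kk mate_eqI[OF M] by (auto simp: insert_commute)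
  have ex: "\<exists>b. mate \<beta> (up k 1 a) = up k 1 b" if a: "a \<in> {1..2*(N-1)}" for a
  proof -
    have u: "up k 1 a \<in> {1..2*N}" using a up1_in[OF k] by simp
    have "mate \<beta> (up k 1 a) \<noteq> k" "mate \<beta> (up k 1 a) \<noteq> k + 1"
      using mate_mate[OF M u] mk up1_notin[of k a] by auto
    then show ?thesis using up1_range by metis
  qed
  show M': "matching (N - 1) (rem k 1 \<beta>)"
  proof (rule matchingI)
    fix l assume l: "l \<in> rem k 1 \<beta>"
    then obtain x y where xy: "up k 1 ` l = {x, y}" "x < y" "x \<in> {1..2*N}" "y \<in> {1..2*N}"
      using matchingD(1)[OF M, of "up k 1 ` l"] by (auto simp: rem_def)
    have "x \<in> up k 1 ` l" "y \<in> up k 1 ` l" using xy(1) by auto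
    then obtain a b where ab: "x = up k 1 a" "y = up k 1 b" by blast
    have "up k 1 ` l = up k 1 ` {a, b}" using xy(1) ab by simp
    then have "l = {a, b}" using inj_image_eq_iff[of "up k 1"] up_eq_iff by (metis injI)
    moreover have "a \<noteq> b" using xy(2) ab by auto
    moreover have "a \<in> {1..2*(N-1)}" "b \<in> {1..2*(N-1)}" using xy(3,4) ab up1_in[OF k] by auto
    ultimately show "\<exists>a b. l = {a, b} \<and> a \<noteq> b \<and> a \<in> {1..2*(N-1)} \<and> b \<in> {1..2*(N-1)}" by blast
  next
    fix a assume a: "a \<in> {1..2*(N-1)}"
    obtain b where "mate \<beta> (up k 1 a) = up k 1 b" using ex[OF a] by blast
    then have "{up k 1 a, up k 1 b} \<in> \<beta>" using mate_link[OF M, of "up k 1 a"] a up1_in[OF k] by simp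
    then show "\<exists>b. {a, b} \<in> rem k 1 \<beta>" using rem_link by blast
  next
    fix a b c assume "{a, b} \<in> rem k 1 \<beta>" "{a, c} \<in> rem k 1 \<beta>"
    then show "b = c" unfolding rem_link using matchingD(3)[OF M, of "up k 1 a" "up k 1 b" "up k 1 c"] by (simp add: up_eq_iff)
  qed
  show "up k 1 (mate (rem k 1 \<beta>) a) = mate \<beta> (up k 1 a)" if "a \<in> {1..2*(N-1)}"
  proof -
    have "{a, mate (rem k 1 \<beta>) a} \<in> rem k 1 \<beta>" by (rule mate_link[OF M' that])
    then show ?thesis using mate_eqI[OF M] by (metis rem_link)
  qed
qed

lemma rem1_NC: "rem k 1 \<beta> \<in> NC (N - 1)"
proof (rule NC_I[OF rem1_matching])
  fix a c assume ac: "a \<in> {1..2*(N-1)}" "c \<in> {1..2*(N-1)}"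
    and "a < c" "c < mate (rem k 1 \<beta>) a" "mate (rem k 1 \<beta>) a < mate (rem k 1 \<beta>) c"
  then have "up k 1 a < up k 1 c" "up k 1 c < mate \<beta> (up k 1 a)" "mate \<beta> (up k 1 a) < mate \<beta> (up k 1 c)"
    unfolding rem1_mate[OF ac(1), symmetric] rem1_mate[OF ac(2), symmetric] by (simp_all add: up_less_iff)
  then show False using NC_not_crossing[OF B] up1_in[OF k] ac by blast
qed

lemma rem1_lefts: "a \<in> {1..2*(N-1)} \<Longrightarrow> a \<in> lefts (rem k 1 \<beta>) \<longleftrightarrow> up k 1 a \<in> lefts \<beta>"
  using rem1_mate[of a] up_less_iff[of k 1 a "mate (rem k 1 \<beta>) a"] up1_in[OF k, of a]
  unfolding lefts_eq[OF NC_matching[OF B]] lefts_eq[OF rem1_matching] by auto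

lemma rem1_lefts_image: "lefts \<beta> - {k} = up k 1 ` lefts (rem k 1 \<beta>)"
proof -
  have kl: "k + 1 \<notin> lefts \<beta>" using peak_iff[OF B k] kk by simp
  show ?thesis
  proof (intro equalityI subsetI)
    fix x assume x: "x \<in> lefts \<beta> - {k}"
    then have "x \<noteq> k" "x \<noteq> k + 1" using kl by auto
    define a where "a = (if x < k then x else x - 2)"
    have a: "up k 1 a = x" unfolding a_def using \<open>x \<noteq> k\<close> \<open>x \<noteq> k + 1\<close> by (rule up1_range)
    then have "a \<in> {1..2*(N-1)}" using up1_in[OF k, of a] lefts_sub[OF NC_matching[OF B], of x] x by auto
    then show "x \<in> up k 1 ` lefts (rem k 1 \<beta>)" using rem1_lefts[of a] a x by auto
  next
    fix x assume "x \<in> up k 1 ` lefts (rem k 1 \<beta>)"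
    then obtain a where a: "a \<in> lefts (rem k 1 \<beta>)" "x = up k 1 a" by blast
    have "a \<in> {1..2*(N-1)}" using lefts_sub[OF rem1_matching a(1)] .
    then show "x \<in> lefts \<beta> - {k}" using rem1_lefts[of a] a up1_notin[of k a] by auto
  qed
qed

lemma peak_heights: "dyck_path \<beta> k = dyck_path \<beta> (k - 1) + 1" "dyck_path \<beta> (k + 1) = dyck_path \<beta> (k - 1)"
proof -
  have l: "k \<in> lefts \<beta>" "k + 1 \<notin> lefts \<beta>" using peak_iff[OF B k] kk by auto
  show "dyck_path \<beta> k = dyck_path \<beta> (k - 1) + 1"
    using dyck_path_Suc[OF NC_matching[OF B], of "k - 1"] k l by simp
  then show "dyck_path \<beta> (k + 1) = dyck_path \<beta> (k - 1)"
    using dyck_path_Suc[OF NC_matching[OF B], of k] l by simp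
qed

lemma rem1_dyck_path:
  "j \<le> 2*(N-1) \<Longrightarrow> dyck_path (rem k 1 \<beta>) j = dyck_path \<beta> (if j < k then j else j + 2)"
proof (induction j)
  case 0
  then show ?case using k by simp
next
  case (Suc j)
  note S = dyck_path_Suc[OF rem1_matching] dyck_path_Suc[OF NC_matching[OF B]]
  have sj: "Suc j \<in> {1..2*(N-1)}" using Suc by auto
  have IH: "dyck_path (rem k 1 \<beta>) j = dyck_path \<beta> (if j < k then j else j + 2)" using Suc by auto
  consider "Suc j < k" | "Suc j = k" | "k \<le> j" by linarith
  then show ?case
  proof cases
    case 1
    then show ?thesis using IH rem1_lefts[OF sj] S(1)[of j] S(2)[of j] by (simp add: up_def)
  next
    case 2
    then have "dyck_path (rem k 1 \<beta>) j = dyck_path \<beta> (k + 1)" using IH peak_heights by auto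
    then show ?thesis using 2 rem1_lefts[OF sj] S(1)[of j] S(2)[of "k + 1"] by (simp add: up_def)
  next
    case 3
    then show ?thesis using IH rem1_lefts[OF sj] S(1)[of j] S(2)[of "j + 2"] by (simp add: up_def)
  qed
qed

text \<open>The short link provides a pivot on the diagonal of the pairing. Equality of the columns
  \<open>k\<close> and \<open>k + 1\<close> lets the Schur complement be written with column
  \<open>k\<close>, a form that is symmetric whenever \<open>K\<close> is.\<close>

lemma ndet_peak:
  assumes "K k (k+1) \<noteq> 0" and "\<And>a. a \<in> {1..2*N} - {k, k+1} \<Longrightarrow> K a (k+1) = K a k"
  shows "ndet \<beta> K = K k (k+1) * ndet (rem k 1 \<beta>)
    (\<lambda>a b. K (up k 1 a) (up k 1 b) - K (up k 1 a) k * K k (up k 1 b) / K k (k+1))"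
proof -
  note M = NC_matching[OF B]
  have mk: "mate \<beta> k = k + 1" using kk mate_eqI[OF M] by auto
  have kl: "k \<in> lefts \<beta>" using peak_iff[OF B k] kk by simp
  let ?S = "\<lambda>a b. K a b - K a (mate \<beta> k) * K k b / K k (mate \<beta> k)"
  have "ndet \<beta> K = K k (k+1) * gdet (lefts \<beta> - {k}) (mate \<beta>) ?S"
    unfolding ndet_def using gdet_schur[OF finite_lefts[OF M] kl, of K "mate \<beta>"] assms(1) mk by simp
  also have "gdet (lefts \<beta> - {k}) (mate \<beta>) ?S = gdet (lefts (rem k 1 \<beta>)) (mate \<beta> \<circ> up k 1) (\<lambda>a b. ?S (up k 1 a) b)"
    unfolding rem1_lefts_image
    by (rule gdet_reindex) (use finite_lefts[OF rem1_matching] up_eq_iff in \<open>auto simp: inj_on_def\<close>)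
  also have "\<dots> = gdet (lefts (rem k 1 \<beta>)) (up k 1 \<circ> mate (rem k 1 \<beta>)) (\<lambda>a b. ?S (up k 1 a) b)"
    by (rule gdet_cong) (use rem1_mate lefts_sub[OF rem1_matching] in auto)
  also have "\<dots> = gdet (lefts (rem k 1 \<beta>)) (mate (rem k 1 \<beta>)) (\<lambda>a b. ?S (up k 1 a) (up k 1 b))"
    by (rule gdet_image)
  also have "\<dots> = ndet (rem k 1 \<beta>) (\<lambda>a b. K (up k 1 a) (up k 1 b) - K (up k 1 a) k * K k (up k 1 b) / K k (k+1))"
    unfolding ndet_def
  proof (rule gdet_cong)
    fix a b assume "a \<in> lefts (rem k 1 \<beta>)"
    then have "up k 1 a \<in> {1..2*N} - {k, k+1}"
      using up1_in[OF k, of a] lefts_sub[OF rem1_matching] up1_notin[of k a] by auto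
    then show "?S (up k 1 a) (up k 1 b) = K (up k 1 a) (up k 1 b) - K (up k 1 a) k * K k (up k 1 b) / K k (k+1)"
      using assms(2) mk by simp
  qed auto
  finally show ?thesis .
qed

end

lemma rem1_inj:
  assumes "\<beta> \<in> NC N" "\<beta>' \<in> NC N" "1 \<le> k" "k < 2*N" "{k, k+1} \<in> \<beta>" "{k, k+1} \<in> \<beta>'" "rem k 1 \<beta> = rem k 1 \<beta>'"
  shows "\<beta> = \<beta>'"
proof (rule NC_eqI_lefts[OF assms(1,2)])
  have "k \<in> lefts \<beta>" "k \<in> lefts \<beta>'" using assms peak_iff by auto
  moreover have "lefts \<beta> - {k} = lefts \<beta>' - {k}"
    unfolding rem1_lefts_image[OF assms(1,3,4,5)] rem1_lefts_image[OF assms(2,3,4,6)] assms(7) ..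
  ultimately show "lefts \<beta> = lefts \<beta>'" by (metis insert_Diff)
qed

lemma rem1_surj:
  assumes G: "\<gamma> \<in> NC (N - 1)" and k: "1 \<le> k" "k < 2*N"
  shows "\<exists>\<beta>\<in>NC N. {k, k+1} \<in> \<beta> \<and> rem k 1 \<beta> = \<gamma>"
proof -
  note M = NC_matching[OF G]
  define dn where "dn x = (if x < k then x else x - 2)" for x
  have du: "dn (up k 1 a) = a" for a by (auto simp: dn_def up_def)
  have ud: "up k 1 (dn x) = x" if "x \<noteq> k" "x \<noteq> k + 1" for x unfolding dn_def using that by (rule up1_range)
  define f where "f x = (if x = k then k + 1 else if x = k + 1 then k else up k 1 (mate \<gamma> (dn x)))" for x
  have fu: "f (up k 1 a) = up k 1 (mate \<gamma> a)" for a using up1_notin[of k a] by (simp add: f_def du del: One_nat_def)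
  have dr: "dn x \<in> {1..2*(N-1)}" if "x \<in> {1..2*N}" "x \<noteq> k" "x \<noteq> k + 1" for x
    using that k by (auto simp: dn_def)
  have I: "f x \<in> {1..2*N} \<and> f x \<noteq> x \<and> f (f x) = x" if x: "x \<in> {1..2*N}" for x
  proof (cases "x = k \<or> x = k + 1")
    case True
    then show ?thesis using k by (auto simp: f_def)
  next
    case False
    define a where "a = dn x"
    have a: "a \<in> {1..2*(N-1)}" "x = up k 1 a" using dr[OF x] ud False by (auto simp: a_def)
    show ?thesis unfolding a(2) fu
      using mate_mate[OF M a(1)] mate_neq[OF M a(1)] mate_in[OF M a(1)] up1_in[OF k, of "mate \<gamma> a"]
      by (simp add: up_eq_iff del: One_nat_def)
  qed
  define \<beta> where "\<beta> = of_involution N f"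
  have M': "matching N \<beta>" unfolding \<beta>_def by (rule matching_of_involution[OF I])
  have m: "mate \<beta> x = f x" if "x \<in> {1..2*N}" for x unfolding \<beta>_def by (rule mate_of_involution[OF I that])
  have B: "\<beta> \<in> NC N"
  proof (rule NC_I[OF M'])
    fix x y assume x: "x \<in> {1..2*N}" and y: "y \<in> {1..2*N}" and h: "x < y" "y < mate \<beta> x" "mate \<beta> x < mate \<beta> y"
    then have h: "x < y" "y < f x" "f x < f y" using m by auto
    have "x \<noteq> k" "x \<noteq> k + 1" "y \<noteq> k + 1" using h by (auto simp: f_def)
    moreover have "y \<noteq> k" using h by (auto simp: f_def)
    ultimately have e: "x = up k 1 (dn x)" "y = up k 1 (dn y)" "dn x \<in> {1..2*(N-1)}" "dn y \<in> {1..2*(N-1)}"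
      using ud dr x y by auto
    have "f x = up k 1 (mate \<gamma> (dn x))" "f y = up k 1 (mate \<gamma> (dn y))" using e(1,2) fu by metis+
    then have "dn x < dn y" "dn y < mate \<gamma> (dn x)" "mate \<gamma> (dn x) < mate \<gamma> (dn y)"
      using h e(1,2) up_less_iff[of k 1] by metis+
    then show False using NC_not_crossing[OF G e(3,4)] by blast
  qed
  have kr: "k \<in> {1..2*N}" using k by auto
  have kk: "{k, k+1} \<in> \<beta>" using mate_link[OF M' kr] m[OF kr] by (simp add: f_def)
  have "rem k 1 \<beta> = \<gamma>"
  proof (rule matching_eqI[OF rem1_matching[OF B k kk] M])
    fix a assume a: "a \<in> {1..2*(N-1)}"
    have "up k 1 (mate (rem k 1 \<beta>) a) = up k 1 (mate \<gamma> a)"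
      using rem1_mate[OF B k kk a] m[of "up k 1 a"] up1_in[OF k, of a] a fu by simp
    then show "mate (rem k 1 \<beta>) a = mate \<gamma> a" by (simp add: up_eq_iff)
  qed
  then show ?thesis using B kk by blast
qed

subsection \<open>Recursions for the number of cover-inclusive tilings\<close>

abbreviation ctil :: "nat \<Rightarrow> nat set set \<Rightarrow> nat set set \<Rightarrow> nat" where
  "ctil N \<alpha> \<beta> \<equiv> card (cover_inclusive_tilings N \<alpha> \<beta>)"

lemma NC_lattice_path:
  assumes "\<beta> \<in> NC N"
  shows "lattice_path n (dyck_path \<beta>)"
  using dyck_path_Suc[OF NC_matching[OF assms]] by (auto simp: lattice_path_def)

lemma NC_parity:
  assumes "\<beta> \<in> NC N"
  shows "even (int j + dyck_path \<beta> j)"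
proof (induction j)
  case (Suc j)
  then show ?case using dyck_path_Suc[OF NC_matching[OF assms], of j] by auto
qed simp

lemma ctil_eq:
  assumes "\<alpha> \<in> NC N" "\<beta> \<in> NC N"
  shows "ctil N \<alpha> \<beta> = card (tilings (boxes (2*N) (dyck_path \<alpha>) (dyck_path \<beta>)))"
  using skew_boxes_eq[OF NC_lattice_path[OF assms(1)] NC_lattice_path[OF assms(2)]]
  by (simp add: cover_inclusive_tilings_def tilings_def)

lemma peak_column_NC:
  assumes "\<alpha> \<in> NC N" "\<beta> \<in> NC N" "1 \<le> k" "k < 2*N" "{k, k+1} \<in> \<beta>"
  shows "peak_column (2*N) k (dyck_path \<alpha>) (dyck_path \<beta>) (dyck_path \<beta> k - 1)"
proof
  show "odd (int k + (dyck_path \<beta> k - 1))" using NC_parity[OF assms(2), of k] by auto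
qed (use assms peak_heights[OF assms(2-5)] NC_parity[OF assms(1), of k] NC_lattice_path[OF assms(1)] in auto)

context
  fixes N k \<alpha> \<beta>
  assumes A: "\<alpha> \<in> NC N" and B: "\<beta> \<in> NC N" and k: "1 \<le> k" "k < 2*N"
    and v: "k \<notin> lefts \<beta>" "k + 1 \<in> lefts \<beta>" and ab: "dyck_above N \<beta> \<alpha>"
begin

lemma flip_up_peak: "{k, k+1} \<in> flip_up N k \<beta>"
  using peak_iff[OF flip_up_NC[OF B k v] k] by (simp add: lefts_flip_up[OF B k v])

lemma flip_up_dyck_path: "dyck_path (flip_up N k \<beta>) j = dyck_path \<beta> j + (if j = k then 2 else 0)"
  by (rule dyck_path_flip[OF v lefts_flip_up[OF B k v] k(1)])

lemma flip_up_above: "dyck_above N (flip_up N k \<beta>) \<alpha>"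
  using ab by (auto simp: dyck_above_def flip_up_dyck_path)

text \<open>Raising the valley adds exactly the top box of column \<open>k\<close>; tilings in which
  this box is a tile of its own are tilings of the old shape.\<close>

lemma ctil_flip_split:
  fixes h
  defines "h \<equiv> dyck_path (flip_up N k \<beta>) k - 1"
  shows "ctil N \<alpha> (flip_up N k \<beta>) = ctil N \<alpha> \<beta> + card (peak_column.multi (2*N) k (dyck_path \<alpha>) (dyck_path (flip_up N k \<beta>)) h)"
    and "(k, h) \<in> boxes (2*N) (dyck_path \<alpha>) (dyck_path (flip_up N k \<beta>))"
proof -
  note kN = k
  interpret peak_column "2*N" k "dyck_path \<alpha>" "dyck_path (flip_up N k \<beta>)" h
    unfolding h_def by (rule peak_column_NC[OF A flip_up_NC[OF B k v] k flip_up_peak])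
  have hk: "h = dyck_path \<beta> k + 1" by (simp add: h_def flip_up_dyck_path)
  have "dyck_path \<alpha> k \<le> dyck_path \<beta> k" using ab k by (simp add: dyck_above_def)
  then show kB: "(k, h) \<in> boxes (2*N) (dyck_path \<alpha>) (dyck_path (flip_up N k \<beta>))"
    using kN par(1) hk by (auto simp: boxes_def flip_up_dyck_path)
  have "boxes (2*N) (dyck_path \<alpha>) (dyck_path (flip_up N k \<beta>)) - {(k, h)} = boxes (2*N) (dyck_path \<alpha>) (dyck_path \<beta>)"
  proof -
    have "y < dyck_path \<beta> k + 2 \<and> y \<noteq> h \<longleftrightarrow> y < dyck_path \<beta> k" if "odd (int k + y)" for y
      using that NC_parity[OF B, of k] hk by presburger
    then have "(x, y) \<in> boxes (2*N) (dyck_path \<alpha>) (dyck_path (flip_up N k \<beta>)) - {(k, h)}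
        \<longleftrightarrow> (x, y) \<in> boxes (2*N) (dyck_path \<alpha>) (dyck_path \<beta>)" for x y
      by (cases "x = k") (simp_all add: boxes_def flip_up_dyck_path, blast)
    then show ?thesis by (intro Set.set_eqI) (simp only: split_paired_all)
  qed
  then show "ctil N \<alpha> (flip_up N k \<beta>) = ctil N \<alpha> \<beta> + card multi"
    using card_tilings_split[OF kB] ctil_eq[OF A B] ctil_eq[OF A flip_up_NC[OF B kN v]] by simp
qed

text \<open>A tiling in \<open>multi\<close> would force a peak of \<alpha> at \<open>k\<close>, and
  a peak of a noncrossing pattern is a short link.\<close>

lemma ctil_flip_eq:
  assumes "{k, k+1} \<notin> \<alpha>"
  shows "ctil N \<alpha> (flip_up N k \<beta>) = ctil N \<alpha> \<beta>"
proof -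
  let ?h = "dyck_path (flip_up N k \<beta>) k - 1"
  note kN = k
  interpret peak_column "2*N" k "dyck_path \<alpha>" "dyck_path (flip_up N k \<beta>)" ?h
    by (rule peak_column_NC[OF A flip_up_NC[OF B k v] k flip_up_peak])
  have "multi = {}"
  proof (rule ccontr)
    assume "multi \<noteq> {}"
    then obtain P where "P \<in> multi" by blast
    from multi_peak[OF this ctil_flip_split(2)]
    have p: "dyck_path \<alpha> (k - 1) = dyck_path \<alpha> k - 1" "dyck_path \<alpha> (k + 1) = dyck_path \<alpha> k - 1" by auto
    have "k \<in> lefts \<alpha>" "k + 1 \<notin> lefts \<alpha>"
      using p dyck_path_Suc[OF NC_matching[OF A], of "k - 1"] dyck_path_Suc[OF NC_matching[OF A], of k] k
      by (auto split: if_splits)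
    then show False using peak_iff[OF A kN] assms by simp
  qed
  then show ?thesis using ctil_flip_split(1) by simp
qed

end

text \<open>Deleting the peak at \<open>k\<close> from both paths is the contraction of the three
  columns to one.\<close>

lemma card_multi_rem:
  assumes A: "\<alpha> \<in> NC N" and B: "\<beta> \<in> NC N" and k: "1 \<le> k" "k < 2*N"
    and kA: "{k, k+1} \<in> \<alpha>" and kB: "{k, k+1} \<in> \<beta>"
  shows "card (peak_column.multi (2*N) k (dyck_path \<alpha>) (dyck_path \<beta>) (dyck_path \<beta> k - 1))
    = ctil (N - 1) (rem k 1 \<alpha>) (rem k 1 \<beta>)"
proof -
  note kN = k
  interpret peak_column "2*N" k "dyck_path \<alpha>" "dyck_path \<beta>" "dyck_path \<beta> k - 1"
    by (rule peak_column_NC[OF A B k kB])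
  interpret two_peaks "2*N" k "dyck_path \<alpha>" "dyck_path \<beta>" "dyck_path \<beta> k - 1"
    by unfold_locales (use peak_heights[OF A kN kA] dyck_path_end[OF NC_matching[OF A]] dyck_path_end[OF NC_matching[OF B]] in auto)
  have "boxes (2*N - 2) fc gc = boxes (2*(N-1)) (dyck_path (rem k 1 \<alpha>)) (dyck_path (rem k 1 \<beta>))"
  proof -
    have "dyck_path (rem k 1 \<alpha>) x = fc x" "dyck_path (rem k 1 \<beta>) x = gc x" if "x < 2*(N-1)" for x
      using that rem1_dyck_path[OF A kN kA, of x] rem1_dyck_path[OF B kN kB, of x] by (auto simp: fc_def gc_def)
    moreover have "2*N - 2 = 2*(N-1)" by simp
    ultimately show ?thesis by (auto simp: boxes_def)
  qed
  then show ?thesis using card_multi ctil_eq[OF rem1_NC[OF A kN kA] rem1_NC[OF B kN kB]] by simp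
qed

lemma ctil_flip_rem:
  assumes A: "\<alpha> \<in> NC N" and B: "\<beta> \<in> NC N" and k: "1 \<le> k" "k < 2*N"
    and kA: "{k, k+1} \<in> \<alpha>" and v: "k \<notin> lefts \<beta>" "k + 1 \<in> lefts \<beta>" and ab: "dyck_above N \<beta> \<alpha>"
  shows "ctil N \<alpha> (flip_up N k \<beta>) = ctil N \<alpha> \<beta> + ctil (N - 1) (rem k 1 \<alpha>) (rem k 1 (flip_up N k \<beta>))"
  using ctil_flip_split(1)[OF A B k v ab]
    card_multi_rem[OF A flip_up_NC[OF B k v] k kA flip_up_peak[OF A B k v ab]] by simp

text \<open>Where the two paths meet at \<open>k\<close> the column is empty, so every tiling
  belongs to \<open>multi\<close>.\<close>

lemma ctil_rem:
  assumes A: "\<alpha> \<in> NC N" and B: "\<beta> \<in> NC N" and k: "1 \<le> k" "k < 2*N"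
    and kA: "{k, k+1} \<in> \<alpha>" and kB: "{k, k+1} \<in> \<beta>" and eq: "dyck_path \<beta> k = dyck_path \<alpha> k"
  shows "ctil N \<alpha> \<beta> = ctil (N - 1) (rem k 1 \<alpha>) (rem k 1 \<beta>)"
proof -
  note kN = k
  interpret peak_column "2*N" k "dyck_path \<alpha>" "dyck_path \<beta>" "dyck_path \<beta> k - 1"
    by (rule peak_column_NC[OF A B k kB])
  have "(k, dyck_path \<beta> k - 1) \<notin> boxes (2*N) (dyck_path \<alpha>) (dyck_path \<beta>)" using eq by (simp add: boxes_def)
  then have "multi = tilings (boxes (2*N) (dyck_path \<alpha>) (dyck_path \<beta>))"
    unfolding multi_def by (auto simp: tilings_def partition_on_def)
  then show ?thesis using card_multi_rem[OF A B kN kA kB] ctil_eq[OF A B] by simp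
qed

section \<open>Symmetries and factorisation of the partition function of an arbitrary kernel\<close>

subsection \<open>Partition functions of arbitrary kernels\<close>

abbreviation above :: "nat \<Rightarrow> nat set set \<Rightarrow> nat set set set" where
  "above N \<alpha> \<equiv> {\<beta>. \<beta> \<in> NC N \<and> dyck_above N \<beta> \<alpha>}"

definition Zp :: "nat \<Rightarrow> nat set set \<Rightarrow> (nat \<Rightarrow> nat \<Rightarrow> real) \<Rightarrow> real" where
  "Zp N \<alpha> K = (\<Sum>\<beta>\<in>above N \<alpha>. real (ctil N \<alpha> \<beta>) * ndet \<beta> K)"

lemma finite_above: "finite (above N \<alpha>)"
  using finite_NC by simp

lemma Zp_cong:
  assumes "\<And>a b. a \<in> {1..2*N} \<Longrightarrow> b \<in> {1..2*N} \<Longrightarrow> a \<noteq> b \<Longrightarrow> K a b = K' a b"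
  shows "Zp N \<alpha> K = Zp N \<alpha> K'"
  unfolding Zp_def
proof (intro sum.cong refl)
  fix \<beta> assume "\<beta> \<in> above N \<alpha>"
  then have "matching N \<beta>" by (simp add: NC_matching)
  then show "real (ctil N \<alpha> \<beta>) * ndet \<beta> K = real (ctil N \<alpha> \<beta>) * ndet \<beta> K'"
    using ndet_cong[of N \<beta> K K'] assms by simp
qed

context
  fixes N k :: nat
  assumes k: "1 \<le> k" "k < 2*N"
begin

definition "valleys \<alpha> = {\<beta> \<in> above N \<alpha>. k \<notin> lefts \<beta> \<and> k + 1 \<in> lefts \<beta>}"
definition "peaks \<alpha> = {\<beta> \<in> above N \<alpha>. {k, k+1} \<in> \<beta>}"
definition "slopes \<alpha> = {\<beta> \<in> above N \<alpha>. k \<in> lefts \<beta> \<longleftrightarrow> k + 1 \<in> lefts \<beta>}"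

lemma sum_above_split:
  "sum f (above N \<alpha>) = sum f (valleys \<alpha>) + sum f (peaks \<alpha>) + sum f (slopes \<alpha>)" for f :: "nat set set \<Rightarrow> real"
proof -
  have "above N \<alpha> = (valleys \<alpha> \<union> peaks \<alpha>) \<union> slopes \<alpha>"
    using peak_iff[OF _ k] by (auto simp: valleys_def peaks_def slopes_def)
  moreover have "finite (valleys \<alpha>)" "finite (peaks \<alpha>)" "finite (slopes \<alpha>)"
    by (auto intro!: finite_subset[OF _ finite_above[of N \<alpha>]] simp: valleys_def peaks_def slopes_def)
  moreover have "valleys \<alpha> \<inter> peaks \<alpha> = {}" "(valleys \<alpha> \<union> peaks \<alpha>) \<inter> slopes \<alpha> = {}"
    using peak_iff[OF _ k] by (auto simp: valleys_def peaks_def slopes_def)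
  ultimately show ?thesis by (simp add: sum.union_disjoint)
qed

lemma ndet_slopes: "\<beta> \<in> slopes \<alpha> \<Longrightarrow> ndet \<beta> (swapped k K) = - ndet \<beta> K"
  using ndet_swapped_up[OF NC_matching k] ndet_swapped_down[OF NC_matching k]
  unfolding slopes_def by blast

lemma flip_up_inj: "inj_on (flip_up N k) (valleys \<alpha>)"
proof (rule inj_onI)
  fix \<beta> \<beta>' assume b: "\<beta> \<in> valleys \<alpha>" "\<beta>' \<in> valleys \<alpha>" and e: "flip_up N k \<beta> = flip_up N k \<beta>'"
  then have B: "\<beta> \<in> NC N" "\<beta>' \<in> NC N" and v: "k \<notin> lefts \<beta>" "k + 1 \<in> lefts \<beta>" "k \<notin> lefts \<beta>'" "k + 1 \<in> lefts \<beta>'"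
    by (auto simp: valleys_def)
  show "\<beta> = \<beta>'"
  proof (rule NC_eqI_lefts[OF B])
    have "insert k (lefts \<beta> - {k+1}) = insert k (lefts \<beta>' - {k+1})"
      using lefts_flip_up[OF B(1) k v(1,2)] lefts_flip_up[OF B(2) k v(3,4)] e by simp
    moreover have "lefts \<beta> = insert (k+1) (insert k (lefts \<beta> - {k+1}) - {k})"
      "lefts \<beta>' = insert (k+1) (insert k (lefts \<beta>' - {k+1}) - {k})" using v by auto
    ultimately show "lefts \<beta> = lefts \<beta>'" by simp
  qed
qed

lemma flip_up_peaks: "\<alpha> \<in> NC N \<Longrightarrow> \<beta> \<in> valleys \<alpha> \<Longrightarrow> flip_up N k \<beta> \<in> peaks \<alpha>"
  using flip_up_NC[OF _ k] flip_up_above[OF _ _ k] flip_up_peak[OF _ _ k] by (auto simp: valleys_def peaks_def)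

text \<open>The second inequality leaves room for lowering the peak above \<alpha>, the first one
  for lowering it above the axis. Only peaks resting on one of them can fail to come from a
  valley.\<close>

lemma peak_not_flip:
  assumes A: "\<alpha> \<in> NC N" and b: "\<beta> \<in> peaks \<alpha>"
    and h: "0 < dyck_path \<beta> (k - 1)" "dyck_path \<alpha> k + 2 \<le> dyck_path \<beta> k"
  shows "\<beta> \<in> flip_up N k ` valleys \<alpha>"
proof -
  have B: "\<beta> \<in> NC N" "{k, k+1} \<in> \<beta>" and ab: "dyck_above N \<beta> \<alpha>" using b by (auto simp: peaks_def)
  obtain \<beta>' where b': "\<beta>' \<in> NC N" "k \<notin> lefts \<beta>'" "k + 1 \<in> lefts \<beta>'" "lefts \<beta> = insert k (lefts \<beta>' - {k+1})"
    using flip_down_ex[OF B(1) k B(2) h(1)] by blast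
  have e: "flip_up N k \<beta>' = \<beta>"
    by (rule NC_eqI_lefts[OF flip_up_NC[OF b'(1) k b'(2,3)] B(1)])
      (simp add: lefts_flip_up[OF b'(1) k b'(2,3)] b'(4))
  have "dyck_above N \<beta>' \<alpha>"
    unfolding dyck_above_def
  proof (intro allI impI)
    fix j assume "j \<le> 2*N"
    then have "dyck_path \<alpha> j \<le> dyck_path \<beta> j" using ab by (simp add: dyck_above_def)
    then show "dyck_path \<alpha> j \<le> dyck_path \<beta>' j"
      using h(2) dyck_path_flip[OF b'(2-4) k(1), of j] by (cases "j = k") auto
  qed
  then show ?thesis using e b' unfolding valleys_def by blast
qed

text \<open>If \<alpha> has no peak at \<open>k\<close>, some neighbour of \<open>k\<close> has
  \<alpha>-height one larger than \<open>k\<close>, whereas both neighbours of a peak of \<beta> are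
  one lower. Hence \<beta> exceeds \<alpha> by at least two at \<open>k\<close> and can be flipped
  down.\<close>

lemma flip_up_onto:
  assumes A: "\<alpha> \<in> NC N" and n: "{k, k+1} \<notin> \<alpha>"
  shows "flip_up N k ` valleys \<alpha> = peaks \<alpha>"
proof (intro equalityI subsetI)
  fix \<beta> assume b: "\<beta> \<in> peaks \<alpha>"
  then have B: "\<beta> \<in> NC N" "{k, k+1} \<in> \<beta>" and ab: "dyck_above N \<beta> \<alpha>" by (auto simp: peaks_def)
  note S = dyck_path_Suc[OF NC_matching[OF A], of "k - 1"] dyck_path_Suc[OF NC_matching[OF A], of k]
  have np: "\<not> (k \<in> lefts \<alpha> \<and> k + 1 \<notin> lefts \<alpha>)" using peak_iff[OF A k] n by simp
  have le: "dyck_path \<alpha> (k - 1) \<le> dyck_path \<beta> (k - 1)" "dyck_path \<alpha> (k + 1) \<le> dyck_path \<beta> (k - 1)"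
    "dyck_path \<alpha> k \<le> dyck_path \<beta> k"
    using ab k peak_heights[OF B(1) k B(2)] unfolding dyck_above_def by (metis less_imp_le_nat le_trans diff_le_self Suc_eq_plus1 Suc_leI)+
  have nn: "0 \<le> dyck_path \<alpha> (k - 1)" "0 \<le> dyck_path \<alpha> k" "0 \<le> dyck_path \<alpha> (k + 1)"
    using dyck_path_nonneg[OF NC_matching[OF A]] k by auto
  have hb: "dyck_path \<beta> k = dyck_path \<beta> (k - 1) + 1" using peak_heights[OF B(1) k B(2)] by simp
  have 1: "dyck_path \<alpha> k + 2 \<le> dyck_path \<beta> k" using S np le k hb by (auto split: if_splits)
  then have 2: "0 < dyck_path \<beta> (k - 1)" using nn hb by linarith
  show "\<beta> \<in> flip_up N k ` valleys \<alpha>" by (rule peak_not_flip[OF A b 2 1])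
qed (use flip_up_peaks[OF A] in auto)

lemma swapped_swapped: "swapped k (swapped k K) = K"
  by (simp add: swapped_def[abs_def])

text \<open>The valley and peak terms are exchanged in pairs.\<close>

lemma Zp_swapped:
  assumes A: "\<alpha> \<in> NC N" and n: "{k, k+1} \<notin> \<alpha>"
  shows "Zp N \<alpha> (swapped k K) = - Zp N \<alpha> K"
proof -
  let ?c = "\<lambda>\<beta>. real (ctil N \<alpha> \<beta>)"
  have V: "\<beta> \<in> NC N \<and> k \<notin> lefts \<beta> \<and> k + 1 \<in> lefts \<beta> \<and> dyck_above N \<beta> \<alpha>" if "\<beta> \<in> valleys \<alpha>" for \<beta>
    using that by (auto simp: valleys_def)
  have c: "?c (flip_up N k \<beta>) = ?c \<beta>" if "\<beta> \<in> valleys \<alpha>" for \<beta>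
    using ctil_flip_eq[OF A _ k _ _ _ n, of \<beta>] V[OF that] by simp
  have d: "ndet \<beta> (swapped k K) = - ndet (flip_up N k \<beta>) K" if "\<beta> \<in> valleys \<alpha>" for \<beta> K
    using ndet_swapped_valley[OF _ k, of \<beta>] V[OF that] by simp
  have d': "ndet (flip_up N k \<beta>) (swapped k K) = - ndet \<beta> K" if "\<beta> \<in> valleys \<alpha>" for \<beta>
    using d[OF that, of "swapped k K"] by (simp add: swapped_swapped)
  have P: "(\<Sum>\<beta>\<in>peaks \<alpha>. f \<beta>) = (\<Sum>\<beta>\<in>valleys \<alpha>. f (flip_up N k \<beta>))" for f :: "nat set set \<Rightarrow> real"
    unfolding flip_up_onto[OF A n, symmetric] by (rule sum.reindex_cong[OF flip_up_inj refl refl])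
  have "Zp N \<alpha> (swapped k K) = (\<Sum>\<beta>\<in>valleys \<alpha>. ?c \<beta> * - ndet (flip_up N k \<beta>) K)
      + (\<Sum>\<beta>\<in>valleys \<alpha>. ?c \<beta> * - ndet \<beta> K) + (\<Sum>\<beta>\<in>slopes \<alpha>. ?c \<beta> * - ndet \<beta> K)"
    unfolding Zp_def sum_above_split P
    by (intro arg_cong2[where f="(+)"] sum.cong refl) (simp_all add: d d' c ndet_slopes)
  moreover have "Zp N \<alpha> K = (\<Sum>\<beta>\<in>valleys \<alpha>. ?c \<beta> * ndet \<beta> K)
      + (\<Sum>\<beta>\<in>valleys \<alpha>. ?c \<beta> * ndet (flip_up N k \<beta>) K) + (\<Sum>\<beta>\<in>slopes \<alpha>. ?c \<beta> * ndet \<beta> K)"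
    unfolding Zp_def sum_above_split P
    by (intro arg_cong2[where f="(+)"] sum.cong refl) (simp_all add: c)
  ultimately show ?thesis by (simp add: sum_negf)
qed

lemma dyck_above_rem:
  assumes A: "\<alpha> \<in> NC N" and B: "\<beta> \<in> NC N" and kA: "{k, k+1} \<in> \<alpha>" and kB: "{k, k+1} \<in> \<beta>"
  shows "dyck_above (N - 1) (rem k 1 \<beta>) (rem k 1 \<alpha>) \<longleftrightarrow> dyck_above N \<beta> \<alpha>"
proof
  assume h: "dyck_above (N - 1) (rem k 1 \<beta>) (rem k 1 \<alpha>)"
  have *: "dyck_path \<alpha> (if j < k then j else j + 2) \<le> dyck_path \<beta> (if j < k then j else j + 2)" if "j \<le> 2*(N-1)" for j
    using h that unfolding dyck_above_def rem1_dyck_path[OF A k kA that, symmetric] rem1_dyck_path[OF B k kB that, symmetric]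
    by blast
  have k1: "dyck_path \<alpha> (k - 1) \<le> dyck_path \<beta> (k - 1)" using *[of "k - 1"] k by auto
  show "dyck_above N \<beta> \<alpha>"
    unfolding dyck_above_def
  proof (intro allI impI)
    fix j assume j: "j \<le> 2*N"
    consider "j < k" | "j = k" | "j = k + 1" | "k + 2 \<le> j" by linarith
    then show "dyck_path \<alpha> j \<le> dyck_path \<beta> j"
    proof cases
      case 1
      then show ?thesis using *[of j] k by auto
    next
      case 2
      then show ?thesis using k1 peak_heights[OF A k kA] peak_heights[OF B k kB] by simp
    next
      case 3
      then show ?thesis using k1 peak_heights[OF A k kA] peak_heights[OF B k kB] by simp
    next
      case 4
      then have "\<not> j - 2 < k" "j - 2 + 2 = j" "j - 2 \<le> 2*(N-1)" using j by auto
      then show ?thesis using *[of "j - 2"] by simp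
    qed
  qed
next
  assume h: "dyck_above N \<beta> \<alpha>"
  show "dyck_above (N - 1) (rem k 1 \<beta>) (rem k 1 \<alpha>)"
    unfolding dyck_above_def
  proof (intro allI impI)
    fix j assume j: "j \<le> 2*(N-1)"
    have "(if j < k then j else j + 2) \<le> 2*N" using j k by auto
    then show "dyck_path (rem k 1 \<alpha>) j \<le> dyck_path (rem k 1 \<beta>) j"
      using h rem1_dyck_path[OF A k kA j] rem1_dyck_path[OF B k kB j] unfolding dyck_above_def by metis
  qed
qed

lemma bij_betw_rem:
  assumes A: "\<alpha> \<in> NC N" and kA: "{k, k+1} \<in> \<alpha>"
  shows "bij_betw (rem k 1) (peaks \<alpha>) (above (N - 1) (rem k 1 \<alpha>))"
  unfolding bij_betw_def
proof
  show "inj_on (rem k 1) (peaks \<alpha>)"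
    using rem1_inj[OF _ _ k] by (auto simp: inj_on_def peaks_def)
  show "rem k 1 ` peaks \<alpha> = above (N - 1) (rem k 1 \<alpha>)"
  proof (intro equalityI subsetI)
    fix \<gamma> assume "\<gamma> \<in> above (N - 1) (rem k 1 \<alpha>)"
    then have G: "\<gamma> \<in> NC (N - 1)" and ab: "dyck_above (N - 1) \<gamma> (rem k 1 \<alpha>)" by auto
    obtain \<beta> where b: "\<beta> \<in> NC N" "{k, k+1} \<in> \<beta>" "rem k 1 \<beta> = \<gamma>" using rem1_surj[OF G k] by blast
    then have "dyck_above N \<beta> \<alpha>" using dyck_above_rem[OF A b(1) kA b(2)] ab by simp
    then show "\<gamma> \<in> rem k 1 ` peaks \<alpha>" using b unfolding peaks_def by blast
  next
    fix \<gamma> assume "\<gamma> \<in> rem k 1 ` peaks \<alpha>"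
    then obtain \<beta> where b: "\<beta> \<in> NC N" "{k, k+1} \<in> \<beta>" "dyck_above N \<beta> \<alpha>" "\<gamma> = rem k 1 \<beta>" unfolding peaks_def by blast
    then show "\<gamma> \<in> above (N - 1) (rem k 1 \<alpha>)"
      using rem1_NC[OF b(1) k b(2)] dyck_above_rem[OF A b(1) kA b(2)] by simp
  qed
qed

text \<open>When the rows of \<open>k\<close> and \<open>k + 1\<close> agree, slopes vanish and a valley cancels against a part of
  the peak above it.\<close>

lemma Zp_twin_adjacent:
  assumes A: "\<alpha> \<in> NC N" and kA: "{k, k+1} \<in> \<alpha>"
    and sym: "\<And>a b. K a b = K b a"
    and tw: "\<And>b. b \<in> {1..2*N} - {k, k+1} \<Longrightarrow> K k b = K (k+1) b"
    and nz: "K k (k+1) \<noteq> 0"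
  shows "Zp N \<alpha> K = K k (k+1) * Zp (N - 1) (rem k 1 \<alpha>)
    (\<lambda>a b. K (up k 1 a) (up k 1 b) - K (up k 1 a) k * K k (up k 1 b) / K k (k+1))"
proof -
  let ?c = "\<lambda>\<beta>. real (ctil N \<alpha> \<beta>)"
  let ?d = "\<lambda>\<beta>. real (ctil (N - 1) (rem k 1 \<alpha>) (rem k 1 \<beta>))"
  let ?K = "\<lambda>a b. K (up k 1 a) (up k 1 b) - K (up k 1 a) k * K k (up k 1 b) / K k (k+1)"
  \<comment> \<open>Twin rows make the exchange of \<open>k\<close> and \<open>k + 1\<close>
    invisible to the determinants.\<close>
  have sw: "ndet \<beta> (swapped k K) = ndet \<beta> K" if "\<beta> \<in> NC N" for \<beta>
  proof (rule ndet_cong[OF NC_matching[OF that]])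
    fix a b assume ab: "a \<in> {1..2*N}" "b \<in> {1..2*N}" "a \<noteq> b"
    consider "a = k" "b = k + 1" | "a = k + 1" "b = k" | "a = k" "b \<notin> {k, k+1}" | "a = k + 1" "b \<notin> {k, k+1}"
      | "b = k" "a \<notin> {k, k+1}" | "b = k + 1" "a \<notin> {k, k+1}" | "a \<notin> {k, k+1}" "b \<notin> {k, k+1}" using ab by blast
    then show "swapped k K a b = K a b"
      by cases (use ab sym tw[of a] tw[of b] in \<open>auto simp: swapped_def\<close>)
  qed
  have s0: "ndet \<beta> K = 0" if "\<beta> \<in> slopes \<alpha>" for \<beta>
    using ndet_slopes[OF that, of K] sw[of \<beta>] that by (simp add: slopes_def)
  have V: "\<beta> \<in> NC N \<and> k \<notin> lefts \<beta> \<and> k + 1 \<in> lefts \<beta> \<and> dyck_above N \<beta> \<alpha>" if "\<beta> \<in> valleys \<alpha>" for \<beta>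
    using that by (auto simp: valleys_def)
  have d: "ndet \<beta> K = - ndet (flip_up N k \<beta>) K" if "\<beta> \<in> valleys \<alpha>" for \<beta>
    using ndet_swapped_valley[OF _ k, of \<beta>] sw[of \<beta>] V[OF that] by simp
  let ?F = "flip_up N k ` valleys \<alpha>"
  have fP: "finite (peaks \<alpha>)" by (auto intro!: finite_subset[OF _ finite_above[of N \<alpha>]] simp: peaks_def)
  have FP: "?F \<subseteq> peaks \<alpha>" using flip_up_peaks[OF A] by auto
  have cF: "(?c (flip_up N k \<beta>) - ?c \<beta>) = ?d (flip_up N k \<beta>)" if "\<beta> \<in> valleys \<alpha>" for \<beta>
    using ctil_flip_rem[OF A _ k kA, of \<beta>] V[OF that] by simp
  \<comment> \<open>A peak that is no flipped valley agrees with \<alpha> at \<open>k\<close>, and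
    its count is that of the reduced pair. For a flipped valley the difference of two counts plays
    this role.\<close>
  have cN: "?c \<beta> = ?d \<beta>" if b: "\<beta> \<in> peaks \<alpha> - ?F" for \<beta>
  proof -
    have B: "\<beta> \<in> NC N" "{k, k+1} \<in> \<beta>" and ab: "dyck_above N \<beta> \<alpha>" using b by (auto simp: peaks_def)
    have le: "dyck_path \<alpha> k \<le> dyck_path \<beta> k" using ab k by (simp add: dyck_above_def)
    have nn: "0 \<le> dyck_path \<alpha> (k - 1)" using dyck_path_nonneg[OF NC_matching[OF A], of "k - 1"] k by simp
    have "\<not> dyck_path \<alpha> k + 2 \<le> dyck_path \<beta> k"
    proof
      assume h: "dyck_path \<alpha> k + 2 \<le> dyck_path \<beta> k"
      then have "0 < dyck_path \<beta> (k - 1)" using nn peak_heights[OF A k kA] peak_heights[OF B(1) k B(2)] by linarith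
      then show False using peak_not_flip[OF A _ _ h] b by blast
    qed
    moreover have "even (dyck_path \<beta> k - dyck_path \<alpha> k)"
      using NC_parity[OF A, of k] NC_parity[OF B(1), of k] by presburger
    ultimately have "dyck_path \<beta> k = dyck_path \<alpha> k" using le by presburger
    then show ?thesis using ctil_rem[OF A B(1) k kA B(2)] by simp
  qed
  have "Zp N \<alpha> K = (\<Sum>\<beta>\<in>valleys \<alpha>. ?c \<beta> * ndet \<beta> K) + (\<Sum>\<beta>\<in>peaks \<alpha>. ?c \<beta> * ndet \<beta> K)"
    unfolding Zp_def sum_above_split using s0 by simp
  also have "(\<Sum>\<beta>\<in>peaks \<alpha>. ?c \<beta> * ndet \<beta> K) = (\<Sum>\<beta>\<in>peaks \<alpha> - ?F. ?c \<beta> * ndet \<beta> K) + (\<Sum>\<beta>\<in>?F. ?c \<beta> * ndet \<beta> K)"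
    by (rule sum.subset_diff[OF FP fP])
  also have "(\<Sum>\<beta>\<in>?F. ?c \<beta> * ndet \<beta> K) = (\<Sum>\<beta>\<in>valleys \<alpha>. ?c (flip_up N k \<beta>) * ndet (flip_up N k \<beta>) K)"
    by (rule sum.reindex_cong[OF flip_up_inj refl refl])
  also have "(\<Sum>\<beta>\<in>valleys \<alpha>. ?c \<beta> * ndet \<beta> K) + ((\<Sum>\<beta>\<in>peaks \<alpha> - ?F. ?c \<beta> * ndet \<beta> K) + \<dots>)
    = (\<Sum>\<beta>\<in>peaks \<alpha> - ?F. ?c \<beta> * ndet \<beta> K)
      + (\<Sum>\<beta>\<in>valleys \<alpha>. (?c (flip_up N k \<beta>) - ?c \<beta>) * ndet (flip_up N k \<beta>) K)"
    by (simp add: d sum.distrib[symmetric] algebra_simps)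
  also have "(\<Sum>\<beta>\<in>valleys \<alpha>. (?c (flip_up N k \<beta>) - ?c \<beta>) * ndet (flip_up N k \<beta>) K)
      = (\<Sum>\<beta>\<in>valleys \<alpha>. ?d (flip_up N k \<beta>) * ndet (flip_up N k \<beta>) K)"
    by (rule sum.cong[OF refl]) (simp only: cF)
  also have "\<dots> = (\<Sum>\<beta>\<in>?F. ?d \<beta> * ndet \<beta> K)"
    by (rule sum.reindex_cong[OF flip_up_inj refl refl, symmetric])
  also have "(\<Sum>\<beta>\<in>peaks \<alpha> - ?F. ?c \<beta> * ndet \<beta> K) = (\<Sum>\<beta>\<in>peaks \<alpha> - ?F. ?d \<beta> * ndet \<beta> K)"
    by (rule sum.cong[OF refl]) (simp only: cN)
  also have "\<dots> + (\<Sum>\<beta>\<in>?F. ?d \<beta> * ndet \<beta> K) = (\<Sum>\<beta>\<in>peaks \<alpha>. ?d \<beta> * ndet \<beta> K)"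
    by (rule sum.subset_diff[OF FP fP, symmetric])
  also have "\<dots> = (\<Sum>\<beta>\<in>peaks \<alpha>. K k (k+1) * (?d \<beta> * ndet (rem k 1 \<beta>) ?K))"
  proof (rule sum.cong[OF refl])
    fix \<beta> assume "\<beta> \<in> peaks \<alpha>"
    then have "ndet \<beta> K = K k (k+1) * ndet (rem k 1 \<beta>) ?K"
      by (intro ndet_peak[OF _ k]) (use sym tw nz in \<open>auto simp: peaks_def\<close>)
    then show "?d \<beta> * ndet \<beta> K = K k (k+1) * (?d \<beta> * ndet (rem k 1 \<beta>) ?K)" by simp
  qed
  also have "\<dots> = K k (k+1) * Zp (N - 1) (rem k 1 \<alpha>) ?K"
    unfolding Zp_def sum_distrib_left[symmetric]
    by (subst sum.reindex_bij_betw[OF bij_betw_rem[OF A kA], symmetric]) simp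
  finally show ?thesis .
qed

end

lemma tendsto_Zp:
  assumes "\<And>a b. a \<in> {1..2*N} \<Longrightarrow> b \<in> {1..2*N} \<Longrightarrow> a \<noteq> b \<Longrightarrow> ((\<lambda>x. K x a b) \<longlongrightarrow> L a b) F"
  shows "((\<lambda>x. Zp N \<alpha> (K x)) \<longlongrightarrow> Zp N \<alpha> L) F"
  unfolding Zp_def ndet_def gdet_def
proof (intro tendsto_sum tendsto_mult tendsto_const tendsto_prod)
  fix \<beta> \<sigma> a assume b: "\<beta> \<in> above N \<alpha>" and s: "\<sigma> \<in> {\<sigma>. \<sigma> permutes lefts \<beta>}" and a: "a \<in> lefts \<beta>"
  have M: "matching N \<beta>" using b NC_matching by blast
  have "\<sigma> a \<in> lefts \<beta>" using s a permutes_in_image by fastforce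
  then have "mate \<beta> (\<sigma> a) \<in> {1..2*N} - lefts \<beta>" using mate_lefts[OF M] by blast
  then show "((\<lambda>x. K x a (mate \<beta> (\<sigma> a))) \<longlongrightarrow> L a (mate \<beta> (\<sigma> a))) F"
    using assms[of a "mate \<beta> (\<sigma> a)"] lefts_sub[OF M a] a by (cases "a = mate \<beta> (\<sigma> a)") auto
qed

lemma Zp_zero_row:
  assumes c: "c \<in> {1..2*N}" and z: "\<And>b. b \<in> {1..2*N} \<Longrightarrow> b \<noteq> c \<Longrightarrow> K c b = 0 \<and> K b c = 0"
  shows "Zp N \<alpha> K = 0"
proof -
  have "ndet \<beta> K = 0" if B: "\<beta> \<in> NC N" for \<beta>
  proof -
    note M = NC_matching[OF B]
    have "(\<Prod>a\<in>lefts \<beta>. K a (mate \<beta> (\<sigma> a))) = 0" if s: "\<sigma> permutes lefts \<beta>" for \<sigma>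
    proof (cases "c \<in> lefts \<beta>")
      case True
      have "\<sigma> c \<in> lefts \<beta>" using s True by (simp add: permutes_in_image)
      then have "mate \<beta> (\<sigma> c) \<in> {1..2*N} - lefts \<beta>" using mate_lefts[OF M] by blast
      then have "K c (mate \<beta> (\<sigma> c)) = 0" using z[of "mate \<beta> (\<sigma> c)"] True by (cases "mate \<beta> (\<sigma> c) = c") auto
      then show ?thesis using True finite_lefts[OF M] by (auto intro!: prod_zero)
    next
      case False
      then obtain a0 where a0: "a0 \<in> lefts \<beta>" "mate \<beta> a0 = c" using mate_lefts[OF M] c by (metis DiffI imageE)
      obtain a where a: "a \<in> lefts \<beta>" "\<sigma> a = a0" using s a0 permutes_image[OF s] by (metis imageE)
      have "a \<noteq> c" using a False by auto
      then have "K a (mate \<beta> (\<sigma> a)) = 0" using z[of a] lefts_sub[OF M a(1)] a a0 by auto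
      then show ?thesis using a finite_lefts[OF M] by (auto intro!: prod_zero)
    qed
    then show ?thesis unfolding ndet_def gdet_def by (intro sum.neutral) auto
  qed
  then show ?thesis unfolding Zp_def by (intro sum.neutral) auto
qed

subsection \<open>Multilinear expansion\<close>

lemma prod_sum_pairs:
  fixes F :: "'a \<Rightarrow> 'w \<Rightarrow> 'w \<Rightarrow> real"
  assumes "finite L" "inj_on r L" "L \<inter> r ` L = {}" "\<And>a. a \<in> L \<union> r ` L \<Longrightarrow> finite (W a)"
  shows "(\<Prod>a\<in>L. \<Sum>w\<in>W a. \<Sum>w'\<in>W (r a). F a w w') = (\<Sum>w\<in>PiE (L \<union> r ` L) W. \<Prod>a\<in>L. F a (w a) (w (r a)))"
proof -
  let ?i = "\<lambda>w. \<lambda>a\<in>L. (w a, w (r a))"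
  let ?j = "\<lambda>g. \<lambda>c\<in>L \<union> r ` L. if c \<in> L then fst (g c) else snd (g (inv_into L r c))"
  have "(\<Prod>a\<in>L. \<Sum>w\<in>W a. \<Sum>w'\<in>W (r a). F a w w') = (\<Prod>a\<in>L. \<Sum>p\<in>W a \<times> W (r a). F a (fst p) (snd p))"
    by (simp add: sum.cartesian_product case_prod_beta)
  also have "\<dots> = (\<Sum>g\<in>PiE L (\<lambda>a. W a \<times> W (r a)). \<Prod>a\<in>L. F a (fst (g a)) (snd (g a)))"
    by (rule prod_sum_PiE) (use assms in auto)
  also have "\<dots> = (\<Sum>w\<in>PiE (L \<union> r ` L) W. \<Prod>a\<in>L. F a (w a) (w (r a)))"
  proof (rule sum.reindex_bij_witness[where i="?i" and j="?j"])
    fix g assume g: "g \<in> PiE L (\<lambda>a. W a \<times> W (r a))"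
    have rn: "r a \<notin> L" if "a \<in> L" for a using that assms(3) by auto
    show "?i (?j g) = g"
    proof
      fix a
      show "?i (?j g) a = g a"
        using g rn[of a] assms(2) by (cases "a \<in> L") (auto simp: PiE_def extensional_def)
    qed
    show "?j g \<in> PiE (L \<union> r ` L) W"
      using g assms(2) rn by (auto simp: PiE_def Pi_def extensional_def mem_Times_iff)
    show "(\<Prod>a\<in>L. F a (?j g a) (?j g (r a))) = (\<Prod>a\<in>L. F a (fst (g a)) (snd (g a)))"
      by (rule prod.cong) (use rn assms(2) in auto)
  next
    fix w assume w: "w \<in> PiE (L \<union> r ` L) W"
    show "?j (?i w) = w"
    proof
      fix c
      show "?j (?i w) c = w c"
        using w assms(2) by (cases "c \<in> L"; cases "c \<in> r ` L") (auto simp: PiE_def extensional_def)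
    qed
    show "?i w \<in> PiE L (\<lambda>a. W a \<times> W (r a))"
      using w by (auto simp: PiE_def Pi_def)
  qed
  finally show ?thesis .
qed

text \<open>In every term of every determinant each index occurs exactly once, as a row or as a
  column. Hence \<open>Zp\<close> is linear in each index, although \<beta> decides which role the
  index plays; a labelling \<open>w\<close> chooses one summand per index.\<close>

lemma Zp_expand:
  assumes fin: "\<And>a. a \<in> {1..2*N} \<Longrightarrow> finite (W a)"
    and K: "\<And>a b. a \<in> {1..2*N} \<Longrightarrow> b \<in> {1..2*N} \<Longrightarrow> a \<noteq> b \<Longrightarrow>
      K a b = (\<Sum>w\<in>W a. \<Sum>w'\<in>W b. X a w * X b w' * H w w')"
  shows "Zp N \<alpha> K = (\<Sum>w\<in>PiE {1..2*N} W. (\<Prod>c\<in>{1..2*N}. X c (w c)) * Zp N \<alpha> (\<lambda>a b. H (w a) (w b)))"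
proof -
  have nd: "ndet \<beta> K = (\<Sum>w\<in>PiE {1..2*N} W. (\<Prod>c\<in>{1..2*N}. X c (w c)) * ndet \<beta> (\<lambda>a b. H (w a) (w b)))"
    if B: "\<beta> \<in> NC N" for \<beta>
  proof -
    note M = NC_matching[OF B]
    let ?L = "lefts \<beta>"
    have *: "(\<Prod>a\<in>?L. K a (mate \<beta> (\<sigma> a))) = (\<Sum>w\<in>PiE {1..2*N} W. (\<Prod>c\<in>{1..2*N}. X c (w c)) *
        (\<Prod>a\<in>?L. H (w a) (w (mate \<beta> (\<sigma> a)))))" if s: "\<sigma> permutes ?L" for \<sigma>
    proof -
      let ?r = "\<lambda>a. mate \<beta> (\<sigma> a)"
      have im: "?r ` ?L = {1..2*N} - ?L"
        using mate_lefts[OF M] permutes_image[OF s] by (simp add: image_image[symmetric, of "mate \<beta>" \<sigma>])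
      have inj: "inj_on ?r ?L"
      proof (rule inj_onI)
        fix x y assume xy: "x \<in> ?L" "y \<in> ?L" "?r x = ?r y"
        have "\<sigma> x \<in> ?L" "\<sigma> y \<in> ?L" using s xy by (simp_all add: permutes_in_image)
        then have "\<sigma> x = \<sigma> y" using xy(3) mate_inj[OF M] lefts_sub[OF M] by (metis inj_onD)
        then show "x = y" using permutes_inj[OF s] by (metis injD)
      qed
      have un: "?L \<union> ?r ` ?L = {1..2*N}" unfolding im using lefts_sub[OF M] by auto
      have dj: "?L \<inter> ?r ` ?L = {}" unfolding im by auto
      have "(\<Prod>a\<in>?L. K a (?r a)) = (\<Prod>a\<in>?L. \<Sum>w\<in>W a. \<Sum>w'\<in>W (?r a). X a w * X (?r a) w' * H w w')"
      proof (rule prod.cong[OF refl])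
        fix a assume a: "a \<in> ?L"
        then have "?r a \<in> {1..2*N} - ?L" using im by blast
        then show "K a (?r a) = (\<Sum>w\<in>W a. \<Sum>w'\<in>W (?r a). X a w * X (?r a) w' * H w w')"
          using a lefts_sub[OF M a] by (intro K) auto
      qed
      also have "\<dots> = (\<Sum>w\<in>PiE (?L \<union> ?r ` ?L) W. \<Prod>a\<in>?L. X a (w a) * X (?r a) (w (?r a)) * H (w a) (w (?r a)))"
        by (rule prod_sum_pairs) (use finite_lefts[OF M] inj dj fin un in auto)
      also have "\<dots> = (\<Sum>w\<in>PiE {1..2*N} W. (\<Prod>c\<in>{1..2*N}. X c (w c)) * (\<Prod>a\<in>?L. H (w a) (w (?r a))))"
      proof (rule sum.cong)
        fix w
        have "(\<Prod>c\<in>{1..2*N}. X c (w c)) = (\<Prod>c\<in>?L. X c (w c)) * (\<Prod>c\<in>?r ` ?L. X c (w c))"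
          unfolding un[symmetric] by (rule prod.union_disjoint) (use finite_lefts[OF M] dj in auto)
        also have "(\<Prod>c\<in>?r ` ?L. X c (w c)) = (\<Prod>a\<in>?L. X (?r a) (w (?r a)))"
          by (rule prod.reindex_cong[OF inj refl refl])
        finally show "(\<Prod>a\<in>?L. X a (w a) * X (?r a) (w (?r a)) * H (w a) (w (?r a))) =
          (\<Prod>c\<in>{1..2*N}. X c (w c)) * (\<Prod>a\<in>?L. H (w a) (w (?r a)))" by (simp add: prod.distrib)
      qed (simp only: un)
      finally show ?thesis .
    qed
    have "ndet \<beta> K = (\<Sum>\<sigma> | \<sigma> permutes ?L. \<Sum>w\<in>PiE {1..2*N} W. (\<Prod>c\<in>{1..2*N}. X c (w c)) *
        (of_int (sign \<sigma>) * (\<Prod>a\<in>?L. H (w a) (w (mate \<beta> (\<sigma> a))))))"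
      unfolding ndet_def gdet_def by (intro sum.cong refl) (simp add: * sum_distrib_left mult.left_commute)
    also have "\<dots> = (\<Sum>w\<in>PiE {1..2*N} W. (\<Prod>c\<in>{1..2*N}. X c (w c)) * ndet \<beta> (\<lambda>a b. H (w a) (w b)))"
      unfolding ndet_def gdet_def sum_distrib_left by (rule sum.swap)
    finally show ?thesis .
  qed
  have "Zp N \<alpha> K = (\<Sum>\<beta>\<in>above N \<alpha>. \<Sum>w\<in>PiE {1..2*N} W. (\<Prod>c\<in>{1..2*N}. X c (w c)) *
      (real (ctil N \<alpha> \<beta>) * ndet \<beta> (\<lambda>a b. H (w a) (w b))))"
    unfolding Zp_def by (intro sum.cong refl) (simp add: nd sum_distrib_left mult.left_commute)
  also have "\<dots> = (\<Sum>w\<in>PiE {1..2*N} W. (\<Prod>c\<in>{1..2*N}. X c (w c)) * Zp N \<alpha> (\<lambda>a b. H (w a) (w b)))"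
    unfolding Zp_def sum_distrib_left by (rule sum.swap)
  finally show ?thesis .
qed

subsection \<open>Alternation in an interval without short links\<close>

definition no_short_links :: "nat set set \<Rightarrow> nat \<Rightarrow> nat \<Rightarrow> bool" where
  "no_short_links \<alpha> lo hi \<longleftrightarrow> (\<forall>i. lo < i \<and> i < hi \<longrightarrow> {i, i+1} \<notin> \<alpha>)"

text \<open>A distant transposition is a conjugate of adjacent ones, each of which acts by the sign
  because the interval contains no short link.\<close>

lemma Zp_transpose:
  assumes A: "\<alpha> \<in> NC N" and hi: "hi \<le> 2*N" and n: "no_short_links \<alpha> lo hi"
    and "lo < a" "a < b" "b \<le> hi"
  shows "Zp N \<alpha> (\<lambda>x y. K (Transposition.transpose a b x) (Transposition.transpose a b y)) = - Zp N \<alpha> K"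
  using assms(4-6)
proof (induction "b - a" arbitrary: b K rule: less_induct)
  case less
  have base: "Zp N \<alpha> (\<lambda>x y. K (Transposition.transpose c (c+1) x) (Transposition.transpose c (c+1) y)) = - Zp N \<alpha> K"
    if "lo < c" "c < hi" for c K
    using Zp_swapped[OF _ _ A, of c K] that n hi by (simp add: no_short_links_def swapped_def[abs_def])
  show ?case
  proof (cases "b = a + 1")
    case True
    then show ?thesis using base[of a K] less.prems by simp
  next
    case False
    define c where "c = b - 1"
    have c: "b = c + 1" "a < c" using False less.prems by (auto simp: c_def)
    let ?t = "Transposition.transpose c (c+1)" and ?u = "Transposition.transpose a c"
    have e: "?t (?u (?t x)) = Transposition.transpose a (c+1) x" for x
      using c(2) by (auto simp: Transposition.transpose_def)
    have "Zp N \<alpha> (\<lambda>x y. K (?t (?u (?t x))) (?t (?u (?t y)))) = - Zp N \<alpha> (\<lambda>x y. K (?t (?u x)) (?t (?u y)))"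
      using base[of c "\<lambda>x y. K (?t (?u x)) (?t (?u y))"] less.prems c by simp
    also have "\<dots> = Zp N \<alpha> (\<lambda>x y. K (?t x) (?t y))"
      using less.hyps[of c "\<lambda>x y. K (?t x) (?t y)"] less.prems c by simp
    also have "\<dots> = - Zp N \<alpha> K" using base[of c K] less.prems c by simp
    finally show ?thesis using c(1) e by simp
  qed
qed

lemma Zp_perm:
  assumes A: "\<alpha> \<in> NC N" and hi: "hi \<le> 2*N" and n: "no_short_links \<alpha> lo hi" and p: "\<pi> permutes {lo<..hi}"
  shows "Zp N \<alpha> (\<lambda>a b. K (\<pi> a) (\<pi> b)) = of_int (sign \<pi>) * Zp N \<alpha> K"
proof -
  have "\<forall>K. Zp N \<alpha> (\<lambda>a b. K (\<pi> a) (\<pi> b)) = of_int (sign \<pi>) * Zp N \<alpha> K"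
    using p finite_greaterThanAtMost
  proof (induction rule: permutes_induct)
    case id
    then show ?case by simp
  next
    case (swap a b p)
    let ?t = "Transposition.transpose a b"
    have P: "permutation p" using swap.hyps(4) permutation_permutes finite_greaterThanAtMost by blast
    have t: "Zp N \<alpha> (\<lambda>x y. K (?t x) (?t y)) = - Zp N \<alpha> K" for K
    proof (cases "a < b")
      case True
      then show ?thesis using Zp_transpose[OF A hi n, of a b K] swap.hyps by auto
    next
      case False
      then have "b < a" using swap.hyps by auto
      then show ?thesis using Zp_transpose[OF A hi n, of b a K] swap.hyps by (auto simp: Transposition.transpose_commute)
    qed
    show ?case
    proof
      fix K
      have "Zp N \<alpha> (\<lambda>x y. K ((?t \<circ> p) x) ((?t \<circ> p) y)) = of_int (sign p) * Zp N \<alpha> (\<lambda>x y. K (?t x) (?t y))"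
        using swap.IH[rule_format, of "\<lambda>x y. K (?t x) (?t y)"] by simp
      then show "Zp N \<alpha> (\<lambda>x y. K ((?t \<circ> p) x) ((?t \<circ> p) y)) = of_int (sign (?t \<circ> p)) * Zp N \<alpha> K"
        using swap.hyps(3) by (simp add: t sign_compose[OF permutation_swap_id P] sign_swap_id)
    qed
  qed
  then show ?thesis by blast
qed

text \<open>Exchanging \<open>p\<close> and \<open>q\<close> leaves the kernel unchanged off the
  diagonal but reverses the sign of \<open>Zp\<close>.\<close>

lemma Zp_twin_zero:
  assumes A: "\<alpha> \<in> NC N" and hi: "hi \<le> 2*N" and n: "no_short_links \<alpha> lo hi"
    and pq: "lo < p" "p < q" "q \<le> hi" and sym: "\<And>a b. K a b = K b a"
    and tw: "\<And>b. b \<in> {1..2*N} - {p, q} \<Longrightarrow> K p b = K q b"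
  shows "Zp N \<alpha> K = 0"
proof -
  let ?t = "Transposition.transpose p q"
  have "Zp N \<alpha> (\<lambda>x y. K (?t x) (?t y)) = Zp N \<alpha> K"
  proof (rule Zp_cong)
    fix a b assume ab: "a \<in> {1..2*N}" "b \<in> {1..2*N}" "a \<noteq> b"
    consider "a = p" "b = q" | "a = q" "b = p" | "a = p" "b \<notin> {p, q}" | "a = q" "b \<notin> {p, q}"
      | "b = p" "a \<notin> {p, q}" | "b = q" "a \<notin> {p, q}" | "a \<notin> {p, q}" "b \<notin> {p, q}" using ab by blast
    then show "K (?t a) (?t b) = K a b"
      by cases (use ab sym tw[of a] tw[of b] in auto)
  qed
  then show ?thesis using Zp_transpose[OF A hi n pq, of K] by simp
qed

subsection \<open>Twin rows in two neighbouring blocks\<close>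

text \<open>For p < q this is the increasing map that leaves out \<open>p\<close> and
  \<open>q\<close>.\<close>

definition skip :: "nat \<Rightarrow> nat \<Rightarrow> nat \<Rightarrow> nat" where
  "skip p q a = (if a < p then a else if a + 1 < q then a + 1 else a + 2)"

definition schur :: "(nat \<Rightarrow> nat \<Rightarrow> real) \<Rightarrow> nat \<Rightarrow> nat \<Rightarrow> nat \<Rightarrow> nat \<Rightarrow> real" where
  "schur K p q a b = K a b - K a p * K p b / K p q"

lemma skip_adjacent: "skip k (k+1) a = up k 1 a"
  by (auto simp: skip_def up_def)

lemma skip_eq_iff: "p < q \<Longrightarrow> skip p q a = skip p q b \<longleftrightarrow> a = b"
  by (auto simp: skip_def)

lemma skip_notin: "p < q \<Longrightarrow> skip p q a \<noteq> p \<and> skip p q a \<noteq> q"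
  by (auto simp: skip_def)

lemma skip_in: "1 \<le> p \<Longrightarrow> p < q \<Longrightarrow> q \<le> 2*N \<Longrightarrow> skip p q a \<in> {1..2*N} \<longleftrightarrow> a \<in> {1..2*(N-1)}"
  by (auto simp: skip_def)

text \<open>Adjacent transpositions move \<open>p\<close> up to \<open>k\<close> and
  \<open>q\<close> down to \<open>k + 1\<close>, each within an interval free of short links and
  each with a sign; then the adjacent case removes the link.\<close>

lemma Zp_twin:
  assumes A: "\<alpha> \<in> NC N" and kA: "{k, k+1} \<in> \<alpha>" and hi: "hi \<le> 2*N"
    and n1: "no_short_links \<alpha> lo k" and n2: "no_short_links \<alpha> k hi"
    and "lo < p" "p \<le> k" "k < q" "q \<le> hi" "\<And>a b. K a b = K b a"
    and "\<And>b. b \<in> {1..2*N} - {p, q} \<Longrightarrow> K p b = K q b" "K p q \<noteq> 0"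
  shows "Zp N \<alpha> K = (-1) ^ ((k - p) + (q - (k+1))) * K p q *
    Zp (N - 1) (rem k 1 \<alpha>) (\<lambda>a b. schur K p q (skip p q a) (skip p q b))"
  using assms(6-)
proof (induction "(k - p) + (q - (k+1))" arbitrary: p q K rule: less_induct)
  case less
  note pr = less.prems
  have k: "1 \<le> k" "k < 2*N" using pr hi by auto
  consider "p < k" | "p = k" "k + 1 < q" | "p = k" "q = k + 1" using pr by linarith
  then show ?case
  proof cases
    case 1
    let ?t = "Transposition.transpose p (p+1)"
    let ?K = "\<lambda>a b. K (?t a) (?t b)"
    have pn: "\<not> p + 1 = q" using 1 pr by auto
    have "Zp N \<alpha> ?K = - Zp N \<alpha> K"
      by (rule Zp_transpose[OF A _ n1]) (use 1 pr k in auto)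
    moreover have "Zp N \<alpha> ?K = (-1) ^ ((k - (p+1)) + (q - (k+1))) * ?K (p+1) q *
      Zp (N - 1) (rem k 1 \<alpha>) (\<lambda>a b. schur ?K (p+1) q (skip (p+1) q a) (skip (p+1) q b))"
    proof (rule less.hyps)
      fix b assume b: "b \<in> {1..2*N} - {p+1, q}"
      have "?t b \<in> {1..2*N} - {p, q}"
        using b pr 1 hi by (cases "b = p") (auto simp: Transposition.transpose_def)
      then have "K p (?t b) = K q (?t b)" by (rule pr(6))
      then show "?K (p+1) b = ?K q b" using pr 1 by simp
    qed (use 1 pr in auto)
    moreover have "?K (p+1) q = K p q" using pr 1 by simp
    moreover have "(-1::real) ^ ((k - p) + (q - (k+1))) = - ((-1) ^ ((k - (p+1)) + (q - (k+1))))"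
    proof -
      have "(k - p) + (q - (k+1)) = Suc ((k - (p+1)) + (q - (k+1)))" using 1 by simp
      then show ?thesis by simp
    qed
    moreover have "schur ?K (p+1) q (skip (p+1) q a) (skip (p+1) q b) = schur K p q (skip p q a) (skip p q b)" for a b
    proof -
      have "?t (skip (p+1) q c) = skip p q c" for c using 1 pr by (auto simp: skip_def Transposition.transpose_def)
      moreover have "?t q = q" "?t (p+1) = p" using 1 pr by auto
      ultimately show ?thesis by (simp add: schur_def)
    qed
    ultimately show ?thesis by simp
  next
    case 2
    let ?t = "Transposition.transpose (q-1) q"
    let ?K = "\<lambda>a b. K (?t a) (?t b)"
    have "Zp N \<alpha> ?K = - Zp N \<alpha> K"
      by (rule Zp_transpose[OF A _ n2]) (use 2 pr hi in auto)
    moreover have "Zp N \<alpha> ?K = (-1) ^ ((k - p) + ((q-1) - (k+1))) * ?K p (q-1) *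
      Zp (N - 1) (rem k 1 \<alpha>) (\<lambda>a b. schur ?K p (q-1) (skip p (q-1) a) (skip p (q-1) b))"
    proof (rule less.hyps)
      fix b assume b: "b \<in> {1..2*N} - {p, q-1}"
      have "?t b \<in> {1..2*N} - {p, q}"
        using b pr 2 hi by (cases "b = q") (auto simp: Transposition.transpose_def)
      then have "K p (?t b) = K q (?t b)" by (rule pr(6))
      then show "?K p b = ?K (q-1) b" using pr 2 by simp
    qed (use 2 pr in auto)
    moreover have "?K p (q-1) = K p q" using pr 2 by simp
    moreover have "(-1::real) ^ ((k - p) + (q - (k+1))) = - ((-1) ^ ((k - p) + ((q-1) - (k+1))))"
    proof -
      have "(k - p) + (q - (k+1)) = Suc ((k - p) + ((q-1) - (k+1)))" using 2 by simp
      then show ?thesis by simp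
    qed
    moreover have "schur ?K p (q-1) (skip p (q-1) a) (skip p (q-1) b) = schur K p q (skip p q a) (skip p q b)" for a b
    proof -
      have "?t (skip p (q-1) c) = skip p q c" for c using 2 pr by (auto simp: skip_def Transposition.transpose_def)
      moreover have "?t p = p" "?t (q-1) = q" using 2 pr by auto
      ultimately show ?thesis by (simp add: schur_def)
    qed
    ultimately show ?thesis by simp
  next
    case 3
    have "Zp N \<alpha> K = K k (k+1) * Zp (N - 1) (rem k 1 \<alpha>)
      (\<lambda>a b. K (up k 1 a) (up k 1 b) - K (up k 1 a) k * K k (up k 1 b) / K k (k+1))"
      by (rule Zp_twin_adjacent[OF k A kA]) (use pr 3 in auto)
    then show ?thesis using 3 skip_adjacent[of k] by (simp add: schur_def)
  qed
qed

text \<open>Only the two fusing blocks are recorded, as adjacent intervals without internal links.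
  Removing a link between them shrinks just these intervals, so the predicate is inductive, which a
  description by all valences would not be as conveniently.\<close>

definition two_blocks :: "nat \<Rightarrow> nat set set \<Rightarrow> nat \<Rightarrow> nat \<Rightarrow> nat \<Rightarrow> bool" where
  "two_blocks N \<alpha> lo k hi \<longleftrightarrow> \<alpha> \<in> NC N \<and> lo \<le> k \<and> k \<le> hi \<and> hi \<le> 2*N \<and>
     (\<forall>a\<in>{lo<..k}. mate \<alpha> a \<notin> {lo<..k}) \<and> (\<forall>a\<in>{k<..hi}. mate \<alpha> a \<notin> {k<..hi})"

definition cross_links :: "nat set set \<Rightarrow> nat \<Rightarrow> nat \<Rightarrow> nat \<Rightarrow> nat" where
  "cross_links \<alpha> lo k hi = card {a \<in> {lo<..k}. mate \<alpha> a \<in> {k<..hi}}"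

lemma two_blocks_short:
  assumes "two_blocks N \<alpha> lo k hi"
  shows "no_short_links \<alpha> lo k" "no_short_links \<alpha> k hi"
proof -
  have M: "matching N \<alpha>" using assms NC_matching by (auto simp: two_blocks_def)
  show "no_short_links \<alpha> lo k" "no_short_links \<alpha> k hi"
    using assms mate_eqI[OF M] unfolding no_short_links_def two_blocks_def by force+
qed

text \<open>Take the link between the blocks with the largest left end. If it did not join
  \<open>k\<close> to \<open>k + 1\<close>, the link of \<open>k\<close> or that of
  \<open>k + 1\<close> would cross it.\<close>

lemma cross_links_pos:
  assumes T: "two_blocks N \<alpha> lo k hi" and x: "0 < cross_links \<alpha> lo k hi"
  shows "{k, k+1} \<in> \<alpha>" "lo < k" "k < hi"
proof -
  have A: "\<alpha> \<in> NC N" and hi: "hi \<le> 2*N" using T by (auto simp: two_blocks_def)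
  note M = NC_matching[OF A]
  let ?S = "{a \<in> {lo<..k}. mate \<alpha> a \<in> {k<..hi}}"
  have S: "finite ?S" "?S \<noteq> {}" using x by (auto simp: cross_links_def card_gt_0_iff)
  define p where "p = Max ?S"
  have pS: "p \<in> ?S" unfolding p_def using Max_in[OF S] .
  have pmax: "a \<le> p" if "a \<in> ?S" for a unfolding p_def using Max_ge[OF S(1) that] .
  define q where "q = mate \<alpha> p"
  have r: "lo < p" "p \<le> k" "k < q" "q \<le> hi" using pS by (auto simp: q_def)
  then show "lo < k" "k < hi" by auto
  have pr: "p \<in> {1..2*N}" using r hi by auto
  have mq: "mate \<alpha> q = p" unfolding q_def by (rule mate_mate[OF M pr])
  have pk: "p = k"
  proof (rule ccontr)
    assume "p \<noteq> k"
    then have pk: "p < k" using r by simp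
    have kr: "k \<in> {1..2*N}" using r hi by auto
    let ?c = "mate \<alpha> k"
    have c: "?c \<notin> {lo<..k}" using T r by (auto simp: two_blocks_def)
    have cq: "?c \<noteq> q" using mq mate_mate[OF M kr] pk by auto
    have "\<not> ?c \<in> {k<..hi}" using pmax[of k] pk r by auto
    then have "?c \<le> lo \<or> hi < ?c" using c by auto
    then show False
    proof
      assume "hi < ?c"
      then show False using NC_not_crossing[OF A pr kr] pk r q_def by auto
    next
      assume l: "?c \<le> lo"
      have "?c \<in> {1..2*N}" by (rule mate_in[OF M kr])
      then show False using NC_not_crossing[OF A _ pr, of ?c] l r pk q_def mate_mate[OF M kr] by auto
    qed
  qed
  have "q = k + 1"
  proof (rule ccontr)
    assume "q \<noteq> k + 1"
    then have q1: "k + 1 < q" using r by simp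
    have kr: "k + 1 \<in> {1..2*N}" using r hi by auto
    let ?c = "mate \<alpha> (k+1)"
    have c: "?c \<notin> {k<..hi}" using T r q1 by (auto simp: two_blocks_def)
    have "?c \<noteq> k" using mate_mate[OF M kr] pk q_def q1 by auto
    then have "?c < k \<or> hi < ?c" using c by auto
    then show False
    proof
      assume "hi < ?c"
      then show False using NC_not_crossing[OF A pr kr] pk r q1 q_def by auto
    next
      assume l: "?c < k"
      have "?c \<in> {1..2*N}" by (rule mate_in[OF M kr])
      then show False using NC_not_crossing[OF A _ pr, of ?c] l pk q1 q_def mate_mate[OF M kr] by auto
    qed
  qed
  then show "{k, k+1} \<in> \<alpha>" using mate_link[OF M pr] pk q_def by simp
qed

lemma no_cross_links_short:
  assumes T: "two_blocks N \<alpha> lo k hi" and x: "cross_links \<alpha> lo k hi = 0 \<or> {k, k+1} \<notin> \<alpha>"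
  shows "no_short_links \<alpha> lo hi"
  unfolding no_short_links_def
proof (intro allI impI)
  fix i assume i: "lo < i \<and> i < hi"
  have M: "matching N \<alpha>" using T NC_matching by (auto simp: two_blocks_def)
  consider "i < k" | "i = k" | "k < i" by linarith
  then show "{i, i+1} \<notin> \<alpha>"
  proof cases
    case 2
    show ?thesis
    proof
      assume h: "{i, i+1} \<in> \<alpha>"
      then have "k \<in> {a \<in> {lo<..k}. mate \<alpha> a \<in> {k<..hi}}" using i 2 mate_eqI[OF M h] by auto
      then have "0 < cross_links \<alpha> lo k hi" unfolding cross_links_def by (subst card_gt_0_iff) auto
      then show False using x h 2 by auto
    qed
  qed (use i two_blocks_short[OF T] in \<open>auto simp: no_short_links_def\<close>)
qed

lemma two_blocks_rem:
  assumes T: "two_blocks N \<alpha> lo k hi" and kk: "{k, k+1} \<in> \<alpha>" and l: "lo < k" "k < hi"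
  shows "two_blocks (N - 1) (rem k 1 \<alpha>) lo (k - 1) (hi - 2)"
    and "cross_links (rem k 1 \<alpha>) lo (k - 1) (hi - 2) + 1 = cross_links \<alpha> lo k hi"
proof -
  have A: "\<alpha> \<in> NC N" and hi: "hi \<le> 2*N" using T by (auto simp: two_blocks_def)
  note M = NC_matching[OF A]
  have k: "1 \<le> k" "k < 2*N" using l hi by auto
  let ?m = "mate (rem k 1 \<alpha>)"
  have m: "up k 1 (?m a) = mate \<alpha> (up k 1 a)" if "a \<in> {1..2*(N-1)}" for a by (rule rem1_mate[OF A k kk that])
  have u1: "a \<in> {lo<..k-1} \<longleftrightarrow> up k 1 a \<in> {lo<..k}" and u2: "a \<in> {k-1<..hi-2} \<longleftrightarrow> up k 1 a \<in> {k<..hi}" for a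
    using l by (auto simp: up_def)
  have r1: "a \<in> {1..2*(N-1)}" if "a \<in> {lo<..k-1} \<or> a \<in> {k-1<..hi-2}" for a
    using that l hi by auto
  have mk: "mate \<alpha> k = k + 1" using mate_eqI[OF M kk] .
  show "two_blocks (N - 1) (rem k 1 \<alpha>) lo (k - 1) (hi - 2)"
    unfolding two_blocks_def
  proof (intro conjI ballI)
    show "rem k 1 \<alpha> \<in> NC (N - 1)" by (rule rem1_NC[OF A k kk])
    show "?m a \<notin> {lo<..k-1}" if a: "a \<in> {lo<..k-1}" for a
      using T a m[OF r1[of a]] unfolding u1 two_blocks_def by auto
    show "?m a \<notin> {k-1<..hi-2}" if a: "a \<in> {k-1<..hi-2}" for a
      using T a m[OF r1[of a]] unfolding u2 two_blocks_def by auto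
  qed (use l hi in auto)
  have "{a \<in> {lo<..k}. mate \<alpha> a \<in> {k<..hi}} = insert k (up k 1 ` {a \<in> {lo<..k-1}. ?m a \<in> {k-1<..hi-2}})"
  proof (intro equalityI subsetI)
    fix x assume x: "x \<in> {a \<in> {lo<..k}. mate \<alpha> a \<in> {k<..hi}}"
    show "x \<in> insert k (up k 1 ` {a \<in> {lo<..k-1}. ?m a \<in> {k-1<..hi-2}})"
    proof (cases "x = k")
      case False
      then have xl: "x \<in> {lo<..k-1}" "up k 1 x = x" using x by (auto simp: up_def)
      then have "?m x \<in> {k-1<..hi-2}" using m[OF r1[of x]] x unfolding u2 by auto
      then show ?thesis using xl by (metis (mono_tags, lifting) imageI insertCI mem_Collect_eq)
    qed simp
  next
    fix x assume "x \<in> insert k (up k 1 ` {a \<in> {lo<..k-1}. ?m a \<in> {k-1<..hi-2}})"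
    then show "x \<in> {a \<in> {lo<..k}. mate \<alpha> a \<in> {k<..hi}}"
    proof
      assume "x = k"
      then show ?thesis using mk l by auto
    next
      assume "x \<in> up k 1 ` {a \<in> {lo<..k-1}. ?m a \<in> {k-1<..hi-2}}"
      then show ?thesis
      proof
        fix a assume a: "x = up k 1 a" "a \<in> {a \<in> {lo<..k-1}. ?m a \<in> {k-1<..hi-2}}"
        then have a': "a \<in> {lo<..k-1}" "?m a \<in> {k-1<..hi-2}" by blast+
        have "up k 1 (?m a) = mate \<alpha> x" using m[OF r1[of a]] a'(1) a(1) by blast
        then show ?thesis using a'(1)[unfolded u1] a'(2)[unfolded u2] a(1) by simp
      qed
    qed
  qed
  moreover have "k \<notin> up k 1 ` {a \<in> {lo<..k-1}. ?m a \<in> {k-1<..hi-2}}" 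
  proof
    assume "k \<in> up k 1 ` {a \<in> {lo<..k-1}. ?m a \<in> {k-1<..hi-2}}"
    then show False by (elim imageE) (use up1_notin(1)[of k] in metis)
  qed
  moreover have "card (up k 1 ` {a \<in> {lo<..k-1}. ?m a \<in> {k-1<..hi-2}}) = card {a \<in> {lo<..k-1}. ?m a \<in> {k-1<..hi-2}}"
    by (rule card_image) (use up_eq_iff in \<open>auto simp: inj_on_def\<close>)
  ultimately show "cross_links (rem k 1 \<alpha>) lo (k - 1) (hi - 2) + 1 = cross_links \<alpha> lo k hi"
    by (simp add: cross_links_def)
qed

lemma rem_rem:
  assumes "n < k"
  shows "rem (k - 1) n (rem k 1 \<alpha>) = rem k (n + 1) \<alpha>"
proof -
  have "up k 1 (up (k - 1) n a) = up k (n + 1) a" for a using assms by (auto simp: up_def)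
  then have "up k 1 ` up (k - 1) n ` l = up k (n + 1) ` l" for l by (simp add: image_image)
  then show ?thesis by (simp add: rem_def)
qed

lemma rem_0: "rem k 0 \<alpha> = \<alpha>"
proof -
  have "up k 0 ` l = l" for l by (auto simp: up_def image_iff)
  then show ?thesis by (simp add: rem_def)
qed

lemma cross_links_le:
  shows "cross_links \<alpha> lo k hi \<le> k - lo"
proof -
  have "card {a \<in> {lo<..k}. mate \<alpha> a \<in> {k<..hi}} \<le> card {lo<..k}" by (rule card_mono) auto
  then show ?thesis by (simp add: cross_links_def)
qed

lemma two_blocks_rem_many:
  assumes "two_blocks N \<alpha> lo k hi" "n \<le> cross_links \<alpha> lo k hi"
  shows "two_blocks (N - n) (rem k n \<alpha>) lo (k - n) (hi - 2*n) \<and> n + lo \<le> k \<and> k + n \<le> hi \<and>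
    cross_links (rem k n \<alpha>) lo (k - n) (hi - 2*n) + n = cross_links \<alpha> lo k hi"
  using assms
proof (induction n arbitrary: N \<alpha> k hi)
  case 0
  then show ?case by (auto simp: rem_0 two_blocks_def)
next
  case (Suc n)
  note kk = cross_links_pos[OF Suc.prems(1)]
  have l: "{k, k+1} \<in> \<alpha>" "lo < k" "k < hi" using kk Suc.prems(2) by auto
  note R = two_blocks_rem[OF Suc.prems(1) l]
  have I: "two_blocks (N - 1 - n) (rem (k - 1) n (rem k 1 \<alpha>)) lo (k - 1 - n) (hi - 2 - 2*n) \<and> n + lo \<le> k - 1 \<and> k - 1 + n \<le> hi - 2 \<and>
    cross_links (rem (k - 1) n (rem k 1 \<alpha>)) lo (k - 1 - n) (hi - 2 - 2*n) + n = cross_links (rem k 1 \<alpha>) lo (k - 1) (hi - 2)"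
    by (rule Suc.IH[OF R(1)]) (use R(2) Suc.prems(2) in auto)
  have e: "N - 1 - n = N - Suc n" "k - 1 - n = k - Suc n" "hi - 2 - 2*n = hi - 2 * Suc n" by auto
  have "n < k" using I l by auto
  have rr: "rem (k - 1) n (rem k 1 \<alpha>) = rem k (Suc n) \<alpha>" using rem_rem[OF \<open>n < k\<close>] by simp
  show ?case using I R(2) l unfolding e rr by auto
qed

text \<open>Each application of \<open>Zp_twin\<close> consumes one twin pair and one link between the two blocks.\<close>

lemma Zp_many_twins:
  assumes "two_blocks N \<alpha> lo k hi"
    and "finite T" "T \<subseteq> {lo<..k} \<times> {k<..hi}" "inj_on fst T" "inj_on snd T"
    and "\<And>a b. K a b = K b a"
    and "\<And>p q b. (p, q) \<in> T \<Longrightarrow> b \<in> {1..2*N} - {p, q} \<Longrightarrow> K p b = K q b"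
    and "\<And>p q. (p, q) \<in> T \<Longrightarrow> K p q \<noteq> 0"
    and "\<And>p q p' q'. (p, q) \<in> T \<Longrightarrow> (p', q') \<in> T \<Longrightarrow> p \<noteq> p' \<Longrightarrow> K p p' = 0"
    and "card T > cross_links \<alpha> lo k hi"
  shows "Zp N \<alpha> K = 0"
  using assms
proof (induction "card T" arbitrary: N \<alpha> k hi T K)
  case 0
  then show ?case by simp
next
  case (Suc n)
  note pr = Suc.prems
  have A: "\<alpha> \<in> NC N" and hi: "hi \<le> 2*N" using pr(1) by (auto simp: two_blocks_def)
  have "T \<noteq> {}" using Suc.hyps(2) by auto
  then obtain p q where pq: "(p, q) \<in> T" by (metis ex_in_conv surj_pair)
  then have r: "lo < p" "p \<le> k" "k < q" "q \<le> hi" using pr(3) by auto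
  then have p1: "1 \<le> p" "p < q" "q \<le> 2*N" using hi by auto
  have tw: "\<And>b. b \<in> {1..2*N} - {p, q} \<Longrightarrow> K p b = K q b" using pr(7)[OF pq] .
  show ?case
  proof (cases "{k, k+1} \<in> \<alpha>")
    \<comment> \<open>Without the link {k, k+1} the union of the two blocks has no short link, so a
      single twin pair already gives zero.\<close>
    case False
    show ?thesis
      by (rule Zp_twin_zero[OF A hi no_cross_links_short[OF pr(1)], of p q]) (use False r tw pr(6) in auto)
  next
    case True
    note R = two_blocks_rem[OF pr(1) True]
    have lk: "lo < k" "k < hi" using r by auto
    let ?s = "skip p q"
    let ?K = "\<lambda>a b. schur K p q (?s a) (?s b)"
    let ?un = "\<lambda>x. if x < p then x else if x < q then x - 1 else x - 2"
    have su: "?s (?un x) = x" if "x \<noteq> p" "x \<noteq> q" for x using that p1 by (auto simp: skip_def)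
    define T' where "T' = {(a, b). (?s a, ?s b) \<in> T - {(p, q)}}"
    have ne: "a \<noteq> p" "b \<noteq> q" "a \<noteq> q" "b \<noteq> p" if "(a, b) \<in> T - {(p, q)}" for a b
    proof -
      show "a \<noteq> p" using inj_onD[OF pr(4), of "(a, b)" "(p, q)"] that pq by auto
      show "b \<noteq> q" using inj_onD[OF pr(5), of "(a, b)" "(p, q)"] that pq by auto
      show "a \<noteq> q" "b \<noteq> p" using that pr(3) r by auto
    qed
    have im: "map_prod ?s ?s ` T' = T - {(p, q)}"
    proof (intro equalityI subsetI)
      fix x assume "x \<in> T - {(p, q)}"
      moreover obtain a b where x: "x = (a, b)" by (cases x)
      ultimately have ab: "(a, b) \<in> T - {(p, q)}" by simp
      have "(?un a, ?un b) \<in> T'" unfolding T'_def using ab su ne[OF ab] by auto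
      moreover have "map_prod ?s ?s (?un a, ?un b) = x" using su ne[OF ab] x by simp
      ultimately show "x \<in> map_prod ?s ?s ` T'" by (metis imageI)
    qed (auto simp: T'_def)
    have inj: "inj_on (map_prod ?s ?s) T'" using skip_eq_iff[OF p1(2)] by (auto simp: inj_on_def)
    have fT': "finite T'" using im inj pr(2) by (metis finite_Diff finite_imageD)
    have cT': "card T' = n"
      using card_image[OF inj] im Suc.hyps(2) pq pr(2) by simp
    have "Zp (N - 1) (rem k 1 \<alpha>) ?K = 0"
    proof (rule Suc.hyps(1)[OF cT'[symmetric] R(1)[OF lk] fT'])
      show "T' \<subseteq> {lo<..k-1} \<times> {k-1<..hi-2}"
      proof clarify
        fix a b assume "(a, b) \<in> T'"
        then have "(?s a, ?s b) \<in> T" by (auto simp: T'_def)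
        then have "lo < ?s a" "?s a \<le> k" "k < ?s b" "?s b \<le> hi" using pr(3) by auto
        then show "a \<in> {lo<..k-1} \<and> b \<in> {k-1<..hi-2}"
          using r by (auto simp: skip_def split: if_splits)
      qed
      show "inj_on fst T'" "inj_on snd T'"
      proof -
        show "inj_on fst T'"
        proof (rule inj_onI)
          fix x y assume xy: "x \<in> T'" "y \<in> T'" "fst x = fst y"
          then have "(?s (fst x), ?s (snd x)) = (?s (fst y), ?s (snd y))"
            by (intro inj_onD[OF pr(4)]) (auto simp: T'_def case_prod_beta)
          then show "x = y" using xy(3) skip_eq_iff[OF p1(2)] by (simp add: prod_eq_iff)
        qed
        show "inj_on snd T'"
        proof (rule inj_onI)
          fix x y assume xy: "x \<in> T'" "y \<in> T'" "snd x = snd y"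
          then have "(?s (fst x), ?s (snd x)) = (?s (fst y), ?s (snd y))"
            by (intro inj_onD[OF pr(5)]) (auto simp: T'_def case_prod_beta)
          then show "x = y" using xy(3) skip_eq_iff[OF p1(2)] by (simp add: prod_eq_iff)
        qed
      qed
      show "?K a b = ?K b a" for a b
        using pr(6)[of "?s a" "?s b"] pr(6)[of "?s a" p] pr(6)[of p "?s b"] by (simp add: schur_def)
      \<comment> \<open>Rows of different twin pairs do not couple, so the Schur correction vanishes
        on the remaining twin rows and all hypotheses pass to the smaller pattern.\<close>
      have z: "K (?s a) p = 0" "K (?s b) p = 0" if ab: "(a, b) \<in> T'" for a b
      proof -
        have h: "(?s a, ?s b) \<in> T" using ab by (auto simp: T'_def)
        have n: "?s a \<noteq> p" "?s b \<noteq> p" using skip_notin[OF p1(2)] by auto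
        show "K (?s a) p = 0" by (rule pr(9)[OF h pq n(1)])
        moreover have "K (?s a) p = K (?s b) p" by (rule pr(7)[OF h]) (use n p1 in auto)
        ultimately show "K (?s b) p = 0" by simp
      qed
      show "?K a b' = ?K b b'" if ab: "(a, b) \<in> T'" and b': "b' \<in> {1..2*(N-1)} - {a, b}" for a b b'
      proof -
        have h: "(?s a, ?s b) \<in> T" using ab by (auto simp: T'_def)
        have "?s b' \<in> {1..2*N} - {?s a, ?s b}" using b' skip_in[OF p1, of b'] skip_eq_iff[OF p1(2)] by auto
        then have "K (?s a) (?s b') = K (?s b) (?s b')" by (rule pr(7)[OF h])
        then show ?thesis using z[OF ab] by (simp add: schur_def)
      qed
      show "?K a b \<noteq> 0" if ab: "(a, b) \<in> T'" for a b
        using z[OF ab] pr(8)[of "?s a" "?s b"] ab by (auto simp: schur_def T'_def)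
      show "?K a a' = 0" if ab: "(a, b) \<in> T'" "(a', b') \<in> T'" "a \<noteq> a'" for a b a' b'
        using z[OF ab(1)] pr(9)[of "?s a" "?s b" "?s a'" "?s b'"] ab skip_eq_iff[OF p1(2)] by (auto simp: schur_def T'_def)
      show "card T' > cross_links (rem k 1 \<alpha>) lo (k-1) (hi-2)"
        using R(2)[OF lk] pr(10) Suc.hyps(2) cT' by simp
    qed
    then show ?thesis
      using Zp_twin[OF A True hi two_blocks_short[OF pr(1)] r pr(6) tw pr(8)[OF pq]] by simp
  qed
qed

text \<open>A small perturbation of the diagonal entries of the twin pairs.\<close>

lemma Zp_many_twins_zero:
  assumes B: "two_blocks N \<alpha> lo k hi"
    and T: "finite T" "T \<subseteq> {lo<..k} \<times> {k<..hi}" "inj_on fst T" "inj_on snd T"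
    and sym: "\<And>a b. K a b = K b a"
    and tw: "\<And>p q b. (p, q) \<in> T \<Longrightarrow> b \<in> {1..2*N} - {p, q} \<Longrightarrow> K p b = K q b"
    and z: "\<And>a b. a \<in> {lo<..hi} \<Longrightarrow> b \<in> {lo<..hi} \<Longrightarrow> K a b = 0"
    and c: "card T > cross_links \<alpha> lo k hi"
  shows "Zp N \<alpha> K = 0"
proof -
  define K' where "K' e a b = K a b + (if (a, b) \<in> T \<or> (b, a) \<in> T then e else 0)" for e :: real and a b
  have kk: "lo \<le> k" "k \<le> hi" using B by (auto simp: two_blocks_def)
  have TP: "p \<in> {lo<..hi}" "q \<in> {lo<..hi}" "lo < p" "p \<le> k" "k < q" "q \<le> hi" if "(p, q) \<in> T" for p q
    using T(2) that kk by auto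
  have f1: "q = q'" if "(p, q) \<in> T" "(p, q') \<in> T" for p q q' using inj_onD[OF T(3) _ that] by simp
  have f2: "p = p'" if "(p, q) \<in> T" "(p', q) \<in> T" for p p' q using inj_onD[OF T(4) _ that] by simp
  have zero: "Zp N \<alpha> (K' e) = 0" if "e \<noteq> 0" for e
  proof (rule Zp_many_twins[OF B T])
    show "K' e a b = K' e b a" for a b using sym[of a b] by (auto simp: K'_def)
    show "K' e p b = K' e q b" if pq: "(p, q) \<in> T" and b: "b \<in> {1..2*N} - {p, q}" for p q b
    proof -
      have "(p, b) \<notin> T" "(b, p) \<notin> T" "(q, b) \<notin> T" "(b, q) \<notin> T"
        using f1[OF pq, of b] f2[OF pq, of b] TP[OF pq] TP[of b p] TP[of q b] b by auto
      then show ?thesis using tw[OF pq b] by (simp add: K'_def)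
    qed
    show "K' e p q \<noteq> 0" if "(p, q) \<in> T" for p q using z TP[OF that] that \<open>e \<noteq> 0\<close> by (auto simp: K'_def)
    show "K' e p p' = 0" if "(p, q) \<in> T" "(p', q') \<in> T" "p \<noteq> p'" for p q p' q'
    proof -
      have "(p, p') \<notin> T" "(p', p) \<notin> T" using TP[OF that(1)] TP[OF that(2)] TP[of p p'] TP[of p' p] by auto
      then show ?thesis using z TP[OF that(1)] TP[OF that(2)] by (auto simp: K'_def)
    qed
  qed (rule c)
  have "((\<lambda>e. Zp N \<alpha> (K' e)) \<longlongrightarrow> Zp N \<alpha> K) (at 0)"
  proof (rule tendsto_Zp)
    fix a b
    show "((\<lambda>e. K' e a b) \<longlongrightarrow> K a b) (at 0)"
    proof (cases "(a, b) \<in> T \<or> (b, a) \<in> T")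
      case True
      then show ?thesis unfolding K'_def using tendsto_add[OF tendsto_const[of "K a b"] tendsto_ident_at[of 0 UNIV]] by simp
    qed (simp add: K'_def)
  qed
  moreover have "((\<lambda>e. Zp N \<alpha> (K' e)) \<longlongrightarrow> 0) (at (0::real))"
    by (rule tendsto_eventually) (use zero in \<open>auto simp: eventually_at_filter\<close>)
  ultimately show ?thesis using tendsto_unique[OF at_neq_bot] by blast
qed

subsection \<open>Splitting off symmetric pairs\<close>

text \<open>\<open>ls\<close> lists, in decreasing order, the distances \<open>l\<close> of the pairs \<open>{k + 1 - l, k + l}\<close> to be removed.\<close>

fun skip_pairs :: "nat \<Rightarrow> nat list \<Rightarrow> nat \<Rightarrow> nat" where
  "skip_pairs k [] a = a"
| "skip_pairs k (l # ls) a = skip (k + 1 - l) (k + l) (skip_pairs (k - 1) ls a)"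

text \<open>Both rows of a listed pair vanish except at each other, so they are twins with zero
  Schur correction. The outermost pair goes first, which keeps the inner pairs symmetric about the
  gap, now at k - 1. Moving a symmetric pair to the gap takes an even number of transpositions, so
  no sign appears.\<close>

lemma Zp_pairs:
  assumes "two_blocks N \<alpha> lo k hi" "sorted_wrt (>) ls"
    and "\<And>l. l \<in> set ls \<Longrightarrow> 1 \<le> l \<and> l + lo \<le> k \<and> k + l \<le> hi"
    and "\<And>a b. K a b = K b a"
    and "\<And>l b. l \<in> set ls \<Longrightarrow> b \<in> {1..2*N} - {k+1-l, k+l} \<Longrightarrow> K (k+1-l) b = 0 \<and> K (k+l) b = 0"
    and "\<And>l. l \<in> set ls \<Longrightarrow> K (k+1-l) (k+l) \<noteq> 0"
    and "length ls \<le> cross_links \<alpha> lo k hi"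
  shows "Zp N \<alpha> K = (\<Prod>l\<leftarrow>ls. K (k+1-l) (k+l)) *
    Zp (N - length ls) (rem k (length ls) \<alpha>) (\<lambda>a b. K (skip_pairs k ls a) (skip_pairs k ls b))"
  using assms
proof (induction ls arbitrary: N \<alpha> k hi K)
  case Nil
  then show ?case by (simp add: rem_0)
next
  case (Cons l ls)
  note pr = Cons.prems
  have A: "\<alpha> \<in> NC N" and hi: "hi \<le> 2*N" using pr(1) by (auto simp: two_blocks_def)
  note kk = cross_links_pos[OF pr(1)]
  have lk: "{k, k+1} \<in> \<alpha>" "lo < k" "k < hi" using kk pr(7) by auto
  have l: "1 \<le> l" "l + lo \<le> k" "k + l \<le> hi" using pr(3)[of l] by auto
  let ?p = "k + 1 - l" and ?q = "k + l"
  have r: "lo < ?p" "?p \<le> k" "k < ?q" "?q \<le> hi" using l by auto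
  then have p1: "1 \<le> ?p" "?p < ?q" "?q \<le> 2*N" using hi by auto
  have z: "K ?p b = 0" "K ?q b = 0" if "b \<in> {1..2*N} - {?p, ?q}" for b using pr(5)[of l b] that by auto
  have nz: "K ?p ?q \<noteq> 0" using pr(6)[of l] by simp
  note R = two_blocks_rem[OF pr(1) lk]
  let ?s = "skip ?p ?q"
  let ?K = "\<lambda>a b. K (?s a) (?s b)"
  have lt: "l' < l" if "l' \<in> set ls" for l' using pr(2) that by simp
  have sp: "?s (k - 1 + 1 - l') = k + 1 - l'" "?s (k - 1 + l') = k + l'" if "l' \<in> set ls" for l'
    using lt[OF that] pr(3)[of l'] that l by (auto simp: skip_def)
  have e: "(k - ?p) + (?q - (k+1)) = 2 * (l - 1)" using l by auto
  have "Zp N \<alpha> K = (-1) ^ ((k - ?p) + (?q - (k+1))) * K ?p ?q *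
      Zp (N - 1) (rem k 1 \<alpha>) (\<lambda>a b. schur K ?p ?q (?s a) (?s b))"
    by (rule Zp_twin[OF A lk(1) hi two_blocks_short[OF pr(1)] r pr(4) _ nz]) (use z in auto)
  also have "Zp (N - 1) (rem k 1 \<alpha>) (\<lambda>a b. schur K ?p ?q (?s a) (?s b)) = Zp (N - 1) (rem k 1 \<alpha>) ?K"
  proof (rule Zp_cong)
    fix a b assume "b \<in> {1..2*(N-1)}"
    then have "?s b \<in> {1..2*N} - {?p, ?q}" using skip_in[OF p1] skip_notin[OF p1(2)] by auto
    then show "schur K ?p ?q (?s a) (?s b) = ?K a b" using z(1) by (simp add: schur_def)
  qed
  also have "Zp (N - 1) (rem k 1 \<alpha>) ?K = (\<Prod>l'\<leftarrow>ls. ?K (k-1+1-l') (k-1+l')) *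
    Zp (N - 1 - length ls) (rem (k-1) (length ls) (rem k 1 \<alpha>)) (\<lambda>a b. ?K (skip_pairs (k-1) ls a) (skip_pairs (k-1) ls b))"
  proof (rule Cons.IH[OF R(1)])
    show "sorted_wrt (>) ls" using pr(2) by simp
    show "1 \<le> l' \<and> l' + lo \<le> k - 1 \<and> k - 1 + l' \<le> hi - 2" if "l' \<in> set ls" for l'
      using lt[OF that] pr(3)[of l'] that l by auto
    show "?K a b = ?K b a" for a b by (rule pr(4))
    show "?K (k-1+1-l') b = 0 \<and> ?K (k-1+l') b = 0" if l': "l' \<in> set ls" and b: "b \<in> {1..2*(N-1)} - {k-1+1-l', k-1+l'}" for l' b
    proof -
      have "?s b \<in> {1..2*N} - {k+1-l', k+l'}"
        using b skip_in[OF p1, of b] skip_eq_iff[OF p1(2)] sp[OF l'] by (metis DiffD1 DiffD2 DiffI insert_iff singletonD)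
      then show ?thesis using pr(5)[of l' "?s b"] l' sp[OF l'] by simp
    qed
    show "?K (k-1+1-l') (k-1+l') \<noteq> 0" if "l' \<in> set ls" for l' using sp[OF that] pr(6)[of l'] that by simp
    show "length ls \<le> cross_links (rem k 1 \<alpha>) lo (k-1) (hi-2)" using R(2) pr(7) by simp
  qed
  also have "(\<Prod>l'\<leftarrow>ls. ?K (k-1+1-l') (k-1+l')) = (\<Prod>l'\<leftarrow>ls. K (k+1-l') (k+l'))"
    using sp by (intro arg_cong[where f=prod_list] map_cong) auto
  also have "rem (k-1) (length ls) (rem k 1 \<alpha>) = rem k (length ls + 1) \<alpha>"
  proof (rule rem_rem)
    have "length ls < cross_links \<alpha> lo k hi" using pr(7) by simp
    then show "length ls < k" using cross_links_le[of \<alpha> lo k hi] by linarith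
  qed
  finally show ?case unfolding e by simp
qed

section \<open>Asymptotics of small rows, positivity and the binomial identities\<close>

subsection \<open>Leading asymptotics for a block with small rows\<close>

definition tri :: "nat \<Rightarrow> nat" where
  "tri n = (\<Sum>i<n. i + 1)"

lemma tri_Suc: "tri (Suc n) = tri n + n + 1"
  by (simp add: tri_def)

lemma tri_strict_mono: "m < n \<Longrightarrow> tri m < tri n"
  by (rule strict_monoD[of tri]) (auto simp: strict_mono_Suc_iff tri_Suc)

lemma le_tri: "n \<le> tri n"
  by (induction n) (auto simp: tri_Suc)

text \<open>Labels 0, 1, 2, ... will carry the orders 1, 2, 3, ... in y. Removing the largest of
  \<open>m\<close> distinct labels, which is at least m - 1, gives the cheapest total order and its
  unique minimiser.\<close>

lemma tri_le_sum:
  fixes S :: "nat set"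
  assumes "finite S" "card S = m"
  shows "tri m \<le> (\<Sum>n\<in>S. n + 1) \<and> ((\<Sum>n\<in>S. n + 1) = tri m \<longrightarrow> S = {..<m})"
  using assms
proof (induction m arbitrary: S)
  case 0
  then show ?case by (simp add: tri_def)
next
  case (Suc m)
  have ne: "S \<noteq> {}" using Suc.prems by auto
  let ?x = "Max S"
  have x: "?x \<in> S" using Max_in[OF Suc.prems(1) ne] .
  have c: "card (S - {?x}) = m" using Suc.prems x by simp
  have "S \<subseteq> {..?x}" using Suc.prems(1) by auto
  then have "card S \<le> ?x + 1" using card_mono[of "{..?x}" S] by simp
  then have xm: "m \<le> ?x" using Suc.prems by simp
  have s: "(\<Sum>n\<in>S. n + 1) = (?x + 1) + (\<Sum>n\<in>S - {?x}. n + 1)"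
    by (rule sum.remove[OF Suc.prems(1) x])
  have I: "tri m \<le> (\<Sum>n\<in>S - {?x}. n + 1)" "(\<Sum>n\<in>S - {?x}. n + 1) = tri m \<longrightarrow> S - {?x} = {..<m}"
    using Suc.IH[OF _ c] Suc.prems(1) by auto
  show ?case
  proof (intro conjI impI)
    show "tri (Suc m) \<le> (\<Sum>n\<in>S. n + 1)" using s I(1) xm by (simp add: tri_Suc)
    assume "(\<Sum>n\<in>S. n + 1) = tri (Suc m)"
    then have "?x = m" "(\<Sum>n\<in>S - {?x}. n + 1) = tri m" using s I(1) xm by (auto simp: tri_Suc)
    then have "S = insert m {..<m}" using I(2) x by (metis insert_Diff)
    then show "S = {..<Suc m}" by (simp add: lessThan_Suc)
  qed
qed

text \<open>Inner rows are combinations of labelled rows \<open>G n\<close> of weight y^(e n).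
  Labels below \<open>M\<close> stand for derivatives of order \<open>n\<close>, with weight n + 1;
  the others stand for Taylor remainders, whose weight M + 1 exceeds \<open>tri L\<close>. The
  number \<open>t\<close> counts links between the blocks not yet used up, and \<open>L\<close> the
  indices that remain once they are.\<close>

locale small_rows =
  fixes N lo k hi M :: nat and \<alpha> :: "nat set set" and \<Gamma> :: "nat set" and e :: "nat \<Rightarrow> nat"
    and c :: "nat \<Rightarrow> nat \<Rightarrow> real" and y :: "'x \<Rightarrow> real" and F :: "'x filter"
    and G :: "'x \<Rightarrow> nat \<Rightarrow> nat \<Rightarrow> real" and Gl :: "nat \<Rightarrow> nat \<Rightarrow> real"
    and Ko :: "nat \<Rightarrow> nat \<Rightarrow> real" and K :: "'x \<Rightarrow> nat \<Rightarrow> nat \<Rightarrow> real"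
    and t L :: nat
  assumes blocks: "two_blocks N \<alpha> lo k hi"
    and t_def: "t = cross_links \<alpha> lo k hi"
    and L: "L + 2 * t = hi - lo"
    and Gam: "finite \<Gamma>" "{..<M} \<subseteq> \<Gamma>"
    and e: "\<And>n. n < M \<Longrightarrow> e n = n + 1" "\<And>n. M \<le> n \<Longrightarrow> e n = M + 1"
    and tM: "tri L \<le> M"
    and y: "(y \<longlongrightarrow> 0) F" "eventually (\<lambda>x. y x > 0) F"
    and Glim: "\<And>n b. n \<in> \<Gamma> \<Longrightarrow> b \<in> {1..2*N} - {lo<..hi} \<Longrightarrow> ((\<lambda>x. G x n b) \<longlongrightarrow> Gl n b) F"
    and Ksym: "\<And>x a b. K x a b = K x b a"
    and Kin: "\<And>x a b. a \<in> {lo<..hi} \<Longrightarrow> b \<in> {lo<..hi} \<Longrightarrow> K x a b = 0"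
    and Kmix: "\<And>x a b. a \<in> {lo<..hi} \<Longrightarrow> b \<in> {1..2*N} - {lo<..hi} \<Longrightarrow>
        K x a b = (\<Sum>n\<in>\<Gamma>. c a n * y x ^ e n * G x n b)"
    and Kout: "\<And>x a b. a \<in> {1..2*N} - {lo<..hi} \<Longrightarrow> b \<in> {1..2*N} - {lo<..hi} \<Longrightarrow> K x a b = Ko a b"
    and Kosym: "\<And>a b. Ko a b = Ko b a"
begin

abbreviation "J \<equiv> {lo<..hi}"

definition "W a = (if a \<in> J then Inr ` \<Gamma> else {Inl a :: nat + nat})"
definition "X x a w = (case w of Inl _ \<Rightarrow> 1 | Inr n \<Rightarrow> c a n * y x ^ e n)" for w :: "nat + nat"
definition "H g w w' = (case w of
    Inl a \<Rightarrow> (case w' of Inl b \<Rightarrow> Ko a b | Inr n \<Rightarrow> g n a)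
  | Inr n \<Rightarrow> (case w' of Inl b \<Rightarrow> g n b | Inr n' \<Rightarrow> (0::real)))" for w w' :: "nat + nat"
definition "lab w a = projr (w a :: nat + nat)" for w :: "nat \<Rightarrow> nat + nat" and a :: nat
definition "ex w = (\<Sum>a\<in>J. e (lab w a))"
definition "co w = (\<Prod>a\<in>J. c a (lab w a))"
definition "Khat a b = (if a \<in> J then (if b \<in> J then 0 else Gl (a - lo - 1) b)
    else if b \<in> J then Gl (b - lo - 1) a else Ko a b)"
definition "good w \<longleftrightarrow> t = 0 \<and> lab w ` J = {..<L}"

abbreviation "Ws \<equiv> PiE {1..2*N} W"

lemma A: "\<alpha> \<in> NC N" and order: "lo \<le> k" "k \<le> hi" "hi \<le> 2*N"
  using blocks by (auto simp: two_blocks_def)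

lemma J_sub: "a \<in> J \<Longrightarrow> a \<in> {1..2*N}" using order by auto

lemma W_J: "w \<in> Ws \<Longrightarrow> a \<in> J \<Longrightarrow> w a = Inr (lab w a) \<and> lab w a \<in> \<Gamma>"
  using PiE_mem[of w "{1..2*N}" W a] J_sub[of a] by (auto simp: W_def lab_def)

lemma W_out: "w \<in> Ws \<Longrightarrow> a \<in> {1..2*N} - J \<Longrightarrow> w a = Inl a"
  using PiE_mem[of w "{1..2*N}" W a] by (auto simp: W_def)

lemma H_sym: "H g w w' = H g w' w"
  using Kosym by (auto simp: H_def split: sum.split)

lemma expand: "Zp N \<alpha> (K x) = (\<Sum>w\<in>Ws. co w * y x ^ ex w * Zp N \<alpha> (\<lambda>a b. H (G x) (w a) (w b)))"
proof -
  have "Zp N \<alpha> (K x) = (\<Sum>w\<in>Ws. (\<Prod>a\<in>{1..2*N}. X x a (w a)) * Zp N \<alpha> (\<lambda>a b. H (G x) (w a) (w b)))"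
  proof (rule Zp_expand)
    show "finite (W a)" for a using Gam by (simp add: W_def)
    fix a b assume ab: "a \<in> {1..2*N}" "b \<in> {1..2*N}"
    have sJ: "(\<Sum>w\<in>Inr ` \<Gamma>. f w) = (\<Sum>n\<in>\<Gamma>. f (Inr n))" for f :: "nat + nat \<Rightarrow> real"
      by (rule sum.reindex_cong[of Inr]) auto
    show "K x a b = (\<Sum>w\<in>W a. \<Sum>w'\<in>W b. X x a w * X x b w' * H (G x) w w')"
    proof (cases "a \<in> J"; cases "b \<in> J")
      assume "a \<in> J" "b \<in> J"
      then show ?thesis using Kin[of a b x] by (simp add: W_def sJ H_def del: greaterThanAtMost_iff)
    next
      assume "a \<in> J" "b \<notin> J"
      then show ?thesis using Kmix[of a b x] ab by (simp add: W_def sJ H_def X_def del: greaterThanAtMost_iff)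
    next
      assume "a \<notin> J" "b \<in> J"
      then show ?thesis using Kmix[of b a x] Ksym[of x a b] ab by (simp add: W_def sJ H_def X_def del: greaterThanAtMost_iff)
    next
      assume "a \<notin> J" "b \<notin> J"
      then show ?thesis using Kout[of a b x] ab by (simp add: W_def H_def X_def del: greaterThanAtMost_iff)
    qed
  qed
  also have "\<dots> = (\<Sum>w\<in>Ws. co w * y x ^ ex w * Zp N \<alpha> (\<lambda>a b. H (G x) (w a) (w b)))"
  proof (rule sum.cong[OF refl])
    fix w assume w: "w \<in> Ws"
    have "(\<Prod>a\<in>{1..2*N}. X x a (w a)) = (\<Prod>a\<in>J. X x a (w a))"
      by (rule prod.mono_neutral_right) (use J_sub W_out[OF w] in \<open>auto simp: X_def\<close>)
    also have "\<dots> = (\<Prod>a\<in>J. c a (lab w a) * y x ^ e (lab w a))"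
      by (rule prod.cong[OF refl]) (use W_J[OF w] in \<open>simp add: X_def\<close>)
    also have "\<dots> = co w * y x ^ ex w"
      by (simp add: prod.distrib co_def ex_def power_sum)
    finally show "(\<Prod>a\<in>{1..2*N}. X x a (w a)) * Zp N \<alpha> (\<lambda>a b. H (G x) (w a) (w b)) =
        co w * y x ^ ex w * Zp N \<alpha> (\<lambda>a b. H (G x) (w a) (w b))" by simp
  qed
  finally show ?thesis .
qed

text \<open>Rows with equal labels are equal, so too few distinct labels force a zero.\<close>

lemma few_labels:
  assumes w: "w \<in> Ws" and few: "card (lab w ` J) + t < hi - lo"
  shows "Zp N \<alpha> (\<lambda>a b. H g (w a) (w b)) = 0"
proof -
  let ?P = "{lo<..k}" and ?Q = "{k<..hi}"
  have JU: "J = ?P \<union> ?Q" using order by auto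
  have row: "w p = w q" if "p \<in> J" "q \<in> J" "lab w p = lab w q" for p q
    using W_J[OF w] that by metis
  have twin: "Zp N \<alpha> (\<lambda>a b. H g (w a) (w b)) = 0"
    if h: "no_short_links \<alpha> l h" "h \<le> 2*N" "p \<in> {l<..h}" "q \<in> {l<..h}" "p \<noteq> q" "p \<in> J" "q \<in> J" "lab w p = lab w q" for l h p q
  proof -
    have wpq: "w p = w q" by (rule row[OF h(6,7,8)])
    show ?thesis
    proof (cases "p < q")
      case True
      show ?thesis by (rule Zp_twin_zero[OF A h(2,1), of p q]) (use True h(3,4) wpq H_sym in auto)
    next
      case False
      then have "q < p" using h(5) by simp
      then show ?thesis by (intro Zp_twin_zero[OF A h(2,1), of q p]) (use h(3,4) wpq H_sym in auto)
    qed
  qed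
  show ?thesis
  proof (cases "inj_on (lab w) ?P \<and> inj_on (lab w) ?Q")
    case False
    then show ?thesis
    proof (cases "inj_on (lab w) ?P")
      case False
      then obtain p q where "p \<in> ?P" "q \<in> ?P" "p \<noteq> q" "lab w p = lab w q" by (auto simp: inj_on_def)
      then show ?thesis using twin[OF two_blocks_short(1)[OF blocks], of p q] order JU by auto
    next
      case True
      then have "\<not> inj_on (lab w) ?Q" using False by auto
      then obtain p q where "p \<in> ?Q" "q \<in> ?Q" "p \<noteq> q" "lab w p = lab w q" by (auto simp: inj_on_def)
      then show ?thesis using twin[OF two_blocks_short(2)[OF blocks], of p q] order JU by auto
    qed
  next
    case True
    \<comment> \<open>Labels are distinct within each block, so a coincidence pairs a left row with
      a right row. The number of coincidences is the number of indices minus the number of labels,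
      hence larger than \<open>t\<close>.\<close>
    define T where "T = {(p, q). p \<in> ?P \<and> q \<in> ?Q \<and> lab w p = lab w q}"
    have TS: "T \<subseteq> ?P \<times> ?Q" by (auto simp: T_def)
    have fT: "finite T" by (rule finite_subset[OF TS]) simp
    have i1: "inj_on fst T" "inj_on snd T" using True by (auto simp: T_def inj_on_def)
    have "lab w ` ?P \<inter> lab w ` ?Q = (lab w \<circ> fst) ` T"
    proof (intro equalityI subsetI)
      fix x assume "x \<in> lab w ` ?P \<inter> lab w ` ?Q"
      then obtain p q where "p \<in> ?P" "q \<in> ?Q" "x = lab w p" "x = lab w q" by (elim IntE imageE) blast
      then have "(p, q) \<in> T" "x = (lab w \<circ> fst) (p, q)" unfolding T_def by simp_all
      then show "x \<in> (lab w \<circ> fst) ` T" by blast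
    next
      fix x assume "x \<in> (lab w \<circ> fst) ` T"
      then obtain p q where pq: "(p, q) \<in> T" "x = lab w p" by auto
      then have "p \<in> ?P" "q \<in> ?Q" "x = lab w q" by (simp_all add: T_def)
      then have "x \<in> lab w ` ?P" "x \<in> lab w ` ?Q"
        using pq(2) imageI[of p ?P "lab w"] imageI[of q ?Q "lab w"] by simp_all
      then show "x \<in> lab w ` ?P \<inter> lab w ` ?Q" by (rule IntI)
    qed
    moreover have "fst ` T \<subseteq> ?P" using TS by auto
    then have "inj_on (lab w \<circ> fst) T"
      by (rule comp_inj_on[OF i1(1) inj_on_subset[OF conjunct1[OF True]]])
    ultimately have "card (lab w ` ?P \<inter> lab w ` ?Q) = card T" by (simp only: card_image)
    moreover have "card (lab w ` J) + card (lab w ` ?P \<inter> lab w ` ?Q) = card (lab w ` ?P) + card (lab w ` ?Q)"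
      unfolding JU image_Un by (rule card_Un_Int[symmetric]) auto
    moreover have "card (lab w ` ?P) = k - lo" "card (lab w ` ?Q) = hi - k" using True by (simp_all add: card_image)
    ultimately have cT: "card T > cross_links \<alpha> lo k hi" using few order unfolding t_def by linarith
    show ?thesis
    proof (rule Zp_many_twins_zero[OF blocks fT TS i1 _ _ _ cT])
      show "H g (w a) (w b) = H g (w b) (w a)" for a b by (rule H_sym)
      show "H g (w p) (w b) = H g (w q) (w b)" if "(p, q) \<in> T" for p q b
        using that row[of p q] JU by (auto simp: T_def)
      show "H g (w a) (w b) = 0" if ab: "a \<in> J" "b \<in> J" for a b
      proof -
        obtain n m where "w a = Inr n" "w b = Inr m" using W_J[OF w ab(1)] W_J[OF w ab(2)] by blast
        then show ?thesis by (simp add: H_def)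
      qed
    qed
  qed
qed

text \<open>At least L + t distinct labels occur. One remainder label alone costs M + 1 > tri L;
  otherwise the cost is at least \<open>tri (L + t)\<close>, and it equals \<open>tri L\<close> only
  for t = 0 and the labels 0, ..., L - 1.\<close>

lemma exponent:
  assumes w: "w \<in> Ws" and many: "hi - lo \<le> card (lab w ` J) + t"
  shows "tri L < ex w \<or> (ex w = tri L \<and> good w)"
proof -
  let ?S = "lab w ` J"
  have f: "finite ?S" by simp
  have cS: "L + t \<le> card ?S" using many L by linarith
  have cJ: "card ?S \<le> L + 2*t" using card_image_le[of J "lab w"] L by simp
  show ?thesis
  proof (cases "\<exists>a\<in>J. M \<le> lab w a")
    case True
    then obtain a where a: "a \<in> J" "M \<le> lab w a" by blast
    then have "e (lab w a) \<le> ex w" unfolding ex_def by (intro member_le_sum) auto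
    then show ?thesis using e(2)[OF a(2)] tM by simp
  next
    case False
    have ee: "ex w = (\<Sum>a\<in>J. lab w a + 1)" unfolding ex_def 
    proof (rule sum.cong[OF refl])
      fix a assume "a \<in> J"
      then show "e (lab w a) = lab w a + 1" using False e(1) by (meson not_le)
    qed
    have s: "(\<Sum>n\<in>?S. n + 1) \<le> ex w"
      unfolding ee using sum_image_le[of J "\<lambda>n. n + 1" "lab w"] by simp
    note T = tri_le_sum[OF f refl]
    show ?thesis
    proof (cases "L < card ?S")
      case True
      then show ?thesis using tri_strict_mono[OF True] T s by linarith
    next
      case False
      then have c: "card ?S = L" "t = 0" using cS by auto
      show ?thesis
      proof (cases "(\<Sum>n\<in>?S. n + 1) = tri L")
        case True
        then have S: "?S = {..<L}" using T c by auto
        have "inj_on (lab w) J" using c L by (intro eq_card_imp_inj_on) auto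
        then have "ex w = (\<Sum>n\<in>?S. n + 1)" unfolding ee by (simp add: sum.reindex)
        then show ?thesis using True S c unfolding good_def by auto
      next
        case False
        then show ?thesis using T s c by auto
      qed
    qed
  qed
qed

text \<open>Terms with too few labels vanish identically, terms of higher order tend to 0, and the
  good ones have exactly the order \<open>tri L\<close>.\<close>

lemma term_limit:
  assumes w: "w \<in> Ws"
  shows "((\<lambda>x. co w * y x ^ ex w * Zp N \<alpha> (\<lambda>a b. H (G x) (w a) (w b)) / y x ^ tri L) \<longlongrightarrow>
    (if good w then co w * Zp N \<alpha> (\<lambda>a b. H Gl (w a) (w b)) else 0)) F"
proof -
  have Zl: "((\<lambda>x. Zp N \<alpha> (\<lambda>a b. H (G x) (w a) (w b))) \<longlongrightarrow> Zp N \<alpha> (\<lambda>a b. H Gl (w a) (w b))) F"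
  proof (rule tendsto_Zp)
    fix a b assume ab: "a \<in> {1..2*N}" "b \<in> {1..2*N}"
    show "((\<lambda>x. H (G x) (w a) (w b)) \<longlongrightarrow> H Gl (w a) (w b)) F"
    proof (cases "a \<in> J"; cases "b \<in> J")
      assume "a \<in> J" "b \<in> J"
      then obtain n m where "w a = Inr n" "w b = Inr m" using W_J[OF w, of a] W_J[OF w, of b] by blast
      then show ?thesis by (simp add: H_def)
    next
      assume h: "a \<in> J" "b \<notin> J"
      obtain n where "w a = Inr n" "n \<in> \<Gamma>" using W_J[OF w h(1)] by blast
      moreover have "w b = Inl b" using W_out[OF w] h ab by blast
      ultimately show ?thesis using Glim[of n b] h ab by (simp add: H_def)
    next
      assume h: "a \<notin> J" "b \<in> J"
      obtain n where "w b = Inr n" "n \<in> \<Gamma>" using W_J[OF w h(2)] by blast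
      moreover have "w a = Inl a" using W_out[OF w] h ab by blast
      ultimately show ?thesis using Glim[of n a] h ab by (simp add: H_def)
    next
      assume "a \<notin> J" "b \<notin> J"
      then have "w a = Inl a" "w b = Inl b" using W_out[OF w] ab by auto
      then show ?thesis by (simp add: H_def)
    qed
  qed
  show ?thesis
  proof (cases "hi - lo \<le> card (lab w ` J) + t")
    case False
    then have "Zp N \<alpha> (\<lambda>a b. H g (w a) (w b)) = 0" for g using few_labels[OF w] by simp
    then show ?thesis by simp
  next
    case True
    from exponent[OF w True] show ?thesis
    proof
      assume lt: "tri L < ex w"
      have "\<not> good w"
      proof
        assume g: "good w"
        have LM: "L \<le> M" using le_tri[of L] tM by linarith
        have "card (lab w ` J) = card J" using g L by (simp add: good_def)
        then have inj: "inj_on (lab w) J" by (intro eq_card_imp_inj_on) auto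
        have "ex w = (\<Sum>n\<in>lab w ` J. e n)" unfolding ex_def using inj by (simp add: sum.reindex)
        also have "\<dots> = tri L" using g e(1) LM by (simp add: good_def tri_def)
        finally show False using lt by simp
      qed
      have "((\<lambda>x. co w * y x ^ (ex w - tri L) * Zp N \<alpha> (\<lambda>a b. H (G x) (w a) (w b)))
          \<longlongrightarrow> co w * 0 ^ (ex w - tri L) * Zp N \<alpha> (\<lambda>a b. H Gl (w a) (w b))) F"
        by (intro tendsto_mult tendsto_const tendsto_power y(1) Zl)
      moreover have "(0::real) ^ (ex w - tri L) = 0" using lt by (intro zero_power) simp
      ultimately have "((\<lambda>x. co w * y x ^ (ex w - tri L) * Zp N \<alpha> (\<lambda>a b. H (G x) (w a) (w b))) \<longlongrightarrow> 0) F"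
        by simp
      moreover have "eventually (\<lambda>x. co w * y x ^ (ex w - tri L) * Zp N \<alpha> (\<lambda>a b. H (G x) (w a) (w b))
          = co w * y x ^ ex w * Zp N \<alpha> (\<lambda>a b. H (G x) (w a) (w b)) / y x ^ tri L) F"
        using y(2) by eventually_elim (use lt in \<open>simp add: power_diff\<close>)
      ultimately show ?thesis using \<open>\<not> good w\<close> by (simp add: tendsto_cong)
    next
      assume g: "ex w = tri L \<and> good w"
      have "((\<lambda>x. co w * Zp N \<alpha> (\<lambda>a b. H (G x) (w a) (w b))) \<longlongrightarrow> co w * Zp N \<alpha> (\<lambda>a b. H Gl (w a) (w b))) F"
        by (intro tendsto_mult tendsto_const Zl)
      moreover have "eventually (\<lambda>x. co w * Zp N \<alpha> (\<lambda>a b. H (G x) (w a) (w b))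
          = co w * y x ^ ex w * Zp N \<alpha> (\<lambda>a b. H (G x) (w a) (w b)) / y x ^ tri L) F"
        using y(2) by eventually_elim (use g in simp)
      ultimately show ?thesis using g by (simp add: tendsto_cong)
    qed
  qed
qed

text \<open>For t = 0 the good labellings are the permutations of 0, ..., L - 1 spread over the two
  blocks, whose union now has no short link. Alternation turns each of them into its sign times the
  same value, so the coefficients assemble to a determinant.\<close>

lemma sum_good:
  assumes t0: "t = 0"
  shows "(\<Sum>w\<in>Ws. if good w then co w * Zp N \<alpha> (\<lambda>a b. H Gl (w a) (w b)) else 0)
    = gdet {..<L} id (\<lambda>i n. c (lo + 1 + i) n) * Zp N \<alpha> Khat"
proof -
  let ?sh = "\<lambda>i. lo + 1 + i"
  have LJ: "L = hi - lo" using L t0 by simp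
  have bb: "bij_betw ?sh {..<L} J"
    unfolding bij_betw_def
  proof
    show "?sh ` {..<L} = J"
    proof (intro equalityI subsetI)
      fix a assume "a \<in> J"
      then have "a = ?sh (a - lo - 1)" "a - lo - 1 \<in> {..<L}" using LJ by auto
      then show "a \<in> ?sh ` {..<L}" by blast
    qed (use LJ in auto)
  qed auto
  have sh1: "?sh (a - lo - 1) = a" "a - lo - 1 < L" if "a \<in> J" for a using that LJ by auto
  have LM: "{..<L} \<subseteq> \<Gamma>" using le_tri[of L] tM Gam by auto
  let ?i = "\<lambda>p. \<lambda>a\<in>{1..2*N}. if a \<in> J then Inr (p (a - lo - 1)) else (Inl a :: nat + nat)"
  let ?j = "\<lambda>w i. if i < L then lab w (?sh i) else i"
  have labi: "lab (?i p) a = p (a - lo - 1)" if "a \<in> J" for a p using that J_sub[OF that] by (simp add: lab_def)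
  have eq: "co (?i p) * Zp N \<alpha> (\<lambda>a b. H Gl (?i p a) (?i p b)) =
        (of_int (sign p) * (\<Prod>i<L. c (?sh i) (p i))) * Zp N \<alpha> Khat" if p: "p permutes {..<L}" for p
    proof -
      have co: "co (?i p) = (\<Prod>i<L. c (?sh i) (p i))"
        unfolding co_def by (subst prod.reindex_bij_betw[OF bb, symmetric])
          (rule prod.cong[OF refl], use labi bb in \<open>simp add: bij_betw_apply[OF bb, simplified]\<close>)
      define q where "q = map_permutation {..<L} ?sh p"
      have qp: "q permutes J" unfolding q_def by (rule map_permutation_permutes[OF bb p])
      have qs: "sign q = sign p" unfolding q_def by (rule sign_map_permutation) (use p in auto)
      have qa: "q a = ?sh (p (a - lo - 1))" if "a \<in> J" for a
      proof -
        have "q (?sh (a - lo - 1)) = ?sh (p (a - lo - 1))"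
          unfolding q_def by (rule map_permutation_apply) (use sh1[OF that] in auto)
        then show ?thesis using sh1[OF that] by simp
      qed
      have qo: "q a = a" if "a \<notin> J" for a using permutes_not_in[OF qp that] .
      have "Zp N \<alpha> (\<lambda>a b. H Gl (?i p a) (?i p b)) = Zp N \<alpha> (\<lambda>a b. Khat (q a) (q b))"
      proof (rule Zp_cong)
        fix a b assume ab: "a \<in> {1..2*N}" "b \<in> {1..2*N}"
        have qJ: "q a \<in> J \<longleftrightarrow> a \<in> J" for a by (rule permutes_in_image[OF qp])
        have qm: "q a - lo - 1 = p (a - lo - 1)" if "a \<in> J" for a using qa[OF that] by simp
        show "H Gl (?i p a) (?i p b) = Khat (q a) (q b)"
          unfolding Khat_def qJ using ab qm qo by (auto simp: H_def simp del: One_nat_def)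
      qed
      also have "\<dots> = of_int (sign p) * Zp N \<alpha> Khat"
        using Zp_perm[OF A order(3) _ qp, of Khat] no_cross_links_short[OF blocks] t0 t_def qs by simp
      finally show ?thesis using co by simp
    qed
  have gw: "finite Ws" using Gam by (intro finite_PiE) (auto simp: W_def)
  have "(\<Sum>w\<in>Ws. if good w then co w * Zp N \<alpha> (\<lambda>a b. H Gl (w a) (w b)) else 0)
      = (\<Sum>w\<in>{w\<in>Ws. good w}. co w * Zp N \<alpha> (\<lambda>a b. H Gl (w a) (w b)))"
    by (rule sum.inter_filter[symmetric, OF gw])
  also have "\<dots> = (\<Sum>p | p permutes {..<L}. (of_int (sign p) * (\<Prod>i<L. c (?sh i) (p i))) * Zp N \<alpha> Khat)"
  proof (rule sum.reindex_bij_witness[where i="?i" and j="?j"])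
    fix p assume "p \<in> {p. p permutes {..<L}}"
    then have p: "p permutes {..<L}" by simp
    show "?j (?i p) = p"
    proof
      fix i
      show "?j (?i p) i = p i"
      proof (cases "i < L")
        case True
        then have "?sh i \<in> J" using bb by (auto simp: bij_betw_def)
        then show ?thesis using True labi[of "?sh i"] by simp
      next
        case False
        then show ?thesis using permutes_not_in[OF p, of i] by simp
      qed
    qed
    have pin: "p i < L" if "i < L" for i using permutes_in_image[OF p, of i] that by simp
    have "?i p \<in> Ws"
      using sh1 pin LM by (auto simp: W_def subset_iff)
    moreover have "lab (?i p) ` J = {..<L}"
    proof -
      have "lab (?i p) ` J = p ` (\<lambda>a. a - lo - 1) ` J" using labi by (force simp: image_iff)
      also have "(\<lambda>a. a - lo - 1) ` J = {..<L}"
      proof (intro equalityI subsetI)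
        fix i assume "i \<in> {..<L}"
        then show "i \<in> (\<lambda>a. a - lo - 1) ` J" using LJ by (intro image_eqI[of _ _ "?sh i"]) auto
      qed (use sh1 in auto)
      also have "p ` {..<L} = {..<L}" by (rule permutes_image[OF p])
      finally show ?thesis .
    qed
    ultimately show "?i p \<in> {w \<in> Ws. good w}" using t0 unfolding good_def by blast
  next
    fix w assume "w \<in> {w \<in> Ws. good w}"
    then have w: "w \<in> Ws" and g: "lab w ` J = {..<L}" by (auto simp: good_def)
    have inj: "inj_on (lab w) J" using g LJ by (intro eq_card_imp_inj_on) auto
    show ij: "?i (?j w) = w"
    proof
      fix a
      show "?i (?j w) a = w a"
      proof (cases "a \<in> {1..2*N}")
        case True
        show ?thesis
        proof (cases "a \<in> J")
          case aJ: True
          have "?j w (a - lo - 1) = lab w a" using sh1[OF aJ] by simp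
          then have "?i (?j w) a = Inr (lab w a)" using aJ True by (simp only: restrict_apply if_True)
          then show ?thesis using W_J[OF w aJ] by simp
        next
          case False
          then show ?thesis using W_out[OF w, of a] True by (simp del: greaterThanAtMost_iff)
        qed
      next
        case False
        then show ?thesis using PiE_arb[OF w False] by (simp only: restrict_apply if_False)
      qed
    qed
    have "bij_betw (lab w \<circ> ?sh) {..<L} {..<L}"
      using bij_betw_trans[OF bb, of "lab w" "{..<L}"] inj g by (simp add: bij_betw_def)
    moreover have "bij_betw (?j w) {..<L} {..<L} \<longleftrightarrow> bij_betw (lab w \<circ> ?sh) {..<L} {..<L}"
      by (rule bij_betw_cong) simp
    ultimately have "bij_betw (?j w) {..<L} {..<L}" by blast
    then have jp: "?j w permutes {..<L}" by (rule bij_imp_permutes) simp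
    then show "?j w \<in> {p. p permutes {..<L}}" by blast
    show "(of_int (sign (?j w)) * (\<Prod>i<L. c (?sh i) (?j w i))) * Zp N \<alpha> Khat = co w * Zp N \<alpha> (\<lambda>a b. H Gl (w a) (w b))"
      using eq[OF jp, unfolded ij] by (rule sym)
  qed
  also have "\<dots> = gdet {..<L} id (\<lambda>i n. c (?sh i) n) * Zp N \<alpha> Khat"
    by (simp add: gdet_def sum_distrib_right)
  finally show ?thesis .
qed

theorem small_rows_limit:
  "((\<lambda>x. Zp N \<alpha> (K x) / y x ^ tri L) \<longlongrightarrow>
    (if t = 0 then gdet {..<L} id (\<lambda>i n. c (lo + 1 + i) n) * Zp N \<alpha> Khat else 0)) F"
proof -
  have "((\<lambda>x. \<Sum>w\<in>Ws. co w * y x ^ ex w * Zp N \<alpha> (\<lambda>a b. H (G x) (w a) (w b)) / y x ^ tri L) \<longlongrightarrow>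
    (\<Sum>w\<in>Ws. if good w then co w * Zp N \<alpha> (\<lambda>a b. H Gl (w a) (w b)) else 0)) F"
    by (intro tendsto_sum term_limit)
  moreover have "(\<Sum>w\<in>Ws. if good w then co w * Zp N \<alpha> (\<lambda>a b. H Gl (w a) (w b)) else 0) = 0" if "t \<noteq> 0"
    using that by (intro sum.neutral) (simp add: good_def)
  ultimately show ?thesis
    using sum_good by (cases "t = 0") (simp_all add: expand sum_divide_distrib)
qed

end

subsection \<open>Positivity of a determinant of polynomials\<close>

text \<open>A Vandermonde argument by Schur complement. Since p_0 is constant, pivoting on the entry
  (0, 0) leaves p_n(\<mu>_i) - p_n(\<mu>_0). Dividing by the positive \<mu>_i - \<mu>_0 gives
  polynomials of degree n - 1 with positive leading coefficient.\<close>

lemma gdet_poly_pos: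
  fixes \<mu> :: "nat \<Rightarrow> real" and p :: "nat \<Rightarrow> real poly"
  assumes "\<And>n. n < L \<Longrightarrow> degree (p n) = n \<and> lead_coeff (p n) > 0"
    and "\<And>i j. i < j \<Longrightarrow> j < L \<Longrightarrow> \<mu> i < \<mu> j"
  shows "gdet {..<L} id (\<lambda>i n. poly (p n) (\<mu> i)) > 0"
  using assms
proof (induction L arbitrary: \<mu> p)
  case 0
  have "{\<sigma>::nat\<Rightarrow>nat. \<sigma> permutes {}} = {id}" by auto
  then show ?case by (simp add: gdet_def)
next
  case (Suc L)
  obtain c where p0: "p 0 = [:c:]" "c > 0"
  proof -
    have d: "degree (p 0) = 0" "lead_coeff (p 0) > 0" using Suc.prems(1)[of 0] by auto
    obtain c where "p 0 = [:c:]" using d(1) by (rule degree_eq_zeroE)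
    then show ?thesis using that d by simp
  qed
  define q where "q n = (if n = 0 then p 0 else p n - [:poly (p n) (\<mu> 0):])" for n
  have "\<exists>r. p (Suc n) - [:poly (p (Suc n)) (\<mu> 0):] = [:- \<mu> 0, 1:] * r" for n
  proof -
    have "poly (p (Suc n) - [:poly (p (Suc n)) (\<mu> 0):]) (\<mu> 0) = 0" by simp
    then show ?thesis by (simp only: poly_eq_0_iff_dvd dvd_def)
  qed
  then obtain r where r: "\<And>n. p (Suc n) - [:poly (p (Suc n)) (\<mu> 0):] = [:- \<mu> 0, 1:] * r n" by metis
  have rp: "degree (r n) = n \<and> lead_coeff (r n) > 0" if "n < L" for n
  proof -
    have d: "degree (p (Suc n)) = Suc n" "lead_coeff (p (Suc n)) > 0" using Suc.prems(1)[of "Suc n"] that by auto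
    have e: "p (Suc n) = [:poly (p (Suc n)) (\<mu> 0):] + [:- \<mu> 0, 1:] * r n" using r[of n] by (simp add: algebra_simps)
    have "degree (p (Suc n) + [:- poly (p (Suc n)) (\<mu> 0):]) = degree (p (Suc n))"
      by (rule degree_add_eq_left) (use d in simp)
    moreover have "p (Suc n) + [:- poly (p (Suc n)) (\<mu> 0):] = [:- \<mu> 0, 1:] * r n"
      unfolding r[of n, symmetric] by (simp add: poly_eq_iff coeff_pCons split: nat.split)
    ultimately have dq: "degree ([:- \<mu> 0, 1:] * r n) = Suc n" using d(1) by simp
    then have rn: "r n \<noteq> 0" by auto
    have "degree ([:- \<mu> 0, 1:] * r n) = degree [:- \<mu> 0, 1:] + degree (r n)" by (rule degree_mult_eq) (use rn in auto)
    then have dr: "degree (r n) = n" using dq by simp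
    have "coeff (p (Suc n)) (Suc n) = coeff ([:poly (p (Suc n)) (\<mu> 0):] + [:- \<mu> 0, 1:] * r n) (Suc n)"
      using e by (rule arg_cong)
    also have "\<dots> = coeff ([:- \<mu> 0, 1:] * r n) (Suc n)" by (simp only: coeff_add coeff_pCons_Suc coeff_0 add_0)
    also have "\<dots> = lead_coeff ([:- \<mu> 0, 1:] * r n)" by (simp only: dq)
    also have "\<dots> = lead_coeff [:- \<mu> 0, 1:] * lead_coeff (r n)" by (rule lead_coeff_mult)
    also have "\<dots> = lead_coeff (r n)" by simp
    finally show ?thesis using dr d by simp
  qed
  have "gdet {..<Suc L} id (\<lambda>i n. poly (p n) (\<mu> i)) =
      c * gdet ({..<Suc L} - {0}) id (\<lambda>i n. poly (p n) (\<mu> i) - poly (p 0) (\<mu> i) * poly (p n) (\<mu> 0) / poly (p 0) (\<mu> 0))"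
    using gdet_schur[of "{..<Suc L}" 0 "\<lambda>i n. poly (p n) (\<mu> i)" id] p0 by simp
  also have "{..<Suc L} - {0} = Suc ` {..<L}" unfolding image_Suc_lessThan by auto
  also have "gdet (Suc ` {..<L}) id (\<lambda>i n. poly (p n) (\<mu> i) - poly (p 0) (\<mu> i) * poly (p n) (\<mu> 0) / poly (p 0) (\<mu> 0))
    = gdet {..<L} (Suc \<circ> id) (\<lambda>i n. poly (p n) (\<mu> (Suc i)) - poly (p n) (\<mu> 0))"
    using p0 by (subst gdet_reindex) (auto intro!: gdet_cong)
  also have "\<dots> = gdet {..<L} id (\<lambda>i n. (\<mu> (Suc i) - \<mu> 0) * poly (r n) (\<mu> (Suc i)))"
  proof -
    have "poly (p (Suc n)) x - poly (p (Suc n)) (\<mu> 0) = (x - \<mu> 0) * poly (r n) x" for n x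
      using arg_cong[OF r[of n], of "\<lambda>f. poly f x"] by (simp add: algebra_simps)
    then show ?thesis unfolding gdet_image by simp
  qed
  also have "\<dots> = (\<Prod>i<L. \<mu> (Suc i) - \<mu> 0) * gdet {..<L} id (\<lambda>i n. poly (r n) (\<mu> (Suc i)))"
    by (simp add: gdet_def prod.distrib sum_distrib_left mult.left_commute)
  finally have eq: "gdet {..<Suc L} id (\<lambda>i n. poly (p n) (\<mu> i)) =
      c * ((\<Prod>i<L. \<mu> (Suc i) - \<mu> 0) * gdet {..<L} id (\<lambda>i n. poly (r n) (\<mu> (Suc i))))" .
  have "gdet {..<L} id (\<lambda>i n. poly (r n) (\<mu> (Suc i))) > 0"
  proof (rule Suc.IH)
    show "degree (r n) = n \<and> lead_coeff (r n) > 0" if "n < L" for n by (rule rp[OF that])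
  qed (use Suc.prems(2) in auto)
  moreover have "(\<Prod>i<L. \<mu> (Suc i) - \<mu> 0) > 0" by (rule prod_pos) (use Suc.prems(2) in auto)
  ultimately show ?case unfolding eq using p0(2) by (intro mult_pos_pos)
qed

text \<open>The weight, next to y^(n+1), of the n-th derivative at the left point in the transformed
  row at signed distance \<mu> from the gap. One formula serves both blocks: \<mu> = -l gives a
  finite combination, \<mu> = l the Taylor expansion of a combination taken at the right
  point.\<close>

definition row_coeff :: "real \<Rightarrow> nat \<Rightarrow> real" where
  "row_coeff \<mu> n = pochhammer \<mu> (n + 1) / (fact (n + 1) * fact n)"

text \<open>As a polynomial in \<mu>, \<open>row_coeff\<close> is \<mu> times a polynomial of degree
  \<open>n\<close> with positive leading coefficient. The factor \<mu> comes out of each row and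
  carries all the signs.\<close>

lemma gdet_row_coeff:
  fixes \<mu> :: "nat \<Rightarrow> real"
  assumes "\<And>i j. i < j \<Longrightarrow> j < L \<Longrightarrow> \<mu> i < \<mu> j"
  shows "\<exists>g>0. gdet {..<L} id (\<lambda>i n. row_coeff (\<mu> i) n) = (\<Prod>i<L. \<mu> i) * g"
proof -
  define q :: "nat \<Rightarrow> real poly" where "q n = pochhammer [:1, 1:] n" for n
  have q: "degree (q n) = n \<and> lead_coeff (q n) = 1" for n
  proof (induction n)
    case (Suc n)
    have e: "q (Suc n) = q n * [:1 + of_nat n, 1:]" by (simp add: q_def pochhammer_Suc of_nat_poly)
    have "q n \<noteq> 0" using Suc by auto
    have "degree (q (Suc n)) = degree (q n) + degree [:1 + real n, 1:]"
      unfolding e by (rule degree_mult_eq) (use \<open>q n \<noteq> 0\<close> in auto)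
    moreover have "lead_coeff (q (Suc n)) = lead_coeff (q n) * lead_coeff [:1 + real n, 1:]"
      unfolding e by (rule lead_coeff_mult)
    moreover have "coeff (q n) n = 1" using Suc by metis
    ultimately show ?case using Suc by simp
  qed (simp add: q_def)
  have pq: "poly (q n) x = pochhammer (x + 1) n" for n x
  proof (induction n)
    case (Suc n)
    have e: "q (Suc n) = q n * [:1 + of_nat n, 1:]" by (simp add: q_def pochhammer_Suc of_nat_poly)
    show ?case unfolding e using Suc by (simp add: pochhammer_Suc algebra_simps)
  qed (simp add: q_def)
  define p where "p n = Polynomial.smult (1 / (fact (n + 1) * fact n)) (q n)" for n
  have "gdet {..<L} id (\<lambda>i n. poly (p n) (\<mu> i)) > 0"
  proof (rule gdet_poly_pos)
    fix n
    have "coeff (q n) n = 1" using q[of n] by metis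
    then show "degree (p n) = n \<and> lead_coeff (p n) > 0" using q[of n] by (simp add: p_def)
  qed (rule assms)
  moreover have "gdet {..<L} id (\<lambda>i n. row_coeff (\<mu> i) n) = (\<Prod>i<L. \<mu> i) * gdet {..<L} id (\<lambda>i n. poly (p n) (\<mu> i))"
  proof -
    have "row_coeff x n = x * poly (p n) x" for x n
      by (simp add: row_coeff_def p_def pq pochhammer_rec)
    then show ?thesis by (simp add: gdet_def prod.distrib sum_distrib_left mult.left_commute)
  qed
  ultimately show ?thesis by blast
qed

subsection \<open>Binomial identities\<close>

text \<open>Up to sign the left side is the n-th finite difference of (m choose p) in m, and by
  Pascal's rule each difference lowers p by one.\<close>

lemma sum_alternating_binomial:
  "(\<Sum>r\<le>n. (-1) ^ r * int (n choose r) * int ((m + r) choose p)) = (if n \<le> p then (-1) ^ n * int (m choose (p - n)) else 0)"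
proof (induction n arbitrary: m p)
  case 0
  then show ?case by simp
next
  case (Suc n)
  let ?f = "\<lambda>n m r. (-1) ^ r * int (n choose r) * int ((m + r) choose p)"
  have "(\<Sum>r\<le>Suc n. ?f (Suc n) m r) = int (m choose p) + (\<Sum>r\<le>n. ?f (Suc n) m (Suc r))"
    by (subst sum.atMost_Suc_shift) simp
  also have "(\<Sum>r\<le>n. ?f (Suc n) m (Suc r)) = (\<Sum>r\<le>n. (-1) ^ Suc r * int (n choose Suc r) * int ((m + Suc r) choose p)) - (\<Sum>r\<le>n. ?f n (Suc m) r)"
    unfolding sum_subtractf[symmetric] by (intro sum.cong refl) (simp add: algebra_simps)
  also have "int (m choose p) + ((\<Sum>r\<le>n. (-1) ^ Suc r * int (n choose Suc r) * int ((m + Suc r) choose p)) - (\<Sum>r\<le>n. ?f n (Suc m) r))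
    = (\<Sum>r\<le>Suc n. ?f n m r) - (\<Sum>r\<le>n. ?f n (Suc m) r)"
  proof -
    have "(\<Sum>r\<le>Suc n. ?f n m r) = int (m choose p) + (\<Sum>r\<le>n. ?f n m (Suc r))"
      by (subst sum.atMost_Suc_shift) simp
    then show ?thesis by simp
  qed
  also have "(\<Sum>r\<le>Suc n. ?f n m r) = (\<Sum>r\<le>n. ?f n m r)" by simp
  finally have "(\<Sum>r\<le>Suc n. ?f (Suc n) m r) = (\<Sum>r\<le>n. ?f n m r) - (\<Sum>r\<le>n. ?f n (Suc m) r)" .
  also have "\<dots> = (if Suc n \<le> p then (-1) ^ Suc n * int (m choose (p - Suc n)) else 0)"
  proof (cases "Suc n \<le> p")
    case True
    then have "p - n = Suc (p - Suc n)" by simp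
    then show ?thesis unfolding Suc.IH using True by (simp add: algebra_simps)
  next
    case False
    then show ?thesis unfolding Suc.IH by (cases "n = p") simp_all
  qed
  finally show ?case .
qed

text \<open>The binomial vanishes for i \<ge> l, so the row transformation is triangular, with
  diagonal entry 1 / fact (l - 1) at i = l - 1.\<close>

definition mix :: "nat \<Rightarrow> nat \<Rightarrow> real" where
  "mix l i = real (l choose (i + 1)) / fact i"

text \<open>This is the residue pairing of powers of \<phi> in coordinates. The alternating sum over
  \<open>j\<close> is a finite difference of order l', zero for i + 1 < l', while
  \<open>mix l i\<close> is zero for i + 1 > l. With l \<le> l' only i + 1 = l = l' is left.\<close>

lemma mix_orthogonal_le:
  assumes l: "1 \<le> l" "l \<le> l'" "l \<le> s" "l' \<le> s'"
  shows "(\<Sum>i<s. \<Sum>j<s'. (-1) ^ (i + 1) * mix l i * mix l' j * ((-1) ^ j * fact (i + j + 1))) = (if l = l' then - real l else 0)"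
proof -
  have inner: "(\<Sum>j<s'. mix l i * mix l' j * ((-1) ^ j * fact (i + j + 1))) =
      (if i + 1 = l \<and> l = l' then - ((-1) ^ l * real l) else 0)" if i: "i < s" for i
  proof -
    have f: "mix l i * mix l' j * ((-1) ^ j * fact (i + j + 1)) =
        (l choose (i+1)) * (i + 1) * ((-1) ^ j * real (l' choose (j + 1)) * real ((i + (j + 1)) choose (i + 1)))" for j
    proof -
      have b: "real ((i + (j + 1)) choose (i + 1)) = fact (i + j + 1) / (fact (i + 1) * fact j)"
        using binomial_fact[of "i + 1" "i + (j + 1)", where 'a=real] by (simp add: ac_simps)
      have f1: "fact (i + 1) = real (i + 1) * fact i" by simp
      have K: "a / x * (b / z) * (c * d) = a * A * (c * b * (d / ((A * x) * z)))"
        if "A \<noteq> 0" "x \<noteq> 0" "z \<noteq> 0" for a b c d A x z :: real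
        using that by (simp add: field_simps)
      show ?thesis unfolding mix_def b f1 of_nat_mult by (rule K) (simp_all del: of_nat_Suc of_nat_add)
    qed
    let ?g = "\<lambda>r. (-1) ^ r * int (l' choose r) * int ((i + r) choose (i + 1))"
    have "(\<Sum>j<s'. (-1) ^ j * real (l' choose (j + 1)) * real ((i + (j + 1)) choose (i + 1)))
        = (\<Sum>j<l'. (-1) ^ j * real (l' choose (j + 1)) * real ((i + (j + 1)) choose (i + 1)))"
      by (rule sum.mono_neutral_right) (use l in auto)
    also have "\<dots> = - real_of_int (\<Sum>j<l'. ?g (Suc j))"
      by (simp add: sum_negf[symmetric])
    also have "(\<Sum>j<l'. ?g (Suc j)) = (\<Sum>r\<le>l'. ?g r)"
      by (subst sum.atMost_shift) simp
    also have "\<dots> = (if l' \<le> i + 1 then (-1) ^ l' * int (i choose (i + 1 - l')) else 0)"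
      by (rule sum_alternating_binomial)
    finally have S: "(\<Sum>j<s'. (-1) ^ j * real (l' choose (j + 1)) * real ((i + (j + 1)) choose (i + 1)))
      = - (if l' \<le> i + 1 then (-1) ^ l' * real (i choose (i + 1 - l')) else 0)" by simp
    have "(\<Sum>j<s'. mix l i * mix l' j * ((-1) ^ j * fact (i + j + 1))) =
      (l choose (i+1)) * (i + 1) * - (if l' \<le> i + 1 then (-1) ^ l' * real (i choose (i + 1 - l')) else 0)"
      unfolding f sum_distrib_left[symmetric] S by simp
    also have "\<dots> = (if i + 1 = l \<and> l = l' then - ((-1) ^ l * real l) else 0)"
    proof (cases "l' \<le> i + 1 \<and> i + 1 \<le> l")
      case True
      then have "l' = i + 1" "l = i + 1" using l by auto
      then show ?thesis by simp
    next
      case False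
      then show ?thesis using l by (cases "i + 1 \<le> l") (auto simp: binomial_eq_0)
    qed
    finally show ?thesis .
  qed
  have "(\<Sum>i<s. \<Sum>j<s'. (-1) ^ (i + 1) * mix l i * mix l' j * ((-1) ^ j * fact (i + j + 1)))
    = (\<Sum>i<s. (-1) ^ (i + 1) * (\<Sum>j<s'. mix l i * mix l' j * ((-1) ^ j * fact (i + j + 1))))"
    by (simp add: sum_distrib_left mult.assoc)
  also have "\<dots> = (\<Sum>i<s. if i = l - 1 then (if l = l' then - real l else 0) else 0)"
  proof (rule sum.cong[OF refl])
    fix i assume i: "i \<in> {..<s}"
    show "(-1) ^ (i + 1) * (\<Sum>j<s'. mix l i * mix l' j * ((-1) ^ j * fact (i + j + 1))) =
      (if i = l - 1 then (if l = l' then - real l else 0) else 0)"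
    proof (cases "i + 1 = l \<and> l = l'")
      case True
      then have "(\<Sum>j<s'. mix l i * mix l' j * ((-1) ^ j * fact (i + j + 1))) = - ((-1) ^ l * real l)"
        using inner[of i] i by simp
      moreover have "(-1::real) ^ (i + 1) * (-1) ^ l = 1" using True by (simp flip: power_mult_distrib)
      ultimately show ?thesis using True by (auto simp: algebra_simps)
    next
      case False
      then have "(\<Sum>j<s'. mix l i * mix l' j * ((-1) ^ j * fact (i + j + 1))) = 0" using inner[of i] i by auto
      then show ?thesis using False l by auto
    qed
  qed
  also have "\<dots> = (if l = l' then - real l else 0)" using l by (subst sum.delta) auto
  finally show ?thesis .
qed

lemma mix_orthogonal:
  assumes l: "1 \<le> l" "1 \<le> l'" "l \<le> s" "l' \<le> s'"
  shows "(\<Sum>i<s. \<Sum>j<s'. (-1) ^ (i + 1) * mix l i * mix l' j * ((-1) ^ j * fact (i + j + 1))) = (if l = l' then - real l else 0)"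
proof (cases "l \<le> l'")
  case True
  then show ?thesis using mix_orthogonal_le[of l l' s s'] l by simp
next
  case False
  have "(\<Sum>i<s. \<Sum>j<s'. (-1) ^ (i + 1) * mix l i * mix l' j * ((-1) ^ j * fact (i + j + 1)))
      = (\<Sum>j<s'. \<Sum>i<s. (-1) ^ (j + 1) * mix l' j * mix l i * ((-1) ^ i * fact (j + i + 1)))"
    by (subst sum.swap) (simp add: ac_simps)
  also have "\<dots> = (if l' = l then - real l' else 0)" using mix_orthogonal_le[of l' l s' s] l False by simp
  finally show ?thesis by auto
qed

lemma row_coeff_neg: "row_coeff (- real l) n = (-1) ^ (n + 1) * mix l n"
proof -
  have "real (l choose (n + 1)) = (-1) ^ (n + 1) * pochhammer (- real l) (n + 1) / fact (n + 1)"
    by (simp only: binomial_gbinomial gbinomial_pochhammer)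
  moreover have "(-1::real) ^ (n + 1) * (-1) ^ (n + 1) = 1" by (simp flip: power_mult_distrib)
  ultimately show ?thesis by (simp add: row_coeff_def mix_def)
qed

text \<open>Expanding the i-th derivative at the right point around the left one puts the weight
  y^(n-i) / fact (n - i) on the n-th derivative; adding up these weights is Vandermonde's
  convolution.\<close>

lemma row_coeff_pos: "(\<Sum>i\<le>n. mix l i / fact (n - i)) = row_coeff (real l) n"
proof -
  have "(\<Sum>i\<le>n. mix l i / fact (n - i)) = (\<Sum>i\<le>n. real (l choose (i + 1)) * real (n choose (n - i))) / fact n"
  proof -
    have "mix l i / fact (n - i) = real (l choose (i + 1)) * real (n choose (n - i)) / fact n" if "i \<le> n" for i
      using that binomial_fact[of i n, where 'a=real] binomial_symmetric[of i n] by (simp add: mix_def field_simps)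
    then show ?thesis by (simp add: sum_divide_distrib)
  qed
  also have "(\<Sum>i\<le>n. real (l choose (i + 1)) * real (n choose (n - i))) = real ((l + n) choose (n + 1))"
  proof -
    have "(\<Sum>k\<le>n + 1. (l choose k) * (n choose (n + 1 - k))) = (l + n) choose (n + 1)" by (rule vandermonde)
    moreover have "(\<Sum>k\<le>Suc n. (l choose k) * (n choose (Suc n - k))) = (\<Sum>i\<le>n. (l choose Suc i) * (n choose (n - i)))"
      by (subst sum.atMost_Suc_shift) simp
    ultimately show ?thesis by (simp flip: of_nat_mult of_nat_sum)
  qed
  also have "real ((l + n) choose (n + 1)) = pochhammer (real l) (n + 1) / fact (n + 1)"
    by (simp add: binomial_gbinomial gbinomial_pochhammer' algebra_simps)
  finally show ?thesis by (simp add: row_coeff_def)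
qed

subsection \<open>Reversal of an interval\<close>

definition reversal :: "nat \<Rightarrow> nat \<Rightarrow> nat \<Rightarrow> nat" where
  "reversal lo k a = (if a \<in> {lo<..k} then lo + k + 1 - a else a)"

lemma reversal_permutes: "reversal lo k permutes {lo<..k}"
proof (rule bij_imp_permutes)
  show "bij_betw (reversal lo k) {lo<..k} {lo<..k}"
    by (rule bij_betw_byWitness[where f'="reversal lo k"]) (auto simp: reversal_def)
qed (auto simp: reversal_def)

text \<open>Reversing s = k - lo points has sign (-1)^(s(s-1)/2), and tri s = s(s+1)/2, so the two
  signs combine to (-1)^s. The induction peels off the transposition of the two end points.\<close>

lemma sign_reversal: "of_int (sign (reversal lo k)) * (-1) ^ tri (k - lo) = ((-1) ^ (k - lo) :: real)"
proof (induction "k - lo" arbitrary: lo k rule: less_induct)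
  case less
  show ?case
  proof (cases "k - lo < 2")
    case True
    then have "reversal lo k = id" by (auto simp: reversal_def fun_eq_iff)
    moreover have "k - lo = 0 \<or> k - lo = 1" using True by auto
    then have "tri (k - lo) = k - lo" by (auto simp: tri_def)
    ultimately show ?thesis by simp
  next
    case False
    then obtain n where n: "k - lo = n + 2" by (metis add.commute le_Suc_ex not_less)
    let ?t = "Transposition.transpose (lo + 1) k"
    let ?r = "reversal (lo + 1) (k - 1)"
    have e: "reversal lo k = ?t \<circ> ?r"
    proof
      fix a
      consider "a = lo + 1" | "a = k" | "lo + 1 < a" "a < k" | "a \<le> lo \<or> k < a" by linarith
      then show "reversal lo k a = (?t \<circ> ?r) a"
        by cases (use n in \<open>auto simp: reversal_def Transposition.transpose_def\<close>)
    qed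
    have P: "permutation ?r" using reversal_permutes permutation_permutes finite_greaterThanAtMost by blast
    have "lo + 1 \<noteq> k" using n by auto
    then have "sign (reversal lo k) = - sign ?r"
      unfolding e sign_compose[OF permutation_swap_id P] sign_swap_id by (simp only: if_False mult_minus1)
    moreover have "tri (k - lo) = tri n + 2 * n + 3" 
    proof -
      have "k - lo = Suc (Suc n)" using n by simp
      then have "tri (k - lo) = tri n + n + 1 + Suc n + 1" by (simp only: tri_Suc)
      then show ?thesis by simp
    qed
    moreover have "of_int (sign ?r) * (-1) ^ tri n = ((-1) ^ n :: real)"
    proof -
      have "k - 1 - (lo + 1) = n" using n by simp
      then show ?thesis using less.hyps[of "k - 1" "lo + 1"] n by simp
    qed
    ultimately show ?thesis using n by (simp add: power_add power_mult)
  qed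
qed

text \<open>A bijection of the interval preserves the sum of its points, so a pointwise bound by
  another bijection is an equality.\<close>

lemma bounded_inj_is_reversal:
  fixes w :: "nat \<Rightarrow> nat"
  assumes "inj_on w {lo<..k}" "\<And>a. a \<in> {lo<..k} \<Longrightarrow> w a \<in> {lo<..k}"
    and "\<And>a. a \<in> {lo<..k} \<Longrightarrow> w a \<le> reversal lo k a" and a: "a \<in> {lo<..k}"
  shows "w a = reversal lo k a"
proof (rule ccontr)
  assume ne: "w a \<noteq> reversal lo k a"
  have "bij_betw w {lo<..k} {lo<..k}"
    unfolding bij_betw_def using assms(1,2) by (intro conjI endo_inj_surj) auto
  then have "(\<Sum>a\<in>{lo<..k}. w a) = (\<Sum>a\<in>{lo<..k}. a)" by (rule sum.reindex_bij_betw)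
  also have "\<dots> = (\<Sum>a\<in>{lo<..k}. reversal lo k a)"
    by (rule sum.reindex_bij_betw[symmetric]) (rule permutes_imp_bij[OF reversal_permutes])
  finally have "(\<Sum>a\<in>{lo<..k}. w a) = (\<Sum>a\<in>{lo<..k}. reversal lo k a)" .
  moreover have "(\<Sum>a\<in>{lo<..k}. w a) < (\<Sum>a\<in>{lo<..k}. reversal lo k a)"
    by (rule sum_strict_mono_ex1) (use assms(3) a ne in \<open>auto intro!: bexI[of _ a] simp: order_less_le\<close>)
  ultimately show False by simp
qed

subsection \<open>Properties of skip_pairs\<close>

lemma skip_pairs_less: "1 \<le> k \<Longrightarrow> (\<And>l. l \<in> set ls \<Longrightarrow> 1 \<le> l) \<Longrightarrow> a < b \<Longrightarrow> skip_pairs k ls a < skip_pairs k ls b"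
proof (induction ls arbitrary: k)
  case (Cons l ls)
  have 1: "skip_pairs j ls a < skip_pairs j ls b" for j
  proof (cases "1 \<le> j")
    case True
    then show ?thesis using Cons by simp
  next
    case False
    \<comment> \<open>Subtraction truncates at 0, so from there on the recursion keeps the gap at
      0.\<close>
    have gen: "skip_pairs 0 ls' a < skip_pairs 0 ls' b" if "\<And>l. l \<in> set ls' \<Longrightarrow> 1 \<le> l" for ls'
      using that Cons.prems(3)
    proof (induction ls')
      case (Cons l ls')
      then have "skip_pairs 0 ls' a < skip_pairs 0 ls' b" "1 \<le> l" by auto
      then show ?case by (auto simp: skip_def)
    qed simp
    have "j = 0" using False by simp
    then show ?thesis using gen[of ls] Cons.prems by simp
  qed
  have "1 \<le> l" using Cons.prems by simp
  then show ?case using 1[of "k - 1"] by (auto simp: skip_def)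
qed simp

lemma skip_pairs_out:
  assumes "\<And>l. l \<in> set ls \<Longrightarrow> 1 \<le> l \<and> l + lo \<le> k \<and> k + l \<le> hi" "sorted_wrt (>) ls"
  shows "a \<le> lo \<Longrightarrow> skip_pairs k ls a = a" "hi < a + 2 * length ls \<Longrightarrow> skip_pairs k ls a = a + 2 * length ls"
proof -
  have "(a \<le> lo \<longrightarrow> skip_pairs k ls a = a) \<and> (hi < a + 2 * length ls \<longrightarrow> skip_pairs k ls a = a + 2 * length ls)"
    using assms
  proof (induction ls arbitrary: k hi)
    case (Cons l ls)
    have l: "1 \<le> l" "l + lo \<le> k" "k + l \<le> hi" using Cons.prems(1)[of l] by auto
    have lt: "l' < l" if "l' \<in> set ls" for l' using Cons.prems(2) that by simp
    have "(a \<le> lo \<longrightarrow> skip_pairs (k - 1) ls a = a) \<and> (hi - 2 < a + 2 * length ls \<longrightarrow> skip_pairs (k - 1) ls a = a + 2 * length ls)"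
    proof (rule Cons.IH)
      show "1 \<le> l' \<and> l' + lo \<le> k - 1 \<and> k - 1 + l' \<le> hi - 2" if "l' \<in> set ls" for l'
        using lt[OF that] Cons.prems(1)[of l'] that l by auto
    qed (use Cons.prems in auto)
    then show ?case using l by (auto simp: skip_def)
  qed simp
  then show "a \<le> lo \<Longrightarrow> skip_pairs k ls a = a" "hi < a + 2 * length ls \<Longrightarrow> skip_pairs k ls a = a + 2 * length ls" by auto
qed

text \<open>Each removed pair has one point on either side of the gap, so exactly
  \<open>length ls\<close> of the points up to \<open>k\<close> are missing.\<close>

lemma skip_pairs_le_iff:
  assumes "\<And>l. l \<in> set ls \<Longrightarrow> 1 \<le> l \<and> l \<le> k" "sorted_wrt (>) ls"
  shows "skip_pairs k ls a \<le> k \<longleftrightarrow> a + length ls \<le> k"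
  using assms
proof (induction ls arbitrary: k)
  case (Cons l ls)
  have l: "1 \<le> l" "l \<le> k" using Cons.prems(1)[of l] by auto
  have lt: "l' < l" if "l' \<in> set ls" for l' using Cons.prems(2) that by simp
  have "skip_pairs (k - 1) ls a \<le> k - 1 \<longleftrightarrow> a + length ls \<le> k - 1"
  proof (rule Cons.IH)
    show "1 \<le> l' \<and> l' \<le> k - 1" if "l' \<in> set ls" for l'
      using lt[OF that] Cons.prems(1)[of l'] that l by auto
  qed (use Cons.prems in auto)
  moreover have "skip_pairs k (l # ls) a \<le> k \<longleftrightarrow> skip_pairs (k - 1) ls a \<le> k - 1"
    using l by (auto simp: skip_def)
  ultimately show ?case using l by auto
qed simp

text \<open>Translation reduces the blocks to lo = 0, so that the limiting constant depends on the
  block sizes only.\<close>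

lemma skip_pairs_add:
  assumes "\<And>l. l \<in> set ls \<Longrightarrow> 1 \<le> l \<and> l \<le> k" "sorted_wrt (>) ls"
  shows "skip_pairs (k + c) ls (a + c) = skip_pairs k ls a + c"
  using assms
proof (induction ls arbitrary: k)
  case (Cons l ls)
  have l: "1 \<le> l" "l \<le> k" using Cons.prems(1)[of l] by auto
  have lt: "l' < l" if "l' \<in> set ls" for l' using Cons.prems(2) that by simp
  have "skip_pairs (k - 1 + c) ls (a + c) = skip_pairs (k - 1) ls a + c"
  proof (rule Cons.IH)
    show "1 \<le> l' \<and> l' \<le> k - 1" if "l' \<in> set ls" for l'
      using lt[OF that] Cons.prems(1)[of l'] that l by auto
  qed (use Cons.prems in auto)
  moreover have "k + c - 1 = k - 1 + c" using l by simp
  ultimately show ?case using l by (auto simp: skip_def)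
qed simp

lemma skip_pairs_mem:
  assumes "\<And>l. l \<in> set ls \<Longrightarrow> 1 \<le> l \<and> l + lo \<le> k \<and> k + l \<le> hi" "sorted_wrt (>) ls"
  shows "skip_pairs k ls a \<in> {lo<..hi} \<longleftrightarrow> a \<in> {lo<..hi - 2 * length ls}"
    and "l \<in> set ls \<Longrightarrow> skip_pairs k ls a \<noteq> k + 1 - l \<and> skip_pairs k ls a \<noteq> k + l"
proof -
  have "(skip_pairs k ls a \<in> {lo<..hi} \<longleftrightarrow> a \<in> {lo<..hi - 2 * length ls}) \<and>
    (\<forall>l\<in>set ls. skip_pairs k ls a \<noteq> k + 1 - l \<and> skip_pairs k ls a \<noteq> k + l)"
    using assms
  proof (induction ls arbitrary: k hi)
    case (Cons l ls)
    have l: "1 \<le> l" "l + lo \<le> k" "k + l \<le> hi" using Cons.prems(1)[of l] by auto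
    have lt: "l' < l" if "l' \<in> set ls" for l' using Cons.prems(2) that by simp
    let ?x = "skip_pairs (k - 1) ls a"
    have I: "(?x \<in> {lo<..hi - 2} \<longleftrightarrow> a \<in> {lo<..hi - 2 - 2 * length ls}) \<and>
      (\<forall>l\<in>set ls. ?x \<noteq> k - 1 + 1 - l \<and> ?x \<noteq> k - 1 + l)"
    proof (rule Cons.IH)
      show "1 \<le> l' \<and> l' + lo \<le> k - 1 \<and> k - 1 + l' \<le> hi - 2" if "l' \<in> set ls" for l'
        using lt[OF that] Cons.prems(1)[of l'] that l by auto
    qed (use Cons.prems in auto)
    have "skip (k + 1 - l) (k + l) ?x \<in> {lo<..hi} \<longleftrightarrow> ?x \<in> {lo<..hi - 2}" using l by (auto simp: skip_def)
    moreover have "skip (k + 1 - l) (k + l) ?x \<noteq> k + 1 - l \<and> skip (k + 1 - l) (k + l) ?x \<noteq> k + l"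
      using l by (intro skip_notin) auto
    moreover have "skip (k + 1 - l) (k + l) ?x \<noteq> k + 1 - l' \<and> skip (k + 1 - l) (k + l) ?x \<noteq> k + l'" if "l' \<in> set ls" for l'
    proof -
      have "?x \<noteq> k - 1 + 1 - l' \<and> ?x \<noteq> k - 1 + l'" using conjunct2[OF I] that by (rule bspec)
      moreover have "1 \<le> l'" using Cons.prems(1)[of l'] that by simp
      ultimately show ?thesis using lt[OF that] l by (auto simp: skip_def)
    qed
    ultimately show ?case using I by (auto simp: diff_diff_eq)
  qed simp
  then show "skip_pairs k ls a \<in> {lo<..hi} \<longleftrightarrow> a \<in> {lo<..hi - 2 * length ls}"
    and "l \<in> set ls \<Longrightarrow> skip_pairs k ls a \<noteq> k + 1 - l \<and> skip_pairs k ls a \<noteq> k + l" by blast+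
qed

section \<open>The concrete kernel and the limit of two merging blocks\<close>

subsection \<open>The derivatives of the kernel\<close>

text \<open>\<open>kernel_deriv p q (x - y)\<close> is the derivative of order \<open>p\<close> in \<open>x\<close> and \<open>q\<close> in \<open>y\<close> of \<open>1 / (pi * (x - y)\<^sup>2)\<close>.\<close>

definition kernel_deriv :: "nat \<Rightarrow> nat \<Rightarrow> real \<Rightarrow> real" where
  "kernel_deriv p q z = (-1) ^ p * fact (p + q + 1) / (pi * z ^ (p + q + 2))"

lemma kernel_deriv_flip: "kernel_deriv p q (x - y) = kernel_deriv q p (y - x)"
proof -
  have "(x - y) ^ (p + q + 2) = (-1) ^ (p + q) * (y - x) ^ (p + q + 2)"
    using power_minus[of "y - x" "p + q + 2"] by (simp add: power_add)
  moreover have "(-1::real) ^ p / (-1) ^ (p + q) = (-1) ^ q"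
    by (cases "even p"; cases "even q") (simp_all add: power_add)
  moreover have "a * G / (pi * (b * Z)) = a / b * G / (pi * Z)" for a b G Z :: real
    by (simp add: divide_inverse mult_ac)
  ultimately show ?thesis
    by (simp only: kernel_deriv_def add.commute[of q p])
qed

lemma kernel_deriv_DERIV:
  assumes "t \<noteq> x"
  shows "((\<lambda>t. kernel_deriv p q (t - x)) has_real_derivative kernel_deriv (Suc p) q (t - x)) (at t)"
proof -
  have *: "((\<lambda>t. C / (t - x) ^ Suc n) has_real_derivative - (C * real (Suc n)) / (t - x) ^ Suc (Suc n)) (at t)"
    for C :: real and n
  proof -
    have "((\<lambda>t. (t - x) ^ Suc n) has_real_derivative (1 + real n) * ((1 - 0) * (t - x) ^ n)) (at t)"
      by (intro DERIV_power_Suc DERIV_diff DERIV_ident DERIV_const)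
    then have "((\<lambda>t. (t - x) ^ Suc n) has_real_derivative real (Suc n) * (t - x) ^ n) (at t)" by simp
    then have "((\<lambda>t. C / (t - x) ^ Suc n) has_real_derivative
        (0 * (t - x) ^ Suc n - C * (real (Suc n) * (t - x) ^ n)) / ((t - x) ^ Suc n * (t - x) ^ Suc n)) (at t)"
      using assms by (intro DERIV_divide DERIV_const) auto
    moreover have "(0 * (t - x) ^ Suc n - C * (real (Suc n) * (t - x) ^ n)) / ((t - x) ^ Suc n * (t - x) ^ Suc n)
        = - (C * real (Suc n)) / (t - x) ^ Suc (Suc n)"
    proof -
      have "(t - x) ^ n \<noteq> 0" using assms by simp
      then show ?thesis by (simp add: divide_simps)
    qed
    ultimately show ?thesis by simp
  qed
  have e: "kernel_deriv r q z = (-1) ^ r * fact (r + q + 1) / pi / z ^ Suc (r + q + 1)" for r z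
    by (simp add: kernel_deriv_def)
  have H: "- ((-1) ^ p * fact (p + q + 1) / pi * real (Suc (p + q + 1))) = (-1) ^ Suc p * fact (Suc p + q + 1) / pi"
    by (simp add: field_simps)
  have S: "Suc p + q + 1 = Suc (p + q + 1)" by simp
  show ?thesis using *[of "(-1) ^ p * fact (p + q + 1) / pi" "p + q + 1"] unfolding e H unfolding S .
qed

lemma kernel_deriv_tendsto:
  assumes "(f \<longlongrightarrow> \<xi>) F" "\<xi> \<noteq> x"
  shows "((\<lambda>t. kernel_deriv p q (f t - x)) \<longlongrightarrow> kernel_deriv p q (\<xi> - x)) F"
  unfolding kernel_deriv_def using assms by (intro tendsto_intros) auto

abbreviation fusion_filter :: "real \<Rightarrow> (real \<times> real) filter" where
  "fusion_filter \<xi> \<equiv> at (\<xi>, \<xi>) within {(u, v). u < v}"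

lemma fusion_filter:
  shows fusion_filter_less: "eventually (\<lambda>p. fst p < snd p) (fusion_filter \<xi>)"
    and fusion_filter_fst: "(fst \<longlongrightarrow> \<xi>) (fusion_filter \<xi>)"
    and fusion_filter_snd: "(snd \<longlongrightarrow> \<xi>) (fusion_filter \<xi>)"
    and fusion_filter_diff: "((\<lambda>p. snd p - fst p) \<longlongrightarrow> 0) (fusion_filter \<xi>)"
proof -
  show "eventually (\<lambda>p. fst p < snd p) (fusion_filter \<xi>)"
    unfolding eventually_at_filter by (rule always_eventually) auto
  show 1: "(fst \<longlongrightarrow> \<xi>) (fusion_filter \<xi>)"
    using tendsto_fst[OF tendsto_ident_at[of "(\<xi>, \<xi>)" "{(u, v). u < v}"]] by simp
  show 2: "(snd \<longlongrightarrow> \<xi>) (fusion_filter \<xi>)"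
    using tendsto_snd[OF tendsto_ident_at[of "(\<xi>, \<xi>)" "{(u, v). u < v}"]] by simp
  show "((\<lambda>p. snd p - fst p) \<longlongrightarrow> 0) (fusion_filter \<xi>)"
    using tendsto_diff[OF 2 1] by simp
qed

text \<open>Lagrange's form of the remainder has an intermediate point between the two coordinates,
  which is squeezed to \<xi>. The result is a joint limit in both variables, as the filter
  demands.\<close>

lemma taylor_remainder:
  assumes x: "\<xi> \<noteq> x" and r: "0 < r"
  shows "((\<lambda>p. (kernel_deriv i q (snd p - x) - (\<Sum>j<r. kernel_deriv (i + j) q (fst p - x) * (snd p - fst p) ^ j / fact j))
    / (snd p - fst p) ^ r) \<longlongrightarrow> kernel_deriv (i + r) q (\<xi> - x) / fact r) (fusion_filter \<xi>)"
proof -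
  let ?f = "\<lambda>p. (kernel_deriv i q (snd p - x) - (\<Sum>j<r. kernel_deriv (i + j) q (fst p - x) * (snd p - fst p) ^ j / fact j))
    / (snd p - fst p) ^ r"
  define good where "good p t \<longleftrightarrow> fst p < t \<and> t < snd p \<and> ?f p = kernel_deriv (i + r) q (t - x) / fact r" for p t
  have ex: "eventually (\<lambda>p. \<exists>t. good p t) (fusion_filter \<xi>)"
  proof -
    have side: "eventually (\<lambda>p. x \<notin> {fst p..snd p}) (fusion_filter \<xi>)"
    proof (cases "\<xi> < x")
      case True
      then have "eventually (\<lambda>p. snd p < x) (fusion_filter \<xi>)" using order_tendstoD(2)[OF fusion_filter_snd] by blast
      then show ?thesis by eventually_elim auto
    next
      case False
      then have "eventually (\<lambda>p. x < fst p) (fusion_filter \<xi>)" using order_tendstoD(1)[OF fusion_filter_fst] x by auto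
      then show ?thesis by eventually_elim auto
    qed
    show ?thesis
      using side fusion_filter_less
    proof eventually_elim
      case (elim p)
      have "\<exists>t. (if snd p < fst p then snd p < t \<and> t < fst p else fst p < t \<and> t < snd p) \<and>
        kernel_deriv i q (snd p - x) = (\<Sum>j<r. kernel_deriv (i + j) q (fst p - x) / fact j * (snd p - fst p) ^ j)
          + kernel_deriv (i + r) q (t - x) / fact r * (snd p - fst p) ^ r"
      proof (rule Taylor[where a="fst p" and b="snd p"])
        show "\<forall>m t. m < r \<and> fst p \<le> t \<and> t \<le> snd p \<longrightarrow> DERIV (\<lambda>t. kernel_deriv (i + m) q (t - x)) t :> kernel_deriv (i + Suc m) q (t - x)"
          using kernel_deriv_DERIV elim by auto
      qed (use r elim in auto)
      then obtain t where "fst p < t" "t < snd p" and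
        "kernel_deriv i q (snd p - x) = (\<Sum>j<r. kernel_deriv (i + j) q (fst p - x) / fact j * (snd p - fst p) ^ j)
          + kernel_deriv (i + r) q (t - x) / fact r * (snd p - fst p) ^ r" using elim by auto
      then have "good p t" using elim by (simp add: good_def)
      then show ?case by blast
    qed
  qed
  define t where "t p = (SOME t. good p t)" for p
  have g: "eventually (\<lambda>p. good p (t p)) (fusion_filter \<xi>)"
    using ex by eventually_elim (auto simp: t_def intro: someI_ex)
  have "(t \<longlongrightarrow> \<xi>) (fusion_filter \<xi>)"
    by (rule tendsto_sandwich[OF _ _ fusion_filter_fst fusion_filter_snd]; use g in eventually_elim) (auto simp: good_def)
  then have "((\<lambda>p. kernel_deriv (i + r) q (t p - x) / fact r) \<longlongrightarrow> kernel_deriv (i + r) q (\<xi> - x) / fact r) (fusion_filter \<xi>)"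
    by (intro tendsto_divide kernel_deriv_tendsto tendsto_const x) auto
  moreover have "eventually (\<lambda>p. kernel_deriv (i + r) q (t p - x) / fact r = ?f p) (fusion_filter \<xi>)"
    using g by eventually_elim (simp add: good_def)
  ultimately show ?thesis by (rule Lim_transform_eventually)
qed

subsection \<open>Fusion of two blocks for an arbitrary pattern\<close>

text \<open>The value 0 is left out: the gap lies between \<open>k\<close>, with offset -1, and
  \<open>k + 1\<close>, with offset 1.\<close>

definition offset :: "nat \<Rightarrow> nat \<Rightarrow> real" where
  "offset k a = (if a \<le> k then - real (k + 1 - a) else real (a - k))"

definition desc :: "nat set \<Rightarrow> nat list" where
  "desc I = rev (sorted_list_of_set I)"

text \<open>The contribution of a set \<open>I\<close> of coupled pairs: their couplings times the
  determinant of the Taylor coefficients of the \<open>L\<close> remaining rows, in the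
  normalisation lo = 0, k = s.\<close>

definition pair_weight :: "nat \<Rightarrow> nat \<Rightarrow> nat set \<Rightarrow> real" where
  "pair_weight s L I = (\<Prod>l\<in>I. - (real l / pi)) *
     gdet {..<L} id (\<lambda>i n. row_coeff (offset s (skip_pairs s (desc I) (1 + i))) n)"

text \<open>The diagonal of the triangular row transformation on a block of size \<open>s\<close>,
  powers of y and signs apart.\<close>

definition fusion_norm :: "nat \<Rightarrow> real" where
  "fusion_norm s = (\<Prod>l=1..s. 1 / fact (l - 1))"

text \<open>The prefactor undoes the row transformation; its sign (-1)^s stems from the left block
  alone. The sum runs over all choices of \<open>m\<close> coupled pairs.\<close>

definition fusion_const :: "nat \<Rightarrow> nat \<Rightarrow> nat \<Rightarrow> real" where
  "fusion_const s s' m = (-1) ^ s / (fusion_norm s * fusion_norm s') *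
     (\<Sum>I | I \<subseteq> {1..min s s'} \<and> card I = m. pair_weight s (s + s' - 2*m) I)"

lemma fusion_norm_pos: "0 < fusion_norm s"
  unfolding fusion_norm_def by (intro prod_pos) auto

lemma desc:
  assumes "finite I"
  shows "set (desc I) = I" "sorted_wrt (>) (desc I)" "length (desc I) = card I" "prod_list (map f (desc I)) = (\<Prod>l\<in>I. f l :: real)"
proof -
  show 1: "set (desc I) = I" "length (desc I) = card I" using assms by (simp_all add: desc_def)
  show "sorted_wrt (>) (desc I)" using assms by (simp add: desc_def sorted_wrt_rev strict_sorted_list_of_set)
  have "distinct (desc I)" using assms by (simp add: desc_def)
  then show "prod_list (map f (desc I)) = (\<Prod>l\<in>I. f l)" using 1 prod.distinct_set_conv_list[of "desc I" f] by simp
qed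

text \<open>The couplings give (-1)^m, and the s - m uncoupled rows left of the gap have negative
  offsets and give (-1)^(s-m). Against (-1)^s all signs cancel, whichever \<open>I\<close> is
  taken.\<close>

lemma pair_weight_sign:
  assumes I: "I \<subseteq> {1..min s s'}" and m: "card I = m"
  shows "0 \<le> (-1) ^ s * pair_weight s (s + s' - 2*m) I"
proof -
  let ?L = "s + s' - 2*m"
  have fI: "finite I" using I finite_subset by blast
  note D = desc[OF fI]
  have ms: "m \<le> min s s'" using card_mono[OF _ I] m by simp
  have l: "1 \<le> l \<and> l \<le> s" if "l \<in> set (desc I)" for l using that D(1) I by auto
  let ?x = "\<lambda>i. skip_pairs s (desc I) (1 + i)"
  let ?\<mu> = "\<lambda>i. offset s (?x i)"
  have inc: "?x i < ?x j" if "i < j" for i j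
  proof (cases "s = 0")
    case True
    then have "desc I = []" using l by (cases "desc I") auto
    then show ?thesis using that by simp
  next
    case False
    then show ?thesis by (intro skip_pairs_less) (use l that in auto)
  qed
  have omono: "offset s a < offset s b" if "a < b" for a b using that by (auto simp: offset_def)
  obtain g where g: "g > 0" "gdet {..<?L} id (\<lambda>i n. row_coeff (?\<mu> i) n) = (\<Prod>i<?L. ?\<mu> i) * g"
    using gdet_row_coeff[of ?L ?\<mu>] omono[OF inc] by blast
  have neg: "?x i \<le> s \<longleftrightarrow> i < s - m" for i
    using skip_pairs_le_iff[OF l D(2), of "1 + i"] D(3) m by auto
  have "(\<Prod>i<?L. ?\<mu> i) = (\<Prod>i<s - m. ?\<mu> i) * (\<Prod>i\<in>{s - m..<?L}. ?\<mu> i)"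
  proof -
    have "{..<?L} = {..<s - m} \<union> {s - m..<?L}" using ms by auto
    then show ?thesis by (simp add: prod.union_disjoint ivl_disj_int)
  qed
  also have "(\<Prod>i<s - m. ?\<mu> i) = (-1) ^ (s - m) * (\<Prod>i<s - m. - ?\<mu> i)"
  proof -
    have "(\<Prod>i<s - m. ?\<mu> i) = (\<Prod>i<s - m. (-1) * - ?\<mu> i)" by simp
    then show ?thesis by (simp only: prod.distrib) simp
  qed
  finally have P: "(\<Prod>i<?L. ?\<mu> i) = (-1) ^ (s - m) * ((\<Prod>i<s - m. - ?\<mu> i) * (\<Prod>i\<in>{s - m..<?L}. ?\<mu> i))" by simp
  have "(\<Prod>i<s - m. - ?\<mu> i) \<ge> 0" by (rule prod_nonneg) (use neg in \<open>auto simp: offset_def\<close>)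
  moreover have "(\<Prod>i\<in>{s - m..<?L}. ?\<mu> i) \<ge> 0" by (rule prod_nonneg) (use neg in \<open>auto simp: offset_def\<close>)
  moreover have "(\<Prod>l\<in>I. - (real l / pi)) = (-1) ^ m * (\<Prod>l\<in>I. real l / pi)"
  proof -
    have "(\<Prod>l\<in>I. - (real l / pi)) = (\<Prod>l\<in>I. (-1) * (real l / pi))" by simp
    then show ?thesis using m by (simp only: prod.distrib) simp
  qed
  moreover have "(\<Prod>l\<in>I. real l / pi) \<ge> 0" by (rule prod_nonneg) auto
  moreover have "(-1::real) ^ s * ((-1) ^ m * (-1) ^ (s - m)) = 1"
    using ms by (simp flip: power_add add: mult_2[symmetric])
  ultimately obtain a b c :: real where "0 \<le> a" "0 \<le> b" "0 \<le> c" "(-1::real) ^ s * ((-1) ^ m * (-1) ^ (s - m)) = 1"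
    and "(\<Prod>i<s - m. - ?\<mu> i) = a" "(\<Prod>i\<in>{s - m..<?L}. ?\<mu> i) = b" "(\<Prod>l\<in>I. - (real l / pi)) = (-1) ^ m * c"
    by blast
  moreover have "(-1) ^ s * ((-1) ^ m * c * ((-1) ^ (s - m) * (a * b) * g)) =
    ((-1::real) ^ s * ((-1) ^ m * (-1) ^ (s - m))) * (c * (a * b) * g)" by (simp only: mult_ac)
  ultimately have "(-1) ^ s * pair_weight s ?L I = c * (a * b) * g"
    unfolding pair_weight_def g(2) P by (simp only: mult_1)
  then show ?thesis using \<open>0 \<le> a\<close> \<open>0 \<le> b\<close> \<open>0 \<le> c\<close> g(1) by simp
qed

lemma fusion_const_nonneg: "0 \<le> fusion_const s s' m"
proof -
  have "fusion_const s s' m = 1 / (fusion_norm s * fusion_norm s') *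
     (\<Sum>I | I \<subseteq> {1..min s s'} \<and> card I = m. (-1) ^ s * pair_weight s (s + s' - 2*m) I)"
    by (simp add: fusion_const_def sum_distrib_left)
  moreover have "0 \<le> (\<Sum>I | I \<subseteq> {1..min s s'} \<and> card I = m. (-1) ^ s * pair_weight s (s + s' - 2*m) I)"
    by (rule sum_nonneg) (use pair_weight_sign in blast)
  moreover have "0 \<le> 1 / (fusion_norm s * fusion_norm s')"
    using fusion_norm_pos[of s] fusion_norm_pos[of s'] by simp
  ultimately show ?thesis by (simp only: mult_nonneg_nonneg)
qed

text \<open>The pair \<open>p\<close> holds the two merging points. Towards the blocks an outer
  index \<open>b\<close> enters only through its point \<open>x b\<close> and its derivative order
  \<open>q b\<close>; the kernel \<open>Ko\<close> among outer indices may be any symmetric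
  one.\<close>

locale fusion =
  fixes N lo k hi m :: nat and \<alpha> :: "nat set set" and q :: "nat \<Rightarrow> nat" and x :: "nat \<Rightarrow> real" and \<xi> :: real
    and Ko :: "nat \<Rightarrow> nat \<Rightarrow> real" and K :: "real \<times> real \<Rightarrow> nat \<Rightarrow> nat \<Rightarrow> real"
  assumes blocks: "two_blocks N \<alpha> lo k hi"
    and m: "m = cross_links \<alpha> lo k hi"
    and Ksym: "\<And>p a b. K p a b = K p b a"
    and KPP: "\<And>p a b. a \<in> {lo<..k} \<Longrightarrow> b \<in> {lo<..k} \<Longrightarrow> K p a b = 0"
    and KQQ: "\<And>p a b. a \<in> {k<..hi} \<Longrightarrow> b \<in> {k<..hi} \<Longrightarrow> K p a b = 0"
    and KPQ: "\<And>p a b. a \<in> {lo<..k} \<Longrightarrow> b \<in> {k<..hi} \<Longrightarrow> fst p < snd p \<Longrightarrow>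
      K p a b = kernel_deriv (a - lo - 1) (b - k - 1) (fst p - snd p)"
    and KPO: "\<And>p a b. a \<in> {lo<..k} \<Longrightarrow> b \<in> {1..2*N} - {lo<..hi} \<Longrightarrow> K p a b = kernel_deriv (a - lo - 1) (q b) (fst p - x b)"
    and KQO: "\<And>p a b. a \<in> {k<..hi} \<Longrightarrow> b \<in> {1..2*N} - {lo<..hi} \<Longrightarrow> K p a b = kernel_deriv (a - k - 1) (q b) (snd p - x b)"
    and KOO: "\<And>p a b. a \<in> {1..2*N} - {lo<..hi} \<Longrightarrow> b \<in> {1..2*N} - {lo<..hi} \<Longrightarrow> K p a b = Ko a b"
    and Kosym: "\<And>a b. Ko a b = Ko b a"
    and x: "\<And>b. b \<in> {1..2*N} - {lo<..hi} \<Longrightarrow> \<xi> \<noteq> x b"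
begin

abbreviation "P \<equiv> {lo<..k}"
abbreviation "Q \<equiv> {k<..hi}"
abbreviation "Inn \<equiv> {lo<..hi}"
abbreviation "Out \<equiv> {1..2*N} - {lo<..hi}"
abbreviation "s \<equiv> k - lo"
abbreviation "s' \<equiv> hi - k"
abbreviation "y p \<equiv> snd p - (fst p :: real)"

lemma A: "\<alpha> \<in> NC N" and order: "lo \<le> k" "k \<le> hi" "hi \<le> 2*N"
  using blocks by (auto simp: two_blocks_def)

lemma Inn_PQ: "Inn = P \<union> Q" using order by auto
lemma PQ_disjoint: "a \<in> P \<Longrightarrow> a \<notin> Q" by auto

definition "Bl a = (if a \<in> P then P else if a \<in> Q then Q else {a})"
text \<open>A row uses derivative orders smaller than its distance to the gap. In the left block the
  distance decreases with the index while the order increases, so the transformation is triangular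
  there only after a reversal.\<close>

definition "Mx p a c = (if a \<in> P then (-1) ^ (c - lo) * mix (k + 1 - a) (c - lo - 1) * y p ^ (c - lo)
   else if a \<in> Q then mix (a - k) (c - k - 1) * y p ^ (c - k) else 1)"
definition "K1 p a b = (\<Sum>c\<in>Bl a. \<Sum>d\<in>Bl b. Mx p a c * Mx p b d * K p c d)"

lemma K1_sym: "K1 p a b = K1 p b a"
  unfolding K1_def by (subst sum.swap) (simp add: Ksym mult_ac)

lemma K1_PP: "a \<in> P \<Longrightarrow> b \<in> P \<Longrightarrow> K1 p a b = 0"
  unfolding K1_def Bl_def by (simp add: KPP)

lemma K1_QQ: "a \<in> Q \<Longrightarrow> b \<in> Q \<Longrightarrow> K1 p a b = 0"
  unfolding K1_def Bl_def by (simp add: KQQ)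

lemma K1_OO: "a \<in> Out \<Longrightarrow> b \<in> Out \<Longrightarrow> K1 p a b = Ko a b"
proof -
  assume ab: "a \<in> Out" "b \<in> Out"
  then have "a \<notin> P" "a \<notin> Q" "b \<notin> P" "b \<notin> Q" using order by auto
  then show "K1 p a b = Ko a b" unfolding K1_def Bl_def Mx_def using KOO[OF ab, of p] by (simp del: greaterThanAtMost_iff)
qed

lemma sum_block: "(\<Sum>c\<in>{l<..h}. f c) = (\<Sum>i<h - l. f (l + 1 + i))" for f :: "nat \<Rightarrow> real" and l h :: nat
  by (rule sum.reindex_bij_witness[where i="\<lambda>i. l + 1 + i" and j="\<lambda>c. c - l - 1"]) auto

lemma K1_PO:
  assumes a: "a \<in> P" and b: "b \<in> Out"
  shows "K1 p a b = (\<Sum>i<s. row_coeff (offset k a) i * y p ^ (i + 1) * kernel_deriv i (q b) (fst p - x b))"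
proof -
  have b': "b \<notin> P" "b \<notin> Q" using b order by auto
  have "K1 p a b = (\<Sum>c\<in>P. Mx p a c * K p c b)"
    unfolding K1_def Bl_def using a b' by (simp add: Mx_def del: greaterThanAtMost_iff)
  also have "\<dots> = (\<Sum>i<s. Mx p a (lo + 1 + i) * K p (lo + 1 + i) b)" by (rule sum_block)
  also have "\<dots> = (\<Sum>i<s. row_coeff (offset k a) i * y p ^ (i + 1) * kernel_deriv i (q b) (fst p - x b))"
  proof (rule sum.cong[OF refl])
    fix i assume i: "i \<in> {..<s}"
    have "lo + 1 + i \<in> P" using i by auto
    then have "K p (lo + 1 + i) b = kernel_deriv i (q b) (fst p - x b)" using KPO[OF _ b, of "lo + 1 + i" p] by simp
    moreover have "offset k a = - real (k + 1 - a)" using a by (simp add: offset_def)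
    then have "row_coeff (offset k a) i = (-1) ^ (i + 1) * mix (k + 1 - a) i" by (simp only: row_coeff_neg)
    ultimately show "Mx p a (lo + 1 + i) * K p (lo + 1 + i) b =
        row_coeff (offset k a) i * y p ^ (i + 1) * kernel_deriv i (q b) (fst p - x b)"
      using a by (simp add: Mx_def)
  qed
  finally show ?thesis .
qed

lemma K1_QO:
  assumes a: "a \<in> Q" and b: "b \<in> Out"
  shows "K1 p a b = (\<Sum>i<s'. mix (a - k) i * y p ^ (i + 1) * kernel_deriv i (q b) (snd p - x b))"
proof -
  have b': "b \<notin> P" "b \<notin> Q" and a': "a \<notin> P" using a b order by auto
  have "K1 p a b = (\<Sum>c\<in>Q. Mx p a c * K p c b)"
    unfolding K1_def Bl_def using a a' b' by (simp add: Mx_def del: greaterThanAtMost_iff)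
  also have "\<dots> = (\<Sum>i<s'. Mx p a (k + 1 + i) * K p (k + 1 + i) b)" by (rule sum_block)
  also have "\<dots> = (\<Sum>i<s'. mix (a - k) i * y p ^ (i + 1) * kernel_deriv i (q b) (snd p - x b))"
  proof (rule sum.cong[OF refl])
    fix i assume i: "i \<in> {..<s'}"
    have "k + 1 + i \<in> Q" using i by auto
    then have "K p (k + 1 + i) b = kernel_deriv i (q b) (snd p - x b)" using KQO[OF _ b, of "k + 1 + i" p] by simp
    then show "Mx p a (k + 1 + i) * K p (k + 1 + i) b = mix (a - k) i * y p ^ (i + 1) * kernel_deriv i (q b) (snd p - x b)"
      using a a' by (simp add: Mx_def)
  qed
  finally show ?thesis .
qed

text \<open>The row transformation diagonalises the coupling between the two blocks.\<close>

lemma K1_PQ: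
  assumes a: "a \<in> P" and b: "b \<in> Q" and p: "fst p < snd p"
  shows "K1 p a b = (if k + 1 - a = b - k then - (real (b - k) / pi) else 0)"
proof -
  have n: "a \<notin> Q" "b \<notin> P" using a b by auto
  let ?l = "k + 1 - a" and ?l' = "b - k"
  have "K1 p a b = (\<Sum>c\<in>P. \<Sum>d\<in>Q. Mx p a c * Mx p b d * K p c d)"
    unfolding K1_def Bl_def using a b n by (simp del: greaterThanAtMost_iff)
  also have "\<dots> = (\<Sum>i<s. \<Sum>j<s'. Mx p a (lo + 1 + i) * Mx p b (k + 1 + j) * K p (lo + 1 + i) (k + 1 + j))"
    by (simp only: sum_block)
  also have "\<dots> = (\<Sum>i<s. \<Sum>j<s'. ((-1) ^ (i + 1) * mix ?l i * mix ?l' j * ((-1) ^ j * fact (i + j + 1))) / pi)"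
  proof (intro sum.cong refl)
    fix i j assume ij: "i \<in> {..<s}" "j \<in> {..<s'}"
    have "lo + 1 + i \<in> P" "k + 1 + j \<in> Q" using ij by auto
    then have K: "K p (lo + 1 + i) (k + 1 + j) = kernel_deriv i j (fst p - snd p)" using KPQ[OF _ _ p] by simp
    have pw: "(fst p - snd p) ^ (i + j + 2) = (-1) ^ (i + j) * y p ^ (i + j + 2)"
      using power_minus[of "y p" "i + j + 2"] by (simp add: power_add)
    have sg: "(-1::real) ^ i / (-1) ^ (i + j) = (-1) ^ j"
      by (cases "even i"; cases "even j") (simp_all add: power_add)
    have kd: "y p ^ (i + j + 2) * kernel_deriv i j (fst p - snd p) = (-1) ^ j * fact (i + j + 1) / pi"
    proof -
      have "Z * (S * G / (pi * (T * Z))) = S / T * G / pi" if "Z \<noteq> 0" for Z S T G :: real using that by simp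
      from this[of "y p ^ (i + j + 2)"] show ?thesis unfolding kernel_deriv_def pw sg[symmetric] using p by simp
    qed
    have "Mx p a (lo + 1 + i) * Mx p b (k + 1 + j) = (-1) ^ (i + 1) * mix ?l i * mix ?l' j * y p ^ (i + j + 2)"
      using a b n by (simp add: Mx_def power_add mult_ac power2_eq_square)
    then have "Mx p a (lo + 1 + i) * Mx p b (k + 1 + j) * K p (lo + 1 + i) (k + 1 + j)
      = (-1) ^ (i + 1) * mix ?l i * mix ?l' j * (y p ^ (i + j + 2) * kernel_deriv i j (fst p - snd p))"
      unfolding K by (simp only: mult.assoc)
    then show "Mx p a (lo + 1 + i) * Mx p b (k + 1 + j) * K p (lo + 1 + i) (k + 1 + j) =
        ((-1) ^ (i + 1) * mix ?l i * mix ?l' j * ((-1) ^ j * fact (i + j + 1))) / pi"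
      unfolding kd by simp
  qed
  also have "\<dots> = (\<Sum>i<s. \<Sum>j<s'. (-1) ^ (i + 1) * mix ?l i * mix ?l' j * ((-1) ^ j * fact (i + j + 1))) / pi"
    by (simp only: sum_divide_distrib)
  also have "\<dots> = (if ?l = ?l' then - real ?l else 0) / pi"
    by (subst mix_orthogonal) (use a b in auto)
  finally show ?thesis by auto
qed

text \<open>Alternation kills every selection of rows that is not injective on each block.
  Triangularity bounds a selection with nonzero weight by the reversal on the left block and by the
  identity on the right one. So one term survives: the product of the diagonal entries with the sign
  of the reversal.\<close>

lemma Zp_K1:
  "Zp N \<alpha> (K1 p) = (-1) ^ s * (fusion_norm s * fusion_norm s') * y p ^ (tri s + tri s') * Zp N \<alpha> (K p)"
proof -
  define w0 where "w0 = restrict (reversal lo k) {1..2*N}"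
  let ?T = "\<lambda>w. (\<Prod>c\<in>{1..2*N}. Mx p c (w c)) * Zp N \<alpha> (\<lambda>a b. K p (w a) (w b))"
  have PN: "P \<subseteq> {1..2*N}" "Q \<subseteq> {1..2*N}" using order by auto
  have rev_in: "reversal lo k a \<in> P" if "a \<in> P" for a
    using permutes_in_image[OF reversal_permutes, of lo k a] that by blast
  have rev_out: "reversal lo k a = a" if "a \<notin> P" for a
    using that by (simp add: reversal_def del: greaterThanAtMost_iff)
  have w0: "w0 \<in> PiE {1..2*N} Bl"
    unfolding w0_def using rev_in rev_out by (intro restrict_PiE_iff[THEN iffD2]) (simp add: Bl_def del: greaterThanAtMost_iff)
  have "Zp N \<alpha> (K1 p) = (\<Sum>w\<in>PiE {1..2*N} Bl. ?T w)"
    by (rule Zp_expand) (auto simp: K1_def Bl_def)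
  also have "\<dots> = (\<Sum>w\<in>{w0}. ?T w)"
  proof (rule sum.mono_neutral_right)
    show "finite (PiE {1..2*N} Bl)" by (intro finite_PiE) (auto simp: Bl_def)
    show "{w0} \<subseteq> PiE {1..2*N} Bl" using w0 by simp
    show "\<forall>w\<in>PiE {1..2*N} Bl - {w0}. ?T w = 0"
    proof (intro ballI, rule ccontr)
      fix w assume w: "w \<in> PiE {1..2*N} Bl - {w0}" and nz: "?T w \<noteq> 0"
      have wB: "w a \<in> Bl a" if "a \<in> {1..2*N}" for a using w that by (meson DiffD1 PiE_mem)
      have wP: "w a \<in> P" if "a \<in> P" for a using wB[of a] that PN unfolding Bl_def by (metis subsetD)
      have wQ: "w a \<in> Q" if "a \<in> Q" for a using wB[of a] that PN PQ_disjoint unfolding Bl_def by (metis subsetD)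
      have inj: "inj_on w {l<..h}" if n: "no_short_links \<alpha> l h" "h \<le> 2*N" and z: "\<And>a b. a \<in> {l<..h} \<Longrightarrow> b \<in> {l<..h} \<Longrightarrow> K p (w a) (w b) = 0" for l h
      proof (rule linorder_inj_onI)
        fix a b assume ab: "a < b" "a \<in> {l<..h}" "b \<in> {l<..h}"
        show "w a \<noteq> w b"
        proof
          assume e: "w a = w b"
          have "Zp N \<alpha> (\<lambda>a b. K p (w a) (w b)) = 0"
            by (rule Zp_twin_zero[OF A n(2,1), of a b]) (use ab e Ksym in auto)
          then show False using nz by simp
        qed
      qed auto
      have iP: "inj_on w P" by (rule inj[OF two_blocks_short(1)[OF blocks]]) (use order wP KPP in auto)
      have iQ: "inj_on w Q" by (rule inj[OF two_blocks_short(2)[OF blocks]]) (use order wQ KQQ in auto)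
      have Mnz: "Mx p a (w a) \<noteq> 0" if "a \<in> {1..2*N}" for a using nz that by auto
      have bP: "w a = reversal lo k a" if "a \<in> P" for a
      proof (rule bounded_inj_is_reversal[OF iP wP _ that])
        fix a assume a: "a \<in> P"
        have "mix (k + 1 - a) (w a - lo - 1) \<noteq> 0" using Mnz[of a] a PN by (auto simp: Mx_def)
        then have "(k + 1 - a) choose (w a - lo - 1 + 1) \<noteq> 0" by (auto simp: mix_def)
        then have "w a - lo - 1 + 1 \<le> k + 1 - a" by (metis binomial_eq_0 not_le)
        then show "w a \<le> reversal lo k a" using a wP[OF a] by (simp add: reversal_def)
      qed
      have bQ: "w a = a" if aQ: "a \<in> Q" for a
      proof -
        have le: "w a \<le> a" if a: "a \<in> Q" for a
        proof -
          have "mix (a - k) (w a - k - 1) \<noteq> 0" using Mnz[of a] a PN PQ_disjoint[of a] by (auto simp: Mx_def)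
          then have "(a - k) choose (w a - k - 1 + 1) \<noteq> 0" by (auto simp: mix_def)
          then have "w a - k - 1 + 1 \<le> a - k" by (metis binomial_eq_0 not_le)
          then show ?thesis using a wQ[OF a] by simp
        qed
        have "bij_betw w Q Q" unfolding bij_betw_def using iQ wQ by (intro conjI endo_inj_surj) auto
        then have "(\<Sum>a\<in>Q. w a) = (\<Sum>a\<in>Q. a)" by (rule sum.reindex_bij_betw)
        then show ?thesis using sum_mono_inv[of w Q "\<lambda>a. a" a] le aQ by auto
      qed
      have "w = w0"
      proof
        fix a
        consider "a \<in> P" | "a \<in> Q" | "a \<in> {1..2*N} - P - Q" | "a \<notin> {1..2*N}" by blast
        then show "w a = w0 a"
        proof cases
          case 1
          then show ?thesis using bP PN by (simp add: w0_def subset_iff)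
        next
          case 2
          then show ?thesis using bQ PN PQ_disjoint rev_out by (auto simp: w0_def)
        next
          case 3
          then show ?thesis using wB[of a] rev_out[of a] by (auto simp: w0_def Bl_def)
        next
          case 4
          then have "w a = undefined" using w by (intro PiE_arb[of w "{1..2*N}" Bl]) auto
          then show ?thesis using 4 by (simp add: w0_def del: atLeastAtMost_iff)
        qed
      qed
      then show False using w by simp
    qed
  qed
  also have "\<dots> = ?T w0" by simp
  also have "Zp N \<alpha> (\<lambda>a b. K p (w0 a) (w0 b)) = Zp N \<alpha> (\<lambda>a b. K p (reversal lo k a) (reversal lo k b))"
    by (rule Zp_cong) (simp add: w0_def)
  also have "\<dots> = of_int (sign (reversal lo k)) * Zp N \<alpha> (K p)"
    by (rule Zp_perm[OF A _ two_blocks_short(1)[OF blocks] reversal_permutes]) (use order in auto)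
  also have "(\<Prod>c\<in>{1..2*N}. Mx p c (w0 c)) = (\<Prod>c\<in>P. Mx p c (reversal lo k c)) * (\<Prod>c\<in>Q. Mx p c c)"
  proof -
    have "(\<Prod>c\<in>{1..2*N}. Mx p c (w0 c)) = (\<Prod>c\<in>P \<union> Q. Mx p c (w0 c))"
      by (rule prod.mono_neutral_right) (use PN in \<open>auto simp: Mx_def\<close>)
    also have "\<dots> = (\<Prod>c\<in>P. Mx p c (w0 c)) * (\<Prod>c\<in>Q. Mx p c (w0 c))"
      by (rule prod.union_disjoint) auto
    also have "(\<Prod>c\<in>P. Mx p c (w0 c)) = (\<Prod>c\<in>P. Mx p c (reversal lo k c))"
      by (rule prod.cong[OF refl]) (use PN in \<open>auto simp: w0_def\<close>)
    also have "(\<Prod>c\<in>Q. Mx p c (w0 c)) = (\<Prod>c\<in>Q. Mx p c c)"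
      by (rule prod.cong[OF refl]) (use PN rev_out in \<open>auto simp: w0_def\<close>)
    finally show ?thesis .
  qed
  also have "(\<Prod>c\<in>P. Mx p c (reversal lo k c)) = (\<Prod>l=1..s. (-1) ^ l * (1 / fact (l - 1)) * y p ^ l)"
    by (rule prod.reindex_bij_witness[where i="\<lambda>l. k + 1 - l" and j="\<lambda>c. k + 1 - c"])
      (auto simp: Mx_def reversal_def mix_def Suc_diff_le)
  also have "\<dots> = (-1) ^ tri s * fusion_norm s * y p ^ tri s"
  proof -
    have t: "(\<Sum>l=1..s. l) = tri s" unfolding tri_def
      by (rule sum.reindex_bij_witness[where i="\<lambda>i. i + 1" and j="\<lambda>l. l - 1"]) auto
    show ?thesis unfolding t[symmetric] fusion_norm_def by (simp only: prod.distrib power_sum)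
  qed
  also have "(\<Prod>c\<in>Q. Mx p c c) = (\<Prod>l=1..s'. (1 / fact (l - 1)) * y p ^ l)"
    by (rule prod.reindex_bij_witness[where i="\<lambda>l. k + l" and j="\<lambda>c. c - k"])
      (auto simp: Mx_def mix_def Suc_diff_Suc)
  also have "\<dots> = fusion_norm s' * y p ^ tri s'"
  proof -
    have t: "(\<Sum>l=1..s'. l) = tri s'" unfolding tri_def
      by (rule sum.reindex_bij_witness[where i="\<lambda>i. i + 1" and j="\<lambda>l. l - 1"]) auto
    show ?thesis unfolding t[symmetric] fusion_norm_def by (simp only: prod.distrib power_sum)
  qed
  also have "(-1) ^ tri s * fusion_norm s * y p ^ tri s * (fusion_norm s' * y p ^ tri s') * (of_int (sign (reversal lo k)) * Zp N \<alpha> (K p))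
     = (of_int (sign (reversal lo k)) * (-1) ^ tri s) * (fusion_norm s * fusion_norm s') * y p ^ (tri s + tri s') * Zp N \<alpha> (K p)"
    by (simp add: power_add mult_ac)
  finally show ?thesis unfolding sign_reversal .
qed

end

lemma mix_zero: "l \<le> i \<Longrightarrow> mix l i = 0"
  by (simp add: mix_def binomial_eq_0)

text \<open>The double sum over the derivative order \<open>i\<close> at the right point and the
  Taylor order \<open>j\<close> is collected by n = i + j. It may stop at i < r because
  \<open>mix l i\<close> is zero for i \<ge> l.\<close>

lemma row_coeff_reorder:
  assumes "l \<le> r" "r \<le> M"
  shows "(\<Sum>n<M. row_coeff (real l) n * Y ^ (n + 1) * f n) =
    (\<Sum>i<r. mix l i * Y ^ (i + 1) * (\<Sum>j<M - i. f (i + j) * Y ^ j / fact j))"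
proof -
  let ?g = "\<lambda>i j. mix l i / fact j * Y ^ (i + j + 1) * f (i + j)"
  have "(\<Sum>n<M. row_coeff (real l) n * Y ^ (n + 1) * f n) = (\<Sum>n<M. \<Sum>i\<le>n. ?g i (n - i))"
    by (rule sum.cong[OF refl]) (simp add: sum_distrib_right flip: row_coeff_pos)
  also have "\<dots> = (\<Sum>(i, j)\<in>{(i, j). i + j < M}. ?g i j)"
    by (rule sum.triangle_reindex[symmetric])
  also have "{(i, j). i + j < M} = Sigma {..<M} (\<lambda>i. {..<M - i})" by auto
  also have "(\<Sum>(i, j)\<in>Sigma {..<M} (\<lambda>i. {..<M - i}). ?g i j) = (\<Sum>i<M. \<Sum>j<M - i. ?g i j)"
    by (rule sum.Sigma[symmetric]) auto
  also have "\<dots> = (\<Sum>i<r. \<Sum>j<M - i. ?g i j)"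
    by (rule sum.mono_neutral_right) (use assms in \<open>auto simp: mix_zero\<close>)
  also have "\<dots> = (\<Sum>i<r. mix l i * Y ^ (i + 1) * (\<Sum>j<M - i. f (i + j) * Y ^ j / fact j))"
    by (intro sum.cong refl) (simp add: sum_distrib_left power_add mult_ac)
  finally show ?thesis .
qed

context fusion
begin

definition "sel p a v b w = (if a \<in> Inn \<and> b \<in> Inn then (if v \<and> w then K1 p a b else 0)
  else if a \<in> Inn then (if v then 0 else K1 p a b)
  else if b \<in> Inn then (if w then 0 else K1 p a b) else K1 p a b)"

text \<open>Inner indices in \<open>E\<close> are linked to inner indices only, the other inner indices to outer ones only.\<close>

definition "K2 E p a b = sel p a (a \<in> E) b (b \<in> E)"

lemma K2_sym: "K2 E p a b = K2 E p b a"
  unfolding K2_def sel_def using K1_sym[of p a b] by presburger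

text \<open>By linearity the row of each inner index splits into its part towards inner and its part
  towards outer indices; \<open>E\<close> collects the indices that take the first part. Entries
  between incompatible choices are 0 in \<open>sel\<close>.\<close>

lemma Zp_K2: "Zp N \<alpha> (K1 p) = (\<Sum>E\<in>Pow Inn. Zp N \<alpha> (K2 E p))"
proof -
  let ?W = "\<lambda>a. {a} \<times> (if a \<in> Inn then UNIV else {False})"
  let ?H = "\<lambda>w w'. sel p (fst w) (snd w) (fst w') (snd w')"
  let ?i = "\<lambda>E. \<lambda>a\<in>{1..2*N}. (a, a \<in> E)"
  let ?j = "\<lambda>w. {a \<in> Inn. snd (w a)} :: nat set"
  have IN: "a \<in> {1..2*N}" if "a \<in> Inn" for a using that order by auto
  have wW: "w a = (a, a \<in> ?j w)" if w: "w \<in> PiE {1..2*N} ?W" and a: "a \<in> {1..2*N}" for w a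
  proof -
    have "w a \<in> ?W a" using w a by (rule PiE_mem)
    then show ?thesis by (cases "w a") (simp del: greaterThanAtMost_iff split: if_splits)
  qed
  have sP: "(\<Sum>w\<in>{a} \<times> V. f w) = (\<Sum>v\<in>V. f (a, v))" for a :: nat and V :: "bool set" and f :: "nat \<times> bool \<Rightarrow> real"
    by (rule sum.reindex_bij_witness[where i="\<lambda>v. (a, v)" and j=snd]) auto
  have "Zp N \<alpha> (K1 p) = (\<Sum>w\<in>PiE {1..2*N} ?W. (\<Prod>c\<in>{1..2*N}. 1) * Zp N \<alpha> (\<lambda>a b. ?H (w a) (w b)))"
  proof (rule Zp_expand)
    show "finite (?W a)" for a by simp
    show "K1 p a b = (\<Sum>w\<in>?W a. \<Sum>w'\<in>?W b. 1 * 1 * ?H w w')" for a b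
      unfolding sP by (simp add: sel_def UNIV_bool del: greaterThanAtMost_iff)
  qed
  also have "\<dots> = (\<Sum>E\<in>Pow Inn. Zp N \<alpha> (K2 E p))"
  proof (rule sum.reindex_bij_witness[where i="?i" and j="?j"])
    fix w assume w: "w \<in> PiE {1..2*N} ?W"
    show "?i (?j w) = w"
    proof
      fix a
      show "?i (?j w) a = w a"
        using wW[OF w, of a] PiE_arb[OF w, of a] by (cases "a \<in> {1..2*N}") (simp_all only: restrict_apply if_True if_False simp_thms)
    qed
    show "?j w \<in> Pow Inn" by blast
    have "Zp N \<alpha> (K2 (?j w) p) = Zp N \<alpha> (\<lambda>a b. ?H (w a) (w b))"
    proof (rule Zp_cong)
      fix a b assume ab: "a \<in> {1..2*N}" "b \<in> {1..2*N}"
      have "?H (w a) (w b) = ?H (a, a \<in> ?j w) (b, b \<in> ?j w)"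
        using wW[OF w ab(1)] wW[OF w ab(2)] by (simp only:)
      then show "K2 (?j w) p a b = ?H (w a) (w b)" unfolding K2_def by (simp only: fst_conv snd_conv)
    qed
    then show "Zp N \<alpha> (K2 (?j w) p) = (\<Prod>c\<in>{1..2*N}. 1) * Zp N \<alpha> (\<lambda>a b. ?H (w a) (w b))" by simp
  next
    fix E assume E: "E \<in> Pow Inn"
    show "?j (?i E) = E"
    proof (intro equalityI subsetI)
      fix a assume "a \<in> E"
      then show "a \<in> ?j (?i E)" using E IN[of a] by (simp add: subset_iff del: greaterThanAtMost_iff atLeastAtMost_iff)
    next
      fix a assume "a \<in> ?j (?i E)"
      then show "a \<in> E" using IN[of a] by (simp del: greaterThanAtMost_iff atLeastAtMost_iff)
    qed
    show "?i E \<in> PiE {1..2*N} ?W" using E by (intro restrict_PiE_iff[THEN iffD2]) (auto simp del: greaterThanAtMost_iff)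
  qed
  finally show ?thesis .
qed

lemma K1_Inn:
  assumes "a \<in> Inn" "b \<in> Inn" "fst p < snd p"
  shows "K1 p a b = (if a + b = 2*k + 1 then - (real (max a b - k) / pi) else 0)"
proof -
  have PQ: "K1 p a b = (if a + b = 2*k + 1 then - (real (max a b - k) / pi) else 0)" if "a \<in> P" "b \<in> Q" for a b
  proof -
    have "k + 1 - a = b - k \<longleftrightarrow> a + b = 2*k + 1" "max a b = b" using that by auto
    then show ?thesis using K1_PQ[OF that assms(3)] by simp
  qed
  consider "a \<in> P" "b \<in> P" | "a \<in> P" "b \<in> Q" | "a \<in> Q" "b \<in> P" | "a \<in> Q" "b \<in> Q" using assms Inn_PQ by blast
  then show ?thesis
  proof cases
    case 1
    then show ?thesis using K1_PP[OF 1] by auto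
  next
    case 2
    then show ?thesis by (rule PQ)
  next
    case 3
    then show ?thesis using PQ[of b a] K1_sym[of p a b] by (simp add: add.commute max.commute)
  next
    case 4
    then show ?thesis using K1_QQ[OF 4] by auto
  qed
qed

lemma K2_row:
  assumes "fst p < snd p" "E \<subseteq> Inn" "a \<in> E" "b \<noteq> 2*k + 1 - a \<or> b \<notin> E"
  shows "K2 E p a b = 0"
proof -
  have a: "a \<in> Inn" using assms by blast
  have "K1 p a b = 0" if "b \<in> Inn" "b \<in> E" using K1_Inn[OF a that(1) assms(1)] assms(4) that by auto
  then show ?thesis unfolding K2_def sel_def using a assms(3) by (auto simp del: greaterThanAtMost_iff)
qed

definition "PQ I = (\<lambda>l. k + 1 - l) ` I \<union> (\<lambda>l. k + l) ` I"

lemma PQ_sub: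
  assumes "I \<subseteq> {1..min s s'}"
  shows "PQ I \<subseteq> Inn"
  using assms order by (fastforce simp: PQ_def)

text \<open>An index of \<open>E\<close> couples only to its mirror image 2k + 1 - a, so a row
  vanishes unless \<open>E\<close> is symmetric about the gap. The symmetric sets are the unions
  \<open>PQ I\<close> of mirror pairs.\<close>

lemma sum_K2:
  assumes p: "fst p < snd p"
  shows "(\<Sum>E\<in>Pow Inn. Zp N \<alpha> (K2 E p)) = (\<Sum>I\<in>Pow {1..min s s'}. Zp N \<alpha> (K2 (PQ I) p))"
proof -
  let ?D = "{1..min s s'}"
  let ?back = "\<lambda>E. {l \<in> ?D. k + l \<in> E}"
  have bk: "?back (PQ I) = I" if "I \<in> Pow ?D" for I
  proof (intro equalityI subsetI)
    fix l assume "l \<in> ?back (PQ I)"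
    then obtain l' where l: "1 \<le> l" "l' \<in> I" "k + l = k + 1 - l' \<or> k + l = k + l'" by (auto simp: PQ_def)
    have "1 \<le> l'" using \<open>I \<in> Pow ?D\<close> l(2) by auto
    then have "l = l'" using l by auto
    then show "l \<in> I" using l by simp
  next
    fix l assume "l \<in> I"
    then show "l \<in> ?back (PQ I)" using \<open>I \<in> Pow ?D\<close> by (auto simp: PQ_def)
  qed
  then have inj: "inj_on PQ (Pow ?D)" by (rule inj_on_inverseI)
  have "(\<Sum>E\<in>Pow Inn. Zp N \<alpha> (K2 E p)) = (\<Sum>E\<in>PQ ` Pow ?D. Zp N \<alpha> (K2 E p))"
  proof (rule sum.mono_neutral_right)
    show "finite (Pow Inn)" by simp
    show "PQ ` Pow ?D \<subseteq> Pow Inn" using PQ_sub by blast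
    show "\<forall>E\<in>Pow Inn - PQ ` Pow ?D. Zp N \<alpha> (K2 E p) = 0"
    proof (intro ballI, rule ccontr)
      fix E assume E: "E \<in> Pow Inn - PQ ` Pow ?D" and nz: "Zp N \<alpha> (K2 E p) \<noteq> 0"
      have EI: "E \<subseteq> Inn" using E by blast
      have cl: "2*k + 1 - a \<in> E" if a: "a \<in> E" for a
      proof (rule ccontr)
        assume n: "2*k + 1 - a \<notin> E"
        have "Zp N \<alpha> (K2 E p) = 0"
        proof (rule Zp_zero_row[of a])
          show "a \<in> {1..2*N}" using EI a order by force
          show "K2 E p a b = 0 \<and> K2 E p b a = 0" for b
            using K2_row[OF p EI a, of b] K2_sym[of E p a b] n by auto
        qed
        then show False using nz by simp
      qed
      have r: "lo < a" "a \<le> hi" "lo < 2*k + 1 - a" "2*k + 1 - a \<le> hi" if "a \<in> E" for a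
        using EI that cl[OF that] by auto
      have "E = PQ (?back E)"
      proof (intro equalityI subsetI)
        fix a assume a: "a \<in> E"
        show "a \<in> PQ (?back E)"
        proof (cases "a \<le> k")
          case True
          have "k + (k + 1 - a) = 2*k + 1 - a" using True by simp
          then have "k + 1 - a \<in> ?back E" using cl[OF a] r[OF a] True by auto
          moreover have "a = k + 1 - (k + 1 - a)" using True by simp
          ultimately show ?thesis unfolding PQ_def by blast
        next
          case False
          then have "a - k \<in> ?back E" using a r[OF a] by auto
          moreover have "a = k + (a - k)" using False by simp
          ultimately show ?thesis unfolding PQ_def by blast
        qed
      next
        fix a assume "a \<in> PQ (?back E)"
        then obtain l where l: "l \<in> ?back E" "a = k + 1 - l \<or> a = k + l" unfolding PQ_def by blast
        have "2*k + 1 - (k + l) = k + 1 - l" by simp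
        then show "a \<in> E" using l cl[of "k + l"] by auto
      qed
      moreover have "?back E \<in> Pow ?D" by blast
      ultimately show False using E by blast
    qed
  qed
  also have "\<dots> = (\<Sum>I\<in>Pow ?D. Zp N \<alpha> (K2 (PQ I) p))" by (rule sum.reindex_cong[OF inj refl refl])
  finally show ?thesis .
qed

lemma K2_pairs:
  assumes I: "I \<subseteq> {1..min s s'}" and p: "fst p < snd p" and l: "l \<in> I"
  shows "k + 1 - l \<in> P" "k + l \<in> Q"
    and "b \<noteq> k + l \<Longrightarrow> K2 (PQ I) p (k + 1 - l) b = 0" "b \<noteq> k + 1 - l \<Longrightarrow> K2 (PQ I) p (k + l) b = 0"
    and "K2 (PQ I) p (k + 1 - l) (k + l) = - (real l / pi)"
proof -
  have l1: "1 \<le> l" "l \<le> s" "l \<le> s'" using I l by auto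
  show PQ: "k + 1 - l \<in> P" "k + l \<in> Q" using l1 by auto
  have E: "k + 1 - l \<in> PQ I" "k + l \<in> PQ I" using l by (auto simp: PQ_def)
  have e: "2*k + 1 - (k + 1 - l) = k + l" "2*k + 1 - (k + l) = k + 1 - l" using l1 by auto
  show "b \<noteq> k + l \<Longrightarrow> K2 (PQ I) p (k + 1 - l) b = 0" "b \<noteq> k + 1 - l \<Longrightarrow> K2 (PQ I) p (k + l) b = 0"
    using K2_row[OF p PQ_sub[OF I] E(1), of b] K2_row[OF p PQ_sub[OF I] E(2), of b] e by auto
  have "k + 1 - l \<in> Inn" "k + l \<in> Inn" using PQ_sub[OF I] E by auto
  then have "K2 (PQ I) p (k + 1 - l) (k + l) = K1 p (k + 1 - l) (k + l)"
    unfolding K2_def sel_def using E by (simp del: greaterThanAtMost_iff)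
  also have "\<dots> = - (real l / pi)"
    using K1_PQ[OF PQ p] l1 by auto
  finally show "K2 (PQ I) p (k + 1 - l) (k + l) = - (real l / pi)" .
qed

text \<open>Both rows of a coupled pair vanish except at each other, so the pairs are twins, and
  there are more of them than links between the blocks.\<close>

lemma Zp_K2_zero:
  assumes I: "I \<subseteq> {1..min s s'}" and p: "fst p < snd p" and c: "m < card I"
  shows "Zp N \<alpha> (K2 (PQ I) p) = 0"
proof -
  let ?T = "(\<lambda>l. (k + 1 - l, k + l)) ` I"
  have fI: "finite I" using I finite_subset by blast
  have lk: "l \<le> k" "1 \<le> l" if "l \<in> I" for l using subsetD[OF I that] by auto
  note R = K2_pairs[OF I p]
  show ?thesis
  proof (rule Zp_many_twins[OF blocks])
    show "finite ?T" using fI by simp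
    show "?T \<subseteq> P \<times> Q" using R(1,2) by blast
    show "inj_on fst ?T" "inj_on snd ?T"
      using lk by (auto simp: inj_on_def) (metis Suc_diff_le diff_diff_cancel le_SucI)+
    show "K2 (PQ I) p a b = K2 (PQ I) p b a" for a b by (rule K2_sym)
    show "K2 (PQ I) p c b = K2 (PQ I) p d b" if "(c, d) \<in> ?T" "b \<in> {1..2*N} - {c, d}" for c d b
      using that R(3,4) by auto
    show "K2 (PQ I) p c d \<noteq> 0" if "(c, d) \<in> ?T" for c d using that R(5) lk(2) by fastforce
    show "K2 (PQ I) p c c' = 0" if h: "(c, d) \<in> ?T" "(c', d') \<in> ?T" "c \<noteq> c'" for c d c' d'
    proof -
      obtain l l' where ll: "l \<in> I" "c = k + 1 - l" "l' \<in> I" "c' = k + 1 - l'" using h by auto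
      have "c' \<noteq> k + l" using ll lk[of l] lk[of l'] by simp
      then show ?thesis using R(3)[OF ll(1), of c'] ll by simp
    qed
    have "inj_on (\<lambda>l. (k + 1 - l, k + l)) I" by (auto simp: inj_on_def)
    then show "cross_links \<alpha> lo k hi < card ?T" using c m by (simp add: card_image)
  qed
qed

text \<open>For a right row this is the part beyond the first \<open>M\<close> Taylor terms, divided
  by y^(M+1) so that it has a finite limit.\<close>

definition "rest M a b p = (K1 p a b - (\<Sum>n<M. row_coeff (offset k a) n * y p ^ (n + 1) * kernel_deriv n (q b) (fst p - x b)))
  / y p ^ (M + 1)"

definition "rest_lim M a b = (\<Sum>i<s'. mix (a - k) i * (kernel_deriv M (q b) (\<xi> - x b) / fact (M - i)))"

lemma rest_tendsto:
  assumes a: "a \<in> Q" and b: "b \<in> Out" and M: "s' \<le> M"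
  shows "(rest M a b \<longlongrightarrow> rest_lim M a b) (fusion_filter \<xi>)"
proof -
  let ?S = "\<lambda>p i. \<Sum>j<M - i. kernel_deriv (i + j) (q b) (fst p - x b) * y p ^ j / fact j"
  let ?R = "\<lambda>p i. (kernel_deriv i (q b) (snd p - x b) - ?S p i) / y p ^ (M - i)"
  have "((\<lambda>p. \<Sum>i<s'. mix (a - k) i * ?R p i) \<longlongrightarrow> rest_lim M a b) (fusion_filter \<xi>)"
    unfolding rest_lim_def
  proof (intro tendsto_sum tendsto_mult tendsto_const)
    fix i assume i: "i \<in> {..<s'}"
    then have "0 < M - i" "i + (M - i) = M" using M by auto
    then show "((\<lambda>p. ?R p i) \<longlongrightarrow> kernel_deriv M (q b) (\<xi> - x b) / fact (M - i)) (fusion_filter \<xi>)"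
      using taylor_remainder[OF x[OF b], of "M - i" i "q b"] by simp
  qed
  moreover have "eventually (\<lambda>p. (\<Sum>i<s'. mix (a - k) i * ?R p i) = rest M a b p) (fusion_filter \<xi>)"
    using fusion_filter_less
  proof eventually_elim
    case (elim p)
    then have y: "y p \<noteq> 0" by simp
    have o: "offset k a = real (a - k)" using a by (simp add: offset_def)
    have "(\<Sum>n<M. row_coeff (offset k a) n * y p ^ (n + 1) * kernel_deriv n (q b) (fst p - x b)) =
        (\<Sum>i<s'. mix (a - k) i * y p ^ (i + 1) * ?S p i)"
      unfolding o by (rule row_coeff_reorder) (use a M in auto)
    then have "rest M a b p = (\<Sum>i<s'. (mix (a - k) i * y p ^ (i + 1) * kernel_deriv i (q b) (snd p - x b) -
        mix (a - k) i * y p ^ (i + 1) * ?S p i) / y p ^ (M + 1))"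
      unfolding rest_def K1_QO[OF a b] by (simp only: sum_subtractf[symmetric] sum_divide_distrib)
    also have "\<dots> = (\<Sum>i<s'. mix (a - k) i * ?R p i)"
    proof (rule sum.cong[OF refl])
      fix i assume "i \<in> {..<s'}"
      then have Y: "y p ^ (M + 1) = y p ^ (i + 1) * y p ^ (M - i)" using M by (simp flip: power_add power_Suc)
      have R: "(A * B * C - A * B * D) / (B * E) = A * ((C - D) / E)" if "B \<noteq> 0" for A B C D E :: real
        using that by (cases "E = 0") (auto simp: field_simps)
      show "(mix (a - k) i * y p ^ (i + 1) * kernel_deriv i (q b) (snd p - x b) -
        mix (a - k) i * y p ^ (i + 1) * ?S p i) / y p ^ (M + 1) = mix (a - k) i * ?R p i"
        unfolding Y by (rule R) (rule power_not_zero[OF y])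
    qed
    finally show ?case by simp
  qed
  ultimately show ?thesis by (rule Lim_transform_eventually)
qed

text \<open>In the smaller pattern the indices lo + 1, ..., hi - 2m form the fused block: the n-th
  of them carries the derivative of order n - 1 at \<xi>, exactly the orders selected by the leading
  power of y.\<close>

definition "Kh a b = (if a \<in> {lo<..hi - 2*m} then (if b \<in> {lo<..hi - 2*m} then 0
      else kernel_deriv (a - lo - 1) (q (up k m b)) (\<xi> - x (up k m b)))
    else if b \<in> {lo<..hi - 2*m} then kernel_deriv (b - lo - 1) (q (up k m a)) (\<xi> - x (up k m a))
    else Ko (up k m a) (up k m b))"

abbreviation "L \<equiv> s + s' - 2*m"

lemma m_le: "m + lo \<le> k" "k + m \<le> hi"
  using two_blocks_rem_many[OF blocks, of m] m by auto

text \<open>The coupled pairs are split off exactly. In the remaining pattern the inner rows no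
  longer couple to each other, and the asymptotics of small rows applies with t = m - card I, so
  that the limit can be nonzero only for t = 0.\<close>

lemma Zp_K2_limit:
  assumes I: "I \<subseteq> {1..min s s'}" and n: "card I \<le> m"
  shows "((\<lambda>p. Zp N \<alpha> (K2 (PQ I) p) / y p ^ tri L) \<longlongrightarrow>
    (if card I = m then pair_weight s L I * Zp (N - m) (rem k m \<alpha>) Kh else 0)) (fusion_filter \<xi>)"
proof -
  have fI: "finite I" using I finite_subset by blast
  note D = desc[OF fI]
  define n where "n = card I"
  have nm: "n \<le> m" "n \<le> cross_links \<alpha> lo k hi" using n m by (simp_all add: n_def)
  have len: "length (desc I) = n" using D(3) by (simp add: n_def)
  note R = two_blocks_rem_many[OF blocks nm(2)]
  have lI: "1 \<le> l \<and> l + lo \<le> k \<and> k + l \<le> hi" if "l \<in> set (desc I)" for l using that D(1) I by fastforce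
  have lI': "1 \<le> l \<and> l \<le> s" if "l \<in> set (desc I)" for l using lI[OF that] by auto
  define sk where "sk = skip_pairs k (desc I)"
  have sk_in: "sk a \<in> Inn \<longleftrightarrow> a \<in> {lo<..hi - 2*n}" for a
    unfolding sk_def using skip_pairs_mem(1)[OF lI D(2), of a] len by simp
  have sk_PQ: "sk a \<notin> PQ I" for a
    unfolding sk_def PQ_def using skip_pairs_mem(2)[OF lI D(2), of _ a] D(1) by blast
  have sk_up: "sk b = up k n b" if "b \<in> {1..2*(N - n)} - {lo<..hi - 2*n}" for b
    using that skip_pairs_out[OF lI D(2), of b] len R unfolding sk_def up_def by auto
  have sk_out: "sk b \<in> Out" if b: "b \<in> {1..2*(N - n)} - {lo<..hi - 2*n}" for b
  proof -
    have "up k n b \<in> {1..2*N}" using b R order unfolding up_def by auto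
    then show ?thesis using sk_in[of b] sk_up[OF b] b by auto
  qed
  \<comment> \<open>Two requirements are met at once: M \<ge> tri L makes the remainders negligible,
    and \<open>M\<close> not smaller than the block sizes makes the left rows exact and the Taylor
    orders M - i positive.\<close>
  define M where "M = hi + tri L"
  \<comment> \<open>Labels below \<open>M\<close> are derivative orders; the label M + a, for
    \<open>a\<close> in \<open>Q\<close>, is the remainder of row \<open>a\<close>, whence the range
    up to M + hi.\<close>
  define \<Gamma> where "\<Gamma> = {..<M + hi + 1}"
  define e where "e i = (if i < M then i + 1 else M + 1)" for i
  define c where "c a i = (if i < M then row_coeff (offset k (sk a)) i
    else if sk a \<in> Q \<and> i = M + sk a then 1 else 0)" for a i
  define G where "G p i b = (if i < M then kernel_deriv i (q (sk b)) (fst p - x (sk b))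
    else if i - M \<in> Q then rest M (i - M) (sk b) p else 0)" for p i b
  define Gl where "Gl i b = (if i < M then kernel_deriv i (q (sk b)) (\<xi> - x (sk b))
    else if i - M \<in> Q then rest_lim M (i - M) (sk b) else 0)" for i b
  define K3 where "K3 p a b = (if sk a \<in> Inn \<and> sk b \<in> Inn then 0 else K1 p (sk a) (sk b))" for p a b
  \<comment> \<open>The expansion is required at every \<open>p\<close>. Where the two points
    coincide, \<open>rest\<close> is 0 by division by zero, and the transformed right row vanishes
    as well.\<close>
  have y0: "K1 p a b = 0" if "y p = 0" "a \<in> Q" "b \<in> Out" for p a b
    using that by (simp add: K1_QO)
  interpret S: small_rows "N - n" lo "k - n" "hi - 2*n" M "rem k n \<alpha>" \<Gamma> e c y "fusion_filter \<xi>" G Gl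
    "\<lambda>a b. Ko (sk a) (sk b)" K3 "m - n" L
  proof
    show "two_blocks (N - n) (rem k n \<alpha>) lo (k - n) (hi - 2*n)" using R by blast
    show "m - n = cross_links (rem k n \<alpha>) lo (k - n) (hi - 2*n)" using R m by linarith
    show "L + 2*(m - n) = hi - 2*n - lo" using m_le nm(1) order by linarith
    show "finite \<Gamma>" "{..<M} \<subseteq> \<Gamma>" by (auto simp: \<Gamma>_def)
    show "e i = i + 1" if "i < M" for i using that by (simp add: e_def)
    show "e i = M + 1" if "M \<le> i" for i using that by (simp add: e_def)
    show "tri L \<le> M" by (simp add: M_def)
    show "(y \<longlongrightarrow> 0) (fusion_filter \<xi>)" by (rule fusion_filter_diff)
    show "\<forall>\<^sub>F p in fusion_filter \<xi>. 0 < y p" using fusion_filter_less by eventually_elim simp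
    show "K3 p a b = K3 p b a" for p a b using K1_sym[of p "sk a" "sk b"] by (simp add: K3_def)
    show "Ko (sk a) (sk b) = Ko (sk b) (sk a)" for a b by (rule Kosym)
    show "K3 p a b = 0" if "a \<in> {lo<..hi - 2*n}" "b \<in> {lo<..hi - 2*n}" for p a b
      using that sk_in[of a] sk_in[of b] by (simp add: K3_def)
    show "K3 p a b = Ko (sk a) (sk b)" if "a \<in> {1..2*(N - n)} - {lo<..hi - 2*n}" "b \<in> {1..2*(N - n)} - {lo<..hi - 2*n}" for p a b
      using K1_OO[OF sk_out[OF that(1)] sk_out[OF that(2)]] sk_out[OF that(1)] by (simp add: K3_def del: greaterThanAtMost_iff)
    show "((\<lambda>p. G p i b) \<longlongrightarrow> Gl i b) (fusion_filter \<xi>)" if b: "b \<in> {1..2*(N - n)} - {lo<..hi - 2*n}" for i b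
    proof -
      note b' = sk_out[OF b]
      have M': "s' \<le> M" using order by (simp add: M_def)
      show ?thesis
        unfolding G_def Gl_def
        using kernel_deriv_tendsto[OF fusion_filter_fst x[OF b']] rest_tendsto[OF _ b' M', of "i - M"] by auto
    qed
    show "K3 p a b = (\<Sum>i\<in>\<Gamma>. c a i * y p ^ e i * G p i b)"
      if a: "a \<in> {lo<..hi - 2*n}" and b: "b \<in> {1..2*(N - n)} - {lo<..hi - 2*n}" for p a b
    proof -
      note b' = sk_out[OF b]
      have a': "sk a \<in> Inn" using a sk_in by blast
      let ?A = "\<Sum>i<M. row_coeff (offset k (sk a)) i * y p ^ (i + 1) * kernel_deriv i (q (sk b)) (fst p - x (sk b))"
      have "(\<Sum>i\<in>\<Gamma>. c a i * y p ^ e i * G p i b) =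
        (\<Sum>i<M. c a i * y p ^ e i * G p i b) + (\<Sum>i\<in>{M..<M + hi + 1}. c a i * y p ^ e i * G p i b)"
        unfolding \<Gamma>_def lessThan_atLeast0 by (rule sum.atLeastLessThan_concat[symmetric]) auto
      also have "(\<Sum>i<M. c a i * y p ^ e i * G p i b) = ?A"
        by (rule sum.cong[OF refl]) (simp add: c_def e_def G_def)
      also have "(\<Sum>i\<in>{M..<M + hi + 1}. c a i * y p ^ e i * G p i b) =
        (if sk a \<in> Q then y p ^ (M + 1) * rest M (sk a) (sk b) p else 0)"
      proof (cases "sk a \<in> Q")
        case True
        have "(\<Sum>i\<in>{M..<M + hi + 1}. c a i * y p ^ e i * G p i b) = (\<Sum>i\<in>{M + sk a}. c a i * y p ^ e i * G p i b)"
          by (rule sum.mono_neutral_right) (use True in \<open>auto simp: c_def\<close>)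
        also have "\<dots> = y p ^ (M + 1) * rest M (sk a) (sk b) p"
          using True by (simp add: c_def e_def G_def del: greaterThanAtMost_iff)
        finally show ?thesis using True by simp
      next
        case False
        have "(\<Sum>i\<in>{M..<M + hi + 1}. c a i * y p ^ e i * G p i b) = 0"
          by (rule sum.neutral) (simp add: c_def False del: greaterThanAtMost_iff)
        then show ?thesis using False by (simp only: if_False)
      qed
      also have "?A + (if sk a \<in> Q then y p ^ (M + 1) * rest M (sk a) (sk b) p else 0) = K1 p (sk a) (sk b)"
      proof (cases "sk a \<in> Q")
        case True
        show ?thesis
        proof (cases "y p = 0")
          case yz: True
          then show ?thesis using y0[OF yz True b'] by simp
        next
          case False
          then have "y p ^ (M + 1) * rest M (sk a) (sk b) p = K1 p (sk a) (sk b) - ?A" by (simp add: rest_def)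
          then show ?thesis using True by simp
        qed
      next
        case False
        then have aP: "sk a \<in> P" using a' Inn_PQ by blast
        have "?A = (\<Sum>i<s. row_coeff (offset k (sk a)) i * y p ^ (i + 1) * kernel_deriv i (q (sk b)) (fst p - x (sk b)))"
        proof (rule sum.mono_neutral_right)
          have ok: "offset k (sk a) = - real (k + 1 - sk a)" using aP by (simp add: offset_def)
          have "row_coeff (offset k (sk a)) i = 0" if "s \<le> i" for i
          proof -
            have "mix (k + 1 - sk a) i = 0" using aP that by (intro mix_zero) auto
            then show ?thesis unfolding ok row_coeff_neg by simp
          qed
          then show "\<forall>i\<in>{..<M} - {..<s}. row_coeff (offset k (sk a)) i * y p ^ (i + 1) * kernel_deriv i (q (sk b)) (fst p - x (sk b)) = 0"
            by simp
        qed (use order in \<open>auto simp: M_def\<close>)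
        then show ?thesis using False K1_PO[OF aP b', of p] by (simp del: greaterThanAtMost_iff)
      qed
      finally have "(\<Sum>i\<in>\<Gamma>. c a i * y p ^ e i * G p i b) = K1 p (sk a) (sk b)" .
      moreover have "sk b \<notin> Inn" using b' by blast
      ultimately show ?thesis by (simp add: K3_def del: greaterThanAtMost_iff)
    qed
  qed
  let ?w = "\<Prod>l\<in>I. - (real l / pi)"
  have ev: "eventually (\<lambda>p. ?w * (Zp (N - n) (rem k n \<alpha>) (K3 p) / y p ^ tri L) = Zp N \<alpha> (K2 (PQ I) p) / y p ^ tri L) (fusion_filter \<xi>)"
    using fusion_filter_less
  proof eventually_elim
    case (elim p)
    note E = K2_pairs[OF I elim]
    have "Zp N \<alpha> (K2 (PQ I) p) = (\<Prod>l\<leftarrow>desc I. K2 (PQ I) p (k + 1 - l) (k + l)) *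
      Zp (N - length (desc I)) (rem k (length (desc I)) \<alpha>) (\<lambda>a b. K2 (PQ I) p (skip_pairs k (desc I) a) (skip_pairs k (desc I) b))"
      by (rule Zp_pairs[OF blocks D(2) lI K2_sym]) (use E(3-5) D(1) lI len nm in force)+
    also have "(\<Prod>l\<leftarrow>desc I. K2 (PQ I) p (k + 1 - l) (k + l)) = ?w"
      unfolding D(4) by (rule prod.cong) (use E(5) in auto)
    also have "Zp (N - length (desc I)) (rem k (length (desc I)) \<alpha>) (\<lambda>a b. K2 (PQ I) p (skip_pairs k (desc I) a) (skip_pairs k (desc I) b))
      = Zp (N - n) (rem k n \<alpha>) (K3 p)"
      unfolding len sk_def[symmetric]
      by (rule Zp_cong) (use sk_PQ in \<open>simp add: K2_def sel_def K3_def del: greaterThanAtMost_iff\<close>)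
    finally show ?case by simp
  qed
  have lim: "((\<lambda>p. ?w * (Zp (N - n) (rem k n \<alpha>) (K3 p) / y p ^ tri L)) \<longlongrightarrow>
      ?w * (if m - n = 0 then gdet {..<L} id (\<lambda>i j. c (lo + 1 + i) j) * Zp (N - n) (rem k n \<alpha>) S.Khat else 0)) (fusion_filter \<xi>)"
    by (intro tendsto_mult tendsto_const S.small_rows_limit)
  have "?w * (if m - n = 0 then gdet {..<L} id (\<lambda>i j. c (lo + 1 + i) j) * Zp (N - n) (rem k n \<alpha>) S.Khat else 0) =
    (if card I = m then pair_weight s L I * Zp (N - m) (rem k m \<alpha>) Kh else 0)"
  proof (cases "n = m")
    case True
    have LM: "i < M" if "i < L" for i using that le_tri[of L] by (simp add: M_def)
    have "gdet {..<L} id (\<lambda>i j. c (lo + 1 + i) j) = gdet {..<L} id (\<lambda>i j. row_coeff (offset s (skip_pairs s (desc I) (1 + i))) j)"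
    proof (rule gdet_cong[OF refl refl])
      fix i j assume "i \<in> {..<L}" "j \<in> id ` {..<L}"
      have "sk (lo + 1 + i) = skip_pairs (s + lo) (desc I) ((1 + i) + lo)" using order by (simp add: sk_def add_ac)
      also have "\<dots> = skip_pairs s (desc I) (1 + i) + lo" by (rule skip_pairs_add[OF lI' D(2)])
      finally have "offset k (sk (lo + 1 + i)) = offset s (skip_pairs s (desc I) (1 + i))"
        using order by (auto simp: offset_def)
      then show "c (lo + 1 + i) j = row_coeff (offset s (skip_pairs s (desc I) (1 + i))) j"
        using LM[of j] \<open>j \<in> id ` {..<L}\<close> by (simp add: c_def)
    qed
    moreover have "Zp (N - n) (rem k n \<alpha>) S.Khat = Zp (N - n) (rem k n \<alpha>) Kh"
    proof (rule Zp_cong)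
      fix a b assume "a \<in> {1..2*(N - n)}" "b \<in> {1..2*(N - n)}"
      then have ab: "a \<in> {1..2*(N - m)}" "b \<in> {1..2*(N - m)}" using True by simp_all
      have G: "Gl (a - lo - 1) b = kernel_deriv (a - lo - 1) (q (up k m b)) (\<xi> - x (up k m b))"
        if "a \<in> {lo<..hi - 2*m}" "b \<in> {1..2*(N - m)} - {lo<..hi - 2*m}" for a b
      proof -
        have "a - lo - 1 < L" using that(1) m_le by auto
        then show ?thesis using LM sk_up[unfolded True, OF that(2)] by (simp add: Gl_def)
      qed
      show "S.Khat a b = Kh a b"
        unfolding S.Khat_def unfolding Kh_def True
        using G[of a b] G[of b a] sk_up[unfolded True, of a] sk_up[unfolded True, of b] ab
        by (simp del: greaterThanAtMost_iff)
    qed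
    ultimately show ?thesis using True by (simp add: n_def pair_weight_def)
  next
    case False
    then show ?thesis using nm by (simp add: n_def)
  qed
  then show ?thesis using Lim_transform_eventually[OF lim ev] by simp
qed

text \<open>The exponent has two sources: \<open>tri L\<close> is the leading order of the small
  rows, and -(tri s + tri s') comes from undoing the row transformation.\<close>

theorem fusion_limit:
  "((\<lambda>p. Zp N \<alpha> (K p) / y p powr (real (tri L) - real (tri s) - real (tri s'))) \<longlongrightarrow>
    fusion_const s s' m * Zp (N - m) (rem k m \<alpha>) Kh) (fusion_filter \<xi>)"
proof -
  let ?A = "(-1) ^ s * (fusion_norm s * fusion_norm s')" and ?D = "{1..min s s'}"
  let ?Z = "Zp (N - m) (rem k m \<alpha>) Kh"
  have A: "?A \<noteq> 0" using fusion_norm_pos[of s] fusion_norm_pos[of s'] by simp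
  have "((\<lambda>p. Zp N \<alpha> (K2 (PQ I) p) / y p ^ tri L) \<longlongrightarrow> (if card I = m then pair_weight s L I * ?Z else 0)) (fusion_filter \<xi>)"
    if I: "I \<in> Pow ?D" for I
  proof (cases "card I \<le> m")
    case True
    then show ?thesis using Zp_K2_limit I by blast
  next
    case False
    have "eventually (\<lambda>p. 0 = Zp N \<alpha> (K2 (PQ I) p) / y p ^ tri L) (fusion_filter \<xi>)"
      using fusion_filter_less by eventually_elim (use Zp_K2_zero[of I] I False in simp)
    then have "((\<lambda>p. Zp N \<alpha> (K2 (PQ I) p) / y p ^ tri L) \<longlongrightarrow> 0) (fusion_filter \<xi>)"
      by (rule Lim_transform_eventually[OF tendsto_const])
    then show ?thesis using False by simp
  qed
  then have "((\<lambda>p. 1 / ?A * (\<Sum>I\<in>Pow ?D. Zp N \<alpha> (K2 (PQ I) p) / y p ^ tri L)) \<longlongrightarrow>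
      1 / ?A * (\<Sum>I\<in>Pow ?D. if card I = m then pair_weight s L I * ?Z else 0)) (fusion_filter \<xi>)"
    by (intro tendsto_mult tendsto_const tendsto_sum)
  moreover have "1 / ?A * (\<Sum>I\<in>Pow ?D. if card I = m then pair_weight s L I * ?Z else 0) = fusion_const s s' m * ?Z"
  proof -
    have "(\<Sum>I\<in>Pow ?D. if card I = m then pair_weight s L I * ?Z else 0) = (\<Sum>I\<in>{I \<in> Pow ?D. card I = m}. pair_weight s L I * ?Z)"
      by (rule sum.inter_filter[symmetric]) simp
    also have "{I \<in> Pow ?D. card I = m} = {I. I \<subseteq> ?D \<and> card I = m}" by blast
    finally have "(\<Sum>I\<in>Pow ?D. if card I = m then pair_weight s L I * ?Z else 0) = (\<Sum>I | I \<subseteq> ?D \<and> card I = m. pair_weight s L I) * ?Z"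
      by (simp only: sum_distrib_right)
    moreover have "1 / ?A = (-1) ^ s / (fusion_norm s * fusion_norm s')" by (cases "even s") simp_all
    ultimately show ?thesis by (simp only: fusion_const_def mult.assoc)
  qed
  moreover have "eventually (\<lambda>p. 1 / ?A * (\<Sum>I\<in>Pow ?D. Zp N \<alpha> (K2 (PQ I) p) / y p ^ tri L) =
    Zp N \<alpha> (K p) / y p powr (real (tri L) - real (tri s) - real (tri s'))) (fusion_filter \<xi>)"
    using fusion_filter_less
  proof eventually_elim
    case (elim p)
    then have y: "0 < y p" by simp
    have "y p powr (real (tri L) - real (tri s) - real (tri s')) = y p ^ tri L / y p ^ (tri s + tri s')"
      using y by (simp add: powr_diff powr_realpow power_add)
    moreover have "(\<Sum>I\<in>Pow ?D. Zp N \<alpha> (K2 (PQ I) p) / y p ^ tri L) = ?A * y p ^ (tri s + tri s') * Zp N \<alpha> (K p) / y p ^ tri L"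
      unfolding sum_divide_distrib[symmetric] sum_K2[OF elim, symmetric] Zp_K2[symmetric] Zp_K1 ..
    moreover have "1 / A * (A * B * C / E) = C / (E / B)" if "A \<noteq> 0" for A B C E :: real using that by simp
    ultimately show ?case using A by simp
  qed
  ultimately show ?thesis using Lim_transform_eventually by fastforce
qed

end

section \<open>Translation of the original definitions into matchings, intervals and closed
  formulas\<close>

subsection \<open>Link patterns are noncrossing matchings\<close>

definition plane :: "complex \<Rightarrow> real ^ 2" where
  "plane z = (\<chi> i. if i = 1 then Re z else Im z)"

lemma plane_nth [simp]: "plane z $ 1 = Re z" "plane z $ 2 = Im z"
  by (simp_all add: plane_def)

lemma continuous_on_plane: "continuous_on S plane"
  unfolding plane_def
proof (rule continuous_on_vec_lambda)
  fix i :: 2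
  show "continuous_on S (\<lambda>z. if i = 1 then Re z else Im z)"
    by (cases "i = 1") (auto intro!: continuous_intros)
qed

text \<open>The four endpoints interlace on the lower edge of a rectangle containing both curves, so
  the curves meet by the interlaced form of the fashoda theorem. That theorem lives in
  \<open>real ^ 2\<close>, which is the purpose of \<open>plane\<close>.\<close>

lemma upper_paths_cross:
  fixes f g :: "real \<Rightarrow> complex" and a b c e :: real
  assumes f: "path f" "pathstart f = of_real a" "pathfinish f = of_real b" "\<And>t. t \<in> {0<..<1} \<Longrightarrow> 0 < Im (f t)"
    and g: "path g" "pathstart g = of_real c" "pathfinish g = of_real e" "\<And>t. t \<in> {0<..<1} \<Longrightarrow> 0 < Im (g t)"
    and o: "a < c" "c < b" "b < e"
  shows "path_image f \<inter> path_image g \<noteq> {}"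
proof -
  have im: "0 \<le> Im z" if zh: "z \<in> path_image h" and h: "pathstart h = of_real u" "pathfinish h = of_real v"
    "\<And>t. t \<in> {0<..<1} \<Longrightarrow> 0 < Im (h t)" for z h u v
  proof -
    obtain t where t: "t \<in> {0..1}" "z = h t" using zh by (auto simp: path_image_def)
    consider "t = 0" | "t = 1" | "t \<in> {0<..<1}" using t by fastforce
    then show ?thesis
      by cases (use t h(1,2) h(3)[of t] in \<open>auto simp: pathstart_def pathfinish_def\<close>)
  qed
  have "bounded (path_image f \<union> path_image g)" using f(1) g(1) by (simp add: bounded_path_image)
  then obtain R where R: "\<And>z. z \<in> path_image f \<union> path_image g \<Longrightarrow> norm z \<le> R" by (auto simp: bounded_iff)
  define lo :: "real ^ 2" where "lo = (\<chi> i. if i = 1 then - R else 0)"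
  define hi :: "real ^ 2" where "hi = (\<chi> i. R)"
  have box: "plane z \<in> cbox lo hi" if "z \<in> path_image f \<union> path_image g" for z
  proof -
    have "0 \<le> Im z" using that im[of z f a b] im[of z g c e] f g by blast
    moreover have "\<bar>Re z\<bar> \<le> R" "\<bar>Im z\<bar> \<le> R" using R[OF that] abs_Re_le_cmod[of z] abs_Im_le_cmod[of z] by linarith+
    ultimately show ?thesis by (auto simp: mem_box_cart forall_2 lo_def hi_def)
  qed
  obtain w where "w \<in> path_image (plane \<circ> f)" "w \<in> path_image (plane \<circ> g)"
  proof (rule fashoda_interlace[of "plane \<circ> f" "plane \<circ> g" lo hi])
    show "path (plane \<circ> f)" "path (plane \<circ> g)" using f(1) g(1) by (auto intro: path_continuous_image continuous_on_plane)
    show "path_image (plane \<circ> f) \<subseteq> cbox lo hi" "path_image (plane \<circ> g) \<subseteq> cbox lo hi"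
      using box by (auto simp: path_image_compose)
  qed (use f g o in \<open>auto simp: pathstart_compose pathfinish_compose lo_def\<close>)
  then obtain z z' where z: "z \<in> path_image f" "z' \<in> path_image g" "plane z = plane z'"
    by (auto simp: path_image_compose)
  have "z = z'"
    using arg_cong[OF z(3), of "\<lambda>v. vec_nth v 1"] arg_cong[OF z(3), of "\<lambda>v. vec_nth v 2"] by (simp add: complex_eq_iff)
  then show ?thesis using z by auto
qed

definition semicircle :: "real \<Rightarrow> real \<Rightarrow> real \<Rightarrow> complex" where
  "semicircle a b t = of_real ((a + b) / 2) + of_real ((b - a) / 2) * cis (pi * (1 - t))"

lemma path_semicircle: "path (semicircle a b)"
  unfolding path_def semicircle_def[abs_def] cis_conv_exp by (intro continuous_intros)

lemma semicircle_ends: "pathstart (semicircle a b) = of_real a" "pathfinish (semicircle a b) = of_real b"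
  by (simp_all add: pathstart_def pathfinish_def semicircle_def field_simps)

lemma semicircle_upper: "a < b \<Longrightarrow> t \<in> {0<..<1} \<Longrightarrow> 0 < Im (semicircle a b t)"
  by (auto simp: semicircle_def intro!: mult_pos_pos sin_gt_zero)

lemma semicircle_image:
  assumes "a < b" "z \<in> path_image (semicircle a b)"
  shows "a \<le> Re z \<and> Re z \<le> b \<and> (Re z - a) * (b - Re z) = (Im z)\<^sup>2"
proof -
  obtain t where z: "z = semicircle a b t" using assms(2) by (auto simp: path_image_def)
  let ?c = "cos (pi * (1 - t))" and ?s = "sin (pi * (1 - t))"
  have re: "Re z = (a + b) / 2 + (b - a) / 2 * ?c" and im: "Im z = (b - a) / 2 * ?s"
    by (simp_all add: z semicircle_def)
  have "(b - a) / 2 * ?c \<le> (b - a) / 2 * 1" "(b - a) / 2 * (-1) \<le> (b - a) / 2 * ?c"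
    using assms(1) by (intro mult_left_mono; simp)+
  then have "a \<le> Re z" "Re z \<le> b" unfolding re by (simp_all add: field_simps)
  moreover have "(Re z - a) * (b - Re z) = ((b - a) / 2)\<^sup>2 * (1 - ?c\<^sup>2)"
    unfolding re by (simp add: field_simps power2_eq_square)
  then have "(Re z - a) * (b - Re z) = (Im z)\<^sup>2"
    unfolding im power_mult_distrib sin_squared_eq .
  ultimately show ?thesis by blast
qed

text \<open>On the semicircle over [a, b] one has (Re z - a)(b - Re z) = (Im z)^2. For nested
  intervals this product is strictly larger for the outer one, so there is no common point;
  separated intervals have disjoint real parts.\<close>

lemma semicircles_disjoint:
  assumes "a < b" "c < e" "a < c" "b < c \<or> e < b"
  shows "path_image (semicircle a b) \<inter> path_image (semicircle c e) = {}"
proof (rule ccontr)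
  assume "path_image (semicircle a b) \<inter> path_image (semicircle c e) \<noteq> {}"
  then obtain z where z: "z \<in> path_image (semicircle a b)" "z \<in> path_image (semicircle c e)" by blast
  note 1 = semicircle_image[OF assms(1) z(1)] and 2 = semicircle_image[OF assms(2) z(2)]
  have "e < b" using 1 2 assms(4) by linarith
  have "(Re z - c) * (e - Re z) \<le> (Re z - a) * (e - Re z)" using 2 assms by (intro mult_right_mono) auto
  also have "\<dots> < (Re z - a) * (b - Re z)" using 2 assms \<open>e < b\<close> by (intro mult_strict_left_mono) auto
  finally show False using 1 2 by simp
qed

text \<open>Curves belonging to crossing links would have to meet, and conversely semicircles
  realise a noncrossing matching.\<close>

lemma link_patterns_eq_NC: "link_patterns N = NC N"
proof (intro equalityI subsetI)
  fix \<beta> assume "\<beta> \<in> link_patterns N"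
  then have M: "matching N \<beta>" and "\<exists>\<gamma> :: nat set \<Rightarrow> real \<Rightarrow> complex.
        (\<forall>l\<in>\<beta>. path (\<gamma> l) \<and> {pathstart (\<gamma> l), pathfinish (\<gamma> l)} = of_nat ` l \<and>
               (\<forall>t\<in>{0<..<1}. 0 < Im (\<gamma> l t))) \<and>
        disjoint_family_on (\<lambda>l. path_image (\<gamma> l)) \<beta>"
    unfolding link_patterns_def matching_def by blast+
  then obtain \<gamma> :: "nat set \<Rightarrow> real \<Rightarrow> complex"
    where g: "\<And>l. l \<in> \<beta> \<Longrightarrow> path (\<gamma> l) \<and> {pathstart (\<gamma> l), pathfinish (\<gamma> l)} = of_nat ` l \<and> (\<forall>t\<in>{0<..<1}. 0 < Im (\<gamma> l t))"
    and dj: "disjoint_family_on (\<lambda>l. path_image (\<gamma> l)) \<beta>"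
    by blast
  have orient: "\<exists>f. path f \<and> pathstart f = complex_of_real (real a) \<and> pathfinish f = complex_of_real (real b) \<and>
    (\<forall>t\<in>{0<..<1}. 0 < Im (f t)) \<and> path_image f = path_image (\<gamma> {a, b})" if "{a, b} \<in> \<beta>" for a b
  proof -
    note G = g[OF that]
    have "{pathstart (\<gamma> {a, b}), pathfinish (\<gamma> {a, b})} = {complex_of_real (real a), complex_of_real (real b)}" using G by simp
    then consider "pathstart (\<gamma> {a, b}) = complex_of_real (real a)" "pathfinish (\<gamma> {a, b}) = complex_of_real (real b)"
      | "pathstart (\<gamma> {a, b}) = complex_of_real (real b)" "pathfinish (\<gamma> {a, b}) = complex_of_real (real a)"
      by (auto simp: doubleton_eq_iff)
    then show ?thesis
    proof cases
      case 1
      then show ?thesis using G by blast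
    next
      case 2
      have "\<forall>t\<in>{0<..<1}. 0 < Im (reversepath (\<gamma> {a, b}) t)" using G by (auto simp: reversepath_def)
      then show ?thesis using 2 G by (intro exI[of _ "reversepath (\<gamma> {a, b})"]) auto
    qed
  qed
  have "noncrossing \<beta>"
    unfolding noncrossing_def
  proof (intro allI impI notI)
    fix a b c e assume l: "{a, b} \<in> \<beta>" "{c, e} \<in> \<beta>" and o: "a < c \<and> c < b \<and> b < e"
    obtain f where f: "path f" "pathstart f = complex_of_real (real a)" "pathfinish f = complex_of_real (real b)"
      "\<forall>t\<in>{0<..<1}. 0 < Im (f t)" "path_image f = path_image (\<gamma> {a, b})" using orient[OF l(1)] by blast
    obtain h where h: "path h" "pathstart h = complex_of_real (real c)" "pathfinish h = complex_of_real (real e)"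
      "\<forall>t\<in>{0<..<1}. 0 < Im (h t)" "path_image h = path_image (\<gamma> {c, e})" using orient[OF l(2)] by blast
    have "path_image f \<inter> path_image h \<noteq> {}"
      by (rule upper_paths_cross[OF f(1-3) _ h(1-3)]) (use f(4) h(4) o in auto)
    moreover have "{a, b} \<noteq> {c, e}" using o by (auto simp: doubleton_eq_iff)
    ultimately show False using dj l f(5) h(5) unfolding disjoint_family_on_def by metis
  qed
  then show "\<beta> \<in> NC N" using M by (simp add: NC_def)
next
  fix \<beta> assume B: "\<beta> \<in> NC N"
  then have M: "matching N \<beta>" and nc: "noncrossing \<beta>" by (auto simp: NC_def)
  define \<gamma> where "\<gamma> l = semicircle (real (Min l)) (real (Max l))" for l :: "nat set"
  have ends: "\<exists>a b. l = {a, b} \<and> a < b \<and> Min l = a \<and> Max l = b" if lB: "l \<in> \<beta>" for l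
  proof -
    obtain a b where "l = {a, b}" "a < b" using matchingD(1)[OF M lB] by blast
    then show ?thesis by (intro exI[of _ a] exI[of _ b]) auto
  qed
  have "path (\<gamma> l) \<and> {pathstart (\<gamma> l), pathfinish (\<gamma> l)} = of_nat ` l \<and> (\<forall>t\<in>{0<..<1}. 0 < Im (\<gamma> l t))" if "l \<in> \<beta>" for l
    using ends[OF that] path_semicircle semicircle_ends semicircle_upper by (auto simp: \<gamma>_def)
  moreover have "disjoint_family_on (\<lambda>l. path_image (\<gamma> l)) \<beta>"
    unfolding disjoint_family_on_def
  proof (intro ballI impI)
    have *: "path_image (\<gamma> {a, b}) \<inter> path_image (\<gamma> {c, e}) = {}"
      if "{a, b} \<in> \<beta>" "{c, e} \<in> \<beta>" "a < b" "c < e" "a < c" for a b c e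
    proof -
      have ne: "b \<noteq> c" "b \<noteq> e"
        using matchingD(3)[OF M, of b a e] matchingD(3)[OF M, of b a c] that by (auto simp: insert_commute)
      have "b < c \<or> e < b" using nc that ne unfolding noncrossing_def by (metis linorder_neqE_nat)
      moreover have "Min {a, b} = a" "Max {a, b} = b" "Min {c, e} = c" "Max {c, e} = e" using that by auto
      ultimately show ?thesis using semicircles_disjoint[of "real a" "real b" "real c" "real e"] that by (simp add: \<gamma>_def)
    qed
    fix l l' assume l: "l \<in> \<beta>" "l' \<in> \<beta>" "l \<noteq> l'"
    obtain a b where ab: "l = {a, b}" "a < b" using ends[OF l(1)] by blast
    obtain c e where ce: "l' = {c, e}" "c < e" using ends[OF l(2)] by blast
    have "a \<noteq> c" using matchingD(3)[OF M, of a b e] l ab ce by auto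
    then consider "a < c" | "c < a" by linarith
    then show "path_image (\<gamma> l) \<inter> path_image (\<gamma> l') = {}"
      by cases (use *[of a b c e] *[of c e a b] l ab ce in auto)
  qed
  ultimately show "\<beta> \<in> link_patterns N" using M unfolding link_patterns_def matching_def by blast
qed

subsection \<open>Blocks\<close>

lemma valence_sum_0 [simp]: "valence_sum s 0 = 0"
  by (simp add: valence_sum_def)

lemma valence_sum_Suc: "valence_sum s (Suc i) = valence_sum s i + s (Suc i)"
  by (simp add: valence_sum_def)

lemma valence_sum_mono: "i \<le> j \<Longrightarrow> valence_sum s i \<le> valence_sum s j"
  by (rule lift_Suc_mono_le[of "valence_sum s"]) (simp_all add: valence_sum_Suc)

lemma block_disjoint:
  assumes "a \<in> block s i" "a \<in> block s j"
  shows "i = j"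
proof -
  have "\<not> i < j" if "a \<in> block s i" "a \<in> block s j" for i j
  proof
    assume "i < j"
    then have "valence_sum s i \<le> valence_sum s (j - 1)" by (intro valence_sum_mono) simp
    then show False using that by (simp add: block_def)
  qed
  then show ?thesis using assms by (metis linorder_neqE_nat)
qed

lemma block_of_eq: "a \<in> block s i \<Longrightarrow> block_of s a = i"
  unfolding block_of_def using block_disjoint by blast

lemma ex_block:
  assumes "a \<in> {1..valence_sum s d}"
  shows "\<exists>i\<in>{1..d}. a \<in> block s i"
  using assms
proof (induction d)
  case (Suc d)
  show ?case
  proof (cases "a \<le> valence_sum s d")
    case True
    then show ?thesis using Suc by fastforce
  next
    case False
    then have "a \<in> block s (Suc d)" using Suc.prems by (simp add: block_def)
    then show ?thesis by auto
  qed
qed simp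

lemma block_of_mem:
  assumes "a \<in> {1..valence_sum s d}"
  shows "a \<in> block s (block_of s a)" "block_of s a \<in> {1..d}"
  using ex_block[OF assms] block_of_eq by auto

lemma block_of_mono:
  assumes "a \<le> b" "a \<in> {1..valence_sum s d}" "b \<in> {1..valence_sum s d}"
  shows "block_of s a \<le> block_of s b"
proof (rule ccontr)
  assume "\<not> block_of s a \<le> block_of s b"
  then have "valence_sum s (block_of s b) \<le> valence_sum s (block_of s a - 1)" by (intro valence_sum_mono) simp
  then show False using block_of_mem[OF assms(2)] block_of_mem[OF assms(3)] assms(1) by (auto simp: block_def)
qed

lemma down_closed_interval:
  fixes D :: "nat set"
  assumes "D \<subseteq> {l<..h}" "\<And>a b. a \<in> {l<..h} \<Longrightarrow> a < b \<Longrightarrow> b \<in> D \<Longrightarrow> a \<in> D"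
  shows "D = {l<..l + card D}"
proof (cases "D = {}")
  case False
  have f: "finite D" using assms(1) finite_subset by blast
  have M: "Max D \<in> D" using Max_in[OF f False] .
  have "D = {l<..Max D}"
  proof (intro equalityI subsetI)
    fix a assume "a \<in> {l<..Max D}"
    then show "a \<in> D" using M assms(1) assms(2)[of a "Max D"] by (cases "a = Max D") auto
  qed (use assms(1) f in auto)
  moreover from this have "card D = Max D - l" by (metis card_greaterThanAtMost)
  moreover have "l < Max D" using M assms(1) by auto
  ultimately show ?thesis by simp
qed simp

context
  fixes N d :: nat and s :: "nat \<Rightarrow> nat" and \<beta> :: "nat set set"
  assumes B: "\<beta> \<in> NC N" and vs: "valence_sum s d = 2*N" and nl: "no_link_in_block d s \<beta>"
begin

lemma mate_other_block:
  assumes a: "a \<in> {1..2*N}" "i \<in> {1..d}" "a \<in> block s i"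
  shows "mate \<beta> a \<notin> block s i"
  using nl mate_link[OF NC_matching[OF B] a(1)] a unfolding no_link_in_block_def by force

text \<open>In a block without internal links, a left endpoint followed by a right endpoint would
  produce a crossing. Hence the right endpoints form an initial segment.\<close>

lemma rights_in_block:
  assumes i: "i \<in> {1..d}"
  shows "block s i - lefts \<beta> = {valence_sum s (i-1)<..valence_sum s (i-1) + card (block s i - lefts \<beta>)}"
proof (rule down_closed_interval)
  note M = NC_matching[OF B]
  show "block s i - lefts \<beta> \<subseteq> {valence_sum s (i-1)<..valence_sum s i}" by (auto simp: block_def)
  fix a b assume ab: "a \<in> {valence_sum s (i-1)<..valence_sum s i}" "a < b" "b \<in> block s i - lefts \<beta>"
  have r: "c \<in> {1..2*N}" if "c \<in> block s i" for c
    using that i valence_sum_mono[of i d s] vs by (auto simp: block_def)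
  have aB: "a \<in> block s i" using ab by (simp add: block_def)
  show "a \<in> block s i - lefts \<beta>"
  proof (rule ccontr)
    assume "a \<notin> block s i - lefts \<beta>"
    then have al: "a < mate \<beta> a" using aB by (auto simp: lefts_eq[OF M])
    have bl: "mate \<beta> b < b" using ab(3) r mate_neq[OF M, of b] by (auto simp: lefts_eq[OF M])
    have "mate \<beta> a \<notin> block s i" "mate \<beta> b \<notin> block s i" using mate_other_block i r aB ab(3) by auto
    then have "b < mate \<beta> a" "mate \<beta> b < a" using al bl ab aB by (auto simp: block_def)
    then show False
      using NC_not_crossing[OF B, of "mate \<beta> b" a] mate_mate[OF M, of b] mate_in[OF M, of b] r aB ab(2,3) by auto
  qed
qed

text \<open>A right endpoint in block \<open>i\<close> belongs to a link whose larger block is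
  \<open>i\<close>, so its count can be read off the collapsed multiset.\<close>

lemma card_rights_in_block:
  assumes i: "i \<in> {1..d}"
  shows "card (block s i - lefts \<beta>) = size (filter_mset (\<lambda>l. Max l = i) (collapse s \<beta>))"
proof -
  note M = NC_matching[OF B]
  have fB: "finite \<beta>" using M finite_elements[of "{1..2*N}"] by (auto simp: matching_def)
  have "size (filter_mset (\<lambda>l. Max l = i) (collapse s \<beta>)) = card {l \<in> \<beta>. Max (block_of s ` l) = i}"
    using fB by (simp add: collapse_def filter_mset_image_mset)
  also have "\<dots> = card (block s i - lefts \<beta>)"
  proof (rule bij_betw_same_card[of Max], unfold bij_betw_def, intro conjI)
    have pair: "\<exists>a b. l = {a, b} \<and> a < b \<and> a \<in> {1..2*N} \<and> b \<in> {1..2*N} \<and> mate \<beta> a = b \<and> mate \<beta> b = a \<and> Max l = b \<and> Max (block_of s ` l) = block_of s b"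
      if l: "l \<in> \<beta>" for l
    proof -
      obtain a b where ab: "l = {a, b}" "a < b" "a \<in> {1..2*N}" "b \<in> {1..2*N}" using matchingD(1)[OF M l] by blast
      have "block_of s a \<le> block_of s b" using block_of_mono[of a b s d] ab vs by simp
      then show ?thesis using ab l mate_eqI[OF M, of a b] mate_eqI[OF M, of b a] by (intro exI[of _ a] exI[of _ b]) (auto simp: insert_commute)
    qed
    show "inj_on Max {l \<in> \<beta>. Max (block_of s ` l) = i}"
    proof (rule inj_onI)
      fix l l' assume "l \<in> {l \<in> \<beta>. Max (block_of s ` l) = i}" "l' \<in> {l \<in> \<beta>. Max (block_of s ` l) = i}" "Max l = Max l'"
      then show "l = l'" using pair[of l] pair[of l'] by auto
    qed
    show "Max ` {l \<in> \<beta>. Max (block_of s ` l) = i} = block s i - lefts \<beta>"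
    proof (intro equalityI subsetI)
      fix b assume "b \<in> Max ` {l \<in> \<beta>. Max (block_of s ` l) = i}"
      then obtain l where l: "l \<in> \<beta>" "Max (block_of s ` l) = i" "b = Max l" by blast
      obtain a b' where "l = {a, b'}" "a < b'" "b' \<in> {1..2*N}" "mate \<beta> b' = a" "Max l = b'" "Max (block_of s ` l) = block_of s b'"
        using pair[OF l(1)] by blast
      then show "b \<in> block s i - lefts \<beta>" using l block_of_mem[of b' s d] vs by (auto simp: lefts_eq[OF M])
    next
      fix b assume b: "b \<in> block s i - lefts \<beta>"
      then have br: "b \<in> {1..2*N}" using i valence_sum_mono[of i d s] vs by (auto simp: block_def)
      have lt: "mate \<beta> b < b" using b br mate_neq[OF M br] by (auto simp: lefts_eq[OF M])
      have l: "{b, mate \<beta> b} \<in> \<beta>" by (rule mate_link[OF M br])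
      have "Max {b, mate \<beta> b} = b" using lt by simp
      moreover from this have "Max (block_of s ` {b, mate \<beta> b}) = i" using pair[OF l] b block_of_eq[of b s i] by auto
      ultimately show "b \<in> Max ` {l \<in> \<beta>. Max (block_of s ` l) = i}" using l by (metis (mono_tags, lifting) imageI mem_Collect_eq)
    qed
  qed
  finally show ?thesis by simp
qed

end

text \<open>The numbers of right endpoints per block, together with their position at the beginning
  of the block, determine all left endpoints and hence the noncrossing pattern.\<close>

lemma collapse_inj:
  assumes "\<beta> \<in> NC N" "\<beta>' \<in> NC N" "valence_sum s d = 2*N" "no_link_in_block d s \<beta>" "no_link_in_block d s \<beta>'"
    and "collapse s \<beta> = collapse s \<beta>'"
  shows "\<beta> = \<beta>'"
proof (rule NC_eqI_lefts[OF assms(1,2)])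
  have "block s i - lefts \<beta> = block s i - lefts \<beta>'" if i: "i \<in> {1..d}" for i
  proof -
    have "card (block s i - lefts \<beta>) = card (block s i - lefts \<beta>')"
      by (simp only: card_rights_in_block[OF assms(1,3,4) i] card_rights_in_block[OF assms(2,3,5) i] assms(6))
    then show ?thesis
      using rights_in_block[OF assms(1,3,4) i] rights_in_block[OF assms(2,3,5) i] by metis
  qed
  note eq = this
  have "a \<in> lefts \<beta> \<longleftrightarrow> a \<in> lefts \<beta>'" if aN: "a \<in> {1..2*N}" for a
  proof -
    obtain i where "i \<in> {1..d}" "a \<in> block s i" using ex_block[of a s d] aN assms(3) by metis
    then show ?thesis using eq by blast
  qed
  then show "lefts \<beta> = lefts \<beta>'"
    using lefts_sub[OF NC_matching[OF assms(1)]] lefts_sub[OF NC_matching[OF assms(2)]] by blast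
qed

lemma unfold_collapse:
  assumes "\<beta> \<in> NC N" "valence_sum s d = 2*N" "no_link_in_block d s \<beta>"
  shows "unfold_pattern d s (collapse s \<beta>) = \<beta>"
  unfolding unfold_pattern_def link_patterns_eq_NC
  by (rule the_equality) (use assms collapse_inj[OF _ _ assms(2)] in auto)

subsection \<open>The kernel and the fused pattern\<close>

text \<open>The formulas hold only away from the singularity; on an open set the pointwise identity
  is stable under \<open>deriv\<close>.\<close>

lemma iterated_deriv_eq:
  fixes F :: "nat \<Rightarrow> real \<Rightarrow> real"
  assumes S: "open S" and F: "\<And>n t. t \<in> S \<Longrightarrow> (F n has_real_derivative F (Suc n) t) (at t)"
    and g: "\<And>t. t \<in> S \<Longrightarrow> g t = F 0 t" and t: "t \<in> S"
  shows "(deriv ^^ n) g t = F n t"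
  using t
proof (induction n arbitrary: t)
  case 0
  then show ?case using g by simp
next
  case (Suc n)
  have "((deriv ^^ n) g has_real_derivative F (Suc n) t) (at t)"
    by (rule has_field_derivative_transform_within_open[OF F[OF Suc.prems] S Suc.prems]) (simp add: Suc.IH)
  then show ?case by (simp add: DERIV_imp_deriv)
qed

lemma iterated_deriv_kernel:
  assumes "xi \<noteq> xj"
  shows "(deriv ^^ p) (\<lambda>u. (deriv ^^ n) (\<lambda>v. 1 / (pi * (u - v)^2)) xj) xi = kernel_deriv p n (xi - xj)"
proof -
  have inner: "(deriv ^^ n) (\<lambda>v. 1 / (pi * (u - v)^2)) xj = kernel_deriv 0 n (u - xj)" if u: "u \<noteq> xj" for u
  proof -
    have "(deriv ^^ n) (\<lambda>v. 1 / (pi * (u - v)^2)) xj = kernel_deriv n 0 (xj - u)"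
    proof (rule iterated_deriv_eq[of "- {u}" "\<lambda>n v. kernel_deriv n 0 (v - u)"])
      show "((\<lambda>v. kernel_deriv n 0 (v - u)) has_real_derivative kernel_deriv (Suc n) 0 (v - u)) (at v)" if "v \<in> - {u}" for n v
        using that by (intro kernel_deriv_DERIV) simp
      show "1 / (pi * (u - v)^2) = kernel_deriv 0 0 (v - u)" for v
        by (simp add: kernel_deriv_def power2_commute flip: power2_eq_square)
    qed (use u in auto)
    then show ?thesis by (simp only: kernel_deriv_flip)
  qed
  show ?thesis
  proof (rule iterated_deriv_eq[of "- {xj}" "\<lambda>p u. kernel_deriv p n (u - xj)"])
    show "((\<lambda>u. kernel_deriv p n (u - xj)) has_real_derivative kernel_deriv (Suc p) n (u - xj)) (at u)" if "u \<in> - {xj}" for p u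
      using that by (intro kernel_deriv_DERIV) simp
  qed (use assms inner in auto)
qed

lemma kernel_eq:
  assumes "a \<in> block s i" "b \<in> block s j"
  shows "i = j \<Longrightarrow> kernel s x a b = 0"
    and "x i \<noteq> x j \<Longrightarrow> kernel s x a b = kernel_deriv (a - valence_sum s (i-1) - 1) (b - valence_sum s (j-1) - 1) (x i - x j)"
proof -
  show "i = j \<Longrightarrow> kernel s x a b = 0" using block_of_eq[OF assms(1)] block_of_eq[OF assms(2)] by (simp add: kernel_def)
  assume ne: "x i \<noteq> x j"
  then have "i \<noteq> j" by auto
  then show "kernel s x a b = kernel_deriv (a - valence_sum s (i-1) - 1) (b - valence_sum s (j-1) - 1) (x i - x j)"
    unfolding kernel_def block_of_eq[OF assms(1)] block_of_eq[OF assms(2)] Let_def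
    by (simp only: if_False iterated_deriv_kernel[OF ne])
qed

lemma pure_partition_function_collapse:
  assumes B: "\<beta> \<in> NC N" and vs: "valence_sum s d = 2*N" and nl: "no_link_in_block d s \<beta>"
  shows "pure_partition_function d s (collapse s \<beta>) x = Zp N \<beta> (kernel s x)"
proof -
  have N: "valence_sum s d div 2 = N" using vs by simp
  show ?thesis
    unfolding pure_partition_function_def Let_def N unfold_collapse[OF assms] link_patterns_eq_NC Zp_def
    by (rule sum.cong[OF refl]) (simp add: det_eq_ndet[OF NC_matching])
qed

text \<open>After the removal of \<open>i\<close> links the next one sits at the shifted gap, and
  lifted back along \<open>up\<close> it joins k - i to k + 1 + i. So the links between the blocks
  are nested around the gap.\<close>

lemma inner_links:
  assumes T: "two_blocks N \<alpha> lo k hi" and i: "i < cross_links \<alpha> lo k hi"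
  shows "{k - i, k + 1 + i} \<in> \<alpha>"
proof -
  note R = two_blocks_rem_many[OF T less_imp_le[OF i]]
  have "0 < cross_links (rem k i \<alpha>) lo (k - i) (hi - 2*i)" using R i by linarith
  then have "{k - i, k - i + 1} \<in> rem k i \<alpha>" using cross_links_pos(1) R by blast
  moreover have "up k i (k - i) = k - i" "up k i (k - i + 1) = k + 1 + i" using R by (auto simp: up_def)
  ultimately show ?thesis by (simp only: rem_link)
qed

locale fused_blocks =
  fixes N d j m :: nat and s :: "nat \<Rightarrow> nat" and \<beta> :: "nat set set"
  assumes B: "\<beta> \<in> NC N" and vs: "valence_sum s d = 2*N" and nl: "no_link_in_block d s \<beta>"
    and j: "1 \<le> j" "j + 1 \<le> d" and m: "m = count (collapse s \<beta>) {j, j+1}"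
begin

abbreviation "V \<equiv> valence_sum s"
abbreviation "lo \<equiv> V (j - 1)"
abbreviation "k \<equiv> V j"
abbreviation "hi \<equiv> V (j + 1)"
abbreviation "sf \<equiv> fused_valences s j m"
abbreviation "Vf \<equiv> valence_sum sf"
abbreviation "full \<equiv> fully_linked s j m"
abbreviation "\<beta>f \<equiv> rem k m \<beta>"

definition "relabel = (if full then (\<lambda>i. if i < j then i else i - 2) else (\<lambda>i. if i \<le> j then i else i - 1))"

lemmas M = NC_matching[OF B]

lemma V_step: "k = lo + s j" "hi = k + s (j + 1)"
  using valence_sum_Suc[of s "j - 1"] valence_sum_Suc[of s j] j by simp_all

lemma block_j: "block s j = {lo<..k}" "block s (j + 1) = {k<..hi}"
  by (simp_all add: block_def)

lemma in_block: "a \<in> {1..2*N} \<Longrightarrow> block_of s a = i \<longleftrightarrow> a \<in> block s i"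
  using block_of_mem[of a s d] block_of_eq[of a s i] vs by auto

lemma hi_le: "hi \<le> 2*N"
  using valence_sum_mono[of "j + 1" d s] j vs by simp

lemma blocks: "two_blocks N \<beta> lo k hi"
  unfolding two_blocks_def
proof (intro conjI ballI)
  show "lo \<le> k" "k \<le> hi" using V_step by auto
  show "mate \<beta> a \<notin> {lo<..k}" if "a \<in> {lo<..k}" for a
    using mate_other_block[OF B vs nl, of a j] that hi_le V_step j unfolding block_j by auto
  show "mate \<beta> a \<notin> {k<..hi}" if "a \<in> {k<..hi}" for a
    using mate_other_block[OF B vs nl, of a "j + 1"] that hi_le j unfolding block_j by auto
qed (use B hi_le in auto)

lemma fused_link_iff:
  assumes "{a, b} \<in> \<beta>"
  shows "block_of s ` {a, b} = {j, j + 1} \<longleftrightarrow> a \<in> {lo<..k} \<and> b \<in> {k<..hi} \<or> b \<in> {lo<..k} \<and> a \<in> {k<..hi}"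
  using in_block[of a j] in_block[of b j] in_block[of a "j + 1"] in_block[of b "j + 1"] link_range[OF M assms]
  unfolding block_j by (auto simp: doubleton_eq_iff)

lemma m_cross: "m = cross_links \<beta> lo k hi"
proof -
  have fB: "finite \<beta>" using M finite_elements[of "{1..2*N}"] by (auto simp: matching_def)
  have "m = size (filter_mset (\<lambda>l. l = {j, j+1}) (collapse s \<beta>))" unfolding m by (simp add: filter_eq_replicate_mset)
  also have "\<dots> = card {l \<in> \<beta>. block_of s ` l = {j, j + 1}}"
    using fB by (simp add: collapse_def filter_mset_image_mset)
  also have "\<dots> = cross_links \<beta> lo k hi"
    unfolding cross_links_def
  proof (rule bij_betw_same_card[symmetric, of "\<lambda>a. {a, mate \<beta> a}"], unfold bij_betw_def, intro conjI)
    have r: "a \<in> {1..2*N}" if "a \<in> {lo<..k}" for a using that hi_le V_step by auto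
    show "inj_on (\<lambda>a. {a, mate \<beta> a}) {a \<in> {lo<..k}. mate \<beta> a \<in> {k<..hi}}"
      by (rule inj_onI) (auto simp: doubleton_eq_iff)
    show "(\<lambda>a. {a, mate \<beta> a}) ` {a \<in> {lo<..k}. mate \<beta> a \<in> {k<..hi}} = {l \<in> \<beta>. block_of s ` l = {j, j + 1}}"
    proof (intro equalityI subsetI)
      fix l assume "l \<in> (\<lambda>a. {a, mate \<beta> a}) ` {a \<in> {lo<..k}. mate \<beta> a \<in> {k<..hi}}"
      then obtain a where a: "l = {a, mate \<beta> a}" "a \<in> {lo<..k}" "mate \<beta> a \<in> {k<..hi}" by blast
      then show "l \<in> {l \<in> \<beta>. block_of s ` l = {j, j + 1}}"
        using mate_link[OF M r[OF a(2)]] fused_link_iff[of a "mate \<beta> a"] by blast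
    next
      fix l assume l: "l \<in> {l \<in> \<beta>. block_of s ` l = {j, j + 1}}"
      then obtain a b where ab: "l = {a, b}" using matchingD(1)[OF M, of l] by blast
      then have ab': "{a, b} \<in> \<beta>" "{b, a} \<in> \<beta>" using l by (auto simp: insert_commute)
      have "a \<in> {lo<..k} \<and> b \<in> {k<..hi} \<or> b \<in> {lo<..k} \<and> a \<in> {k<..hi}"
        using fused_link_iff[OF ab'(1)] l ab by blast
      then show "l \<in> (\<lambda>a. {a, mate \<beta> a}) ` {a \<in> {lo<..k}. mate \<beta> a \<in> {k<..hi}}"
        using mate_eqI[OF M ab'(1)] mate_eqI[OF M ab'(2)] ab by (auto simp: insert_commute image_iff)
    qed
  qed
  finally show ?thesis .
qed

lemma fused:
  shows blocks_f: "two_blocks (N - m) \<beta>f lo (k - m) (hi - 2*m)" and m_le: "m + lo \<le> k" "k + m \<le> hi"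
    and no_cross: "cross_links \<beta>f lo (k - m) (hi - 2*m) = 0"
  using two_blocks_rem_many[OF blocks, of m] m_cross by auto

lemma Bf: "\<beta>f \<in> NC (N - m)" using blocks_f by (simp add: two_blocks_def)

text \<open>All links between the two blocks have been removed, and neither block has internal
  ones.\<close>

lemma no_middle_links:
  assumes "a \<in> {lo<..hi - 2*m}"
  shows "mate \<beta>f a \<notin> {lo<..hi - 2*m}"
proof
  assume b: "mate \<beta>f a \<in> {lo<..hi - 2*m}"
  note Mf = NC_matching[OF Bf]
  have r: "a \<in> {1..2*(N - m)}" using assms hi_le by auto
  have "{a \<in> {lo<..k - m}. mate \<beta>f a \<in> {k - m<..hi - 2*m}} = {}"
    using no_cross by (simp add: cross_links_def)
  then have "\<not> (c \<in> {lo<..k - m} \<and> mate \<beta>f c \<in> {k - m<..hi - 2*m})" for c by blast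
  from this[of a] this[of "mate \<beta>f a"] show False
    using blocks_f assms b mate_mate[OF Mf r] unfolding two_blocks_def by (metis greaterThanAtMost_iff not_le)
qed

lemma Vf_low: "i < j \<Longrightarrow> Vf i = V i"
  unfolding valence_sum_def by (rule sum.cong) (auto simp: fused_valences_def)

text \<open>When the blocks are fully linked, s j + s (j+1) = 2m and the fused block would be empty,
  so the partial sums drop by 2m in both cases.\<close>

lemma Vf_high:
  assumes "j + 1 \<le> i"
  shows "Vf (if full then i - 2 else i - 1) + 2*m = V i"
  using assms
proof (induction i rule: dec_induct)
  case base
  show ?case
  proof (cases full)
    case True
    then show ?thesis using Vf_low[of "j - 1"] V_step j by (simp add: fully_linked_def)
  next
    case False
    then have "Vf j = lo + (s j + s (j + 1) - 2*m)"
      using Vf_low[of "j - 1"] valence_sum_Suc[of sf "j - 1"] j by (simp add: fused_valences_def)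
    then show ?thesis using False V_step m_le by simp
  qed
next
  case (step i)
  show ?case
  proof (cases full)
    case True
    have e: "Suc i - 2 = Suc (i - 2)" "\<not> Suc (i - 2) < j" "Suc (i - 2) + 2 = Suc i" using step j by auto
    have sf: "sf (Suc (i - 2)) = s (Suc i)" unfolding fused_valences_def by (simp only: True if_True e if_False)
    have i: "(if full then Suc i - 2 else Suc i - 1) = Suc (i - 2)" by (simp only: True if_True e)
    have "Vf (i - 2) + 2*m = V i" using step.IH by (simp only: True if_True)
    then show ?thesis unfolding i valence_sum_Suc sf by linarith
  next
    case False
    have e: "Suc i - 1 = Suc (i - 1)" "\<not> Suc (i - 1) < j" "Suc (i - 1) \<noteq> j" "Suc (i - 1) + 1 = Suc i" using step j by auto
    have sf: "sf (Suc (i - 1)) = s (Suc i)" unfolding fused_valences_def by (simp only: False if_False e)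
    have i: "(if full then Suc i - 2 else Suc i - 1) = Suc (i - 1)" by (simp only: False if_False e)
    have "Vf (i - 1) + 2*m = V i" using step.IH by (simp only: False if_False)
    then show ?thesis unfolding i valence_sum_Suc sf by linarith
  qed
qed

lemma Vf_relabel:
  assumes "j + 2 \<le> i"
  shows "Vf (relabel i) + 2*m = V i" "Vf (relabel i - 1) + 2*m = V (i - 1)"
  using Vf_high[of i] Vf_high[of "i - 1"] assms by (auto simp: relabel_def diff_diff_eq add.commute)

lemma vs_f: "Vf (fused_length d s j m) = 2*(N - m)"
  using Vf_high[of d] j vs by (auto simp: fused_length_def)

text \<open>Outside the fused interval an index keeps its position within its block, which is what
  makes the derivative orders of the two kernels agree.\<close>

lemma fused_block_outer:
  assumes a: "a \<in> {1..2*(N - m)} - {lo<..hi - 2*m}"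
  shows "up k m a \<in> {1..2*N} - {lo<..hi}" "block_of s (up k m a) \<in> {1..d} - {j, j + 1}"
    "block_of sf a = relabel (block_of s (up k m a))"
    "a - Vf (block_of sf a - 1) = up k m a - V (block_of s (up k m a) - 1)"
    "a \<in> block sf (block_of sf a)" "up k m a \<in> block s (block_of s (up k m a))"
proof -
  define c where "c = up k m a"
  define i where "i = block_of s c"
  have cr: "c \<in> {1..2*N} - {lo<..hi}" using a m_le hi_le unfolding c_def up_def by auto
  then have i: "c \<in> block s i" "i \<in> {1..d}" using block_of_mem[of c s d] vs by (auto simp: i_def)
  have ij: "i \<notin> {j, j + 1}" using i cr V_step by (auto simp: block_def)
  have "a \<in> block sf (relabel i) \<and> a - Vf (relabel i - 1) = c - V (i - 1)"
  proof (cases "a \<le> lo")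
    case True
    then have c: "c = a" using m_le by (simp add: c_def up_def)
    have "i < j"
    proof (rule ccontr)
      assume "\<not> i < j"
      then have "lo \<le> V (i - 1)" by (intro valence_sum_mono) simp
      then show False using i(1) True c by (simp add: block_def)
    qed
    then have "relabel i = i" "Vf i = V i" "Vf (i - 1) = V (i - 1)" using Vf_low by (auto simp: relabel_def)
    then show ?thesis using i(1) c by (simp add: block_def)
  next
    case False
    then have c: "c = a + 2*m" "hi < c" using a m_le by (auto simp: c_def up_def)
    have "j + 2 \<le> i"
    proof (rule ccontr)
      assume "\<not> j + 2 \<le> i"
      then have "V i \<le> hi" by (intro valence_sum_mono) simp
      then show False using i(1) c by (simp add: block_def)
    qed
    note F = Vf_relabel[OF this]
    show ?thesis using i(1) c F by (auto simp: block_def)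
  qed
  then have bf: "a \<in> block sf (relabel i)" "a - Vf (relabel i - 1) = c - V (i - 1)" by auto
  have e: "block_of sf a = relabel i" using bf(1) by (rule block_of_eq)
  show "up k m a \<in> {1..2*N} - {lo<..hi}" "block_of s (up k m a) \<in> {1..d} - {j, j + 1}"
    "block_of sf a = relabel (block_of s (up k m a))"
    "a - Vf (block_of sf a - 1) = up k m a - V (block_of s (up k m a) - 1)"
    "a \<in> block sf (block_of sf a)" "up k m a \<in> block s (block_of s (up k m a))"
    using cr i ij e bf unfolding c_def i_def by auto
qed

lemma fused_block_middle:
  assumes a: "a \<in> {lo<..hi - 2*m}"
  shows "up k m a \<in> {lo<..hi}" "\<not> full" "block_of sf a = j" "a \<in> block sf j" "Vf (j - 1) = lo"
    "relabel (block_of s (up k m a)) = j"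
proof -
  show 1: "up k m a \<in> {lo<..hi}" using a m_le unfolding up_def by auto
  show nf: "\<not> full"
  proof
    assume full
    then have "hi - 2*m = lo" using V_step by (simp add: fully_linked_def)
    then show False using a by simp
  qed
  show l: "Vf (j - 1) = lo" using Vf_low[of "j - 1"] j by simp
  have "Vf j = hi - 2*m" using Vf_high[of "j + 1"] nf by simp
  then show b: "a \<in> block sf j" using a l by (simp add: block_def)
  then show "block_of sf a = j" by (rule block_of_eq)
  have "up k m a \<in> block s j \<or> up k m a \<in> block s (j + 1)" using 1 unfolding block_j by auto
  then have "block_of s (up k m a) = j \<or> block_of s (up k m a) = j + 1" using block_of_eq by blast
  then show "relabel (block_of s (up k m a)) = j" using nf by (auto simp: relabel_def)
qed

lemma relabel_block: "a \<in> {1..2*(N - m)} \<Longrightarrow> block_of sf a = relabel (block_of s (up k m a))"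
  using fused_block_outer(3)[of a] fused_block_middle(3,6)[of a] by (cases "a \<in> {lo<..hi - 2*m}") auto

lemma relabel_inj:
  assumes "i \<notin> {j, j + 1}" "i' \<notin> {j, j + 1}" "relabel i = relabel i'"
  shows "i = i'"
  using assms j by (auto simp: relabel_def split: if_splits)

lemma relabel_ne: "i \<notin> {j, j + 1} \<Longrightarrow> \<not> full \<Longrightarrow> relabel i \<noteq> j"
  using j by (auto simp: relabel_def)

text \<open>Middle indices are not linked among themselves. Any other link inside a fused block
  would come from a link inside an old one, since \<open>relabel\<close> is injective away from
  \<open>j\<close> and \<open>j + 1\<close> and there avoids the fused block.\<close>

lemma nl_f: "no_link_in_block (fused_length d s j m) sf \<beta>f"
  unfolding no_link_in_block_def
proof (intro ballI notI)
  note Mf = NC_matching[OF Bf]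
  fix l i assume l: "l \<in> \<beta>f" and i: "l \<subseteq> block sf i"
  obtain a b where ab: "l = {a, b}" "a \<in> {1..2*(N - m)}" "b \<in> {1..2*(N - m)}" using matchingD(1)[OF Mf l] by blast
  have mt: "mate \<beta>f a = b" using l ab mate_eqI[OF Mf] by blast
  have lk: "{up k m a, up k m b} \<in> \<beta>" using l ab by (simp add: rem_link)
  have ai: "block_of sf a = i" "block_of sf b = i" using i ab block_of_eq by auto
  show False
  proof (cases "a \<in> {lo<..hi - 2*m}")
    case True
    then have "b \<in> {1..2*(N - m)} - {lo<..hi - 2*m}" using no_middle_links[OF True] mt ab by blast
    note O = fused_block_outer[OF this]
    show False using relabel_ne[of "block_of s (up k m b)"] O(2,3) ai fused_block_middle(2,3)[OF True] by auto
  next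
    case False
    then have a: "a \<in> {1..2*(N - m)} - {lo<..hi - 2*m}" using ab by blast
    note O = fused_block_outer[OF a]
    have b: "b \<in> {1..2*(N - m)} - {lo<..hi - 2*m}"
    proof (rule ccontr)
      assume "\<not> ?thesis"
      then have "b \<in> {lo<..hi - 2*m}" using ab by blast
      then show False using relabel_ne[of "block_of s (up k m a)"] O(2,3) ai fused_block_middle(2,3)[of b] by auto
    qed
    note O' = fused_block_outer[OF b]
    have "block_of s (up k m a) = block_of s (up k m b)"
      by (rule relabel_inj) (use O(2,3) O'(2,3) ai in auto)
    then have "up k m b \<in> block s (block_of s (up k m a))" using O'(6) by simp
    moreover have "mate \<beta> (up k m a) = up k m b" using lk mate_eqI[OF M] by blast
    ultimately show False using mate_other_block[OF B vs nl, of "up k m a" "block_of s (up k m a)"] O by auto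
  qed
qed

lemma collapse_f: "collapse sf \<beta>f = fused_pattern s j m (collapse s \<beta>)"
proof -
  note Mf = NC_matching[OF Bf]
  have fB: "finite \<beta>" using M finite_elements[of "{1..2*N}"] by (auto simp: matching_def)
  have inj: "inj_on ((`) (up k m)) \<beta>f"
    by (rule inj_onI) (metis inj_image_eq_iff injI up_eq_iff)
  have mid: "c \<in> {lo<..hi - 2*m}" if "up k m c \<in> {lo<..hi}" for c using that m_le unfolding up_def by (auto split: if_splits)
  have img: "{l \<in> \<beta>. block_of s ` l \<noteq> {j, j + 1}} = (`) (up k m) ` \<beta>f"
  proof (intro equalityI subsetI)
    fix l assume l: "l \<in> {l \<in> \<beta>. block_of s ` l \<noteq> {j, j + 1}}"
    then obtain a b where ab: "l = {a, b}" "a \<in> {1..2*N}" "b \<in> {1..2*N}" using matchingD(1)[OF M, of l] by blast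
    have lk: "{a, b} \<in> \<beta>" "{b, a} \<in> \<beta>" using l ab by (auto simp: insert_commute)
    have pre: "\<exists>c'. c = up k m c'" if h: "{c, e} \<in> \<beta>" "\<not> block_of s ` {c, e} = {j, j + 1}" for c e
    proof -
      \<comment> \<open>By nesting, the links between the blocks fill the points k - m + 1, ..., k +
        m completely, so every other link is in the image of \<open>up\<close>.\<close>
      have "\<not> (k - m < c \<and> c \<le> k + m)"
      proof
        assume c: "k - m < c \<and> c \<le> k + m"
        have "\<exists>i<m. c = k - i \<or> c = k + 1 + i"
        proof (cases "c \<le> k")
          case True
          then show ?thesis using c by (intro exI[of _ "k - c"]) auto
        next
          case False
          then show ?thesis using c by (intro exI[of _ "c - k - 1"]) auto
        qed
        then obtain i where i: "i < m" "c = k - i \<or> c = k + 1 + i" by blast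
        have L: "{k - i, k + 1 + i} \<in> \<beta>" using inner_links[OF blocks] i m_cross by simp
        then have "{c, e} = {k - i, k + 1 + i}"
          using i(2) matchingD(3)[OF M h(1)] by (metis insert_commute)
        moreover have "k - i \<in> {lo<..k}" "k + 1 + i \<in> {k<..hi}" using i(1) m_le by auto
        ultimately show False using h(2) fused_link_iff[OF L] by metis
      qed
      then have "c = up k m (if c + m \<le> k then c else c - 2*m)" using m_le by (auto simp: up_def)
      then show ?thesis by blast
    qed
    obtain a' where a': "a = up k m a'" using pre[OF lk(1)] l ab by blast
    obtain b' where b': "b = up k m b'" using pre[OF lk(2)] l ab by (auto simp: insert_commute)
    have "{a', b'} \<in> \<beta>f" using lk(1) a' b' by (simp add: rem_link)
    moreover have "l = up k m ` {a', b'}" using ab a' b' by simp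
    ultimately show "l \<in> (`) (up k m) ` \<beta>f" by blast
  next
    fix l assume "l \<in> (`) (up k m) ` \<beta>f"
    then obtain l' where l': "l' \<in> \<beta>f" "l = up k m ` l'" by blast
    obtain a b where ab: "l' = {a, b}" using matchingD(1)[OF Mf l'(1)] by blast
    have mt: "mate \<beta>f a = b" using l' ab mate_eqI[OF Mf] by blast
    have lk: "{up k m a, up k m b} \<in> \<beta>" using l' ab by (simp add: rem_link)
    have "block_of s ` {up k m a, up k m b} \<noteq> {j, j + 1}"
    proof
      assume "block_of s ` {up k m a, up k m b} = {j, j + 1}"
      then have "up k m a \<in> {lo<..hi}" "up k m b \<in> {lo<..hi}" using fused_link_iff[OF lk] V_step by auto
      then show False using mid no_middle_links[of a] mt by blast
    qed
    then show "l \<in> {l \<in> \<beta>. block_of s ` l \<noteq> {j, j + 1}}" using lk l' ab by simp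
  qed
  have "fused_pattern s j m (collapse s \<beta>) =
      image_mset (\<lambda>l. relabel ` l) (filter_mset (\<lambda>l. l \<noteq> {j, j + 1}) (collapse s \<beta>))"
    by (simp add: fused_pattern_def relabel_def Let_def)
  also have "\<dots> = image_mset (\<lambda>l. relabel ` block_of s ` l) (mset_set {l \<in> \<beta>. block_of s ` l \<noteq> {j, j + 1}})"
    using fB by (simp add: collapse_def filter_mset_image_mset multiset.map_comp comp_def)
  also have "\<dots> = image_mset (\<lambda>l. relabel ` block_of s ` up k m ` l) (mset_set \<beta>f)"
    unfolding img by (simp add: image_mset_mset_set[OF inj, symmetric] multiset.map_comp comp_def)
  also have "\<dots> = collapse sf \<beta>f"
    unfolding collapse_def
  proof (rule image_mset_cong)
    fix l assume "l \<in># mset_set \<beta>f"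
    then have "l \<in> \<beta>f" by (metis elem_mset_set empty_iff mset_set.infinite set_mset_empty)
    then have "l \<subseteq> {1..2*(N - m)}" using matchingD(1)[OF Mf, of l] by auto
    then show "relabel ` block_of s ` up k m ` l = block_of sf ` l"
      unfolding image_image by (intro image_cong refl) (use relabel_block in auto)
  qed
  finally show ?thesis by (rule sym)
qed

end

lemma tri_eq: "real (tri n) = real n * (real n + 1) / 2"
  by (induction n) (auto simp: tri_Suc tri_def field_simps)

lemma fusion_exponent_eq: "fusion_exponent s s' m = 2 * (real m)^2 - real m * (2 * real s + 2 * real s' + 1) + real s * real s'"
  by (simp add: fusion_exponent_def h1_def field_simps power2_eq_square)

lemma fusion_exponent_tri: "2*m \<le> s + s' \<Longrightarrow> fusion_exponent s s' m = real (tri (s + s' - 2*m)) - real (tri s) - real (tri s')"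
  by (simp add: fusion_exponent_eq tri_eq of_nat_diff field_simps power2_eq_square)

lemma fun_upd2_neq:
  fixes f :: "'a \<Rightarrow> 'b"
  assumes "u \<noteq> v" "i \<noteq> j \<Longrightarrow> i \<noteq> j' \<Longrightarrow> u \<noteq> f i \<and> v \<noteq> f i" "i' \<noteq> j \<Longrightarrow> i' \<noteq> j' \<Longrightarrow> u \<noteq> f i' \<and> v \<noteq> f i'"
    and "i \<noteq> j \<Longrightarrow> i \<noteq> j' \<Longrightarrow> i' \<noteq> j \<Longrightarrow> i' \<noteq> j' \<Longrightarrow> f i \<noteq> f i'" "i \<noteq> i'"
  shows "(f(j := u, j' := v)) i \<noteq> (f(j := u, j' := v)) i'"
  using assms by (cases "i = j'"; cases "i = j"; cases "i' = j'"; cases "i' = j") auto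

lemma (in fused_blocks) pure_partition_function_limit:
  fixes x :: "nat \<Rightarrow> real"
  assumes x: "strict_mono_on ({1..d} - {j, j+1}) x"
    and xi: "1 < j \<Longrightarrow> x (j - 1) < \<xi>" "j + 2 \<le> d \<Longrightarrow> \<xi> < x (j + 2)"
  shows "((\<lambda>(u, v). pure_partition_function d s (collapse s \<beta>) (x(j := u, j+1 := v)) /
            \<bar>v - u\<bar> powr fusion_exponent (s j) (s (j+1)) m)
     \<longlongrightarrow> fusion_const (s j) (s (j+1)) m *
         pure_partition_function (fused_length d s j m) sf (fused_pattern s j m (collapse s \<beta>)) (fused_points s j m x \<xi>))
     (fusion_filter \<xi>)"
proof -
  let ?I = "{1..d} - {j, j+1}" and ?Out = "{1..2*N} - {lo<..hi}"
  have xinj: "x i \<noteq> x i'" if "i \<in> ?I" "i' \<in> ?I" "i \<noteq> i'" for i i'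
    using strict_mono_on_imp_inj_on[OF x] that by (auto dest: inj_onD)
  have x\<xi>: "\<xi> \<noteq> x i" if i: "i \<in> ?I" for i
  proof (cases "i < j")
    case True
    then have "i = j - 1 \<or> i < j - 1" "j - 1 \<in> ?I" using i j by auto
    then have "x i \<le> x (j - 1)" using strict_mono_onD[OF x i, of "j - 1"] by fastforce
    then show ?thesis using xi(1) True i by auto
  next
    case False
    then have "j + 2 \<le> i" using i by auto
    then have "i = j + 2 \<or> j + 2 < i" "j + 2 \<in> ?I" using i j by auto
    then have "x (j + 2) \<le> x i" using strict_mono_onD[OF x _ i, of "j + 2"] by fastforce
    then show ?thesis using xi(2) \<open>j + 2 \<le> i\<close> i by auto
  qed
  define q where "q b = b - V (block_of s b - 1) - 1" for b
  define X where "X b = x (block_of s b)" for b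
  define pt where "pt p c = (if c \<in> {lo<..k} then fst p else if c \<in> {k<..hi} then snd p else X c)" for p :: "real \<times> real" and c
  define Ko where "Ko a b = (if block_of s a = block_of s b then 0 else kernel_deriv (q a) (q b) (X a - X b))" for a b
  \<comment> \<open>A closed formula replaces the iterated derivatives. It is symmetric for all
    positions \<open>p\<close> and agrees with the kernel as soon as the points are distinct, which
    holds eventually.\<close>
  define Kx where "Kx p a b = (if block_of s a = block_of s b then 0 else kernel_deriv (q a) (q b) (pt p a - pt p b))" for p a b
  have bP: "block_of s a = j" "q a = a - lo - 1" "pt p a = fst p" if "a \<in> {lo<..k}" for a p
    using that block_of_eq[of a s j] unfolding block_j by (simp_all add: q_def pt_def)
  have bQ: "block_of s a = j + 1" "q a = a - k - 1" "pt p a = snd p" if "a \<in> {k<..hi}" for a p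
    using that block_of_eq[of a s "j + 1"] unfolding block_j by (simp_all add: q_def pt_def)
  have bO: "block_of s b \<in> ?I" "pt p b = X b" "b \<in> block s (block_of s b)" if b: "b \<in> ?Out" for b p
  proof -
    have "block_of s b \<noteq> j" "block_of s b \<noteq> j + 1" using in_block[of b] b V_step unfolding block_def by auto
    then show "block_of s b \<in> ?I" using block_of_mem(2)[of b s d] b vs by auto
    show "pt p b = X b" using b V_step by (auto simp: pt_def)
    show "b \<in> block s (block_of s b)" using block_of_mem(1)[of b s d] b vs by auto
  qed
  have sizes: "k - lo = s j" "hi - k = s (j + 1)" using V_step by simp_all
  interpret F: fusion N lo k hi m \<beta> q X \<xi> Ko Kx
  proof
    show "two_blocks N \<beta> lo k hi" by (rule blocks)
    show "m = cross_links \<beta> lo k hi" by (rule m_cross)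
    show "Kx p a b = Kx p b a" for p a b by (auto simp: Kx_def kernel_deriv_flip)
    show "Ko a b = Ko b a" for a b by (auto simp: Ko_def kernel_deriv_flip)
    show "Kx p a b = 0" if "a \<in> {lo<..k}" "b \<in> {lo<..k}" for p a b using that by (simp add: Kx_def bP(1))
    show "Kx p a b = 0" if "a \<in> {k<..hi}" "b \<in> {k<..hi}" for p a b using that by (simp add: Kx_def bQ(1))
    show "Kx p a b = kernel_deriv (a - lo - 1) (b - k - 1) (fst p - snd p)" if "a \<in> {lo<..k}" "b \<in> {k<..hi}" for p a b
      unfolding Kx_def bP[OF that(1)] bQ[OF that(2)] by simp
    show "Kx p a b = kernel_deriv (a - lo - 1) (q b) (fst p - X b)" if "a \<in> {lo<..k}" "b \<in> ?Out" for p a b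
      unfolding Kx_def bP[OF that(1)] bO(2)[OF that(2)] using bO(1)[OF that(2)] by auto
    show "Kx p a b = kernel_deriv (a - k - 1) (q b) (snd p - X b)" if "a \<in> {k<..hi}" "b \<in> ?Out" for p a b
      unfolding Kx_def bQ[OF that(1)] bO(2)[OF that(2)] using bO(1)[OF that(2)] by auto
    show "Kx p a b = Ko a b" if "a \<in> ?Out" "b \<in> ?Out" for p a b
      unfolding Kx_def Ko_def bO(2)[OF that(1)] bO(2)[OF that(2)] ..
    show "\<xi> \<noteq> X b" if "b \<in> ?Out" for b using x\<xi>[OF bO(1)[OF that]] by (simp add: X_def)
  qed
  have ev: "eventually (\<lambda>p. Zp N \<beta> (Kx p) / (snd p - fst p) powr (real (tri (s j + s (j+1) - 2*m)) - real (tri (s j)) - real (tri (s (j+1))))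
    = (case p of (u, v) \<Rightarrow> pure_partition_function d s (collapse s \<beta>) (x(j := u, j+1 := v)) /
            \<bar>v - u\<bar> powr fusion_exponent (s j) (s (j+1)) m)) (fusion_filter \<xi>)"
  proof -
    have e1: "eventually (\<lambda>p. \<forall>i\<in>?I. fst p \<noteq> x i) (fusion_filter \<xi>)"
      by (intro eventually_ball_finite ballI tendsto_imp_eventually_ne[OF fusion_filter_fst]) (use x\<xi> in auto)
    have e2: "eventually (\<lambda>p. \<forall>i\<in>?I. snd p \<noteq> x i) (fusion_filter \<xi>)"
      by (intro eventually_ball_finite ballI tendsto_imp_eventually_ne[OF fusion_filter_snd]) (use x\<xi> in auto)
    show ?thesis
      using e1 e2 fusion_filter_less
    proof eventually_elim
      case (elim p)
      obtain u v where p: "p = (u, v)" by (cases p)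
      let ?x = "x(j := u, j+1 := v)"
      have ptx: "pt p c = ?x (block_of s c)" if c: "c \<in> {1..2*N}" for c
      proof -
        consider "c \<in> {lo<..k}" | "c \<in> {k<..hi}" | "c \<in> ?Out" using c by fastforce
        then show ?thesis
        proof cases
          case 1
          then show ?thesis using bP[OF 1] p by simp
        next
          case 2
          then show ?thesis using bQ[OF 2] p by simp
        next
          case 3
          then show ?thesis using bO(1,2)[OF 3] by (simp add: X_def)
        qed
      qed
      have xd: "?x i \<noteq> ?x i'" if i: "i \<in> {1..d}" "i' \<in> {1..d}" "i \<noteq> i'" for i i'
      proof -
        have "u \<noteq> v" using elim(3) p by simp
        moreover have "i \<in> ?I \<longrightarrow> u \<noteq> x i \<and> v \<noteq> x i" for i using elim(1,2) p by auto
        from this[of i] this[of i']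
        have "i \<noteq> j \<Longrightarrow> i \<noteq> j + 1 \<Longrightarrow> u \<noteq> x i \<and> v \<noteq> x i" "i' \<noteq> j \<Longrightarrow> i' \<noteq> j + 1 \<Longrightarrow> u \<noteq> x i' \<and> v \<noteq> x i'" using i by blast+
        moreover have "i \<noteq> j \<Longrightarrow> i \<noteq> j + 1 \<Longrightarrow> i' \<noteq> j \<Longrightarrow> i' \<noteq> j + 1 \<Longrightarrow> x i \<noteq> x i'"
          using i xinj[of i i'] by blast
        ultimately show ?thesis by (rule fun_upd2_neq[OF _ _ _ _ i(3)])
      qed
      have "Zp N \<beta> (kernel s ?x) = Zp N \<beta> (Kx p)"
      proof (rule Zp_cong)
        fix a b assume ab: "a \<in> {1..2*N}" "b \<in> {1..2*N}"
        have m: "a \<in> block s (block_of s a)" "b \<in> block s (block_of s b)" "block_of s a \<in> {1..d}" "block_of s b \<in> {1..d}"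
          using block_of_mem[of a s d] block_of_mem[of b s d] ab vs by auto
        show "kernel s ?x a b = Kx p a b"
        proof (cases "block_of s a = block_of s b")
          case True
          then show ?thesis using kernel_eq(1)[OF m(1,2)] by (simp add: Kx_def)
        next
          case False
          then show ?thesis
            using kernel_eq(2)[OF m(1,2), of ?x] xd[OF m(3,4)] unfolding Kx_def ptx[OF ab(1)] ptx[OF ab(2)] q_def by simp
        qed
      qed
      moreover have "2*m \<le> s j + s (j + 1)" using m_le sizes by linarith
      ultimately show ?case
        using elim(3) p pure_partition_function_collapse[OF B vs nl, of ?x] by (simp add: fusion_exponent_tri)
    qed
  qed
  let ?xf = "fused_points s j m x \<xi>"
  have xf_outer: "?xf (relabel i) = x i" if i: "i \<in> ?I" for i
  proof (cases "i < j")
    case True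
    then show ?thesis by (simp add: fused_points_def relabel_def)
  next
    case False
    then have "i = Suc (Suc (i - 2))" "j \<le> i - 2" using i j by auto
    then obtain n where "i = Suc (Suc n)" "j \<le> n" by blast
    then show ?thesis by (simp add: fused_points_def relabel_def)
  qed
  \<comment> \<open>The limiting kernel is the kernel of the fused data: middle indices sit at
    \<xi>, and the others keep their point and derivative order.\<close>
  have "Zp (N - m) \<beta>f F.Kh = Zp (N - m) \<beta>f (kernel sf ?xf)"
  proof (rule Zp_cong)
    let ?J = "{lo<..hi - 2*m}" and ?O = "{1..2*(N - m)} - {lo<..hi - 2*m}"
    have mid: "a \<in> block sf j \<and> Vf (j - 1) = lo \<and> ?xf j = \<xi>" if "a \<in> ?J" for a
      using fused_block_middle[OF that] by (simp add: fused_points_def)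
    have out: "a \<in> block sf (relabel (block_of s (up k m a))) \<and>
        a - Vf (relabel (block_of s (up k m a)) - 1) - 1 = q (up k m a) \<and>
        ?xf (relabel (block_of s (up k m a))) = X (up k m a)" if "a \<in> ?O" for a
      using fused_block_outer[OF that] xf_outer by (simp add: q_def X_def)
    have K_mid_out: "kernel sf ?xf a b = kernel_deriv (a - lo - 1) (q (up k m b)) (\<xi> - X (up k m b))"
      "kernel sf ?xf b a = kernel_deriv (a - lo - 1) (q (up k m b)) (\<xi> - X (up k m b))" if a: "a \<in> ?J" and b: "b \<in> ?O" for a b
    proof -
      have ne: "\<xi> \<noteq> X (up k m b)" using x\<xi> fused_block_outer(2)[OF b] by (simp add: X_def)
      show "kernel sf ?xf a b = kernel_deriv (a - lo - 1) (q (up k m b)) (\<xi> - X (up k m b))"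
        using kernel_eq(2)[of a sf j b _ ?xf] mid[OF a] out[OF b] ne by auto
      have "kernel sf ?xf b a = kernel_deriv (q (up k m b)) (a - lo - 1) (X (up k m b) - \<xi>)"
        using kernel_eq(2)[of b sf _ a j ?xf] mid[OF a] out[OF b] ne by auto
      then show "kernel sf ?xf b a = kernel_deriv (a - lo - 1) (q (up k m b)) (\<xi> - X (up k m b))"
        by (simp only: kernel_deriv_flip)
    qed
    fix a b assume ab: "a \<in> {1..2*(N - m)}" "b \<in> {1..2*(N - m)}"
    consider "a \<in> ?J" "b \<in> ?J" | "a \<in> ?J" "b \<in> ?O" | "a \<in> ?O" "b \<in> ?J" | "a \<in> ?O" "b \<in> ?O" using ab by blast
    then show "F.Kh a b = kernel sf ?xf a b"
    proof cases
      case 1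
      then show ?thesis using kernel_eq(1)[of a sf j b j] mid[OF 1(1)] mid[OF 1(2)] unfolding F.Kh_def by (simp del: greaterThanAtMost_iff)
    next
      case 2
      then show ?thesis using K_mid_out(1)[OF 2] unfolding F.Kh_def by (simp del: greaterThanAtMost_iff)
    next
      case 3
      then show ?thesis using K_mid_out(2)[OF 3(2,1)] unfolding F.Kh_def by (simp del: greaterThanAtMost_iff)
    next
      case 4
      let ?i = "block_of s (up k m a)" and ?i' = "block_of s (up k m b)"
      note O = fused_block_outer(2)[OF 4(1)] fused_block_outer(2)[OF 4(2)]
      have Kh: "F.Kh a b = Ko (up k m a) (up k m b)" using 4 unfolding F.Kh_def by auto
      show ?thesis
      proof (cases "?i = ?i'")
        case True
        then show ?thesis using Kh kernel_eq(1)[of a sf "relabel ?i" b "relabel ?i'"] out[OF 4(1)] out[OF 4(2)] by (simp add: Ko_def)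
      next
        case False
        then have "X (up k m a) \<noteq> X (up k m b)" unfolding X_def using xinj O by blast
        then show ?thesis
          using False Kh kernel_eq(2)[of a sf "relabel ?i" b "relabel ?i'" ?xf] out[OF 4(1)] out[OF 4(2)] by (simp add: Ko_def)
      qed
    qed
  qed
  then have eq: "fusion_const (s j) (s (j+1)) m * Zp (N - m) \<beta>f F.Kh = fusion_const (s j) (s (j+1)) m *
      pure_partition_function (fused_length d s j m) sf (fused_pattern s j m (collapse s \<beta>)) ?xf"
    using pure_partition_function_collapse[OF Bf vs_f nl_f, of ?xf] collapse_f by simp
  show ?thesis
    using Lim_transform_eventually[OF F.fusion_limit[unfolded sizes] ev] unfolding eq .
qed

theorem theorem6p1:
  shows "(\<forall>s s' m. fusion_exponent s s' m =
            2 * (real m)^2 - real m * (2 * real s + 2 * real s' + 1) + real s * real s') \<and>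
    (\<exists>C :: nat \<Rightarrow> nat \<Rightarrow> nat \<Rightarrow> real. (\<forall>s s' m. 0 \<le> C s s' m) \<and>
      (\<forall>(N :: nat) (d :: nat) (s :: nat \<Rightarrow> nat) (\<alpha> :: nat set multiset) (j :: nat)
          (x :: nat \<Rightarrow> real) (\<xi> :: real) (m :: nat).
         (\<forall>i\<in>{1..d}. 0 < s i) \<and> (\<Sum>i=1..d. s i) = 2 * N \<and>
         \<alpha> \<in> link_patterns_val d s \<and>
         1 \<le> j \<and> j \<le> d - 1 \<and>
         m = count \<alpha> {j, j+1} \<and>
         strict_mono_on ({1..d} - {j, j+1}) x \<and>
         (1 < j \<longrightarrow> x (j-1) < \<xi>) \<and> (j + 2 \<le> d \<longrightarrow> \<xi> < x (j+2))
         \<longrightarrow>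
         ((\<lambda>(u, v). pure_partition_function d s \<alpha> (x(j := u, j+1 := v)) /
                     \<bar>v - u\<bar> powr fusion_exponent (s j) (s (j+1)) m)
           \<longlongrightarrow> C (s j) (s (j+1)) m *
               pure_partition_function (fused_length d s j m) (fused_valences s j m)
                 (fused_pattern s j m \<alpha>) (fused_points s j m x \<xi>))
         (at (\<xi>, \<xi>) within {(u, v). u < v})))"
proof (intro conjI allI exI[of _ fusion_const] impI)
  show "fusion_exponent s s' m = 2 * (real m)^2 - real m * (2 * real s + 2 * real s' + 1) + real s * real s'" for s s' m
    by (rule fusion_exponent_eq)
  show "0 \<le> fusion_const s s' m" for s s' m by (rule fusion_const_nonneg)
  fix N d j m :: nat and s :: "nat \<Rightarrow> nat" and \<alpha> :: "nat set multiset" and x :: "nat \<Rightarrow> real" and \<xi> :: real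
  assume H: "(\<forall>i\<in>{1..d}. 0 < s i) \<and> (\<Sum>i=1..d. s i) = 2 * N \<and> \<alpha> \<in> link_patterns_val d s \<and>
    1 \<le> j \<and> j \<le> d - 1 \<and> m = count \<alpha> {j, j+1} \<and> strict_mono_on ({1..d} - {j, j+1}) x \<and>
    (1 < j \<longrightarrow> x (j-1) < \<xi>) \<and> (j + 2 \<le> d \<longrightarrow> \<xi> < x (j+2))"
  then obtain \<beta> n where b: "\<alpha> = collapse s \<beta>" "valence_sum s d = 2 * n" "\<beta> \<in> NC n" "no_link_in_block d s \<beta>"
    unfolding link_patterns_val_def link_patterns_eq_NC by blast
  interpret fused_blocks n d j m s \<beta>
    using H b by unfold_locales auto
  show "((\<lambda>(u, v). pure_partition_function d s \<alpha> (x(j := u, j+1 := v)) /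
            \<bar>v - u\<bar> powr fusion_exponent (s j) (s (j+1)) m)
     \<longlongrightarrow> fusion_const (s j) (s (j+1)) m *
         pure_partition_function (fused_length d s j m) (fused_valences s j m) (fused_pattern s j m \<alpha>) (fused_points s j m x \<xi>))
     (at (\<xi>, \<xi>) within {(u, v). u < v})"
    unfolding b(1) by (rule pure_partition_function_limit) (use H in auto)
qed

end
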